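(* For any small object $F$ in $\mathsf{D}(\Lambda)$, any self-map $g:F\to F$ of nonzero degree, that is, any map $g:\Sigma^{a,b}F\to F$ with $(a,b)\ne(0,0)$, is nilpotent.
   Context: Fix a countable field $k$ and integers $n_i\ge 2$ for all $i\ge 1$. Let $\Lambda = k[x_1,x_2,x_3,\dots]/(x_i^{n_i}\ \text{for all } i)$, graded by $\deg x_i = 2^i$. All modules are graded; $\mathsf{D}(\Lambda)$ is the unbounded derived category of (cochain complexes of) graded $\Lambda$-modules with degree-preserving maps. $\Sigma^{a,b}$ denotes the shift by $a$ in the homological grading and by $b$ in the internal module grading. An object $F$ is small if $\mathrm{Hom}_{\mathsf{D}(\Lambda)}(F,-)$ commutes with arbitrary direct sums. The map $g$ is nilpotent if some iterated composite $g\circ\Sigma^{a,b}g\circ\cdots\circ\Sigma^{(m-1)a,(m-1)b}g:\Sigma^{ma,mb}F\to F$ is zero. *)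

theory Defs
  imports
    "HOL-Library.Poly_Mapping"
    "HOL-Algebra.QuotRing"
    "HOL-Algebra.Module"
    "HOL-Algebra.Product_Groups"
    "HOL-Algebra.Algebraic_Closure_Type"
begin

section \<open>The truncated polynomial algebra\<close>

text \<open>Monomials are finitely supported exponent functions. Position \<open>j\<close> of an exponent function
  belongs to the variable \<open>x\<^sub>i\<close> with \<open>i = j + 1\<close>, since the variables are \<open>x\<^sub>1, x\<^sub>2, \<dots>\<close>.\<close>

type_synonym 'k poly_inf = "(nat \<Rightarrow>\<^sub>0 nat) \<Rightarrow>\<^sub>0 'k"

definition indet :: "nat \<Rightarrow> 'k::field poly_inf" where
  "indet i = Poly_Mapping.single (Poly_Mapping.single (i - 1) 1) 1"

definition mono_degree :: "(nat \<Rightarrow>\<^sub>0 nat) \<Rightarrow> nat" where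
  "mono_degree m = (\<Sum>j\<in>Poly_Mapping.keys m. Poly_Mapping.lookup m j * 2 ^ (j + 1))"

definition homogeneous_poly :: "int \<Rightarrow> 'k::field poly_inf \<Rightarrow> bool" where
  "homogeneous_poly d p \<longleftrightarrow> (\<forall>m\<in>Poly_Mapping.keys p. int (mono_degree m) = d)"

definition trunc_ideal :: "(nat \<Rightarrow> nat) \<Rightarrow> 'k::field poly_inf set" where
  "trunc_ideal n = genideal ring_of_type_algebra {indet i ^ n i |i. i \<ge> 1}"

record 'a gring = "'a ring" +
  rdeg :: "int \<Rightarrow> 'a set"

definition trunc_alg :: "(nat \<Rightarrow> nat) \<Rightarrow> 'k::field poly_inf set gring" where
  "trunc_alg n = ring.extend (ring_of_type_algebra Quot trunc_ideal n)
     (gring.fields (\<lambda>d. {trunc_ideal n +>\<^bsub>ring_of_type_algebra\<^esub> p |p. homogeneous_poly d p}))"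


section \<open>Graded modules and cochain complexes\<close>

text \<open>Modules have their carrier inside a type \<open>'u\<close>, which plays the role of the universe. Elements
  of \<open>'u\<close> outside the carriers are junk: maps are only ever compared on carriers.\<close>

record ('a, 'u) gmodule = "('a, 'u) module" +
  mdeg :: "int \<Rightarrow> 'u set"

definition graded_module :: "'a gring \<Rightarrow> ('a, 'u) gmodule \<Rightarrow> bool" where
  "graded_module L M \<longleftrightarrow>
     module L M \<and>
     (\<forall>d. subgroup (mdeg M d) (add_monoid M)) \<and>
     (\<forall>x\<in>carrier M. \<exists>!c. (\<forall>d. c d \<in> mdeg M d) \<and> finite {d. c d \<noteq> \<zero>\<^bsub>M\<^esub>} \<and>
        x = finsum M c {d. c d \<noteq> \<zero>\<^bsub>M\<^esub>}) \<and>
     (\<forall>d e. \<forall>a\<in>rdeg L d. \<forall>x\<in>mdeg M e. a \<odot>\<^bsub>M\<^esub> x \<in> mdeg M (d + e))"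

definition gmod_hom :: "'a gring \<Rightarrow> ('a, 'u) gmodule \<Rightarrow> ('a, 'u) gmodule \<Rightarrow> ('u \<Rightarrow> 'u) set" where
  "gmod_hom L M N = {f \<in> hom (add_monoid M) (add_monoid N).
     (\<forall>a\<in>carrier L. \<forall>x\<in>carrier M. f (a \<odot>\<^bsub>M\<^esub> x) = a \<odot>\<^bsub>N\<^esub> f x) \<and>
     (\<forall>d. f ` mdeg M d \<subseteq> mdeg N d)}"

record ('a, 'u) cpx =
  obj :: "int \<Rightarrow> ('a, 'u) gmodule"
  dif :: "int \<Rightarrow> 'u \<Rightarrow> 'u"

type_synonym 'u maps = "int \<Rightarrow> 'u \<Rightarrow> 'u"

definition cochain_complex :: "'a gring \<Rightarrow> ('a, 'u) cpx \<Rightarrow> bool" where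
  "cochain_complex L A \<longleftrightarrow>
     (\<forall>n. graded_module L (obj A n)) \<and>
     (\<forall>n. dif A n \<in> gmod_hom L (obj A n) (obj A (n + 1))) \<and>
     (\<forall>n. \<forall>x\<in>carrier (obj A n). dif A (n + 1) (dif A n x) = \<zero>\<^bsub>obj A (n + 1 + 1)\<^esub>)"

definition chain_map :: "'a gring \<Rightarrow> ('a, 'u) cpx \<Rightarrow> ('a, 'u) cpx \<Rightarrow> 'u maps set" where
  "chain_map L A B = {f.
     (\<forall>n. f n \<in> gmod_hom L (obj A n) (obj B n)) \<and>
     (\<forall>n. \<forall>x\<in>carrier (obj A n). f (n + 1) (dif A n x) = dif B n (f n x))}"

definition id_map :: "'u maps" where
  "id_map = (\<lambda>n x. x)"

definition zero_map :: "('a, 'u) cpx \<Rightarrow> 'u maps" where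
  "zero_map B = (\<lambda>n x. \<zero>\<^bsub>obj B n\<^esub>)"

definition add_map :: "('a, 'u) cpx \<Rightarrow> 'u maps \<Rightarrow> 'u maps \<Rightarrow> 'u maps" where
  "add_map B f g = (\<lambda>n x. f n x \<oplus>\<^bsub>obj B n\<^esub> g n x)"

definition comp_map :: "'u maps \<Rightarrow> 'u maps \<Rightarrow> 'u maps" where
  "comp_map g f = (\<lambda>n. g n \<circ> f n)"

definition homotopic :: "'a gring \<Rightarrow> ('a, 'u) cpx \<Rightarrow> ('a, 'u) cpx \<Rightarrow> 'u maps \<Rightarrow> 'u maps \<Rightarrow> bool" where
  "homotopic L A B f g \<longleftrightarrow> (\<exists>h.
     (\<forall>n. h n \<in> gmod_hom L (obj A n) (obj B (n - 1))) \<and>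
     (\<forall>n. \<forall>x\<in>carrier (obj A n).
        f n x \<ominus>\<^bsub>obj B n\<^esub> g n x = dif B (n - 1) (h n x) \<oplus>\<^bsub>obj B n\<^esub> h (n + 1) (dif A n x)))"

definition cocycles :: "('a, 'u) cpx \<Rightarrow> int \<Rightarrow> 'u set" where
  "cocycles A n = {x \<in> carrier (obj A n). dif A n x = \<zero>\<^bsub>obj A (n + 1)\<^esub>}"

definition coboundaries :: "('a, 'u) cpx \<Rightarrow> int \<Rightarrow> 'u set" where
  "coboundaries A n = dif A (n - 1) ` carrier (obj A (n - 1))"

definition cohomology :: "('a, 'u) cpx \<Rightarrow> int \<Rightarrow> 'u set monoid" where
  "cohomology A n = (add_monoid (obj A n)\<lparr>carrier := cocycles A n\<rparr>) Mod coboundaries A n"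

definition cohomology_map :: "('a, 'u) cpx \<Rightarrow> 'u maps \<Rightarrow> int \<Rightarrow> 'u set \<Rightarrow> 'u set" where
  "cohomology_map B f n W = (\<Union>x\<in>W. coboundaries B n +>\<^bsub>obj B n\<^esub> f n x)"

definition quasi_iso :: "'a gring \<Rightarrow> ('a, 'u) cpx \<Rightarrow> ('a, 'u) cpx \<Rightarrow> 'u maps set" where
  "quasi_iso L A B = {f \<in> chain_map L A B.
     \<forall>n. cohomology_map B f n \<in> iso (cohomology A n) (cohomology B n)}"


section \<open>The derived category\<close>

text \<open>Morphisms \<open>A \<rightarrow> B\<close> of the derived category are equivalence classes of roofs
  \<open>A \<leftarrow> P \<rightarrow> B\<close> whose left leg is a quasi-isomorphism, i.e. the homotopy category is localized at
  the quasi-isomorphisms. Two roofs are equivalent if they become homotopic on a common refinement.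
  If \<open>'u\<close> is infinite and \<open>L\<close> is countable, then \<open>'u\<close> has room for a K-projective resolution of every
  complex in \<open>'u\<close>, so the restriction of the apexes to \<open>'u\<close> does not affect the morphisms.\<close>

type_synonym ('a, 'u) roof = "('a, 'u) cpx \<times> 'u maps \<times> 'u maps"

definition roofs :: "'a gring \<Rightarrow> ('a, 'u) cpx \<Rightarrow> ('a, 'u) cpx \<Rightarrow> ('a, 'u) roof set" where
  "roofs L A B = {(P, s, f). cochain_complex L P \<and> s \<in> quasi_iso L P A \<and> f \<in> chain_map L P B}"

definition roof_rel ::
  "'a gring \<Rightarrow> ('a, 'u) cpx \<Rightarrow> ('a, 'u) cpx \<Rightarrow> (('a, 'u) roof \<times> ('a, 'u) roof) set" where
  "roof_rel L A B = {((P, s, f), (P', s', f')).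
     (P, s, f) \<in> roofs L A B \<and> (P', s', f') \<in> roofs L A B \<and>
     (\<exists>Q u u'. cochain_complex L Q \<and> u \<in> chain_map L Q P \<and> u' \<in> chain_map L Q P' \<and>
        comp_map s u \<in> quasi_iso L Q A \<and>
        homotopic L Q A (comp_map s u) (comp_map s' u') \<and>
        homotopic L Q B (comp_map f u) (comp_map f' u'))}"

type_synonym ('a, 'u) dmor = "('a, 'u) roof set"

definition loc ::
  "'a gring \<Rightarrow> ('a, 'u) cpx \<Rightarrow> ('a, 'u) cpx \<Rightarrow> 'u maps \<Rightarrow> ('a, 'u) dmor" where
  "loc L A B f = roof_rel L A B `` {(A, id_map, f)}"

text \<open>Composition \<open>A \<rightarrow> B \<rightarrow> C\<close>: the square formed by the inner legs is completed to one that
  commutes up to homotopy; all completions lie in one class.\<close>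

definition dcomp ::
  "'a gring \<Rightarrow> ('a, 'u) cpx \<Rightarrow> ('a, 'u) cpx \<Rightarrow> ('a, 'u) cpx \<Rightarrow>
   ('a, 'u) dmor \<Rightarrow> ('a, 'u) dmor \<Rightarrow> ('a, 'u) dmor" where
  "dcomp L A B C \<beta> \<alpha> = roof_rel L A C ``
     {(R, comp_map s u, comp_map g v) |R u v P s f Q t g.
        (P, s, f) \<in> \<alpha> \<and> (Q, t, g) \<in> \<beta> \<and> cochain_complex L R \<and>
        u \<in> quasi_iso L R P \<and> v \<in> chain_map L R Q \<and>
        homotopic L R B (comp_map f u) (comp_map t v)}"

text \<open>The abelian group of morphisms \<open>A \<rightarrow> B\<close>, as a monoid record whose \<open>mult\<close> is addition of
  morphisms and whose \<open>one\<close> is the zero morphism. Roofs are added over a common left leg.\<close>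

definition dhom :: "'a gring \<Rightarrow> ('a, 'u) cpx \<Rightarrow> ('a, 'u) cpx \<Rightarrow> ('a, 'u) dmor monoid" where
  "dhom L A B = \<lparr>
     carrier = roofs L A B // roof_rel L A B,
     monoid.mult = (\<lambda>\<alpha> \<beta>. roof_rel L A B ``
        {(P, s, add_map B f g) |P s f g. (P, s, f) \<in> \<alpha> \<and> (P, s, g) \<in> \<beta>}),
     one = loc L A B (zero_map B)\<rparr>"


section \<open>Small objects\<close>

text \<open>\<open>B\<close> together with the chain maps \<open>\<iota> i : A i \<rightarrow> B\<close> is a direct sum of the complexes \<open>A i\<close>.
  Direct sums in the derived category are direct sums of complexes.\<close>

definition is_direct_sum ::
  "'a gring \<Rightarrow> 'i set \<Rightarrow> ('i \<Rightarrow> ('a, 'u) cpx) \<Rightarrow> ('a, 'u) cpx \<Rightarrow> ('i \<Rightarrow> 'u maps) \<Rightarrow> bool" where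
  "is_direct_sum L I A B \<iota> \<longleftrightarrow>
     (\<forall>i\<in>I. cochain_complex L (A i)) \<and> cochain_complex L B \<and>
     (\<forall>i\<in>I. \<iota> i \<in> chain_map L (A i) B) \<and>
     (\<forall>n. \<forall>y\<in>carrier (obj B n). \<exists>!x. x \<in> (\<Pi>\<^sub>E i\<in>I. carrier (obj (A i) n)) \<and>
        finite {i \<in> I. x i \<noteq> \<zero>\<^bsub>obj (A i) n\<^esub>} \<and>
        y = finsum (obj B n) (\<lambda>i. \<iota> i n (x i)) {i \<in> I. x i \<noteq> \<zero>\<^bsub>obj (A i) n\<^esub>})"

text \<open>The canonical map from the direct sum of the groups \<open>dhom L F (A i)\<close> to \<open>dhom L F B\<close>.\<close>

definition sum_comparison ::
  "'a gring \<Rightarrow> ('a, 'u) cpx \<Rightarrow> 'i set \<Rightarrow> ('i \<Rightarrow> ('a, 'u) cpx) \<Rightarrow> ('a, 'u) cpx \<Rightarrow> ('i \<Rightarrow> 'u maps) \<Rightarrow>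
   ('i \<Rightarrow> ('a, 'u) dmor) \<Rightarrow> ('a, 'u) dmor" where
  "sum_comparison L F I A B \<iota> \<alpha> =
     finprod (dhom L F B) (\<lambda>i. dcomp L F (A i) B (loc L (A i) B (\<iota> i)) (\<alpha> i))
       {i \<in> I. \<alpha> i \<noteq> \<one>\<^bsub>dhom L F (A i)\<^esub>}"

text \<open>Index sets are subsets of \<open>'u\<close>. This is no loss: within the universe \<open>'u\<close> a direct sum can
  have at most as many nonzero summands as \<open>'u\<close> has elements.\<close>

definition small :: "'a gring \<Rightarrow> ('a, 'u) cpx \<Rightarrow> bool" where
  "small L F \<longleftrightarrow> (\<forall>(I :: 'u set) A B \<iota>. is_direct_sum L I A B \<iota> \<longrightarrow>
     sum_comparison L F I A B \<iota> \<in> iso (sum_group I (\<lambda>i. dhom L F (A i))) (dhom L F B))"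


section \<open>Shifts and nilpotence\<close>

text \<open>In bidegree \<open>(n, d)\<close> the shift \<open>\<Sigma>\<^sup>a\<^sup>,\<^sup>b A\<close> is the part of \<open>A\<close> in bidegree \<open>(n + a, d - b)\<close>; its
  differential is \<open>(-1)\<^sup>a dif A\<close>. The differential is restricted to the carrier so that, for complexes
  \<open>A\<close>, shifting twice equals shifting once by the sum, and is not just isomorphic to it.\<close>

definition shift :: "int \<Rightarrow> int \<Rightarrow> ('a, 'u) cpx \<Rightarrow> ('a, 'u) cpx" where
  "shift a b A = \<lparr>
     obj = (\<lambda>n. (obj A (n + a))\<lparr>mdeg := \<lambda>d. mdeg (obj A (n + a)) (d - b)\<rparr>),
     dif = (\<lambda>n. \<lambda>x\<in>carrier (obj A (n + a)).
        if even a then dif A (n + a) x else \<ominus>\<^bsub>obj A (n + a + 1)\<^esub> dif A (n + a) x)\<rparr>"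

definition shift_map :: "int \<Rightarrow> 'u maps \<Rightarrow> 'u maps" where
  "shift_map a f = (\<lambda>n. f (n + a))"

definition dshift ::
  "'a gring \<Rightarrow> int \<Rightarrow> int \<Rightarrow> ('a, 'u) cpx \<Rightarrow> ('a, 'u) cpx \<Rightarrow> ('a, 'u) dmor \<Rightarrow> ('a, 'u) dmor" where
  "dshift L a b A B \<alpha> = roof_rel L (shift a b A) (shift a b B) ``
     {(shift a b P, shift_map a s, shift_map a f) |P s f. (P, s, f) \<in> \<alpha>}"

text \<open>\<open>iterate L a b F g m\<close> is the composite of the \<open>m + 1\<close> maps
  \<open>g, \<Sigma>\<^sup>a\<^sup>,\<^sup>b g, \<dots>, \<Sigma>\<^sup>m\<^sup>a\<^sup>,\<^sup>m\<^sup>b g\<close>, a morphism from \<open>\<Sigma>\<^sup>(\<^sup>m\<^sup>+\<^sup>1\<^sup>)\<^sup>a\<^sup>,\<^sup>(\<^sup>m\<^sup>+\<^sup>1\<^sup>)\<^sup>b F\<close> to \<open>F\<close>.\<close>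

primrec iterate ::
  "'a gring \<Rightarrow> int \<Rightarrow> int \<Rightarrow> ('a, 'u) cpx \<Rightarrow> ('a, 'u) dmor \<Rightarrow> nat \<Rightarrow> ('a, 'u) dmor" where
  "iterate L a b F g 0 = g"
| "iterate L a b F g (Suc m) =
     dcomp L (shift (int (Suc (Suc m)) * a) (int (Suc (Suc m)) * b) F)
             (shift (int (Suc m) * a) (int (Suc m) * b) F) F
       (iterate L a b F g m)
       (dshift L (int (Suc m) * a) (int (Suc m) * b) (shift a b F) F g)"

definition nilpotent_map ::
  "'a gring \<Rightarrow> int \<Rightarrow> int \<Rightarrow> ('a, 'u) cpx \<Rightarrow> ('a, 'u) dmor \<Rightarrow> bool" where
  "nilpotent_map L a b F g \<longleftrightarrow>
     (\<exists>m. iterate L a b F g m =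
        \<one>\<^bsub>dhom L (shift (int (Suc m) * a) (int (Suc m) * b) F) F\<^esub>)"

end

theory Submission
  imports Defs
begin

text \<open>Suppose first that \<open>F\<close> is a bounded complex of finitely generated free modules. A self-map \<open>g\<close> of
  degree \<open>(a, b)\<close> is then a family of matrices. If \<open>a\<close> is nonzero, its iterates leave the range of degrees in
  which \<open>F\<close> lives. If \<open>a = 0\<close>, only finitely many variables occur in the entries, and since the variables are
  truncated, these generate a subalgebra that is concentrated in a bounded range of degrees. The entries
  of the iterates lie in this subalgebra, but their degrees grow with \<open>b\<close>, which is nonzero; so they
  vanish eventually.

  For the general case it is enough that the identity of a K-projective resolution \<open>P\<close> of \<open>F\<close> is homotopic to
  a chain map \<open>\<phi>\<close> whose image lies in the span of finitely many basis elements. If \<open>\<gamma>\<close> is a chain map that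
  represents \<open>g\<close>, the argument above applies to \<open>\<phi> \<gamma>\<close> instead of \<open>g\<close> (lemma \<open>iter_zero\<close>).

  The resolution \<open>P\<close> is built from cells (theorem \<open>resol_resolution\<close>): a cell is a finite tree that records
  its bidegree, its image in \<open>F\<close> and its boundary in terms of earlier cells, and all consistent cells are
  attached. Morphisms out of \<open>F\<close> are homotopy classes of chain maps out of \<open>P\<close>, and smallness says that a chain
  map from \<open>P\<close> into a direct sum is null-homotopic outside of finitely many summands (lemma
  \<open>small_null_homotopic_tail\<close>).

  This is applied in two ways. The subcomplexes \<open>P\<^sub>j\<close> of cells of rank at most \<open>j\<close> have connecting maps
  \<open>P \<rightarrow> P/P\<^sub>j \<rightarrow> \<Sigma>P\<^sub>j\<close>, which together form a map into a direct sum. Almost all of them are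
  null-homotopic, which gives chain maps \<open>P \<rightarrow> P\<^sub>j\<close> that agree with the identity on larger and larger parts of
  \<open>P\<close>; their successive differences again form a map into a direct sum, and therefore the identity is homotopic to
  a map into some \<open>P\<^sub>j\<close> (lemma \<open>bounded_rank\<close>). From there the rank is lowered step by step: modulo a
  finite subcomplex, the cells of top rank span a direct sum with zero differential, in which finitely
  many summands suffice (lemma \<open>lower_rank\<close>).\<close>

section \<open>Graded modules and their homomorphisms\<close>

lemma graded_moduleD:
  assumes "graded_module L M"
  shows "module L M" "abelian_group M" "cring L" "subgroup (mdeg M d) (add_monoid M)"
  using assms by (auto simp: graded_module_def module_def)

lemma mdeg_in_carrier: "graded_module L M \<Longrightarrow> x \<in> mdeg M d \<Longrightarrow> x \<in> carrier M"
  using graded_moduleD(4)[of L M d] subgroup.subset[of "mdeg M d" "add_monoid M"] by auto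

lemma mdeg_zero: "graded_module L M \<Longrightarrow> \<zero>\<^bsub>M\<^esub> \<in> mdeg M d"
  using graded_moduleD(4)[of L M d] subgroup.one_closed[of "mdeg M d" "add_monoid M"] by auto

lemma mdeg_add:
  "graded_module L M \<Longrightarrow> x \<in> mdeg M d \<Longrightarrow> y \<in> mdeg M d \<Longrightarrow> x \<oplus>\<^bsub>M\<^esub> y \<in> mdeg M d"
  using graded_moduleD(4)[of L M d] subgroup.m_closed[of "mdeg M d" "add_monoid M"] by auto

lemma mdeg_neg: "graded_module L M \<Longrightarrow> x \<in> mdeg M d \<Longrightarrow> \<ominus>\<^bsub>M\<^esub> x \<in> mdeg M d"
  using graded_moduleD(4)[of L M d] subgroup.m_inv_closed[of "mdeg M d" "add_monoid M"]
  by (auto simp: a_inv_def)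

lemma mdeg_diff:
  "graded_module L M \<Longrightarrow> x \<in> mdeg M d \<Longrightarrow> y \<in> mdeg M d \<Longrightarrow> x \<ominus>\<^bsub>M\<^esub> y \<in> mdeg M d"
  by (simp add: a_minus_def mdeg_add mdeg_neg)

lemma mdeg_smult:
  "graded_module L M \<Longrightarrow> a \<in> rdeg L d \<Longrightarrow> x \<in> mdeg M e \<Longrightarrow> a \<odot>\<^bsub>M\<^esub> x \<in> mdeg M (d + e)"
  by (auto simp: graded_module_def)

lemma mdeg_finsum:
  assumes "graded_module L M" "\<And>i. i \<in> I \<Longrightarrow> f i \<in> mdeg M d"
  shows "finsum M f I \<in> mdeg M d"
proof -
  interpret abelian_group M using assms(1) by (rule graded_moduleD)
  show ?thesis using assms(2)
  proof (induction I rule: infinite_finite_induct)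
    case (insert i I)
    then have "f j \<in> carrier M" if "j \<in> insert i I" for j
      using mdeg_in_carrier[OF assms(1)] that by blast
    then have "finsum M f (insert i I) = f i \<oplus>\<^bsub>M\<^esub> finsum M f I"
      using insert.hyps by (intro finsum_insert) auto
    then show ?case using insert by (simp add: mdeg_add[OF assms(1)])
  qed (simp_all add: mdeg_zero[OF assms(1)])
qed

text \<open>Cocycles, coboundaries and cohomology are formed from all elements, but the generators of a graded
  free module must be sent to homogeneous ones. Taking the component of degree \<open>e\<close> turns a solution of a
  linear equation with homogeneous right-hand side into a homogeneous solution.\<close>

definition cpt :: "('a, 'u) gmodule \<Rightarrow> int \<Rightarrow> 'u \<Rightarrow> 'u" where
  "cpt M e x = (THE c. (\<forall>d. c d \<in> mdeg M d) \<and> finite {d. c d \<noteq> \<zero>\<^bsub>M\<^esub>} \<and>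
     x = finsum M c {d. c d \<noteq> \<zero>\<^bsub>M\<^esub>}) e"

lemma cpt_decomposition:
  assumes M: "graded_module L M" and x: "x \<in> carrier M"
  shows "cpt M d x \<in> mdeg M d" "finite {d. cpt M d x \<noteq> \<zero>\<^bsub>M\<^esub>}"
    "x = finsum M (\<lambda>d. cpt M d x) {d. cpt M d x \<noteq> \<zero>\<^bsub>M\<^esub>}"
proof -
  let ?P = "\<lambda>c. (\<forall>d. c d \<in> mdeg M d) \<and> finite {d. c d \<noteq> \<zero>\<^bsub>M\<^esub>} \<and>
     x = finsum M c {d. c d \<noteq> \<zero>\<^bsub>M\<^esub>}"
  have "\<exists>!c. ?P c" using M x by (auto simp: graded_module_def)
  from theI'[OF this] have *: "?P (THE c. ?P c)" .
  have "(THE c. ?P c) = (\<lambda>d. cpt M d x)" by (simp add: cpt_def)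
  with * show "cpt M d x \<in> mdeg M d" "finite {d. cpt M d x \<noteq> \<zero>\<^bsub>M\<^esub>}"
    "x = finsum M (\<lambda>d. cpt M d x) {d. cpt M d x \<noteq> \<zero>\<^bsub>M\<^esub>}" by simp_all
qed

lemma cpt_unique:
  assumes M: "graded_module L M" and c: "\<And>d. c d \<in> mdeg M d"
    and D: "finite D" "\<And>d. d \<notin> D \<Longrightarrow> c d = \<zero>\<^bsub>M\<^esub>" and x: "x = finsum M c D"
  shows "cpt M e x = c e"
proof -
  interpret abelian_group M using M by (rule graded_moduleD)
  have sub: "{d. c d \<noteq> \<zero>\<^bsub>M\<^esub>} \<subseteq> D" using D(2) by auto
  have cc: "c d \<in> carrier M" for d using c mdeg_in_carrier[OF M] by blast
  have "finsum M c {d. c d \<noteq> \<zero>\<^bsub>M\<^esub>} = finsum M c D"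
    by (rule add.finprod_mono_neutral_cong_left) (use D sub cc in auto)
  moreover have "x \<in> carrier M" using x cc by auto
  ultimately have ex: "\<exists>!c. (\<forall>d. c d \<in> mdeg M d) \<and> finite {d. c d \<noteq> \<zero>\<^bsub>M\<^esub>} \<and>
     x = finsum M c {d. c d \<noteq> \<zero>\<^bsub>M\<^esub>}" using M by (auto simp: graded_module_def)
  have "(THE c. (\<forall>d. c d \<in> mdeg M d) \<and> finite {d. c d \<noteq> \<zero>\<^bsub>M\<^esub>} \<and>
     x = finsum M c {d. c d \<noteq> \<zero>\<^bsub>M\<^esub>}) = c"
    using \<open>finsum M c {d. c d \<noteq> \<zero>\<^bsub>M\<^esub>} = finsum M c D\<close> x c finite_subset[OF sub D(1)]
    by (intro the1_equality[OF ex]) auto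
  then show ?thesis by (simp add: cpt_def)
qed

lemma cpt_homogeneous:
  assumes M: "graded_module L M" and x: "x \<in> mdeg M d"
  shows "cpt M e x = (if e = d then x else \<zero>\<^bsub>M\<^esub>)"
proof -
  interpret abelian_group M using M by (rule graded_moduleD)
  have "x \<in> carrier M" using mdeg_in_carrier[OF M x] .
  then show ?thesis
    by (intro cpt_unique[OF M, of _ "{d}"]) (use x mdeg_zero[OF M] in auto)
qed

lemma cpt_add:
  assumes M: "graded_module L M" and x: "x \<in> carrier M" and y: "y \<in> carrier M"
  shows "cpt M e (x \<oplus>\<^bsub>M\<^esub> y) = cpt M e x \<oplus>\<^bsub>M\<^esub> cpt M e y"
proof -
  interpret abelian_group M using M by (rule graded_moduleD)
  define D where "D = {d. cpt M d x \<noteq> \<zero>\<^bsub>M\<^esub>} \<union> {d. cpt M d y \<noteq> \<zero>\<^bsub>M\<^esub>}"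
  have fin: "finite D"
    using cpt_decomposition(2)[OF M x] cpt_decomposition(2)[OF M y] by (simp add: D_def)
  have cc: "cpt M d z \<in> carrier M" if "z \<in> carrier M" for d z
    using cpt_decomposition(1)[OF M that] mdeg_in_carrier[OF M] by blast
  have ext: "z = finsum M (\<lambda>d. cpt M d z) D"
    if "z \<in> carrier M" "{d. cpt M d z \<noteq> \<zero>\<^bsub>M\<^esub>} \<subseteq> D" for z
    by (subst cpt_decomposition(3)[OF M that(1)], rule add.finprod_mono_neutral_cong_left)
       (use fin that cc in auto)
  have "x \<oplus>\<^bsub>M\<^esub> y = finsum M (\<lambda>d. cpt M d x) D \<oplus>\<^bsub>M\<^esub> finsum M (\<lambda>d. cpt M d y) D"
    using ext[OF x] ext[OF y] by (simp add: D_def)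
  also have "\<dots> = finsum M (\<lambda>d. cpt M d x \<oplus>\<^bsub>M\<^esub> cpt M d y) D"
    by (rule finsum_addf[symmetric]) (use cc x y in auto)
  finally show ?thesis
    by (rule cpt_unique[OF M _ fin, rotated 2])
       (use cpt_decomposition(1)[OF M x] cpt_decomposition(1)[OF M y] mdeg_add[OF M] in \<open>auto simp: D_def\<close>)
qed

lemma gmod_homD:
  assumes "f \<in> gmod_hom L M N"
  shows "x \<in> carrier M \<Longrightarrow> f x \<in> carrier N"
    "x \<in> carrier M \<Longrightarrow> y \<in> carrier M \<Longrightarrow> f (x \<oplus>\<^bsub>M\<^esub> y) = f x \<oplus>\<^bsub>N\<^esub> f y"
    "a \<in> carrier L \<Longrightarrow> x \<in> carrier M \<Longrightarrow> f (a \<odot>\<^bsub>M\<^esub> x) = a \<odot>\<^bsub>N\<^esub> f x"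
    "x \<in> mdeg M d \<Longrightarrow> f x \<in> mdeg N d"
  using assms unfolding gmod_hom_def hom_def by (auto 0 3)

lemma gmod_homI:
  assumes "\<And>x. x \<in> carrier M \<Longrightarrow> f x \<in> carrier N"
    "\<And>x y. x \<in> carrier M \<Longrightarrow> y \<in> carrier M \<Longrightarrow> f (x \<oplus>\<^bsub>M\<^esub> y) = f x \<oplus>\<^bsub>N\<^esub> f y"
    "\<And>a x. a \<in> carrier L \<Longrightarrow> x \<in> carrier M \<Longrightarrow> f (a \<odot>\<^bsub>M\<^esub> x) = a \<odot>\<^bsub>N\<^esub> f x"
    "\<And>d x. x \<in> mdeg M d \<Longrightarrow> f x \<in> mdeg N d"
  shows "f \<in> gmod_hom L M N"
  using assms by (auto simp: gmod_hom_def hom_def)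

lemma gmod_hom_group_hom:
  assumes "graded_module L M" "graded_module L N" "f \<in> gmod_hom L M N"
  shows "abelian_group_hom M N f"
  by (intro abelian_group_hom.intro abelian_group_hom_axioms.intro group_hom.intro
        group_hom_axioms.intro abelian_group.a_group)
     (use assms graded_moduleD in \<open>auto simp: gmod_hom_def\<close>)

lemma gmod_hom_zero_neg:
  assumes "graded_module L M" "graded_module L N" "f \<in> gmod_hom L M N"
  shows "f \<zero>\<^bsub>M\<^esub> = \<zero>\<^bsub>N\<^esub>" "x \<in> carrier M \<Longrightarrow> f (\<ominus>\<^bsub>M\<^esub> x) = \<ominus>\<^bsub>N\<^esub> f x"
    "x \<in> carrier M \<Longrightarrow> y \<in> carrier M \<Longrightarrow> f (x \<ominus>\<^bsub>M\<^esub> y) = f x \<ominus>\<^bsub>N\<^esub> f y"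
proof -
  interpret abelian_group_hom M N f using gmod_hom_group_hom[OF assms] .
  interpret M: abelian_group M using assms graded_moduleD by blast
  show "f \<zero>\<^bsub>M\<^esub> = \<zero>\<^bsub>N\<^esub>" by simp
  show "x \<in> carrier M \<Longrightarrow> f (\<ominus>\<^bsub>M\<^esub> x) = \<ominus>\<^bsub>N\<^esub> f x" by simp
  show "x \<in> carrier M \<Longrightarrow> y \<in> carrier M \<Longrightarrow> f (x \<ominus>\<^bsub>M\<^esub> y) = f x \<ominus>\<^bsub>N\<^esub> f y"
    by (simp add: a_minus_def)
qed

lemma gmod_hom_finsum:
  assumes M: "graded_module L M" and N: "graded_module L N" and f: "f \<in> gmod_hom L M N"
    and x: "\<And>i. i \<in> I \<Longrightarrow> x i \<in> carrier M"
  shows "f (finsum M x I) = finsum N (\<lambda>i. f (x i)) I"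
proof -
  interpret M: abelian_group M using M by (rule graded_moduleD)
  interpret N: abelian_group N using N by (rule graded_moduleD)
  show ?thesis using x
    by (induction I rule: infinite_finite_induct)
       (auto simp: gmod_hom_zero_neg[OF M N f] gmod_homD[OF f] Pi_iff)
qed

lemma cpt_hom:
  assumes M: "graded_module L M" and N: "graded_module L N" and f: "f \<in> gmod_hom L M N"
    and x: "x \<in> carrier M"
  shows "f (cpt M e x) = cpt N e (f x)"
proof (rule sym, rule cpt_unique[OF N])
  show "f (cpt M d x) \<in> mdeg N d" for d
    using cpt_decomposition(1)[OF M x] gmod_homD(4)[OF f] by blast
  show "finite {d. cpt M d x \<noteq> \<zero>\<^bsub>M\<^esub>}" by (rule cpt_decomposition(2)[OF M x])
  show "f x = (\<Oplus>\<^bsub>N\<^esub>d\<in>{d. cpt M d x \<noteq> \<zero>\<^bsub>M\<^esub>}. f (cpt M d x))"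
    by (subst cpt_decomposition(3)[OF M x], rule gmod_hom_finsum[OF M N f])
       (use cpt_decomposition(1)[OF M x] mdeg_in_carrier[OF M] in blast)
qed (simp add: gmod_hom_zero_neg[OF M N f])

text \<open>A property that is closed under sums need only be checked on homogeneous components.\<close>

lemma graded_induct:
  assumes M: "graded_module L M" and x: "x \<in> carrier M"
    and "Q \<zero>\<^bsub>M\<^esub>" "\<And>y z. y \<in> carrier M \<Longrightarrow> z \<in> carrier M \<Longrightarrow> Q y \<Longrightarrow> Q z \<Longrightarrow> Q (y \<oplus>\<^bsub>M\<^esub> z)"
    and "\<And>d. Q (cpt M d x)"
  shows "Q x"
proof -
  interpret abelian_group M using M by (rule graded_moduleD)
  have cc: "cpt M d x \<in> carrier M" for d
    using cpt_decomposition(1)[OF M x] mdeg_in_carrier[OF M] by blast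
  have "Q (finsum M (\<lambda>d. cpt M d x) D)" for D
    by (induction D rule: infinite_finite_induct) (use assms cc in auto)
  then show ?thesis using cpt_decomposition(3)[OF M x] by metis
qed

lemma gmod_hom_id: "(\<lambda>x. x) \<in> gmod_hom L M M"
  by (rule gmod_homI) auto

lemma gmod_hom_comp:
  "f \<in> gmod_hom L M N \<Longrightarrow> g \<in> gmod_hom L N K \<Longrightarrow> (\<lambda>x. g (f x)) \<in> gmod_hom L M K"
  by (rule gmod_homI) (auto simp: gmod_homD)

lemma gmod_hom_zero: "graded_module L M \<Longrightarrow> graded_module L N \<Longrightarrow> (\<lambda>x. \<zero>\<^bsub>N\<^esub>) \<in> gmod_hom L M N"
proof (rule gmod_homI, goal_cases)
  case (2 x y)
  interpret abelian_group N using 2 graded_moduleD by blast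
  show ?case by simp
next
  case (3 a x)
  interpret module L N using 3 graded_moduleD by blast
  show ?case using 3 by simp
next
  case (1 x)
  interpret abelian_group N using 1 graded_moduleD by blast
  show ?case by simp
qed (simp add: mdeg_zero)

lemma gmod_hom_add:
  assumes "graded_module L M" and N: "graded_module L N"
    and f: "f \<in> gmod_hom L M N" and g: "g \<in> gmod_hom L M N"
  shows "(\<lambda>x. f x \<oplus>\<^bsub>N\<^esub> g x) \<in> gmod_hom L M N"
proof -
  interpret N: abelian_group N using N graded_moduleD by blast
  interpret module L N using N graded_moduleD by blast
  show ?thesis
  proof (rule gmod_homI)
    fix x y assume "x \<in> carrier M" "y \<in> carrier M"
    then show "f (x \<oplus>\<^bsub>M\<^esub> y) \<oplus>\<^bsub>N\<^esub> g (x \<oplus>\<^bsub>M\<^esub> y) = f x \<oplus>\<^bsub>N\<^esub> g x \<oplus>\<^bsub>N\<^esub> (f y \<oplus>\<^bsub>N\<^esub> g y)"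
      by (simp add: gmod_homD[OF f] gmod_homD[OF g] N.a_ac)
  qed (simp_all add: gmod_homD[OF f] gmod_homD[OF g] mdeg_add[OF N] smult_r_distr)
qed

lemma gmod_hom_neg:
  assumes "graded_module L M" and N: "graded_module L N"
    and f: "f \<in> gmod_hom L M N"
  shows "(\<lambda>x. \<ominus>\<^bsub>N\<^esub> f x) \<in> gmod_hom L M N"
proof -
  interpret module L N using N graded_moduleD by blast
  show ?thesis
    by (rule gmod_homI)
       (simp_all add: gmod_homD[OF f] mdeg_neg[OF N] smult_r_minus M.minus_add)
qed

lemma gmod_hom_diff:
  assumes "graded_module L M" "graded_module L N"
    and "f \<in> gmod_hom L M N" "g \<in> gmod_hom L M N"
  shows "(\<lambda>x. f x \<ominus>\<^bsub>N\<^esub> g x) \<in> gmod_hom L M N"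
  unfolding a_minus_def by (intro gmod_hom_add gmod_hom_neg assms)

section \<open>Complexes, quasi-isomorphisms and homotopies\<close>

lemma (in comm_group) coset_eq_iff:
  assumes "subgroup H G" "x \<in> carrier G" "y \<in> carrier G"
  shows "H #> x = H #> y \<longleftrightarrow> x \<otimes> inv y \<in> H"
proof -
  interpret subgroup H G by fact
  have "H #> x = H #> y \<longleftrightarrow> x \<in> H #> y"
  proof
    assume "x \<in> H #> y"
    then show "H #> x = H #> y" by (rule repr_independence[OF _ assms(3,1), symmetric])
  qed (use rcos_self[OF assms(2,1)] in blast)
  then show ?thesis using rcos_module[OF is_group assms(3,2)] by simp
qed

text \<open>Isomorphism of the map induced on quotients, expressed by elements instead of cosets.\<close>

lemma FactGroup_map_iso_iff:
  assumes "comm_group G" "comm_group K" and H: "subgroup H G" and J: "subgroup J K"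
    and f: "f \<in> hom G K" and fH: "f ` H \<subseteq> J"
  defines "\<Phi> \<equiv> \<lambda>W. \<Union>x\<in>W. J #>\<^bsub>K\<^esub> f x"
  shows "\<Phi> \<in> iso (G Mod H) (K Mod J) \<longleftrightarrow>
    (\<forall>z\<in>carrier G. f z \<in> J \<longrightarrow> z \<in> H) \<and> (\<forall>y\<in>carrier K. \<exists>z\<in>carrier G. \<exists>h\<in>J. y = h \<otimes>\<^bsub>K\<^esub> f z)"
proof -
  interpret G: comm_group G by fact
  interpret K: comm_group K by fact
  interpret f: group_hom G K f using f by unfold_locales
  interpret H: normal H G using G.normal_iff_subgroup H by blast
  interpret J: normal J K using K.normal_iff_subgroup J by blast
  have \<Phi>: "\<Phi> (H #>\<^bsub>G\<^esub> x) = J #>\<^bsub>K\<^esub> f x" if x: "x \<in> carrier G" for x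
  proof -
    have *: "J #>\<^bsub>K\<^esub> f y = J #>\<^bsub>K\<^esub> f x" if "y \<in> H #>\<^bsub>G\<^esub> x" for y
    proof -
      obtain h where h: "h \<in> H" "y = h \<otimes>\<^bsub>G\<^esub> x" using \<open>y \<in> H #>\<^bsub>G\<^esub> x\<close> unfolding r_coset_def by blast
      then have "f y = f h \<otimes>\<^bsub>K\<^esub> f x" "f h \<in> J" using x H.mem_carrier fH by auto
      then show ?thesis using x K.coset_eq_iff[OF J, of "f y" "f x"]
        by (simp add: K.m_assoc J.mem_carrier)
    qed
    show ?thesis unfolding \<Phi>_def
    proof (intro equalityI UN_least)
      show "J #>\<^bsub>K\<^esub> f x \<subseteq> (\<Union>y\<in>H #>\<^bsub>G\<^esub> x. J #>\<^bsub>K\<^esub> f y)"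
        using G.rcos_self[OF x H] by blast
    qed (use * in blast)
  qed
  have cG: "carrier (G Mod H) = (\<lambda>x. H #>\<^bsub>G\<^esub> x) ` carrier G"
    and cK: "carrier (K Mod J) = (\<lambda>x. J #>\<^bsub>K\<^esub> x) ` carrier K"
    by (simp_all add: carrier_FactGroup)
  have hom: "\<Phi> \<in> hom (G Mod H) (K Mod J)"
  proof (rule homI)
    fix V W assume "V \<in> carrier (G Mod H)" "W \<in> carrier (G Mod H)"
    then obtain x y where "x \<in> carrier G" "V = H #>\<^bsub>G\<^esub> x" "y \<in> carrier G" "W = H #>\<^bsub>G\<^esub> y"
      using cG by auto
    then show "\<Phi> (V \<otimes>\<^bsub>G Mod H\<^esub> W) = \<Phi> V \<otimes>\<^bsub>K Mod J\<^esub> \<Phi> W"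
      by (simp add: \<Phi> H.rcos_sum J.rcos_sum)
  next
    fix V assume "V \<in> carrier (G Mod H)"
    then show "\<Phi> V \<in> carrier (K Mod J)" using cG cK \<Phi> by auto
  qed
  have inj: "inj_on \<Phi> (carrier (G Mod H)) \<longleftrightarrow> (\<forall>z\<in>carrier G. f z \<in> J \<longrightarrow> z \<in> H)"
  proof
    assume inj: "inj_on \<Phi> (carrier (G Mod H))"
    show "\<forall>z\<in>carrier G. f z \<in> J \<longrightarrow> z \<in> H"
    proof (intro ballI impI)
      fix z assume z: "z \<in> carrier G" "f z \<in> J"
      have "\<Phi> (H #>\<^bsub>G\<^esub> z) = \<Phi> (H #>\<^bsub>G\<^esub> \<one>\<^bsub>G\<^esub>)"
        using z by (simp add: \<Phi> K.coset_eq_iff[OF J])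
      then have "H #>\<^bsub>G\<^esub> z = H #>\<^bsub>G\<^esub> \<one>\<^bsub>G\<^esub>"
        by (rule inj_onD[OF inj]) (use z in \<open>auto simp: cG\<close>)
      then show "z \<in> H" using z by (simp add: G.coset_eq_iff[OF H])
    qed
  next
    assume *: "\<forall>z\<in>carrier G. f z \<in> J \<longrightarrow> z \<in> H"
    show "inj_on \<Phi> (carrier (G Mod H))"
    proof (rule inj_onI)
      fix V W assume VW: "V \<in> carrier (G Mod H)" "W \<in> carrier (G Mod H)" and e: "\<Phi> V = \<Phi> W"
      obtain x y where x: "x \<in> carrier G" "V = H #>\<^bsub>G\<^esub> x" and y: "y \<in> carrier G" "W = H #>\<^bsub>G\<^esub> y"
        using VW cG by auto
      have "f (x \<otimes>\<^bsub>G\<^esub> inv\<^bsub>G\<^esub> y) \<in> J"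
        using e x y K.coset_eq_iff[OF J, of "f x" "f y"] by (simp add: \<Phi>)
      then show "V = W" using * x y G.coset_eq_iff[OF H, of x y] by simp
    qed
  qed
  have surj: "\<Phi> ` carrier (G Mod H) = carrier (K Mod J) \<longleftrightarrow>
     (\<forall>y\<in>carrier K. \<exists>z\<in>carrier G. \<exists>h\<in>J. y = h \<otimes>\<^bsub>K\<^esub> f z)"
  proof -
    have eq: "J #>\<^bsub>K\<^esub> y = J #>\<^bsub>K\<^esub> f z \<longleftrightarrow> (\<exists>h\<in>J. y = h \<otimes>\<^bsub>K\<^esub> f z)"
      if "y \<in> carrier K" "z \<in> carrier G" for y z
    proof
      assume "J #>\<^bsub>K\<^esub> y = J #>\<^bsub>K\<^esub> f z"
      then have "y \<in> J #>\<^bsub>K\<^esub> f z" using K.rcos_self[OF that(1) J] by simp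
      then show "\<exists>h\<in>J. y = h \<otimes>\<^bsub>K\<^esub> f z" by (auto simp: r_coset_def)
    next
      assume "\<exists>h\<in>J. y = h \<otimes>\<^bsub>K\<^esub> f z"
      then show "J #>\<^bsub>K\<^esub> y = J #>\<^bsub>K\<^esub> f z"
        using that K.coset_eq_iff[OF J, of y "f z"] by (auto simp: K.m_assoc J.mem_carrier)
    qed
    have im: "\<Phi> ` carrier (G Mod H) = (\<lambda>z. J #>\<^bsub>K\<^esub> f z) ` carrier G"
      unfolding cG image_image by (rule image_cong) (use \<Phi> in auto)
    have sub: "(\<lambda>z. J #>\<^bsub>K\<^esub> f z) ` carrier G \<subseteq> carrier (K Mod J)" unfolding cK by auto
    have "\<Phi> ` carrier (G Mod H) = carrier (K Mod J) \<longleftrightarrow>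
        carrier (K Mod J) \<subseteq> (\<lambda>z. J #>\<^bsub>K\<^esub> f z) ` carrier G"
      unfolding im using sub by blast
    also have "\<dots> \<longleftrightarrow> (\<forall>y\<in>carrier K. \<exists>z\<in>carrier G. J #>\<^bsub>K\<^esub> y = J #>\<^bsub>K\<^esub> f z)"
      unfolding cK by blast
    also have "\<dots> \<longleftrightarrow> (\<forall>y\<in>carrier K. \<exists>z\<in>carrier G. \<exists>h\<in>J. y = h \<otimes>\<^bsub>K\<^esub> f z)"
      by (intro ball_cong bex_cong refl eq)
    finally show ?thesis .
  qed
  show ?thesis using hom inj surj by (simp add: iso_def bij_betw_def)
qed

lemma cochain_complexD:
  assumes "cochain_complex L A"
  shows "graded_module L (obj A n)" "abelian_group (obj A n)"
    "dif A n \<in> gmod_hom L (obj A n) (obj A (n + 1))"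
    "dif A (n - 1) \<in> gmod_hom L (obj A (n - 1)) (obj A n)"
    "x \<in> carrier (obj A n) \<Longrightarrow> dif A (n + 1) (dif A n x) = \<zero>\<^bsub>obj A (n + 1 + 1)\<^esub>"
    "y \<in> carrier (obj A (n - 1)) \<Longrightarrow> dif A n (dif A (n - 1) y) = \<zero>\<^bsub>obj A (n + 1)\<^esub>"
proof -
  have "\<And>n. dif A n \<in> gmod_hom L (obj A n) (obj A (n + 1))"
    and "\<And>n x. x \<in> carrier (obj A n) \<Longrightarrow> dif A (n + 1) (dif A n x) = \<zero>\<^bsub>obj A (n + 1 + 1)\<^esub>"
    using assms by (auto simp: cochain_complex_def)
  from this[where n = n] this[where n = "n - 1"]
  show "dif A n \<in> gmod_hom L (obj A n) (obj A (n + 1))"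
    "dif A (n - 1) \<in> gmod_hom L (obj A (n - 1)) (obj A n)"
    "x \<in> carrier (obj A n) \<Longrightarrow> dif A (n + 1) (dif A n x) = \<zero>\<^bsub>obj A (n + 1 + 1)\<^esub>"
    "y \<in> carrier (obj A (n - 1)) \<Longrightarrow> dif A n (dif A (n - 1) y) = \<zero>\<^bsub>obj A (n + 1)\<^esub>" by simp_all
  show "graded_module L (obj A n)" using assms by (auto simp: cochain_complex_def)
  then show "abelian_group (obj A n)" by (rule graded_moduleD)
qed

lemma chain_mapD:
  assumes "f \<in> chain_map L A B"
  shows "f n \<in> gmod_hom L (obj A n) (obj B n)"
    "x \<in> carrier (obj A n) \<Longrightarrow> f (n + 1) (dif A n x) = dif B n (f n x)"
    "y \<in> carrier (obj A (n - 1)) \<Longrightarrow> f n (dif A (n - 1) y) = dif B (n - 1) (f (n - 1) y)"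
proof -
  have "\<And>n x. x \<in> carrier (obj A n) \<Longrightarrow> f (n + 1) (dif A n x) = dif B n (f n x)"
    using assms by (auto simp: chain_map_def)
  from this[where n = n] this[where n = "n - 1"]
  show "x \<in> carrier (obj A n) \<Longrightarrow> f (n + 1) (dif A n x) = dif B n (f n x)"
    "y \<in> carrier (obj A (n - 1)) \<Longrightarrow> f n (dif A (n - 1) y) = dif B (n - 1) (f (n - 1) y)" by simp_all
qed (use assms in \<open>auto simp: chain_map_def\<close>)

lemma cocycles_subgroup:
  assumes A: "cochain_complex L A"
  shows "subgroup (cocycles A n) (add_monoid (obj A n))"
    "coboundaries A n \<subseteq> cocycles A n"
    "subgroup (coboundaries A n) (add_monoid (obj A n)\<lparr>carrier := cocycles A n\<rparr>)"
    "comm_group (add_monoid (obj A n)\<lparr>carrier := cocycles A n\<rparr>)"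
proof -
  note gm = cochain_complexD(1)[OF A]
  interpret f: abelian_group_hom "obj A n" "obj A (n + 1)" "dif A n"
    by (rule gmod_hom_group_hom[OF gm gm cochain_complexD(3)[OF A]])
  interpret g: abelian_group_hom "obj A (n - 1)" "obj A n" "dif A (n - 1)"
    by (rule gmod_hom_group_hom[OF gm gm cochain_complexD(4)[OF A]])
  have "cocycles A n = kernel (add_monoid (obj A n)) (add_monoid (obj A (n + 1))) (dif A n)"
    by (simp add: cocycles_def kernel_def)
  then show *: "subgroup (cocycles A n) (add_monoid (obj A n))"
    using f.a_group_hom group_hom.subgroup_kernel by metis
  show sub: "coboundaries A n \<subseteq> cocycles A n"
    using cochain_complexD(6)[OF A] by (auto simp: coboundaries_def cocycles_def)
  have "subgroup (coboundaries A n) (add_monoid (obj A n))"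
    using group_hom.img_is_subgroup[OF g.a_group_hom] by (simp add: coboundaries_def)
  then show "subgroup (coboundaries A n) (add_monoid (obj A n)\<lparr>carrier := cocycles A n\<rparr>)"
    using group.subgroup_incl[OF f.G.a_group _ * sub] by simp
  show "comm_group (add_monoid (obj A n)\<lparr>carrier := cocycles A n\<rparr>)"
    using subgroup.subgroup_is_group[OF * f.G.a_group] subgroup.subset[OF *]
    by (intro group.group_comm_groupI) (auto intro: f.G.a_comm)
qed

text \<open>Unfolded, a quasi-isomorphism is a chain map that reflects coboundaries and hits every
  cohomology class.\<close>

lemma quasi_iso_iff:
  assumes A: "cochain_complex L A" and B: "cochain_complex L B"
  shows "f \<in> quasi_iso L A B \<longleftrightarrow> f \<in> chain_map L A B \<and>
    (\<forall>n. \<forall>z\<in>cocycles A n. f n z \<in> coboundaries B n \<longrightarrow> z \<in> coboundaries A n) \<and>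
    (\<forall>n. \<forall>y\<in>cocycles B n. \<exists>z\<in>cocycles A n. \<exists>w\<in>carrier (obj B (n - 1)).
       y = dif B (n - 1) w \<oplus>\<^bsub>obj B n\<^esub> f n z)"
proof -
  have "cohomology_map B f n \<in> iso (cohomology A n) (cohomology B n) \<longleftrightarrow>
     (\<forall>z\<in>cocycles A n. f n z \<in> coboundaries B n \<longrightarrow> z \<in> coboundaries A n) \<and>
     (\<forall>y\<in>cocycles B n. \<exists>z\<in>cocycles A n. \<exists>w\<in>carrier (obj B (n - 1)).
       y = dif B (n - 1) w \<oplus>\<^bsub>obj B n\<^esub> f n z)" if f: "f \<in> chain_map L A B" for n
  proof -
    let ?G = "\<lambda>A. add_monoid (obj A n)\<lparr>carrier := cocycles A n\<rparr>"
    have fz: "f n z \<in> cocycles B n" if "z \<in> cocycles A n" for z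
    proof -
      have "dif B n (f n z) = f (n + 1) (dif A n z)"
        using that chain_mapD(2)[OF f, of z n] by (simp add: cocycles_def)
      also have "\<dots> = \<zero>\<^bsub>obj B (n + 1)\<^esub>"
        using that gmod_hom_zero_neg(1)[OF cochain_complexD(1)[OF A] cochain_complexD(1)[OF B] chain_mapD(1)[OF f]]
        by (simp add: cocycles_def)
      finally show ?thesis using that gmod_homD(1)[OF chain_mapD(1)[OF f]] by (simp add: cocycles_def)
    qed
    have "f n \<in> hom (?G A) (?G B)"
      using fz gmod_homD(2)[OF chain_mapD(1)[OF f]] by (auto simp: hom_def cocycles_def)
    moreover have "f n ` coboundaries A n \<subseteq> coboundaries B n"
      using chain_mapD(3)[OF f] gmod_homD(1)[OF chain_mapD(1)[OF f]]
      by (force simp: coboundaries_def)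
    ultimately have *: "(\<lambda>W. \<Union>x\<in>W. coboundaries B n #>\<^bsub>?G B\<^esub> f n x) \<in>
        iso (?G A Mod coboundaries A n) (?G B Mod coboundaries B n) \<longleftrightarrow>
      (\<forall>z\<in>carrier (?G A). f n z \<in> coboundaries B n \<longrightarrow> z \<in> coboundaries A n) \<and>
      (\<forall>y\<in>carrier (?G B). \<exists>z\<in>carrier (?G A). \<exists>h\<in>coboundaries B n. y = h \<otimes>\<^bsub>?G B\<^esub> f n z)"
      by (intro FactGroup_map_iso_iff cocycles_subgroup[OF A] cocycles_subgroup[OF B])
    have "cohomology_map B f n = (\<lambda>W. \<Union>x\<in>W. coboundaries B n #>\<^bsub>?G B\<^esub> f n x)"
      by (simp add: cohomology_map_def fun_eq_iff a_r_coset_def r_coset_def)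
    with * show ?thesis by (simp add: cohomology_def) (auto simp: coboundaries_def)
  qed
  then show ?thesis by (auto simp: quasi_iso_def)
qed

lemma id_map_chain_map: "id_map \<in> chain_map L A A"
  by (auto simp: chain_map_def id_map_def gmod_hom_id)

lemma id_map_quasi_iso:
  assumes A: "cochain_complex L A"
  shows "id_map \<in> quasi_iso L A A"
  unfolding quasi_iso_iff[OF A A]
proof (intro conjI allI ballI impI id_map_chain_map)
  fix n y assume y: "y \<in> cocycles A n"
  interpret abelian_group "obj A n" by (rule cochain_complexD[OF A])
  have "y = dif A (n - 1) \<zero>\<^bsub>obj A (n - 1)\<^esub> \<oplus>\<^bsub>obj A n\<^esub> id_map n y"
    using y gmod_hom_zero_neg(1)[OF cochain_complexD(1)[OF A] cochain_complexD(1)[OF A] cochain_complexD(4)[OF A]]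
    by (simp add: id_map_def cocycles_def)
  moreover have "\<zero>\<^bsub>obj A (n - 1)\<^esub> \<in> carrier (obj A (n - 1))"
    by (intro abelian_monoid.zero_closed abelian_group.axioms cochain_complexD[OF A])
  ultimately show "\<exists>z\<in>cocycles A n. \<exists>w\<in>carrier (obj A (n - 1)).
     y = dif A (n - 1) w \<oplus>\<^bsub>obj A n\<^esub> id_map n z" using y by blast
qed (simp add: id_map_def)

lemma comp_map_chain_map:
  assumes "f \<in> chain_map L A B" "g \<in> chain_map L B C"
  shows "comp_map g f \<in> chain_map L A C"
  using assms gmod_homD(1)[OF chain_mapD(1)[OF assms(1)]]
  by (auto simp: chain_map_def comp_map_def o_def intro: gmod_hom_comp)

lemma add_map_chain_map:
  assumes A: "cochain_complex L A" and B: "cochain_complex L B"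
    and f: "f \<in> chain_map L A B" and g: "g \<in> chain_map L A B"
  shows "add_map B f g \<in> chain_map L A B"
  unfolding chain_map_def
proof (intro CollectI conjI allI ballI)
  fix n show "add_map B f g n \<in> gmod_hom L (obj A n) (obj B n)"
    unfolding add_map_def
    by (intro gmod_hom_add cochain_complexD[OF A] cochain_complexD[OF B] chain_mapD[OF f] chain_mapD[OF g])
  fix x assume "x \<in> carrier (obj A n)"
  then show "add_map B f g (n + 1) (dif A n x) = dif B n (add_map B f g n x)"
    by (simp add: add_map_def chain_mapD[OF f] chain_mapD[OF g] gmod_homD(2)[OF cochain_complexD(3)[OF B]]
       gmod_homD(1)[OF chain_mapD(1)[OF f]] gmod_homD(1)[OF chain_mapD(1)[OF g]])
qed

lemma zero_map_chain_map:
  assumes A: "cochain_complex L A" and B: "cochain_complex L B"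
  shows "zero_map B \<in> chain_map L A B"
  unfolding chain_map_def zero_map_def
  using gmod_hom_zero[OF cochain_complexD(1)[OF A] cochain_complexD(1)[OF B]]
    gmod_hom_zero_neg(1)[OF cochain_complexD(1)[OF B] cochain_complexD(1)[OF B] cochain_complexD(3)[OF B]]
  by auto

definition neg_map :: "('a, 'u) cpx \<Rightarrow> 'u maps \<Rightarrow> 'u maps" where
  "neg_map B f = (\<lambda>n x. \<ominus>\<^bsub>obj B n\<^esub> f n x)"

lemma neg_map_chain_map:
  assumes A: "cochain_complex L A" and B: "cochain_complex L B" and f: "f \<in> chain_map L A B"
  shows "neg_map B f \<in> chain_map L A B"
  unfolding chain_map_def
proof (intro CollectI conjI allI ballI)
  fix n show "neg_map B f n \<in> gmod_hom L (obj A n) (obj B n)"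
    unfolding neg_map_def
    by (intro gmod_hom_neg cochain_complexD[OF A] cochain_complexD[OF B] chain_mapD[OF f])
  fix x assume "x \<in> carrier (obj A n)"
  then show "neg_map B f (n + 1) (dif A n x) = dif B n (neg_map B f n x)"
    by (simp add: neg_map_def chain_mapD[OF f]
       gmod_hom_zero_neg[OF cochain_complexD(1)[OF B] cochain_complexD(1)[OF B] cochain_complexD(3)[OF B]] gmod_homD(1)[OF chain_mapD(1)[OF f]])
qed

lemma homotopicI:
  assumes "\<And>n. h n \<in> gmod_hom L (obj A n) (obj B (n - 1))"
    and "\<And>n x. x \<in> carrier (obj A n) \<Longrightarrow>
      f n x \<ominus>\<^bsub>obj B n\<^esub> g n x = dif B (n - 1) (h n x) \<oplus>\<^bsub>obj B n\<^esub> h (n + 1) (dif A n x)"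
  shows "homotopic L A B f g"
  using assms unfolding homotopic_def by blast

definition homotopy ::
  "'a gring \<Rightarrow> ('a, 'u) cpx \<Rightarrow> ('a, 'u) cpx \<Rightarrow> 'u maps \<Rightarrow> 'u maps \<Rightarrow> 'u maps \<Rightarrow> bool" where
  "homotopy L A B h f g \<longleftrightarrow> (\<forall>n. h n \<in> gmod_hom L (obj A n) (obj B (n - 1))) \<and>
     (\<forall>n. \<forall>x\<in>carrier (obj A n).
        f n x \<ominus>\<^bsub>obj B n\<^esub> g n x = dif B (n - 1) (h n x) \<oplus>\<^bsub>obj B n\<^esub> h (n + 1) (dif A n x))"

lemma homotopic_iff: "homotopic L A B f g \<longleftrightarrow> (\<exists>h. homotopy L A B h f g)"
  by (simp add: homotopic_def homotopy_def)

lemma homotopyD: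
  assumes "homotopy L A B h f g"
  shows "h n \<in> gmod_hom L (obj A n) (obj B (n - 1))"
    and "h (n + 1) \<in> gmod_hom L (obj A (n + 1)) (obj B n)"
    and "x \<in> carrier (obj A n) \<Longrightarrow>
      f n x \<ominus>\<^bsub>obj B n\<^esub> g n x = dif B (n - 1) (h n x) \<oplus>\<^bsub>obj B n\<^esub> h (n + 1) (dif A n x)"
proof -
  have "\<And>n. h n \<in> gmod_hom L (obj A n) (obj B (n - 1))"
    using assms by (simp add: homotopy_def)
  from this[of n] this[of "n + 1"]
  show "h n \<in> gmod_hom L (obj A n) (obj B (n - 1))"
    "h (n + 1) \<in> gmod_hom L (obj A (n + 1)) (obj B n)" by simp_all
qed (use assms in \<open>simp add: homotopy_def\<close>)

text \<open>The identities behind symmetry, transitivity and additivity of homotopy.\<close>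

lemma (in abelian_group) homotopy_identities:
  assumes [simp]: "x \<in> carrier G" "y \<in> carrier G" "z \<in> carrier G" "w \<in> carrier G"
    "s \<in> carrier G" "t \<in> carrier G" "s' \<in> carrier G" "t' \<in> carrier G"
  shows "x \<ominus> y = s \<oplus> t \<Longrightarrow> y \<ominus> x = \<ominus> s \<oplus> \<ominus> t"
    and "x \<ominus> y = s \<oplus> t \<Longrightarrow> y \<ominus> z = s' \<oplus> t' \<Longrightarrow> x \<ominus> z = (s \<oplus> s') \<oplus> (t \<oplus> t')"
    and "x \<ominus> y = s \<oplus> t \<Longrightarrow> z \<ominus> w = s' \<oplus> t' \<Longrightarrow> (x \<oplus> z) \<ominus> (y \<oplus> w) = (s \<oplus> s') \<oplus> (t \<oplus> t')"
proof -
  assume e: "x \<ominus> y = s \<oplus> t"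
  have "y \<ominus> x = \<ominus> (x \<ominus> y)" by (simp add: a_minus_def minus_add a_comm)
  then show "y \<ominus> x = \<ominus> s \<oplus> \<ominus> t" using e by (simp add: minus_add)
next
  assume e: "x \<ominus> y = s \<oplus> t" "y \<ominus> z = s' \<oplus> t'"
  have "x \<ominus> z = (x \<ominus> y) \<oplus> (y \<ominus> z)"
    by (simp add: a_minus_def a_assoc r_neg1)
  then show "x \<ominus> z = (s \<oplus> s') \<oplus> (t \<oplus> t')" using e by (simp add: a_ac)
next
  assume e: "x \<ominus> y = s \<oplus> t" "z \<ominus> w = s' \<oplus> t'"
  have "(x \<oplus> z) \<ominus> (y \<oplus> w) = (x \<ominus> y) \<oplus> (z \<ominus> w)"
    by (simp add: a_minus_def minus_add a_ac)
  then show "(x \<oplus> z) \<ominus> (y \<oplus> w) = (s \<oplus> s') \<oplus> (t \<oplus> t')" using e by (simp add: a_ac)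
qed

context
  fixes L :: "'a gring" and A B :: "('a, 'u) cpx"
  assumes A: "cochain_complex L A" and B: "cochain_complex L B"
begin

lemma homotopic_pointwise:
  assumes f: "f \<in> chain_map L A B" and eq: "\<And>n x. x \<in> carrier (obj A n) \<Longrightarrow> f n x = g n x"
  shows "homotopic L A B f g"
proof (rule homotopicI)
  show "(\<lambda>x. \<zero>\<^bsub>obj B (n - 1)\<^esub>) \<in> gmod_hom L (obj A n) (obj B (n - 1))" for n
    by (intro gmod_hom_zero cochain_complexD[OF A] cochain_complexD[OF B])
  fix n x assume x: "x \<in> carrier (obj A n)"
  interpret abelian_group "obj B n" by (rule cochain_complexD[OF B])
  show "f n x \<ominus>\<^bsub>obj B n\<^esub> g n x = dif B (n - 1) \<zero>\<^bsub>obj B (n - 1)\<^esub> \<oplus>\<^bsub>obj B n\<^esub> \<zero>\<^bsub>obj B (n + 1 - 1)\<^esub>"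
    using x gmod_homD(1)[OF chain_mapD(1)[OF f] x]
    by (simp add: eq gmod_hom_zero_neg(1)[OF cochain_complexD(1)[OF B] cochain_complexD(1)[OF B] cochain_complexD(4)[OF B]] a_minus_def r_neg)
qed

lemma homotopic_refl: "f \<in> chain_map L A B \<Longrightarrow> homotopic L A B f f"
  by (rule homotopic_pointwise) auto

lemma homotopic_sym:
  assumes f: "f \<in> chain_map L A B" and g: "g \<in> chain_map L A B" and "homotopic L A B f g"
  shows "homotopic L A B g f"
proof -
  obtain h where "homotopy L A B h f g"
    using assms(3) by (auto simp: homotopic_iff)
  note h = homotopyD[OF this]
  show ?thesis
  proof (rule homotopicI)
    show "(\<lambda>x. \<ominus>\<^bsub>obj B (n - 1)\<^esub> h n x) \<in> gmod_hom L (obj A n) (obj B (n - 1))" for n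
      by (intro gmod_hom_neg cochain_complexD[OF A] cochain_complexD[OF B] h)
    fix n x assume x: "x \<in> carrier (obj A n)"
    interpret abelian_group "obj B n" by (rule cochain_complexD[OF B])
    note c = gmod_homD(1)[OF chain_mapD(1)[OF f] x] gmod_homD(1)[OF chain_mapD(1)[OF g] x]
      gmod_homD(1)[OF cochain_complexD(4)[OF B] gmod_homD(1)[OF h(1) x]]
      gmod_homD(1)[OF h(2) gmod_homD(1)[OF cochain_complexD(3)[OF A] x]]
    show "g n x \<ominus>\<^bsub>obj B n\<^esub> f n x = dif B (n - 1) (\<ominus>\<^bsub>obj B (n - 1)\<^esub> h n x)
       \<oplus>\<^bsub>obj B n\<^esub> \<ominus>\<^bsub>obj B (n + 1 - 1)\<^esub> h (n + 1) (dif A n x)"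
      using homotopy_identities(1)[OF c(1,2,1,1,3,4,1,1) h(3)[OF x]]
      by (simp add: gmod_hom_zero_neg[OF cochain_complexD(1)[OF B] cochain_complexD(1)[OF B] cochain_complexD(4)[OF B]] gmod_homD(1)[OF h(1) x])
  qed
qed

lemma homotopic_trans:
  assumes f: "f \<in> chain_map L A B" and g: "g \<in> chain_map L A B" and k: "k \<in> chain_map L A B"
    and "homotopic L A B f g" "homotopic L A B g k"
  shows "homotopic L A B f k"
proof -
  obtain h where "homotopy L A B h f g"
    using assms(4) by (auto simp: homotopic_iff)
  note h = homotopyD[OF this]
  obtain h' where "homotopy L A B h' g k"
    using assms(5) by (auto simp: homotopic_iff)
  note h' = homotopyD[OF this]
  show ?thesis
  proof (rule homotopicI)
    show "(\<lambda>x. h n x \<oplus>\<^bsub>obj B (n - 1)\<^esub> h' n x) \<in> gmod_hom L (obj A n) (obj B (n - 1))" for n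
      by (intro gmod_hom_add cochain_complexD[OF A] cochain_complexD[OF B] h h')
    fix n x assume x: "x \<in> carrier (obj A n)"
    interpret abelian_group "obj B n" by (rule cochain_complexD[OF B])
    note c = gmod_homD(1)[OF chain_mapD(1)[OF f] x] gmod_homD(1)[OF chain_mapD(1)[OF g] x]
      gmod_homD(1)[OF chain_mapD(1)[OF k] x]
      gmod_homD(1)[OF cochain_complexD(4)[OF B] gmod_homD(1)[OF h(1) x]]
      gmod_homD(1)[OF h(2) gmod_homD(1)[OF cochain_complexD(3)[OF A] x]]
      gmod_homD(1)[OF cochain_complexD(4)[OF B] gmod_homD(1)[OF h'(1) x]]
      gmod_homD(1)[OF h'(2) gmod_homD(1)[OF cochain_complexD(3)[OF A] x]]
    show "f n x \<ominus>\<^bsub>obj B n\<^esub> k n x = dif B (n - 1) (h n x \<oplus>\<^bsub>obj B (n - 1)\<^esub> h' n x)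
       \<oplus>\<^bsub>obj B n\<^esub> (h (n + 1) (dif A n x) \<oplus>\<^bsub>obj B (n + 1 - 1)\<^esub> h' (n + 1) (dif A n x))"
      using homotopy_identities(2)[OF c(1,2,3,1,4,5,6,7) h(3)[OF x] h'(3)[OF x]]
      by (simp add: gmod_homD[OF cochain_complexD(4)[OF B]] gmod_homD(1)[OF h(1) x] gmod_homD(1)[OF h'(1) x])
  qed
qed

lemma homotopic_add:
  assumes f: "f \<in> chain_map L A B" and g: "g \<in> chain_map L A B"
    and f': "f' \<in> chain_map L A B" and g': "g' \<in> chain_map L A B"
    and "homotopic L A B f g" "homotopic L A B f' g'"
  shows "homotopic L A B (add_map B f f') (add_map B g g')"
proof -
  obtain h where "homotopy L A B h f g"
    using assms(5) by (auto simp: homotopic_iff)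
  note h = homotopyD[OF this]
  obtain h' where "homotopy L A B h' f' g'"
    using assms(6) by (auto simp: homotopic_iff)
  note h' = homotopyD[OF this]
  show ?thesis
  proof (rule homotopicI)
    show "(\<lambda>x. h n x \<oplus>\<^bsub>obj B (n - 1)\<^esub> h' n x) \<in> gmod_hom L (obj A n) (obj B (n - 1))" for n
      by (intro gmod_hom_add cochain_complexD[OF A] cochain_complexD[OF B] h h')
    fix n x assume x: "x \<in> carrier (obj A n)"
    interpret abelian_group "obj B n" by (rule cochain_complexD[OF B])
    note c = gmod_homD(1)[OF chain_mapD(1)[OF f] x] gmod_homD(1)[OF chain_mapD(1)[OF g] x]
      gmod_homD(1)[OF chain_mapD(1)[OF f'] x] gmod_homD(1)[OF chain_mapD(1)[OF g'] x]
      gmod_homD(1)[OF cochain_complexD(4)[OF B] gmod_homD(1)[OF h(1) x]]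
      gmod_homD(1)[OF h(2) gmod_homD(1)[OF cochain_complexD(3)[OF A] x]]
      gmod_homD(1)[OF cochain_complexD(4)[OF B] gmod_homD(1)[OF h'(1) x]]
      gmod_homD(1)[OF h'(2) gmod_homD(1)[OF cochain_complexD(3)[OF A] x]]
    show "add_map B f f' n x \<ominus>\<^bsub>obj B n\<^esub> add_map B g g' n x
       = dif B (n - 1) (h n x \<oplus>\<^bsub>obj B (n - 1)\<^esub> h' n x)
       \<oplus>\<^bsub>obj B n\<^esub> (h (n + 1) (dif A n x) \<oplus>\<^bsub>obj B (n + 1 - 1)\<^esub> h' (n + 1) (dif A n x))"
      using homotopy_identities(3)[OF c(1,2,3,4,5,6,7,8) h(3)[OF x] h'(3)[OF x]]
      by (simp add: add_map_def gmod_homD[OF cochain_complexD(4)[OF B]] gmod_homD(1)[OF h(1) x] gmod_homD(1)[OF h'(1) x])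
  qed
qed

lemma homotopic_comp_left:
  assumes C: "cochain_complex L C" and k: "k \<in> chain_map L B C"
    and f: "f \<in> chain_map L A B" and g: "g \<in> chain_map L A B" and "homotopic L A B f g"
  shows "homotopic L A C (comp_map k f) (comp_map k g)"
proof -
  obtain h where "homotopy L A B h f g"
    using assms(5) by (auto simp: homotopic_iff)
  note h = homotopyD[OF this]
  note hc = gmod_hom_zero_neg(3)[OF cochain_complexD(1)[OF B] cochain_complexD(1)[OF C] chain_mapD(1)[OF k]]
  show ?thesis
  proof (rule homotopicI)
    show "(\<lambda>x. k (n - 1) (h n x)) \<in> gmod_hom L (obj A n) (obj C (n - 1))" for n
      by (rule gmod_hom_comp[OF h(1) chain_mapD(1)[OF k]])
    fix n x assume x: "x \<in> carrier (obj A n)"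
    note c = gmod_homD(1)[OF chain_mapD(1)[OF f] x] gmod_homD(1)[OF chain_mapD(1)[OF g] x]
      gmod_homD(1)[OF cochain_complexD(4)[OF B] gmod_homD(1)[OF h(1) x]]
      gmod_homD(1)[OF h(2) gmod_homD(1)[OF cochain_complexD(3)[OF A] x]]
    have "k n (f n x) \<ominus>\<^bsub>obj C n\<^esub> k n (g n x) = k n (f n x \<ominus>\<^bsub>obj B n\<^esub> g n x)"
      using hc c by simp
    also have "\<dots> = k n (dif B (n - 1) (h n x)) \<oplus>\<^bsub>obj C n\<^esub> k n (h (n + 1) (dif A n x))"
      using h(3)[OF x] gmod_homD(2)[OF chain_mapD(1)[OF k] c(3,4)] by simp
    finally show "comp_map k f n x \<ominus>\<^bsub>obj C n\<^esub> comp_map k g n x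
       = dif C (n - 1) (k (n - 1) (h n x)) \<oplus>\<^bsub>obj C n\<^esub> k (n + 1 - 1) (h (n + 1) (dif A n x))"
      by (simp add: comp_map_def chain_mapD(3)[OF k gmod_homD(1)[OF h(1) x]])
  qed
qed

lemma homotopic_comp_right:
  assumes C: "cochain_complex L C" and k: "k \<in> chain_map L C A" and "homotopic L A B f g"
  shows "homotopic L C B (comp_map f k) (comp_map g k)"
proof -
  obtain h where "homotopy L A B h f g"
    using assms(3) by (auto simp: homotopic_iff)
  note h = homotopyD[OF this]
  show ?thesis
  proof (rule homotopicI)
    show "(\<lambda>x. h n (k n x)) \<in> gmod_hom L (obj C n) (obj B (n - 1))" for n
      by (rule gmod_hom_comp[OF chain_mapD(1)[OF k] h(1)])
    fix n x assume x: "x \<in> carrier (obj C n)"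
    show "comp_map f k n x \<ominus>\<^bsub>obj B n\<^esub> comp_map g k n x
       = dif B (n - 1) (h n (k n x)) \<oplus>\<^bsub>obj B n\<^esub> h (n + 1) (k (n + 1) (dif C n x))"
      using h(3)[OF gmod_homD(1)[OF chain_mapD(1)[OF k] x]]
      by (simp add: comp_map_def chain_mapD(2)[OF k x])
  qed
qed

text \<open>Being a quasi-isomorphism is a property of the homotopy class.\<close>

lemma quasi_iso_homotopic:
  assumes f: "f \<in> quasi_iso L A B" and g: "g \<in> chain_map L A B" and "homotopic L A B f g"
  shows "g \<in> quasi_iso L A B"
proof -
  have fc: "f \<in> chain_map L A B" using f by (simp add: quasi_iso_def)
  note F = f[unfolded quasi_iso_iff[OF A B]]
  obtain h where "homotopy L A B h f g"
    using assms(3) by (auto simp: homotopic_iff)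
  note h = homotopyD[OF this]
  have key: "\<exists>w\<in>carrier (obj B (n - 1)). f n z = dif B (n - 1) w \<oplus>\<^bsub>obj B n\<^esub> g n z"
    if z: "z \<in> cocycles A n" for n z
  proof -
    interpret abelian_group "obj B n" by (rule cochain_complexD[OF B])
    have zc: "z \<in> carrier (obj A n)" "dif A n z = \<zero>\<^bsub>obj A (n + 1)\<^esub>" using z by (auto simp: cocycles_def)
    note c = gmod_homD(1)[OF chain_mapD(1)[OF fc] zc(1)] gmod_homD(1)[OF chain_mapD(1)[OF g] zc(1)]
      gmod_homD(1)[OF cochain_complexD(4)[OF B] gmod_homD(1)[OF h(1) zc(1)]]
    have "f n z \<ominus>\<^bsub>obj B n\<^esub> g n z = dif B (n - 1) (h n z)"
      using h(3)[OF zc(1)] gmod_hom_zero_neg(1)[OF cochain_complexD(1)[OF A] cochain_complexD(1)[OF B] h(2)[of n]] c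
      by (simp add: zc(2))
    moreover have "f n z = (f n z \<ominus>\<^bsub>obj B n\<^esub> g n z) \<oplus>\<^bsub>obj B n\<^esub> g n z"
      using c by (simp add: a_minus_def a_assoc l_neg)
    ultimately show ?thesis using gmod_homD(1)[OF h(1) zc(1)] by auto
  qed
  have add: "dif B (n - 1) w \<oplus>\<^bsub>obj B n\<^esub> (dif B (n - 1) w' \<oplus>\<^bsub>obj B n\<^esub> y) =
      dif B (n - 1) (w \<oplus>\<^bsub>obj B (n - 1)\<^esub> w') \<oplus>\<^bsub>obj B n\<^esub> y"
    if "w \<in> carrier (obj B (n - 1))" "w' \<in> carrier (obj B (n - 1))" "y \<in> carrier (obj B n)" for n w w' y
  proof -
    interpret abelian_group "obj B n" by (rule cochain_complexD[OF B])
    show ?thesis using that by (simp add: gmod_homD[OF cochain_complexD(4)[OF B]] a_assoc)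
  qed
  have cl: "w \<oplus>\<^bsub>obj B n\<^esub> w' \<in> carrier (obj B n)"
    if "w \<in> carrier (obj B n)" "w' \<in> carrier (obj B n)" for n w w'
    using that abelian_monoid.a_closed[OF abelian_group.axioms(1)[OF cochain_complexD(2)[OF B]]] by blast
  show ?thesis unfolding quasi_iso_iff[OF A B]
  proof (intro conjI allI ballI impI g)
    fix n z assume z: "z \<in> cocycles A n" and "g n z \<in> coboundaries B n"
    then obtain w where w1: "w \<in> carrier (obj B (n - 1))" "g n z = dif B (n - 1) w"
      by (auto simp: coboundaries_def)
    obtain w' where w2: "w' \<in> carrier (obj B (n - 1))" "f n z = dif B (n - 1) w' \<oplus>\<^bsub>obj B n\<^esub> g n z"
      using key[OF z] by blast
    note w = w1 w2
    have "f n z = dif B (n - 1) (w' \<oplus>\<^bsub>obj B (n - 1)\<^esub> w)"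
      using w by (simp add: gmod_homD[OF cochain_complexD(4)[OF B]])
    then have "f n z \<in> coboundaries B n" using w cl by (auto simp: coboundaries_def)
    then show "z \<in> coboundaries A n" using F z by blast
  next
    fix n y assume "y \<in> cocycles B n"
    then obtain z w where z: "z \<in> cocycles A n" "w \<in> carrier (obj B (n - 1))"
      "y = dif B (n - 1) w \<oplus>\<^bsub>obj B n\<^esub> f n z" using F by blast
    obtain w' where w': "w' \<in> carrier (obj B (n - 1))" "f n z = dif B (n - 1) w' \<oplus>\<^bsub>obj B n\<^esub> g n z"
      using key[OF z(1)] by blast
    have "z \<in> carrier (obj A n)" using z(1) by (simp add: cocycles_def)
    then have "y = dif B (n - 1) (w \<oplus>\<^bsub>obj B (n - 1)\<^esub> w') \<oplus>\<^bsub>obj B n\<^esub> g n z"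
      using add[OF z(2) w'(1)] z(3) w'(2) gmod_homD(1)[OF chain_mapD(1)[OF g]] by simp
    then show "\<exists>z\<in>cocycles A n. \<exists>w\<in>carrier (obj B (n - 1)). y = dif B (n - 1) w \<oplus>\<^bsub>obj B n\<^esub> g n z"
      using z(1) cl[OF z(2) w'(1)] by blast
  qed
qed

end

section \<open>Morphisms of the derived category out of a complex with a K-projective resolution\<close>

text \<open>Homotopy bundled with its side conditions, so that the calculus below has none.\<close>

definition heq :: "'a gring \<Rightarrow> ('a, 'u) cpx \<Rightarrow> ('a, 'u) cpx \<Rightarrow> 'u maps \<Rightarrow> 'u maps \<Rightarrow> bool" where
  "heq L A B f g \<longleftrightarrow> cochain_complex L A \<and> cochain_complex L B \<and>
     f \<in> chain_map L A B \<and> g \<in> chain_map L A B \<and> homotopic L A B f g"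

lemma heqD:
  assumes "heq L A B f g"
  shows "cochain_complex L A" "cochain_complex L B" "f \<in> chain_map L A B" "g \<in> chain_map L A B"
    "homotopic L A B f g"
  using assms by (auto simp: heq_def)

lemma heq_refl:
  "cochain_complex L A \<Longrightarrow> cochain_complex L B \<Longrightarrow> f \<in> chain_map L A B \<Longrightarrow> heq L A B f f"
  by (simp add: heq_def homotopic_refl)

lemma heq_sym: "heq L A B f g \<Longrightarrow> heq L A B g f"
  by (auto simp: heq_def intro: homotopic_sym)

lemma heq_trans: "heq L A B f g \<Longrightarrow> heq L A B g h \<Longrightarrow> heq L A B f h"
  unfolding heq_def by (blast intro: homotopic_trans)

lemma heq_left:
  "heq L A B f g \<Longrightarrow> cochain_complex L C \<Longrightarrow> k \<in> chain_map L B C \<Longrightarrow>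
    heq L A C (comp_map k f) (comp_map k g)"
  unfolding heq_def by (blast intro: homotopic_comp_left comp_map_chain_map)

lemma heq_right:
  "heq L A B f g \<Longrightarrow> cochain_complex L C \<Longrightarrow> k \<in> chain_map L C A \<Longrightarrow>
    heq L C B (comp_map f k) (comp_map g k)"
  unfolding heq_def by (blast intro: homotopic_comp_right comp_map_chain_map)

lemma heq_add:
  "heq L A B f g \<Longrightarrow> heq L A B f' g' \<Longrightarrow> heq L A B (add_map B f f') (add_map B g g')"
  unfolding heq_def by (blast intro: homotopic_add add_map_chain_map)

lemma heq_pointwise:
  assumes "cochain_complex L A" "cochain_complex L B" "f \<in> chain_map L A B"
    "g \<in> chain_map L A B" "\<And>n x. x \<in> carrier (obj A n) \<Longrightarrow> f n x = g n x"
  shows "heq L A B f g"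
  unfolding heq_def using assms homotopic_pointwise[OF assms(1-3,5)] by blast

lemma comp_map_assoc: "comp_map h (comp_map g f) = comp_map (comp_map h g) f"
  by (simp add: comp_map_def o_assoc)

lemma comp_id_map [simp]: "comp_map f id_map = f" "comp_map id_map f = f"
  by (simp_all add: comp_map_def id_map_def fun_eq_iff)

lemma comp_add_map: "comp_map (add_map B f g) k = add_map B (comp_map f k) (comp_map g k)"
  by (simp add: comp_map_def add_map_def fun_eq_iff)

lemma comp_zero_map [simp]: "comp_map (zero_map B) k = zero_map B"
  by (simp add: comp_map_def zero_map_def fun_eq_iff)

text \<open>K-projectivity: a quasi-isomorphism \<open>t : Q \<rightarrow> A\<close> induces a bijection between the homotopy classes of
  maps \<open>P \<rightarrow> Q\<close> and of maps \<open>P \<rightarrow> A\<close>.\<close>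

definition kproj :: "'a gring \<Rightarrow> ('a, 'u) cpx \<Rightarrow> bool" where
  "kproj L P \<longleftrightarrow> cochain_complex L P \<and> (\<forall>Q A t.
     cochain_complex L Q \<longrightarrow> cochain_complex L A \<longrightarrow> t \<in> quasi_iso L Q A \<longrightarrow>
     (\<forall>f\<in>chain_map L P A. \<exists>g\<in>chain_map L P Q. homotopic L P A (comp_map t g) f) \<and>
     (\<forall>g\<in>chain_map L P Q. \<forall>g'\<in>chain_map L P Q.
        homotopic L P A (comp_map t g) (comp_map t g') \<longrightarrow> homotopic L P Q g g'))"

lemma quasi_iso_chain_map: "t \<in> quasi_iso L Q A \<Longrightarrow> t \<in> chain_map L Q A"
  by (simp add: quasi_iso_def)

lemma kproj_complex: "kproj L P \<Longrightarrow> cochain_complex L P"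
  by (simp add: kproj_def)

lemma kproj_lift:
  assumes "kproj L P" "cochain_complex L Q" "cochain_complex L A" "t \<in> quasi_iso L Q A"
    "f \<in> chain_map L P A"
  obtains g where "g \<in> chain_map L P Q" "heq L P A (comp_map t g) f"
proof -
  have "\<exists>g\<in>chain_map L P Q. homotopic L P A (comp_map t g) f"
    using assms unfolding kproj_def by blast
  then show thesis
    using that assms comp_map_chain_map[OF _ quasi_iso_chain_map[OF assms(4)]]
    unfolding heq_def kproj_def by blast
qed

lemma kproj_cancel:
  assumes "kproj L P" "cochain_complex L Q" "t \<in> quasi_iso L Q A"
    "g \<in> chain_map L P Q" "g' \<in> chain_map L P Q" "heq L P A (comp_map t g) (comp_map t g')"
  shows "heq L P Q g g'"
  using assms heqD[OF assms(6)] unfolding kproj_def heq_def by blast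

definition resolution :: "'a gring \<Rightarrow> ('a, 'u) cpx \<Rightarrow> ('a, 'u) cpx \<Rightarrow> 'u maps \<Rightarrow> bool" where
  "resolution L F P p \<longleftrightarrow> cochain_complex L F \<and> kproj L P \<and> p \<in> quasi_iso L P F"

lemma resolutionD:
  assumes "resolution L F P p"
  shows "cochain_complex L F" "kproj L P" "cochain_complex L P" "p \<in> quasi_iso L P F"
    "p \<in> chain_map L P F"
  using assms by (auto simp: resolution_def kproj_complex quasi_iso_chain_map)

text \<open>A roof \<open>F \<leftarrow> Q \<rightarrow> B\<close> is represented by the composite \<open>P \<rightarrow> Q \<rightarrow> B\<close>, where \<open>P \<rightarrow> Q\<close> lifts the resolution
  \<open>p : P \<rightarrow> F\<close>. In this way morphisms out of \<open>F\<close> become homotopy classes of chain maps out of \<open>P\<close>, and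
  two roofs are equivalent if and only if these maps are homotopic. The class \<open>cls \<dots> f\<close> is the morphism represented by \<open>f\<close>.\<close>

definition rep :: "'a gring \<Rightarrow> ('a, 'u) cpx \<Rightarrow> ('a, 'u) cpx \<Rightarrow> 'u maps \<Rightarrow> ('a, 'u) cpx \<Rightarrow>
    ('a, 'u) roof \<Rightarrow> 'u maps \<Rightarrow> bool" where
  "rep L F P p B r f \<longleftrightarrow> (case r of (Q, s, g) \<Rightarrow>
     \<exists>w\<in>chain_map L P Q. heq L P F (comp_map s w) p \<and> heq L P B (comp_map g w) f)"

definition cls :: "'a gring \<Rightarrow> ('a, 'u) cpx \<Rightarrow> ('a, 'u) cpx \<Rightarrow> 'u maps \<Rightarrow> ('a, 'u) cpx \<Rightarrow>
    'u maps \<Rightarrow> ('a, 'u) dmor" where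
  "cls L F P p B f = {r \<in> roofs L F B. rep L F P p B r f}"

context
  fixes L :: "'a gring" and F P :: "('a, 'u) cpx" and p :: "'u maps" and B :: "('a, 'u) cpx"
  assumes res: "resolution L F P p" and B: "cochain_complex L B"
begin

lemma rep_exists:
  assumes "r \<in> roofs L F B"
  shows "\<exists>f. rep L F P p B r f"
proof -
  obtain Q s g where r: "r = (Q, s, g)" "cochain_complex L Q" "s \<in> quasi_iso L Q F" "g \<in> chain_map L Q B"
    using assms by (auto simp: roofs_def)
  obtain w where "w \<in> chain_map L P Q" "heq L P F (comp_map s w) p"
    using kproj_lift[OF resolutionD(2)[OF res] r(2) resolutionD(1)[OF res] r(3) resolutionD(5)[OF res]] .
  then show ?thesis
    using r heq_refl[OF resolutionD(3)[OF res] B comp_map_chain_map[of w L P Q g]]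
    by (auto simp: rep_def)
qed

text \<open>Any two lifts of \<open>p\<close> through \<open>s\<close> are homotopic, so it does not matter which one is used.\<close>

lemma rep_any_lift:
  assumes r: "(Q, s, g) \<in> roofs L F B" and "rep L F P p B (Q, s, g) f"
    and w: "w \<in> chain_map L P Q" "heq L P F (comp_map s w) p"
  shows "heq L P B (comp_map g w) f"
proof -
  obtain w' where w': "w' \<in> chain_map L P Q" "heq L P F (comp_map s w') p" "heq L P B (comp_map g w') f"
    using assms(2) by (auto simp: rep_def)
  have "heq L P Q w w'"
    using r heq_trans[OF w(2) heq_sym[OF w'(2)]] w w'
    by (intro kproj_cancel[OF resolutionD(2)[OF res], of Q s]) (auto simp: roofs_def)
  then show ?thesis using heq_trans[OF heq_left w'(3)] B r by (auto simp: roofs_def)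
qed

lemma rep_unique:
  assumes "r \<in> roofs L F B" "rep L F P p B r f" "rep L F P p B r f'"
  shows "heq L P B f f'"
  using assms rep_any_lift[of "fst r" "fst (snd r)" "snd (snd r)" f']
  by (cases r) (auto simp: rep_def intro: heq_sym heq_trans)

lemma rep_cong: "rep L F P p B r f \<Longrightarrow> heq L P B f f' \<Longrightarrow> rep L F P p B r f'"
  by (auto simp: rep_def intro: heq_trans)

text \<open>Two equivalent roofs are compared on a lift of the resolution to the common refinement;
  conversely the resolution itself serves as a common refinement.\<close>

lemma roof_rel_iff:
  "(r, r') \<in> roof_rel L F B \<longleftrightarrow> r \<in> roofs L F B \<and> r' \<in> roofs L F B \<and>
    (\<exists>f. rep L F P p B r f \<and> rep L F P p B r' f)"
proof
  assume *: "(r, r') \<in> roof_rel L F B"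
  obtain Q s g where r: "r = (Q, s, g)" by (cases r)
  obtain Q' s' g' where r': "r' = (Q', s', g')" by (cases r')
  obtain T u u' where T: "r \<in> roofs L F B" "r' \<in> roofs L F B" "cochain_complex L T"
    "u \<in> chain_map L T Q" "u' \<in> chain_map L T Q'" "comp_map s u \<in> quasi_iso L T F"
    "homotopic L T F (comp_map s u) (comp_map s' u')"
    "homotopic L T B (comp_map g u) (comp_map g' u')"
    using * unfolding r r' roof_rel_def by blast
  have cm: "cochain_complex L Q" "s \<in> chain_map L Q F" "g \<in> chain_map L Q B"
    "cochain_complex L Q'" "s' \<in> chain_map L Q' F" "g' \<in> chain_map L Q' B"
    using T r r' by (auto simp: roofs_def quasi_iso_chain_map)
  have h1: "heq L T F (comp_map s u) (comp_map s' u')" and h2: "heq L T B (comp_map g u) (comp_map g' u')"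
    using T cm resolutionD[OF res] B by (auto simp: heq_def intro!: comp_map_chain_map)
  obtain y where y: "y \<in> chain_map L P T" "heq L P F (comp_map (comp_map s u) y) p"
    using kproj_lift[OF resolutionD(2)[OF res] T(3) resolutionD(1)[OF res] T(6) resolutionD(5)[OF res]] .
  note P = resolutionD(3)[OF res]
  have "heq L P F (comp_map (comp_map s' u') y) p"
    using heq_trans[OF heq_sym[OF heq_right[OF h1 P y(1)]] y(2)] .
  moreover have "heq L P B (comp_map (comp_map g' u') y) (comp_map (comp_map g u) y)"
    using heq_sym[OF heq_right[OF h2 P y(1)]] .
  moreover have "heq L P B (comp_map (comp_map g u) y) (comp_map (comp_map g u) y)"
    using heq_trans[OF heq_sym calculation(2)] calculation(2) by blast
  ultimately have "rep L F P p B r (comp_map (comp_map g u) y)" "rep L F P p B r' (comp_map (comp_map g u) y)"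
    unfolding r r' rep_def using y comp_map_chain_map[OF y(1)] T(4,5)
    by (auto simp: comp_map_assoc[symmetric])
  then show "r \<in> roofs L F B \<and> r' \<in> roofs L F B \<and> (\<exists>f. rep L F P p B r f \<and> rep L F P p B r' f)"
    using T by blast
next
  assume *: "r \<in> roofs L F B \<and> r' \<in> roofs L F B \<and> (\<exists>f. rep L F P p B r f \<and> rep L F P p B r' f)"
  obtain Q s g where r: "r = (Q, s, g)" by (cases r)
  obtain Q' s' g' where r': "r' = (Q', s', g')" by (cases r')
  obtain f w w' where w: "w \<in> chain_map L P Q" "heq L P F (comp_map s w) p" "heq L P B (comp_map g w) f"
    and w': "w' \<in> chain_map L P Q'" "heq L P F (comp_map s' w') p" "heq L P B (comp_map g' w') f"
    using * unfolding r r' rep_def by auto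
  have "comp_map s w \<in> quasi_iso L P F"
    using quasi_iso_homotopic[OF heqD(1,2)[OF w(2)] resolutionD(4)[OF res] heqD(3)[OF w(2)]]
      heqD(5)[OF heq_sym[OF w(2)]] by blast
  then show "(r, r') \<in> roof_rel L F B"
    using * w w' heqD[OF heq_trans[OF w(2) heq_sym[OF w'(2)]]] heqD[OF heq_trans[OF w(3) heq_sym[OF w'(3)]]]
    unfolding r r' roof_rel_def by blast
qed

text \<open>All operations on morphisms are defined as images of sets of roofs. This lemma evaluates them: it
  suffices that the set is inhabited and that all its members are represented by the same map.\<close>

lemma roof_rel_image:
  assumes "S \<subseteq> roofs L F B" "S \<noteq> {}" "\<And>r. r \<in> S \<Longrightarrow> rep L F P p B r f"
  shows "roof_rel L F B `` S = cls L F P p B f"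
proof (intro Set.set_eqI iffI)
  fix r assume "r \<in> roof_rel L F B `` S"
  then obtain r' where r': "r' \<in> S" "(r', r) \<in> roof_rel L F B" by blast
  then obtain f' where f': "rep L F P p B r' f'" "rep L F P p B r f'" "r \<in> roofs L F B"
    unfolding roof_rel_iff by blast
  have "heq L P B f' f"
    by (rule rep_unique[of r']) (use subsetD[OF assms(1) r'(1)] assms(3)[OF r'(1)] f'(1) in blast)+
  then show "r \<in> cls L F P p B f" using f'(3) rep_cong[OF f'(2)] by (simp add: cls_def)
next
  fix r assume "r \<in> cls L F P p B f"
  then have r: "r \<in> roofs L F B" "rep L F P p B r f" by (auto simp: cls_def)
  obtain r' where r': "r' \<in> S" using assms(2) by blast
  then have "(r', r) \<in> roof_rel L F B"
    using r assms(1) assms(3)[OF r'] unfolding roof_rel_iff by auto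
  then show "r \<in> roof_rel L F B `` S" using r' by (rule ImageI)
qed

lemma standard_roof:
  assumes "f \<in> chain_map L P B"
  shows "(P, p, f) \<in> roofs L F B" "rep L F P p B (P, p, f) f" "(P, p, f) \<in> cls L F P p B f"
proof -
  show *: "(P, p, f) \<in> roofs L F B" using assms resolutionD[OF res] by (simp add: roofs_def)
  have "heq L P F p p" "heq L P B f f"
    using heq_refl[OF resolutionD(3)[OF res] resolutionD(1)[OF res] resolutionD(5)[OF res]] heq_refl[OF resolutionD(3)[OF res] B assms] by auto
  then show "rep L F P p B (P, p, f) f"
    unfolding rep_def by (auto intro!: bexI[of _ id_map] id_map_chain_map)
  with * show "(P, p, f) \<in> cls L F P p B f" by (simp add: cls_def)
qed

lemma cls_eq_iff:
  assumes "f \<in> chain_map L P B" "f' \<in> chain_map L P B"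
  shows "cls L F P p B f = cls L F P p B f' \<longleftrightarrow> heq L P B f f'"
proof
  assume "cls L F P p B f = cls L F P p B f'"
  then have "rep L F P p B (P, p, f) f'" using standard_roof(3)[OF assms(1)] by (auto simp: cls_def)
  then show "heq L P B f f'" using rep_unique standard_roof[OF assms(1)] by blast
next
  assume "heq L P B f f'"
  then show "cls L F P p B f = cls L F P p B f'" unfolding cls_def using rep_cong heq_sym by blast
qed

lemma roof_rel_single: "r \<in> roofs L F B \<Longrightarrow> rep L F P p B r f \<Longrightarrow> roof_rel L F B `` {r} = cls L F P p B f"
  by (rule roof_rel_image) auto

lemma rep_chain_map: "rep L F P p B r f \<Longrightarrow> f \<in> chain_map L P B"
  by (auto simp: rep_def heq_def)

lemma carrier_dhom: "carrier (dhom L F B) = cls L F P p B ` chain_map L P B"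
proof (intro Set.set_eqI iffI)
  fix \<alpha> assume "\<alpha> \<in> carrier (dhom L F B)"
  then obtain r where r: "r \<in> roofs L F B" "\<alpha> = roof_rel L F B `` {r}" by (auto simp: dhom_def quotient_def)
  obtain f where "rep L F P p B r f" using rep_exists r by blast
  then show "\<alpha> \<in> cls L F P p B ` chain_map L P B" using r roof_rel_single rep_chain_map by blast
next
  fix \<alpha> assume "\<alpha> \<in> cls L F P p B ` chain_map L P B"
  then obtain f where f: "f \<in> chain_map L P B" "\<alpha> = cls L F P p B f" by blast
  then have "\<alpha> = roof_rel L F B `` {(P, p, f)}" using roof_rel_single standard_roof by blast
  then show "\<alpha> \<in> carrier (dhom L F B)"
    using standard_roof(1)[OF f(1)] by (auto simp: dhom_def quotient_def)
qed

lemma mult_dhom: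
  assumes f: "f \<in> chain_map L P B" and g: "g \<in> chain_map L P B"
  shows "cls L F P p B f \<otimes>\<^bsub>dhom L F B\<^esub> cls L F P p B g = cls L F P p B (add_map B f g)"
proof -
  let ?S = "{(Q, s, add_map B f' g') |Q s f' g'. (Q, s, f') \<in> cls L F P p B f \<and> (Q, s, g') \<in> cls L F P p B g}"
  have "roof_rel L F B `` ?S = cls L F P p B (add_map B f g)"
  proof (rule roof_rel_image)
    show "?S \<subseteq> roofs L F B"
      using add_map_chain_map[OF _ B] by (auto simp: cls_def roofs_def)
    show "?S \<noteq> {}" using standard_roof(3)[OF f] standard_roof(3)[OF g] by blast
    fix r assume "r \<in> ?S"
    then obtain Q s f' g' where r: "r = (Q, s, add_map B f' g')"
      and fc: "(Q, s, f') \<in> cls L F P p B f" and gc: "(Q, s, g') \<in> cls L F P p B g" by blast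
    then obtain w where w: "w \<in> chain_map L P Q" "heq L P F (comp_map s w) p" "heq L P B (comp_map f' w) f"
      by (auto simp: cls_def rep_def)
    moreover have "heq L P B (comp_map g' w) g"
      using gc rep_any_lift w by (auto simp: cls_def)
    ultimately show "rep L F P p B r (add_map B f g)"
      unfolding r rep_def using w heq_add[OF w(3)] by (auto simp: comp_add_map)
  qed
  then show ?thesis by (simp add: dhom_def)
qed

lemma loc_cls:
  assumes "f \<in> chain_map L F B"
  shows "loc L F B f = cls L F P p B (comp_map f p)"
  unfolding loc_def
proof (rule roof_rel_single)
  show "(F, id_map, f) \<in> roofs L F B"
    using assms resolutionD(1)[OF res] by (simp add: roofs_def id_map_quasi_iso)
  note P = resolutionD(3)[OF res] resolutionD(1)[OF res] resolutionD(5)[OF res]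
  have "heq L P F p p" "heq L P B (comp_map f p) (comp_map f p)"
    using heq_refl[OF P] heq_left[OF heq_refl[OF P] B assms] by auto
  then show "rep L F P p B (F, id_map, f) (comp_map f p)"
    unfolding rep_def using P(3) by auto
qed

lemma one_dhom: "\<one>\<^bsub>dhom L F B\<^esub> = cls L F P p B (zero_map B)"
  using loc_cls[OF zero_map_chain_map[OF resolutionD(1)[OF res] B]] by (simp add: dhom_def)

lemma dhom_comm_monoid: "comm_monoid (dhom L F B)"
proof -
  note P = resolutionD(3)[OF res]
  note am = add_map_chain_map[OF P B]
  have eq: "cls L F P p B f = cls L F P p B g"
    if "f \<in> chain_map L P B" "g \<in> chain_map L P B" "\<And>n x. x \<in> carrier (obj P n) \<Longrightarrow> f n x = g n x" for f g
    using that heq_pointwise[OF P B] cls_eq_iff by blast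
  have c: "f n x \<in> carrier (obj B n)" if "f \<in> chain_map L P B" "x \<in> carrier (obj P n)" for f n x
    using gmod_homD(1)[OF chain_mapD(1)[OF that(1)] that(2)] .
  have zero: "zero_map B \<in> chain_map L P B" by (rule zero_map_chain_map[OF P B])
  show ?thesis
  proof (rule comm_monoidI)
    fix x y z assume "x \<in> carrier (dhom L F B)" "y \<in> carrier (dhom L F B)" "z \<in> carrier (dhom L F B)"
    then obtain f g h where f: "f \<in> chain_map L P B" "x = cls L F P p B f"
      and g: "g \<in> chain_map L P B" "y = cls L F P p B g" and h: "h \<in> chain_map L P B" "z = cls L F P p B h"
      unfolding carrier_dhom by blast
    interpret B: abelian_group "obj B n" for n by (rule cochain_complexD[OF B])
    show "x \<otimes>\<^bsub>dhom L F B\<^esub> y \<otimes>\<^bsub>dhom L F B\<^esub> z = x \<otimes>\<^bsub>dhom L F B\<^esub> (y \<otimes>\<^bsub>dhom L F B\<^esub> z)"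
      unfolding f g h using f(1) g(1) h(1) am
      by (simp add: mult_dhom, intro eq) (auto simp: add_map_def c B.a_assoc)
  next
    fix x y assume "x \<in> carrier (dhom L F B)" "y \<in> carrier (dhom L F B)"
    then obtain f g where f: "f \<in> chain_map L P B" "x = cls L F P p B f"
      and g: "g \<in> chain_map L P B" "y = cls L F P p B g"
      unfolding carrier_dhom by blast
    interpret B: abelian_group "obj B n" for n by (rule cochain_complexD[OF B])
    show "x \<otimes>\<^bsub>dhom L F B\<^esub> y \<in> carrier (dhom L F B)"
      unfolding f g using f(1) g(1) am by (simp add: mult_dhom carrier_dhom)
    show "x \<otimes>\<^bsub>dhom L F B\<^esub> y = y \<otimes>\<^bsub>dhom L F B\<^esub> x"
      unfolding f g using f(1) g(1) am
      by (simp add: mult_dhom, intro eq) (auto simp: add_map_def c B.a_comm)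
  next
    fix x assume "x \<in> carrier (dhom L F B)"
    then obtain f where f: "f \<in> chain_map L P B" "x = cls L F P p B f"
      unfolding carrier_dhom by blast
    interpret B: abelian_group "obj B n" for n by (rule cochain_complexD[OF B])
    show "\<one>\<^bsub>dhom L F B\<^esub> \<otimes>\<^bsub>dhom L F B\<^esub> x = x"
      unfolding f one_dhom using f(1) am zero
      by (simp add: mult_dhom, intro eq) (auto simp: add_map_def zero_map_def c)
  qed (use zero in \<open>simp add: one_dhom carrier_dhom\<close>)
qed

end

text \<open>Composition in the derived category is composition of representing chain maps, once the first
  one has been lifted to the resolutions.\<close>

lemma dcomp_cls:
  assumes resA: "resolution L A PA pA" and resB: "resolution L B PB pB" and C: "cochain_complex L C"
    and f: "f \<in> chain_map L PA B" and g: "g \<in> chain_map L PB C"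
    and l: "l \<in> chain_map L PA PB" and lf: "heq L PA B (comp_map pB l) f"
  shows "dcomp L A B C (cls L B PB pB C g) (cls L A PA pA B f) = cls L A PA pA C (comp_map g l)"
  unfolding dcomp_def
proof (rule roof_rel_image[OF resA C])
  let ?S = "{(R, comp_map s u, comp_map g' v) |R u v P s f' Q t g'.
        (P, s, f') \<in> cls L A PA pA B f \<and> (Q, t, g') \<in> cls L B PB pB C g \<and> cochain_complex L R \<and>
        u \<in> quasi_iso L R P \<and> v \<in> chain_map L R Q \<and>
        homotopic L R B (comp_map f' u) (comp_map t v)}"
  note A = resolutionD[OF resA] and B = resolutionD[OF resB]
  have ru: "comp_map s u \<in> quasi_iso L R A"
    if "cochain_complex L R" "u \<in> quasi_iso L R P" "cochain_complex L P" "s \<in> quasi_iso L P A" for R u P s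
  proof -
    note u = that(2)[unfolded quasi_iso_iff[OF that(1,3)]] and s = that(4)[unfolded quasi_iso_iff[OF that(3) A(1)]]
    have uc: "u n z \<in> cocycles P n" if "z \<in> cocycles R n" for n z
      using that chain_mapD(2)[OF conjunct1[OF u], of z n] gmod_homD(1)[OF chain_mapD(1)[OF conjunct1[OF u]]]
        gmod_hom_zero_neg(1)[OF cochain_complexD(1)[OF \<open>cochain_complex L R\<close>] cochain_complexD(1)[OF \<open>cochain_complex L P\<close>] chain_mapD(1)[OF conjunct1[OF u]]]
      by (auto simp: cocycles_def)
    show ?thesis unfolding quasi_iso_iff[OF that(1) A(1)]
    proof (intro conjI allI ballI impI)
      show "comp_map s u \<in> chain_map L R A" using u s comp_map_chain_map by blast
      fix n z assume "z \<in> cocycles R n" "comp_map s u n z \<in> coboundaries A n"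
      then show "z \<in> coboundaries R n" using u s uc by (simp add: comp_map_def)
    next
      fix n y assume "y \<in> cocycles A n"
      then obtain z w where z: "z \<in> cocycles P n" "w \<in> carrier (obj A (n - 1))"
        "y = dif A (n - 1) w \<oplus>\<^bsub>obj A n\<^esub> s n z" using s by blast
      obtain z' w' where z': "z' \<in> cocycles R n" "w' \<in> carrier (obj P (n - 1))"
        "z = dif P (n - 1) w' \<oplus>\<^bsub>obj P n\<^esub> u n z'" using u z(1) by blast
      interpret An: abelian_group "obj A n" by (rule cochain_complexD[OF A(1)])
      interpret An1: abelian_group "obj A (n - 1)" by (rule cochain_complexD[OF A(1)])
      note sc = conjunct1[OF s] and d = cochain_complexD(4)[OF \<open>cochain_complex L P\<close>, of n] and
        dA = cochain_complexD(4)[OF A(1), of n]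
      have c: "u n z' \<in> carrier (obj P n)" "dif P (n - 1) w' \<in> carrier (obj P n)"
        using uc[OF z'(1)] gmod_homD(1)[OF d z'(2)] by (auto simp: cocycles_def)
      have c': "s (n - 1) w' \<in> carrier (obj A (n - 1))" "s n (u n z') \<in> carrier (obj A n)"
        using gmod_homD(1)[OF chain_mapD(1)[OF sc]] z'(2) c by auto
      have "s n z = dif A (n - 1) (s (n - 1) w') \<oplus>\<^bsub>obj A n\<^esub> s n (u n z')"
        using z'(3) gmod_homD(2)[OF chain_mapD(1)[OF sc] c(2,1)] chain_mapD(3)[OF sc z'(2)] by simp
      then have "y = dif A (n - 1) (w \<oplus>\<^bsub>obj A (n - 1)\<^esub> s (n - 1) w') \<oplus>\<^bsub>obj A n\<^esub> comp_map s u n z'"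
        using z(3) z(2) c' by (simp add: comp_map_def gmod_homD[OF dA] An.a_assoc)
      then show "\<exists>z\<in>cocycles R n. \<exists>w\<in>carrier (obj A (n - 1)). y = dif A (n - 1) w \<oplus>\<^bsub>obj A n\<^esub> comp_map s u n z"
        using z'(1) z(2) c' by blast
    qed
  qed
  show "?S \<subseteq> roofs L A C"
    using ru by (auto simp: cls_def roofs_def intro!: comp_map_chain_map)
  have "(PA, comp_map pA id_map, comp_map g l) \<in> ?S"
    using standard_roof(3)[OF resA B(1) f] standard_roof(3)[OF resB C g] A(3) id_map_quasi_iso[OF A(3)] l
      heqD(5)[OF heq_sym[OF lf]] comp_id_map(1)[of f] by (intro CollectI exI conjI refl) auto
  then show "?S \<noteq> {}" by blast
  fix r assume "r \<in> ?S"
  then obtain R u v P s f' Q t g' where r: "r = (R, comp_map s u, comp_map g' v)"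
    and P: "(P, s, f') \<in> cls L A PA pA B f" and Q: "(Q, t, g') \<in> cls L B PB pB C g"
    and R: "cochain_complex L R" "u \<in> quasi_iso L R P" "v \<in> chain_map L R Q"
      "homotopic L R B (comp_map f' u) (comp_map t v)" by blast
  have Pr: "(P, s, f') \<in> roofs L A B" "rep L A PA pA B (P, s, f') f"
    and Qr: "(Q, t, g') \<in> roofs L B C" "rep L B PB pB C (Q, t, g') g"
    using P Q by (auto simp: cls_def)
  have PQ: "cochain_complex L P" "s \<in> quasi_iso L P A" "f' \<in> chain_map L P B"
    "cochain_complex L Q" "t \<in> quasi_iso L Q B" "t \<in> chain_map L Q B" "g' \<in> chain_map L Q C"
    using Pr Qr by (auto simp: roofs_def quasi_iso_chain_map)
  have h: "heq L R B (comp_map f' u) (comp_map t v)"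
    using R PQ B(1) quasi_iso_chain_map[OF R(2)] by (auto simp: heq_def intro!: comp_map_chain_map)
  obtain y where y: "y \<in> chain_map L PA R" "heq L PA A (comp_map (comp_map s u) y) pA"
    using kproj_lift[OF A(2) R(1) A(1) ru[OF R(1,2) PQ(1,2)] A(5)] .
  have uy: "comp_map u y \<in> chain_map L PA P" and vy: "comp_map v y \<in> chain_map L PA Q"
    using R y quasi_iso_chain_map[OF R(2)] by (auto intro!: comp_map_chain_map)
  have h1: "heq L PA B (comp_map f' (comp_map u y)) f"
    using rep_any_lift[OF resA B(1) Pr uy] y(2) by (simp add: comp_map_assoc)
  have h2: "heq L PA B (comp_map t (comp_map v y)) f"
    using heq_trans[OF heq_sym[OF heq_right[OF h A(3) y(1)]]] h1 by (simp add: comp_map_assoc)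
  obtain w where w: "w \<in> chain_map L PB Q" "heq L PB B (comp_map t w) pB" "heq L PB C (comp_map g' w) g"
    using Qr(2) by (auto simp: rep_def)
  have wl: "comp_map w l \<in> chain_map L PA Q" using w l comp_map_chain_map by blast
  have "heq L PA B (comp_map t (comp_map w l)) f"
    using heq_trans[OF heq_right[OF w(2) A(3) l] lf] by (simp add: comp_map_assoc)
  then have "heq L PA B (comp_map t (comp_map v y)) (comp_map t (comp_map w l))"
    using heq_trans[OF h2 heq_sym] by blast
  then have "heq L PA Q (comp_map v y) (comp_map w l)"
    using kproj_cancel[OF A(2) PQ(4,5) vy wl] by blast
  then have "heq L PA C (comp_map g' (comp_map v y)) (comp_map g' (comp_map w l))"
    using heq_left[OF _ C PQ(7)] by blast
  moreover have "heq L PA C (comp_map g' (comp_map w l)) (comp_map g l)"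
    using heq_right[OF w(3) A(3) l] by (simp add: comp_map_assoc)
  ultimately have "heq L PA C (comp_map (comp_map g' v) y) (comp_map g l)"
    using heq_trans by (auto simp: comp_map_assoc)
  then show "rep L A PA pA C r (comp_map g l)"
    unfolding r rep_def using y by auto
qed

section \<open>Shifts\<close>

text \<open>The sign \<open>(-1)\<^sup>a\<close> in an abelian group.\<close>

definition sg :: "('a, 'u) gmodule \<Rightarrow> int \<Rightarrow> 'u \<Rightarrow> 'u" where
  "sg M a x = (if even a then x else \<ominus>\<^bsub>M\<^esub> x)"

lemma sg_closed: "graded_module L M \<Longrightarrow> x \<in> carrier M \<Longrightarrow> sg M a x \<in> carrier M"
  using abelian_group.a_inv_closed[OF graded_moduleD(2)] by (auto simp: sg_def)

lemma sg_zero: "graded_module L M \<Longrightarrow> sg M a \<zero>\<^bsub>M\<^esub> = \<zero>\<^bsub>M\<^esub>"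
  using abelian_group.minus_equality[OF graded_moduleD(2), of L M "\<zero>\<^bsub>M\<^esub>" "\<zero>\<^bsub>M\<^esub>"]
    abelian_monoid.l_zero[OF abelian_group.axioms(1)[OF graded_moduleD(2)], of L M "\<zero>\<^bsub>M\<^esub>"]
    abelian_monoid.zero_closed[OF abelian_group.axioms(1)[OF graded_moduleD(2)], of L M]
  by (auto simp: sg_def)

lemma sg_sg: "graded_module L M \<Longrightarrow> x \<in> carrier M \<Longrightarrow> sg M a (sg M b x) = sg M (a + b) x"
  using abelian_group.minus_minus[OF graded_moduleD(2)] by (auto simp: sg_def)

lemma gmod_hom_sg:
  "graded_module L M \<Longrightarrow> graded_module L N \<Longrightarrow> f \<in> gmod_hom L M N \<Longrightarrow> x \<in> carrier M \<Longrightarrow>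
    f (sg M a x) = sg N a (f x)"
  by (simp add: sg_def gmod_hom_zero_neg)

lemma sg_gmod_hom:
  "graded_module L M \<Longrightarrow> graded_module L N \<Longrightarrow> f \<in> gmod_hom L M N \<Longrightarrow>
    (\<lambda>x. sg N a (f x)) \<in> gmod_hom L M N"
  by (cases "even a") (simp_all add: sg_def gmod_hom_neg)

lemma gmod_hom_restrict:
  assumes M: "graded_module L M" and f: "f \<in> gmod_hom L M N"
    and eq: "\<And>x. x \<in> carrier M \<Longrightarrow> g x = f x"
  shows "g \<in> gmod_hom L M N"
proof (rule gmod_homI)
  interpret module L M by (rule graded_moduleD[OF M])
  fix x y a d
  show "x \<in> carrier M \<Longrightarrow> g x \<in> carrier N" by (simp add: eq gmod_homD[OF f])
  show "x \<in> carrier M \<Longrightarrow> y \<in> carrier M \<Longrightarrow> g (x \<oplus>\<^bsub>M\<^esub> y) = g x \<oplus>\<^bsub>N\<^esub> g y"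
    by (simp add: eq gmod_homD[OF f])
  show "a \<in> carrier L \<Longrightarrow> x \<in> carrier M \<Longrightarrow> g (a \<odot>\<^bsub>M\<^esub> x) = a \<odot>\<^bsub>N\<^esub> g x"
    by (simp add: eq gmod_homD[OF f])
  show "x \<in> mdeg M d \<Longrightarrow> g x \<in> mdeg N d"
    using mdeg_in_carrier[OF M] by (simp add: eq gmod_homD(4)[OF f])
qed

definition mshift :: "int \<Rightarrow> ('a, 'u) gmodule \<Rightarrow> ('a, 'u) gmodule" where
  "mshift b M = M\<lparr>mdeg := \<lambda>d. mdeg M (d - b)\<rparr>"

lemma mshift_simps [simp]:
  "carrier (mshift b M) = carrier M" "(\<oplus>\<^bsub>mshift b M\<^esub>) = (\<oplus>\<^bsub>M\<^esub>)" "\<zero>\<^bsub>mshift b M\<^esub> = \<zero>\<^bsub>M\<^esub>"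
  "r \<odot>\<^bsub>mshift b M\<^esub> x = r \<odot>\<^bsub>M\<^esub> x" "mdeg (mshift b M) d = mdeg M (d - b)"
  "add_monoid (mshift b M) = add_monoid M"
  by (simp_all add: mshift_def)

lemma mshift_minus [simp]:
  "\<ominus>\<^bsub>mshift b M\<^esub> x = \<ominus>\<^bsub>M\<^esub> x" "x \<ominus>\<^bsub>mshift b M\<^esub> y = x \<ominus>\<^bsub>M\<^esub> y" "sg (mshift b M) a x = sg M a x"
  by (simp_all add: a_inv_def a_minus_def sg_def)

lemma finsum_mshift: "finsum (mshift b M) f I = finsum M f I"
  by (simp add: finsum_def finprod_def)

lemma mshift_graded:
  assumes "graded_module L M"
  shows "graded_module L (mshift b M)"
proof -
  have mod: "module L (mshift b M)"
    using graded_moduleD(1)[OF assms]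
    by (simp add: module_def module_axioms_def abelian_group_def abelian_monoid_def
        abelian_group_axioms_def)
  have ex: "\<exists>!c. (\<forall>d. c d \<in> mdeg (mshift b M) d) \<and> finite {d. c d \<noteq> \<zero>\<^bsub>mshift b M\<^esub>} \<and>
        x = finsum (mshift b M) c {d. c d \<noteq> \<zero>\<^bsub>mshift b M\<^esub>}" if x: "x \<in> carrier M" for x
  proof (rule ex1I[of _ "\<lambda>d. cpt M (d - b) x"])
    interpret abelian_group M by (rule graded_moduleD[OF assms])
    have bij: "{d. c (d - b) \<noteq> \<zero>\<^bsub>M\<^esub>} = (\<lambda>d. d + b) ` {d. c d \<noteq> \<zero>\<^bsub>M\<^esub>}" for c
      by (auto simp: image_iff) (metis diff_add_cancel)
    have cc: "cpt M d x \<in> carrier M" for d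
      using cpt_decomposition(1)[OF assms x] mdeg_in_carrier[OF assms] by blast
    have "finsum M (\<lambda>d. cpt M (d - b) x) ((\<lambda>d. d + b) ` {d. cpt M d x \<noteq> \<zero>\<^bsub>M\<^esub>}) =
        finsum M (\<lambda>d. cpt M d x) {d. cpt M d x \<noteq> \<zero>\<^bsub>M\<^esub>}"
      using cc by (subst finsum_reindex) (auto simp: inj_on_def)
    then show "(\<forall>d. cpt M (d - b) x \<in> mdeg (mshift b M) d) \<and>
        finite {d. cpt M (d - b) x \<noteq> \<zero>\<^bsub>mshift b M\<^esub>} \<and>
        x = finsum (mshift b M) (\<lambda>d. cpt M (d - b) x) {d. cpt M (d - b) x \<noteq> \<zero>\<^bsub>mshift b M\<^esub>}"
      using cpt_decomposition[OF assms x] bij[of "\<lambda>d. cpt M d x"] by (simp add: finsum_mshift)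
    fix c assume c: "(\<forall>d. c d \<in> mdeg (mshift b M) d) \<and> finite {d. c d \<noteq> \<zero>\<^bsub>mshift b M\<^esub>} \<and>
        x = finsum (mshift b M) c {d. c d \<noteq> \<zero>\<^bsub>mshift b M\<^esub>}"
    have cM: "c (d + b) \<in> mdeg M d" for d
      using spec[OF conjunct1[OF c], of "d + b"] by simp
    have cC: "c d \<in> carrier M" for d
      using spec[OF conjunct1[OF c], of d] mdeg_in_carrier[OF assms, of "c d" "d - b"] by simp
    have im: "{d. c d \<noteq> \<zero>\<^bsub>M\<^esub>} = (\<lambda>d. d + b) ` {d. c (d + b) \<noteq> \<zero>\<^bsub>M\<^esub>}"
      using bij[of "\<lambda>d. c (d + b)"] by simp
    have "finsum M c {d. c d \<noteq> \<zero>\<^bsub>M\<^esub>} = finsum M (\<lambda>d. c (d + b)) {d. c (d + b) \<noteq> \<zero>\<^bsub>M\<^esub>}"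
      unfolding im by (subst finsum_reindex) (use cC in \<open>auto simp: inj_on_def\<close>)
    moreover have "finite {d. c (d + b) \<noteq> \<zero>\<^bsub>M\<^esub>}"
    proof (rule finite_imageD)
      show "finite ((\<lambda>d. d + b) ` {d. c (d + b) \<noteq> \<zero>\<^bsub>M\<^esub>})"
        unfolding im[symmetric] using conjunct1[OF conjunct2[OF c]] by simp
    qed (simp add: inj_on_def)
    moreover have "x = finsum M c {d. c d \<noteq> \<zero>\<^bsub>M\<^esub>}"
      using conjunct2[OF conjunct2[OF c]] unfolding finsum_mshift mshift_simps .
    ultimately have "cpt M e x = c (e + b)" for e
      by (intro cpt_unique[OF assms cM]) auto
    then show "c = (\<lambda>d. cpt M (d - b) x)" by auto
  qed
  show ?thesis unfolding graded_module_def
  proof (intro conjI allI ballI)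
    show "subgroup (mdeg (mshift b M) d) (add_monoid (mshift b M))" for d
      using graded_moduleD(4)[OF assms] by simp
    show "r \<odot>\<^bsub>mshift b M\<^esub> x \<in> mdeg (mshift b M) (d + e)"
      if "r \<in> rdeg L d" "x \<in> mdeg (mshift b M) e" for r x d e
      using mdeg_smult[OF assms that(1), of x "e - b"] that by (simp add: algebra_simps)
  qed (use mod ex in simp_all)
qed

lemma gmod_hom_mshift [simp]: "gmod_hom L (mshift b M) (mshift b N) = gmod_hom L M N"
proof -
  have "(\<forall>d. f ` mdeg M (d - b) \<subseteq> mdeg N (d - b)) \<longleftrightarrow> (\<forall>d. f ` mdeg M d \<subseteq> mdeg N d)" for f
    by (metis add_diff_cancel_right')
  then show ?thesis by (simp add: gmod_hom_def)
qed

lemma obj_shift [simp]: "obj (shift a b A) n = mshift b (obj A (n + a))"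
  by (simp add: shift_def mshift_def)

lemma dif_shift: "x \<in> carrier (obj A (n + a)) \<Longrightarrow> dif (shift a b A) n x = sg (obj A (n + a + 1)) a (dif A (n + a) x)"
  by (simp add: shift_def sg_def)

lemma shift_complex:
  assumes A: "cochain_complex L A"
  shows "cochain_complex L (shift a b A)"
proof -
  have i: "n + 1 + a = n + a + 1" for n by simp
  note d = cochain_complexD(3)[OF A] and g = cochain_complexD(1)[OF A]
  have hom: "dif (shift a b A) n \<in> gmod_hom L (obj (shift a b A) n) (obj (shift a b A) (n + 1))" for n
    unfolding obj_shift i gmod_hom_mshift
    by (rule gmod_hom_restrict[OF g sg_gmod_hom[OF g g d, of _ a] dif_shift])
  show ?thesis unfolding cochain_complex_def
  proof (intro conjI allI ballI hom)
    fix n show "graded_module L (obj (shift a b A) n)" by (simp add: mshift_graded g)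
    fix x assume x: "x \<in> carrier (obj (shift a b A) n)"
    then have x': "x \<in> carrier (obj A (n + a))" by simp
    have dx: "dif A (n + a) x \<in> carrier (obj A (n + a + 1))" using gmod_homD(1)[OF d x'] .
    have "dif (shift a b A) (n + 1) (dif (shift a b A) n x) =
       sg (obj A (n + a + 1 + 1)) a (dif A (n + a + 1) (sg (obj A (n + a + 1)) a (dif A (n + a) x)))"
      using dif_shift[of "sg (obj A (n + a + 1)) a (dif A (n + a) x)" A "n + 1" a b] sg_closed[OF g dx]
      by (simp add: dif_shift[OF x'] i)
    also have "\<dots> = \<zero>\<^bsub>obj A (n + a + 1 + 1)\<^esub>"
      by (simp add: gmod_hom_sg[OF g g d dx] cochain_complexD(5)[OF A x'] sg_zero[OF g])
    finally show "dif (shift a b A) (n + 1) (dif (shift a b A) n x) = \<zero>\<^bsub>obj (shift a b A) (n + 1 + 1)\<^esub>"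
      by (simp add: add.assoc add.commute[of a])
  qed
qed

text \<open>An equality and not just an isomorphism, because the shifted differential is restricted to the
  carrier.\<close>

lemma shift_shift:
  assumes A: "cochain_complex L A"
  shows "shift a b (shift a' b' A) = shift (a + a') (b + b') A"
proof -
  note g = cochain_complexD(1)[OF A] and d = cochain_complexD(3)[OF A]
  have "dif (shift a b (shift a' b' A)) n x = dif (shift (a + a') (b + b') A) n x" for n x
  proof (cases "x \<in> carrier (obj A (n + a + a'))")
    case True
    then have x: "x \<in> carrier (obj A (n + (a + a')))" by (simp add: add.assoc)
    have i: "n + a + 1 + a' = n + (a + a') + 1" by simp
    have "dif (shift a b (shift a' b' A)) n x = sg (obj A (n + (a + a') + 1)) a (dif (shift a' b' A) (n + a) x)"
      using dif_shift[of x "shift a' b' A" n a b] True by (simp add: i)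
    also have "dif (shift a' b' A) (n + a) x = sg (obj A (n + (a + a') + 1)) a' (dif A (n + (a + a')) x)"
      using dif_shift[of x A "n + a" a' b'] True by (simp add: add.assoc)
    also have "sg (obj A (n + (a + a') + 1)) a \<dots> = sg (obj A (n + (a + a') + 1)) (a + a') (dif A (n + (a + a')) x)"
      by (rule sg_sg[OF g gmod_homD(1)[OF d x]])
    finally show ?thesis using dif_shift[of x A n "a + a'" "b + b'"] x by simp
  next
    case False
    then show ?thesis by (simp add: shift_def add.assoc)
  qed
  moreover have "obj (shift a b (shift a' b' A)) = obj (shift (a + a') (b + b') A)"
    by (simp add: fun_eq_iff mshift_def algebra_simps)
  ultimately show ?thesis by (intro cpx.equality) (auto simp: fun_eq_iff)
qed

lemma obj_shift_0 [simp]: "obj (shift 0 0 A) = obj A"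
  by (simp add: fun_eq_iff mshift_def)

lemma dif_shift_0: "x \<in> carrier (obj A n) \<Longrightarrow> dif (shift 0 0 A) n x = dif A n x"
  by (simp add: shift_def)

lemma chain_map_shift_0_left [simp]: "chain_map L (shift 0 0 A) B = chain_map L A B"
  unfolding chain_map_def by (auto simp: dif_shift_0)

lemma chain_map_shift_0_right [simp]: "chain_map L A (shift 0 0 B) = chain_map L A B"
proof -
  have "dif (shift 0 0 B) n (f n x) = dif B n (f n x)"
    if "\<forall>n. f n \<in> gmod_hom L (obj A n) (obj B n)" "x \<in> carrier (obj A n)" for f n x
    by (rule dif_shift_0[OF gmod_homD(1)[OF spec[OF that(1), of n] that(2)]])
  then show ?thesis unfolding chain_map_def by auto
qed

lemma homotopic_shift_0_right: "homotopic L A (shift 0 0 B) f g \<Longrightarrow> homotopic L A B f g"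
proof -
  assume "homotopic L A (shift 0 0 B) f g"
  then obtain h where h: "homotopy L A (shift 0 0 B) h f g" by (auto simp: homotopic_iff)
  show ?thesis
  proof (rule homotopicI)
    show hn: "h n \<in> gmod_hom L (obj A n) (obj B (n - 1))" for n using homotopyD(1)[OF h] by simp
    have "dif (shift 0 0 B) (n - 1) (h n x) = dif B (n - 1) (h n x)" if "x \<in> carrier (obj A n)" for n x
      by (rule dif_shift_0[OF gmod_homD(1)[OF hn that]])
    then show "f n x \<ominus>\<^bsub>obj B n\<^esub> g n x = dif B (n - 1) (h n x) \<oplus>\<^bsub>obj B n\<^esub> h (n + 1) (dif A n x)"
      if "x \<in> carrier (obj A n)" for n x
      using homotopyD(3)[OF h, of x n] that by simp
  qed
qed

lemma shift_map_chain_map: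
  assumes A: "cochain_complex L A" and B: "cochain_complex L B" and f: "f \<in> chain_map L A B"
  shows "shift_map a f \<in> chain_map L (shift a b A) (shift a b B)"
proof -
  note g = cochain_complexD(1)[OF A] cochain_complexD(1)[OF B]
  show ?thesis unfolding chain_map_def
  proof (intro CollectI conjI allI ballI)
    show "shift_map a f n \<in> gmod_hom L (obj (shift a b A) n) (obj (shift a b B) n)" for n
      by (simp add: shift_map_def chain_mapD[OF f])
    fix n x assume "x \<in> carrier (obj (shift a b A) n)"
    then have x: "x \<in> carrier (obj A (n + a))" by simp
    have i: "n + 1 + a = n + a + 1" by simp
    show "shift_map a f (n + 1) (dif (shift a b A) n x) = dif (shift a b B) n (shift_map a f n x)"
      by (simp add: shift_map_def i dif_shift x gmod_homD(1)[OF chain_mapD(1)[OF f]]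
          gmod_hom_sg[OF g chain_mapD(1)[OF f]] gmod_homD(1)[OF cochain_complexD(3)[OF A]] chain_mapD(2)[OF f])
  qed
qed

lemma shift_homotopic:
  assumes A: "cochain_complex L A" and B: "cochain_complex L B" and "homotopic L A B f k"
  shows "homotopic L (shift a b A) (shift a b B) (shift_map a f) (shift_map a k)"
proof -
  obtain h where h: "homotopy L A B h f k" using assms(3) by (auto simp: homotopic_iff)
  note gA = cochain_complexD(1)[OF A] and gB = cochain_complexD(1)[OF B]
  have i: "n - 1 + a = n + a - 1" "n + 1 + a = n + a + 1" for n by simp_all
  show ?thesis
  proof (rule homotopicI)
    show "(\<lambda>x. sg (obj B (n + a - 1)) a (h (n + a) x)) \<in>
        gmod_hom L (obj (shift a b A) n) (obj (shift a b B) (n - 1))" for n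
      using sg_gmod_hom[OF gA gB homotopyD(1)[OF h]] by (simp add: i)
    fix n x assume "x \<in> carrier (obj (shift a b A) n)"
    then have x: "x \<in> carrier (obj A (n + a))" by simp
    have hx: "h (n + a) x \<in> carrier (obj B (n + a - 1))" using gmod_homD(1)[OF homotopyD(1)[OF h] x] .
    have dx: "dif A (n + a) x \<in> carrier (obj A (n + a + 1))" using gmod_homD(1)[OF cochain_complexD(3)[OF A] x] .
    have dhx: "dif B (n + a - 1) (h (n + a) x) \<in> carrier (obj B (n + a))"
      using gmod_homD(1)[OF cochain_complexD(4)[OF B] hx] .
    have hdx: "h (n + a + 1) (dif A (n + a) x) \<in> carrier (obj B (n + a))"
      using gmod_homD(1)[OF homotopyD(2)[OF h] dx] .
    have "dif (shift a b B) (n - 1) (sg (obj B (n + a - 1)) a (h (n + a) x)) =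
        sg (obj B (n + a)) a (dif B (n + a - 1) (sg (obj B (n + a - 1)) a (h (n + a) x)))"
      using dif_shift[of "sg (obj B (n + a - 1)) a (h (n + a) x)" B "n - 1" a b] sg_closed[OF gB hx] by (simp add: i)
    also have "\<dots> = dif B (n + a - 1) (h (n + a) x)"
      using gmod_hom_sg[OF gB gB cochain_complexD(4)[OF B] hx, of a] sg_sg[OF gB dhx, of a a]
      by (simp add: sg_def)
    finally have 1: "dif (shift a b B) (n - 1) (sg (obj B (n + a - 1)) a (h (n + a) x)) = \<dots>" .
    have 2: "sg (obj B (n + a)) a (h (n + a + 1) (dif (shift a b A) n x)) = h (n + a + 1) (dif A (n + a) x)"
      using gmod_hom_sg[OF gA gB homotopyD(2)[OF h] dx, of a] sg_sg[OF gB hdx, of a a]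
      by (simp add: dif_shift[OF x]) (simp add: sg_def)
    have i2: "n + 1 + a - 1 = n + a" by simp
    show "shift_map a f n x \<ominus>\<^bsub>obj (shift a b B) n\<^esub> shift_map a k n x =
       dif (shift a b B) (n - 1) (sg (obj B (n + a - 1)) a (h (n + a) x))
       \<oplus>\<^bsub>obj (shift a b B) n\<^esub> sg (obj B (n + 1 + a - 1)) a (h (n + 1 + a) (dif (shift a b A) n x))"
      using homotopyD(3)[OF h x] 1 2 unfolding i2 i by (simp add: shift_map_def)
  qed
qed

lemma shift_heq:
  assumes "heq L A B f k"
  shows "heq L (shift a b A) (shift a b B) (shift_map a f) (shift_map a k)"
  using assms unfolding heq_def by (blast intro: shift_complex shift_map_chain_map shift_homotopic)

lemma sg_eq_zero_iff:
  assumes "graded_module L M" "x \<in> carrier M"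
  shows "sg M a x = \<zero>\<^bsub>M\<^esub> \<longleftrightarrow> x = \<zero>\<^bsub>M\<^esub>"
  using sg_sg[OF assms, of a a] sg_zero[OF assms(1), of a] by (auto simp: sg_def)

lemma cocycles_shift:
  assumes A: "cochain_complex L A"
  shows "cocycles (shift a b A) n = cocycles A (n + a)"
proof -
  have i: "n + 1 + a = n + a + 1" by simp
  have "dif (shift a b A) n x = \<zero>\<^bsub>obj (shift a b A) (n + 1)\<^esub> \<longleftrightarrow>
      dif A (n + a) x = \<zero>\<^bsub>obj A (n + a + 1)\<^esub>" if "x \<in> carrier (obj A (n + a))" for x
    using sg_eq_zero_iff[OF cochain_complexD(1)[OF A] gmod_homD(1)[OF cochain_complexD(3)[OF A] that]]
      dif_shift[OF that, of b] unfolding obj_shift mshift_simps i by simp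
  then show ?thesis by (auto simp: cocycles_def)
qed

lemma dif_shift_pred:
  "w \<in> carrier (obj A (n + a - 1)) \<Longrightarrow> dif (shift a b A) (n - 1) w = sg (obj A (n + a)) a (dif A (n + a - 1) w)"
proof -
  have i: "n - 1 + a = n + a - 1" "n + a - 1 + 1 = n + a" by simp_all
  show "w \<in> carrier (obj A (n + a - 1)) \<Longrightarrow> ?thesis" using dif_shift[of w A "n - 1" a b] unfolding i .
qed

lemma shift_pred: "obj (shift a b A) (n - 1) = mshift b (obj A (n + a - 1))"
proof -
  have i: "n - 1 + a = n + a - 1" by simp
  show ?thesis unfolding obj_shift i ..
qed

lemma coboundaries_shift:
  assumes A: "cochain_complex L A"
  shows "coboundaries (shift a b A) n = coboundaries A (n + a)"
proof -
  note g = cochain_complexD(1)[OF A] and d = cochain_complexD(4)[OF A, of "n + a"]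
  have "sg (obj A (n + a)) a (dif A (n + a - 1) w) = dif A (n + a - 1) (sg (obj A (n + a - 1)) a w)"
    if "w \<in> carrier (obj A (n + a - 1))" for w using gmod_hom_sg[OF g g d that] by simp
  moreover have "sg (obj A (n + a - 1)) a (sg (obj A (n + a - 1)) a w) = w"
    if "w \<in> carrier (obj A (n + a - 1))" for w using sg_sg[OF g that, of a a] by (simp add: sg_def)
  ultimately show ?thesis
    unfolding coboundaries_def shift_pred
    by (auto simp: dif_shift_pred image_iff sg_closed[OF g]) (metis sg_closed[OF g])+
qed

lemma shift_quasi_iso:
  assumes A: "cochain_complex L A" and B: "cochain_complex L B" and f: "f \<in> quasi_iso L A B"
  shows "shift_map a f \<in> quasi_iso L (shift a b A) (shift a b B)"
proof -
  note F = f[unfolded quasi_iso_iff[OF A B]]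
  note g = cochain_complexD(1)[OF B]
  show ?thesis
    unfolding quasi_iso_iff[OF shift_complex[OF A] shift_complex[OF B]] cocycles_shift[OF A]
      cocycles_shift[OF B] coboundaries_shift[OF A] coboundaries_shift[OF B]
  proof (intro conjI allI ballI impI)
    show "shift_map a f \<in> chain_map L (shift a b A) (shift a b B)"
      using F shift_map_chain_map[OF A B] by blast
    fix n z assume "z \<in> cocycles A (n + a)" "shift_map a f n z \<in> coboundaries B (n + a)"
    then show "z \<in> coboundaries A (n + a)" using F by (simp add: shift_map_def)
  next
    fix n y assume "y \<in> cocycles B (n + a)"
    then obtain z w where z: "z \<in> cocycles A (n + a)" "w \<in> carrier (obj B (n + a - 1))"
      "y = dif B (n + a - 1) w \<oplus>\<^bsub>obj B (n + a)\<^esub> f (n + a) z" using F by blast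
    have "dif (shift a b B) (n - 1) (sg (obj B (n + a - 1)) a w) = dif B (n + a - 1) w"
      using dif_shift_pred[OF sg_closed[OF g z(2)], of b a]
        gmod_hom_sg[OF g g cochain_complexD(4)[OF B] z(2), of a]
        sg_sg[OF g gmod_homD(1)[OF cochain_complexD(4)[OF B] z(2)], of a a]
      by (simp add: sg_def split: if_splits)
    then have "y = dif (shift a b B) (n - 1) (sg (obj B (n + a - 1)) a w) \<oplus>\<^bsub>obj (shift a b B) n\<^esub> shift_map a f n z"
      using z by (simp add: shift_map_def)
    moreover have "sg (obj B (n + a - 1)) a w \<in> carrier (obj (shift a b B) (n - 1))"
      unfolding shift_pred using sg_closed[OF g z(2)] by simp
    ultimately show "\<exists>z\<in>cocycles A (n + a). \<exists>w\<in>carrier (obj (shift a b B) (n - 1)).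
        y = dif (shift a b B) (n - 1) w \<oplus>\<^bsub>obj (shift a b B) n\<^esub> shift_map a f n z"
      using z(1) by blast
  qed
qed

lemma shift_map_shift_map [simp]: "shift_map a (shift_map b f) = shift_map (a + b) f"
  by (simp add: shift_map_def add.assoc)

lemma shift_map_0 [simp]: "shift_map 0 f = f"
  by (simp add: shift_map_def)

lemma shift_map_comp: "shift_map a (comp_map f g) = comp_map (shift_map a f) (shift_map a g)"
  by (simp add: shift_map_def comp_map_def o_def)

text \<open>Shifting back reduces K-projectivity of a shift to K-projectivity of the complex itself.\<close>

lemma kproj_shift:
  fixes L :: "'a gring" and P :: "('a, 'u) cpx"
  assumes P: "kproj L P"
  shows "kproj L (shift a b P)"
  unfolding kproj_def
proof (intro conjI allI impI ballI)
  note Pc = kproj_complex[OF P]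
  show "cochain_complex L (shift a b P)" by (rule shift_complex[OF Pc])
  fix Q A :: "('a, 'u) cpx" and t
  assume Q: "cochain_complex L Q" and A: "cochain_complex L A" and t: "t \<in> quasi_iso L Q A"
  let ?Q = "shift (-a) (-b) Q" and ?A = "shift (-a) (-b) A"
  note t' = shift_quasi_iso[OF Q A t, of "-a" "-b"]
  have down: "shift_map (-a) f \<in> chain_map L P (shift (-a) (-b) B)"
    if "cochain_complex L B" "f \<in> chain_map L (shift a b P) B" for f B
    using shift_map_chain_map[OF shift_complex[OF Pc] that, of "-a" "-b"] by (simp add: shift_shift[OF Pc])
  have up: "shift_map a f \<in> chain_map L (shift a b P) B"
    if "cochain_complex L B" "f \<in> chain_map L P (shift (-a) (-b) B)" for f B
    using shift_map_chain_map[OF Pc shift_complex[OF that(1)] that(2), of a b] by (simp add: shift_shift[OF that(1)])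
  have hup: "homotopic L (shift a b P) B (shift_map a f) (shift_map a g)"
    if "cochain_complex L B" "homotopic L P (shift (-a) (-b) B) f g" for f g B
    using shift_homotopic[OF Pc shift_complex[OF that(1)] that(2), of a b] homotopic_shift_0_right
    by (simp add: shift_shift[OF that(1)])
  { fix f assume f: "f \<in> chain_map L (shift a b P) A"
    obtain g where g: "g \<in> chain_map L P ?Q" "heq L P ?A (comp_map (shift_map (-a) t) g) (shift_map (-a) f)"
      using kproj_lift[OF P shift_complex[OF Q] shift_complex[OF A] t' down[OF A f]] .
    have "homotopic L (shift a b P) A (comp_map t (shift_map a g)) f"
      using hup[OF A heqD(5)[OF g(2)]] by (simp add: shift_map_comp)
    then show "\<exists>g\<in>chain_map L (shift a b P) Q. homotopic L (shift a b P) A (comp_map t g) f"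
      using up[OF Q g(1)] by blast }
  { fix g g' assume g: "g \<in> chain_map L (shift a b P) Q" "g' \<in> chain_map L (shift a b P) Q"
      and h: "homotopic L (shift a b P) A (comp_map t g) (comp_map t g')"
    have "homotopic L P ?A (shift_map (-a) (comp_map t g)) (shift_map (-a) (comp_map t g'))"
    proof -
      have "homotopic L (shift 0 0 P) ?A (shift_map (-a) (comp_map t g)) (shift_map (-a) (comp_map t g'))"
        using shift_homotopic[OF shift_complex[OF Pc] A h, of "-a" "-b"] by (simp add: shift_shift[OF Pc])
      then show ?thesis unfolding homotopic_def by (auto simp: dif_shift_0)
    qed
    then have "heq L P ?A (comp_map (shift_map (-a) t) (shift_map (-a) g)) (comp_map (shift_map (-a) t) (shift_map (-a) g'))"
      unfolding heq_def shift_map_comp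
      using Pc shift_complex[OF A] down[OF Q g(1)] down[OF Q g(2)] quasi_iso_chain_map[OF t']
      by (auto intro!: comp_map_chain_map)
    from kproj_cancel[OF P shift_complex[OF Q] t' down[OF Q g(1)] down[OF Q g(2)] this]
    have "homotopic L P ?Q (shift_map (-a) g) (shift_map (-a) g')" by (rule heqD)
    from hup[OF Q this] show "homotopic L (shift a b P) Q g g'" by simp }
qed

lemma resolution_shift:
  assumes "resolution L F P p"
  shows "resolution L (shift a b F) (shift a b P) (shift_map a p)"
  using resolutionD[OF assms] unfolding resolution_def
  by (auto intro: shift_complex kproj_shift shift_quasi_iso)

lemma dshift_cls:
  assumes res: "resolution L A P p" and B: "cochain_complex L B" and f: "f \<in> chain_map L P B"
  shows "dshift L a b A B (cls L A P p B f) =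
    cls L (shift a b A) (shift a b P) (shift_map a p) (shift a b B) (shift_map a f)"
  unfolding dshift_def
proof (rule roof_rel_image[OF resolution_shift[OF res] shift_complex[OF B]])
  let ?S = "{(shift a b Q, shift_map a s, shift_map a g) |Q s g. (Q, s, g) \<in> cls L A P p B f}"
  note A = resolutionD[OF res]
  show "?S \<subseteq> roofs L (shift a b A) (shift a b B)"
    using A(1) B by (auto simp: cls_def roofs_def intro!: shift_complex shift_quasi_iso shift_map_chain_map)
  show "?S \<noteq> {}" using standard_roof(3)[OF res B f] by blast
  fix r assume "r \<in> ?S"
  then obtain Q s g where r: "r = (shift a b Q, shift_map a s, shift_map a g)" and "(Q, s, g) \<in> cls L A P p B f"
    by blast
  then have Q: "cochain_complex L Q" and "rep L A P p B (Q, s, g) f" by (auto simp: cls_def roofs_def)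
  then obtain w where w: "w \<in> chain_map L P Q" "heq L P A (comp_map s w) p" "heq L P B (comp_map g w) f"
    by (auto simp: rep_def)
  then show "rep L (shift a b A) (shift a b P) (shift_map a p) (shift a b B) r (shift_map a f)"
    unfolding r rep_def prod.case
    by (intro bexI[OF _ shift_map_chain_map[OF A(3) Q w(1)]] conjI)
      (use shift_heq[OF w(2), of a b] shift_heq[OF w(3), of a b] in \<open>simp_all add: shift_map_comp\<close>)
qed

section \<open>Free graded modules over a ring with normal forms\<close>

abbreviation lookup where "lookup \<equiv> Poly_Mapping.lookup"
abbreviation keys where "keys \<equiv> Poly_Mapping.keys"

text \<open>The graded ring \<open>L\<close> is a quotient of a commutative ring of type \<open>'r\<close>: \<open>cl\<close> is the projection, \<open>nf p\<close>
  a canonical additive choice of representative of \<open>cl p\<close>, and \<open>prj d p\<close> the homogeneous component of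
  degree \<open>d\<close>. Coefficients of free modules are represented by normal forms, so that computations with
  them take place in type classes.\<close>

locale graded_coeff =
  fixes L :: "'a gring" and cl :: "'r::comm_ring_1 \<Rightarrow> 'a" and nf :: "'r \<Rightarrow> 'r"
    and prj :: "int \<Rightarrow> 'r \<Rightarrow> 'r"
  assumes cring: "cring L"
    and carrier_L: "carrier L = range cl"
    and cl_add: "cl (p + q) = cl p \<oplus>\<^bsub>L\<^esub> cl q"
    and cl_mult: "cl (p * q) = cl p \<otimes>\<^bsub>L\<^esub> cl q"
    and cl_one: "cl 1 = \<one>\<^bsub>L\<^esub>"
    and nf_eq_iff: "nf p = nf q \<longleftrightarrow> cl p = cl q"
    and cl_nf: "cl (nf p) = cl p"
    and nf_add: "nf (p + q) = nf p + nf q"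
    and rdeg_L: "rdeg L d = cl ` {p. prj d p = p}"
    and prj_add: "prj d (p + q) = prj d p + prj d q"
    and prj_prj: "prj d (prj e p) = (if d = e then prj e p else 0)"
    and prj_finite: "finite {d. prj d p \<noteq> 0}"
    and prj_sum: "(\<Sum>d | prj d p \<noteq> 0. prj d p) = p"
    and prj_one: "prj 0 1 = 1"
    and prj_mult: "prj d p = p \<Longrightarrow> prj e q = q \<Longrightarrow> prj (d + e) (p * q) = p * q"
    and nf_prj: "nf (prj d p) = prj d (nf p)"
begin

lemma nf_0 [simp]: "nf 0 = 0" using nf_add[of 0 0] by simp
lemma prj_0 [simp]: "prj d 0 = 0" using prj_add[of d 0 0] by simp
lemma nf_nf [simp]: "nf (nf p) = nf p" using cl_nf[of p] by (simp add: nf_eq_iff)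
lemma nf_minus: "nf (- p) = - nf p" using nf_add[of p "- p"] by (simp add: eq_neg_iff_add_eq_0 add.commute)
lemma prj_minus: "prj d (- p) = - prj d p" using prj_add[of d p "- p"] by (simp add: eq_neg_iff_add_eq_0 add.commute)
lemma nf_diff: "nf (p - q) = nf p - nf q" using nf_add[of p "- q"] by (simp add: nf_minus)
lemma prj_sum_fun: "prj d (sum f A) = (\<Sum>i\<in>A. prj d (f i))"
  by (induction A rule: infinite_finite_induct) (auto simp: prj_add)
lemma nf_mult_nf [simp]: "nf (p * nf q) = nf (p * q)" "nf (nf p * q) = nf (p * q)"
  by (simp_all add: nf_eq_iff cl_mult cl_nf)

lemma nf_mult_cong: "cl p = cl p' \<Longrightarrow> nf (p * q) = nf (p' * q)"
  by (simp add: nf_eq_iff cl_mult)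

lemma cl_0: "cl 0 = \<zero>\<^bsub>L\<^esub>"
proof -
  interpret L: cring L by (rule cring)
  have "cl 0 \<in> carrier L" by (simp add: carrier_L)
  moreover have "cl 0 \<oplus>\<^bsub>L\<^esub> cl 0 = cl 0" using cl_add[of 0 0] by simp
  ultimately show ?thesis by (metis L.add.l_cancel_one' L.add.one_closed)
qed

subsection \<open>Finitely supported vectors of normal forms\<close>

definition normal_vec :: "('b \<Rightarrow>\<^sub>0 'r) \<Rightarrow> bool" where
  "normal_vec x \<longleftrightarrow> (\<forall>b. nf (lookup x b) = lookup x b)"

definition sm :: "'r \<Rightarrow> ('b \<Rightarrow>\<^sub>0 'r) \<Rightarrow> 'b \<Rightarrow>\<^sub>0 'r" where
  "sm p x = Poly_Mapping.map (\<lambda>q. nf (p * q)) x"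

definition unit_vec :: "'b \<Rightarrow> 'b \<Rightarrow>\<^sub>0 'r" where
  "unit_vec b = Poly_Mapping.single b (nf 1)"

definition vec :: "'b set \<Rightarrow> ('b \<Rightarrow> int) \<Rightarrow> int \<Rightarrow> ('b \<Rightarrow>\<^sub>0 'r) set" where
  "vec S hg n = {x. normal_vec x \<and> keys x \<subseteq> {b \<in> S. hg b = n}}"

definition hvec :: "'b set \<Rightarrow> ('b \<Rightarrow> int) \<Rightarrow> ('b \<Rightarrow> int) \<Rightarrow> int \<Rightarrow> int \<Rightarrow> ('b \<Rightarrow>\<^sub>0 'r) set" where
  "hvec S hg ig n d = {x \<in> vec S hg n. \<forall>b. prj (d - ig b) (lookup x b) = lookup x b}"

lemma lookup_sm: "lookup (sm p x) b = nf (p * lookup x b)"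
  by (simp add: sm_def Poly_Mapping.map.rep_eq when_def)

lemma sm_add: "sm p (x + y) = sm p x + sm p y" "sm (p + q) x = sm p x + sm q x"
  by (rule poly_mapping_eqI; simp add: lookup_sm lookup_add algebra_simps nf_add)+

lemma sm_sm: "sm p (sm q x) = sm (p * q) x"
  by (rule poly_mapping_eqI) (simp add: lookup_sm mult.assoc)

lemma sm_one: "normal_vec x \<Longrightarrow> sm 1 x = x"
  by (rule poly_mapping_eqI) (simp add: lookup_sm normal_vec_def)

lemma sm_0 [simp]: "sm p 0 = 0" "sm 0 x = 0"
  by (rule poly_mapping_eqI; simp add: lookup_sm)+

lemma sm_minus: "sm p (- x) = - sm p x" "sm p (x - y) = sm p x - sm p y"
  by (rule poly_mapping_eqI; simp add: lookup_sm lookup_minus nf_minus nf_diff right_diff_distrib)+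

lemma sm_cong: "cl p = cl q \<Longrightarrow> sm p x = sm q x"
  by (rule poly_mapping_eqI) (simp only: lookup_sm, erule nf_mult_cong)

lemma normal_vec_sm: "normal_vec (sm p x)"
  by (simp add: normal_vec_def lookup_sm)

lemma keys_sm: "keys (sm p x) \<subseteq> keys x"
  by (auto simp: in_keys_iff lookup_sm)

lemma vec_0 [simp]: "0 \<in> vec S hg n" "0 \<in> hvec S hg ig n d"
  by (simp_all add: vec_def hvec_def normal_vec_def)

lemma vec_add: "x \<in> vec S hg n \<Longrightarrow> y \<in> vec S hg n \<Longrightarrow> x + y \<in> vec S hg n"
  using keys_add[of x y] by (auto simp: vec_def normal_vec_def lookup_add nf_add)

lemma vec_minus: "x \<in> vec S hg n \<Longrightarrow> - x \<in> vec S hg n"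
  by (auto simp: vec_def normal_vec_def nf_minus in_keys_iff)

lemma vec_diff: "x \<in> vec S hg n \<Longrightarrow> y \<in> vec S hg n \<Longrightarrow> x - y \<in> vec S hg n"
  using vec_add[of x S hg n "- y"] vec_minus[of y S hg n] by simp

lemma vec_sm: "x \<in> vec S hg n \<Longrightarrow> sm p x \<in> vec S hg n"
  using keys_sm[of p x] by (auto simp: vec_def normal_vec_sm)

lemma vec_sum: "(\<And>i. i \<in> A \<Longrightarrow> f i \<in> vec S hg n) \<Longrightarrow> sum f A \<in> vec S hg n"
  by (induction A rule: infinite_finite_induct) (auto simp: vec_add)

lemma hvec_vec: "x \<in> hvec S hg ig n d \<Longrightarrow> x \<in> vec S hg n"
  by (simp add: hvec_def)

lemma hvec_add: "x \<in> hvec S hg ig n d \<Longrightarrow> y \<in> hvec S hg ig n d \<Longrightarrow> x + y \<in> hvec S hg ig n d"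
  by (auto simp: hvec_def vec_add lookup_add prj_add)

lemma hvec_minus: "x \<in> hvec S hg ig n d \<Longrightarrow> - x \<in> hvec S hg ig n d"
  by (auto simp: hvec_def vec_minus prj_minus)

lemma hvec_diff: "x \<in> hvec S hg ig n d \<Longrightarrow> y \<in> hvec S hg ig n d \<Longrightarrow> x - y \<in> hvec S hg ig n d"
  using hvec_add[of x S hg ig n d "- y"] hvec_minus[of y S hg ig n d] by simp

lemma hvec_sum: "(\<And>i. i \<in> A \<Longrightarrow> f i \<in> hvec S hg ig n d) \<Longrightarrow> sum f A \<in> hvec S hg ig n d"
  by (induction A rule: infinite_finite_induct) (auto simp: hvec_add)

lemma hvec_sm:
  assumes "prj d p = p" "x \<in> hvec S hg ig n e"
  shows "sm p x \<in> hvec S hg ig n (d + e)"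
proof -
  have "prj (d + e - ig b) (nf (p * lookup x b)) = nf (p * lookup x b)" for b
    using prj_mult[OF assms(1), of "e - ig b" "lookup x b"] assms(2)
    by (simp add: hvec_def add_diff_eq flip: nf_prj)
  then show ?thesis using assms by (auto simp: hvec_def vec_sm lookup_sm)
qed

lemma unit_vec_hvec: "b \<in> S \<Longrightarrow> hg b = n \<Longrightarrow> unit_vec b \<in> hvec S hg ig n (ig b)"
  using prj_one by (auto simp: hvec_def vec_def normal_vec_def unit_vec_def lookup_single when_def nf_prj[symmetric])

lemma unit_vec_vec: "b \<in> S \<Longrightarrow> hg b = n \<Longrightarrow> unit_vec b \<in> vec S hg n"
  by (rule hvec_vec[OF unit_vec_hvec[where ig = "\<lambda>_. 0"]])

text \<open>Unit vectors carry the coefficient \<open>nf 1\<close> and not \<open>1\<close>, which need not be a normal form if \<open>L\<close> is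
  trivial.\<close>

lemma vec_decomposition:
  assumes "normal_vec x"
  shows "x = (\<Sum>b\<in>keys x. sm (lookup x b) (unit_vec b))"
proof (rule poly_mapping_eqI)
  fix c
  have "lookup (\<Sum>b\<in>keys x. sm (lookup x b) (unit_vec b)) c = (\<Sum>b\<in>keys x. if b = c then nf (lookup x b) else 0)"
    unfolding lookup_sum by (intro sum.cong) (auto simp: lookup_sm unit_vec_def lookup_single when_def)
  also have "\<dots> = lookup x c"
    using assms by (simp add: normal_vec_def in_keys_iff)
  finally show "lookup x c = lookup (\<Sum>b\<in>keys x. sm (lookup x b) (unit_vec b)) c" ..
qed

definition vcpt :: "('b \<Rightarrow> int) \<Rightarrow> int \<Rightarrow> ('b \<Rightarrow>\<^sub>0 'r) \<Rightarrow> 'b \<Rightarrow>\<^sub>0 'r" where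
  "vcpt ig d x = Poly_Mapping.mapp (\<lambda>b. prj (d - ig b)) x"

lemma lookup_vcpt: "lookup (vcpt ig d x) b = prj (d - ig b) (lookup x b)"
  by (simp add: vcpt_def lookup_mapp when_def in_keys_iff)

lemma keys_vcpt: "keys (vcpt ig d x) \<subseteq> keys x"
  by (simp add: vcpt_def keys_mapp_subset)

lemma vcpt_hvec: "x \<in> vec S hg n \<Longrightarrow> vcpt ig d x \<in> hvec S hg ig n d"
  using keys_vcpt[of ig d x] by (auto simp: hvec_def vec_def normal_vec_def lookup_vcpt prj_prj nf_prj)

lemma vcpt_finite: "finite {d. vcpt ig d x \<noteq> 0}"
proof (rule finite_subset)
  show "{d. vcpt ig d x \<noteq> 0} \<subseteq> (\<Union>b\<in>keys x. (\<lambda>e. e + ig b) ` {e. prj e (lookup x b) \<noteq> 0})"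
  proof
    fix d assume "d \<in> {d. vcpt ig d x \<noteq> 0}"
    then obtain b where b: "prj (d - ig b) (lookup x b) \<noteq> 0"
      by (auto simp: poly_mapping_eq_iff fun_eq_iff lookup_vcpt)
    then have "b \<in> keys x" by (auto simp: in_keys_iff)
    then show "d \<in> (\<Union>b\<in>keys x. (\<lambda>e. e + ig b) ` {e. prj e (lookup x b) \<noteq> 0})"
      using b by (intro UN_I[of b]) (auto intro!: image_eqI[of _ _ "d - ig b"])
  qed
qed (auto simp: prj_finite)

lemma vcpt_sum:
  assumes "finite D" "{d. vcpt ig d x \<noteq> 0} \<subseteq> D"
  shows "(\<Sum>d\<in>D. vcpt ig d x) = x"
proof (rule poly_mapping_eqI)
  fix b
  have "lookup (\<Sum>d\<in>D. vcpt ig d x) b = (\<Sum>d\<in>D. prj (d - ig b) (lookup x b))"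
    by (simp add: lookup_sum lookup_vcpt)
  also have "\<dots> = (\<Sum>e\<in>(\<lambda>d. d - ig b) ` D. prj e (lookup x b))"
    by (subst sum.reindex) (auto simp: inj_on_def)
  also have "\<dots> = (\<Sum>e | prj e (lookup x b) \<noteq> 0. prj e (lookup x b))"
  proof (rule sum.mono_neutral_right)
    show "{e. prj e (lookup x b) \<noteq> 0} \<subseteq> (\<lambda>d. d - ig b) ` D"
    proof
      fix e assume "e \<in> {e. prj e (lookup x b) \<noteq> 0}"
      then have "lookup (vcpt ig (e + ig b) x) b \<noteq> 0" by (simp add: lookup_vcpt)
      then have "vcpt ig (e + ig b) x \<noteq> 0" by auto
      then have "e + ig b \<in> D" using assms by auto
      then show "e \<in> (\<lambda>d. d - ig b) ` D" by (intro image_eqI[of _ _ "e + ig b"]) auto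
    qed
  qed (use assms in auto)
  also have "\<dots> = lookup x b" by (rule prj_sum)
  finally show "lookup (\<Sum>d\<in>D. vcpt ig d x) b = lookup x b" .
qed

lemma vcpt_of_sum:
  assumes "finite D" "\<And>d. c d \<in> hvec S hg ig n d"
  shows "vcpt ig e (\<Sum>d\<in>D. c d) = (if e \<in> D then c e else 0)"
proof (rule poly_mapping_eqI)
  fix b
  have c: "prj (d - ig b) (lookup (c d) b) = lookup (c d) b" for d using assms(2)[of d] by (simp add: hvec_def)
  have "prj (e - ig b) (lookup (c d) b) = (if d = e then lookup (c e) b else 0)" for d
    using c[of d] prj_prj[of "e - ig b" "d - ig b" "lookup (c d) b"] by auto
  then have "lookup (vcpt ig e (\<Sum>d\<in>D. c d)) b = (\<Sum>d\<in>D. if d = e then lookup (c e) b else 0)"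
    by (simp add: lookup_vcpt lookup_sum prj_sum_fun)
  then show "lookup (vcpt ig e (\<Sum>d\<in>D. c d)) b = lookup (if e \<in> D then c e else 0) b"
    using assms(1) by simp
qed

subsection \<open>Free modules inside a universe\<close>

text \<open>The vectors are transported into the universe \<open>'u\<close> along an injection \<open>mk\<close>.\<close>

definition rp :: "'a \<Rightarrow> 'r" where "rp a = (SOME p. cl p = a)"

lemma sm_rp: "sm (rp (cl p)) x = sm p x"
  by (rule sm_cong) (metis (mono_tags, lifting) rp_def someI)

definition free_mod :: "(('b \<Rightarrow>\<^sub>0 'r) \<Rightarrow> 'u) \<Rightarrow> 'b set \<Rightarrow> ('b \<Rightarrow> int) \<Rightarrow> ('b \<Rightarrow> int) \<Rightarrow> int \<Rightarrow> ('a, 'u) gmodule" where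
  "free_mod mk S hg ig n = \<lparr>carrier = mk ` vec S hg n, monoid.mult = undefined, one = undefined,
     zero = mk 0, add = (\<lambda>u v. mk (the_inv mk u + the_inv mk v)),
     module.smult = (\<lambda>a u. mk (sm (rp a) (the_inv mk u))), mdeg = (\<lambda>d. mk ` hvec S hg ig n d)\<rparr>"

lemma free_mod_simps:
  "carrier (free_mod mk S hg ig n) = mk ` vec S hg n" "\<zero>\<^bsub>free_mod mk S hg ig n\<^esub> = mk 0"
  "mdeg (free_mod mk S hg ig n) d = mk ` hvec S hg ig n d"
  by (simp_all add: free_mod_def)

lemma free_mod_ops:
  assumes "inj mk"
  shows "mk x \<oplus>\<^bsub>free_mod mk S hg ig n\<^esub> mk y = mk (x + y)" "cl p \<odot>\<^bsub>free_mod mk S hg ig n\<^esub> mk x = mk (sm p x)"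
  using assms by (simp_all add: free_mod_def the_inv_f_f sm_rp)

lemma free_mod_abelian_group:
  assumes inj: "inj mk"
  shows "abelian_group (free_mod mk S hg ig n)"
proof (rule abelian_groupI)
  fix u assume "u \<in> carrier (free_mod mk S hg ig n)"
  then obtain x where "x \<in> vec S hg n" "u = mk x" by (auto simp: free_mod_simps)
  then show "\<exists>v\<in>carrier (free_mod mk S hg ig n). v \<oplus>\<^bsub>free_mod mk S hg ig n\<^esub> u = \<zero>\<^bsub>free_mod mk S hg ig n\<^esub>"
    by (intro bexI[of _ "mk (- x)"]) (auto simp: free_mod_simps free_mod_ops[OF inj] vec_minus)
qed (auto simp: free_mod_simps free_mod_ops[OF inj] vec_add add_ac)

lemma free_mod_minus:
  assumes inj: "inj mk" and "x \<in> vec S hg n"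
  shows "\<ominus>\<^bsub>free_mod mk S hg ig n\<^esub> mk x = mk (- x)"
    "y \<in> vec S hg n \<Longrightarrow> mk y \<ominus>\<^bsub>free_mod mk S hg ig n\<^esub> mk x = mk (y - x)"
proof -
  interpret abelian_group "free_mod mk S hg ig n" by (rule free_mod_abelian_group[OF inj])
  show *: "\<ominus>\<^bsub>free_mod mk S hg ig n\<^esub> mk x = mk (- x)"
    using assms by (intro minus_equality) (auto simp: free_mod_simps free_mod_ops[OF inj] vec_minus)
  show "y \<in> vec S hg n \<Longrightarrow> mk y \<ominus>\<^bsub>free_mod mk S hg ig n\<^esub> mk x = mk (y - x)"
    by (simp add: a_minus_def * free_mod_ops[OF inj])
qed

lemma free_mod_finsum:
  assumes inj: "inj mk" and "\<And>i. i \<in> I \<Longrightarrow> f i \<in> vec S hg n"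
  shows "finsum (free_mod mk S hg ig n) (\<lambda>i. mk (f i)) I = mk (sum f I)"
proof -
  interpret abelian_group "free_mod mk S hg ig n" by (rule free_mod_abelian_group[OF inj])
  show ?thesis using assms(2)
    by (induction I rule: infinite_finite_induct) (auto simp: free_mod_simps free_mod_ops[OF inj] Pi_iff)
qed

lemma free_mod_module:
  assumes inj: "inj mk"
  shows "module L (free_mod mk S hg ig n)"
proof (rule moduleI[OF cring free_mod_abelian_group[OF inj]])
  fix a b u v assume a: "a \<in> carrier L" and u: "u \<in> carrier (free_mod mk S hg ig n)"
  then obtain p x where p: "a = cl p" and x: "u = mk x" "x \<in> vec S hg n" by (auto simp: free_mod_simps carrier_L)
  show "a \<odot>\<^bsub>free_mod mk S hg ig n\<^esub> u \<in> carrier (free_mod mk S hg ig n)"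
    by (auto simp: p x free_mod_simps free_mod_ops[OF inj] vec_sm)
  show "(a \<oplus>\<^bsub>L\<^esub> b) \<odot>\<^bsub>free_mod mk S hg ig n\<^esub> u = a \<odot>\<^bsub>free_mod mk S hg ig n\<^esub> u \<oplus>\<^bsub>free_mod mk S hg ig n\<^esub> b \<odot>\<^bsub>free_mod mk S hg ig n\<^esub> u"
    if "b \<in> carrier L"
    using that by (auto simp: p x carrier_L free_mod_ops[OF inj] sm_add simp flip: cl_add)
  show "a \<otimes>\<^bsub>L\<^esub> b \<odot>\<^bsub>free_mod mk S hg ig n\<^esub> u = a \<odot>\<^bsub>free_mod mk S hg ig n\<^esub> (b \<odot>\<^bsub>free_mod mk S hg ig n\<^esub> u)"
    if "b \<in> carrier L"
    using that by (auto simp: p x carrier_L free_mod_ops[OF inj] sm_sm simp flip: cl_mult)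
  show "a \<odot>\<^bsub>free_mod mk S hg ig n\<^esub> (u \<oplus>\<^bsub>free_mod mk S hg ig n\<^esub> v) = a \<odot>\<^bsub>free_mod mk S hg ig n\<^esub> u \<oplus>\<^bsub>free_mod mk S hg ig n\<^esub> a \<odot>\<^bsub>free_mod mk S hg ig n\<^esub> v"
    if "v \<in> carrier (free_mod mk S hg ig n)"
    using that by (auto simp: p x free_mod_simps free_mod_ops[OF inj] sm_add)
next
  fix u assume "u \<in> carrier (free_mod mk S hg ig n)"
  then show "\<one>\<^bsub>L\<^esub> \<odot>\<^bsub>free_mod mk S hg ig n\<^esub> u = u"
    by (auto simp: free_mod_simps free_mod_ops[OF inj] vec_def sm_one simp flip: cl_one)
qed

lemma free_mod_graded:
  assumes inj: "inj mk"
  shows "graded_module L (free_mod mk S hg ig n)"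
  unfolding graded_module_def
proof (intro conjI allI ballI)
  let ?M = "free_mod mk S hg ig n"
  interpret abelian_group ?M by (rule free_mod_abelian_group[OF inj])
  show "module L ?M" by (rule free_mod_module[OF inj])
  show "subgroup (mdeg ?M d) (add_monoid ?M)" for d
  proof (rule add.subgroupI)
    show "mdeg ?M d \<subseteq> carrier ?M" by (auto simp: free_mod_simps hvec_vec)
    show "mdeg ?M d \<noteq> {}" using vec_0(2)[of S hg ig n d] by (auto simp: free_mod_simps simp del: vec_0)
    fix u assume "u \<in> mdeg ?M d"
    then obtain x where x: "x \<in> hvec S hg ig n d" "u = mk x" by (auto simp: free_mod_simps)
    show "\<ominus>\<^bsub>?M\<^esub> u \<in> mdeg ?M d"
      unfolding x free_mod_minus(1)[OF inj hvec_vec[OF x(1)]] using hvec_minus[OF x(1)] by (auto simp: free_mod_simps)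
    fix v assume "v \<in> mdeg ?M d"
    then obtain y where y: "y \<in> hvec S hg ig n d" "v = mk y" by (auto simp: free_mod_simps)
    show "u \<oplus>\<^bsub>?M\<^esub> v \<in> mdeg ?M d" using hvec_add[OF x(1) y(1)] by (auto simp: x y free_mod_ops[OF inj] free_mod_simps)
  qed
  fix d e a u assume "a \<in> rdeg L d" "u \<in> mdeg ?M e"
  then obtain p x where p: "prj d p = p" "a = cl p" and x: "x \<in> hvec S hg ig n e" "u = mk x"
    by (auto simp: rdeg_L free_mod_simps)
  show "a \<odot>\<^bsub>?M\<^esub> u \<in> mdeg ?M (d + e)" using hvec_sm[OF p(1) x(1)] by (auto simp: p x free_mod_ops[OF inj] free_mod_simps)
next
  let ?M = "free_mod mk S hg ig n"
  fix u assume "u \<in> carrier ?M"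
  then obtain x where x: "x \<in> vec S hg n" "u = mk x" by (auto simp: free_mod_simps)
  have mk0: "mk y = mk 0 \<longleftrightarrow> y = 0" for y using inj by (auto simp: inj_eq)
  show "\<exists>!c. (\<forall>d. c d \<in> mdeg ?M d) \<and> finite {d. c d \<noteq> \<zero>\<^bsub>?M\<^esub>} \<and> u = finsum ?M c {d. c d \<noteq> \<zero>\<^bsub>?M\<^esub>}"
  proof (rule ex1I[of _ "\<lambda>d. mk (vcpt ig d x)"])
    show "(\<forall>d. mk (vcpt ig d x) \<in> mdeg ?M d) \<and> finite {d. mk (vcpt ig d x) \<noteq> \<zero>\<^bsub>?M\<^esub>} \<and>
        u = finsum ?M (\<lambda>d. mk (vcpt ig d x)) {d. mk (vcpt ig d x) \<noteq> \<zero>\<^bsub>?M\<^esub>}"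
    proof -
      have "finsum ?M (\<lambda>d. mk (vcpt ig d x)) {d. vcpt ig d x \<noteq> 0} = mk (\<Sum>d | vcpt ig d x \<noteq> 0. vcpt ig d x)"
        using hvec_vec[OF vcpt_hvec[OF x(1)]] by (intro free_mod_finsum[OF inj])
      then show ?thesis
        using x(2) vcpt_hvec[OF x(1)] vcpt_finite[of ig x] vcpt_sum[OF vcpt_finite subset_refl, of ig x]
        by (simp add: free_mod_simps mk0)
    qed
    fix c assume c: "(\<forall>d. c d \<in> mdeg ?M d) \<and> finite {d. c d \<noteq> \<zero>\<^bsub>?M\<^esub>} \<and>
        u = finsum ?M c {d. c d \<noteq> \<zero>\<^bsub>?M\<^esub>}"
    then have "\<forall>d. \<exists>y. y \<in> hvec S hg ig n d \<and> c d = mk y" by (auto simp: free_mod_simps)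
    then obtain y where y: "y d \<in> hvec S hg ig n d" "c d = mk (y d)" for d by metis
    have cy: "c = (\<lambda>d. mk (y d))" using y by auto
    have fin: "finite {d. y d \<noteq> 0}" using c by (simp add: cy free_mod_simps mk0)
    have "u = finsum ?M c {d. y d \<noteq> 0}" using c by (simp add: cy free_mod_simps mk0)
    also have "\<dots> = mk (\<Sum>d | y d \<noteq> 0. y d)"
      unfolding cy by (rule free_mod_finsum[OF inj]) (rule hvec_vec[OF y(1)])
    finally have "x = (\<Sum>d | y d \<noteq> 0. y d)" using x inj by (auto simp: inj_eq)
    then show "c = (\<lambda>d. mk (vcpt ig d x))" unfolding cy
      using vcpt_of_sum[OF fin, of y S hg ig n] y by auto
  qed
qed

text \<open>Graded linear maps between modules of vectors. They correspond to the homomorphisms of the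
  transported modules, but compose and add without reference to carriers inside the universe.\<close>

definition glinear :: "'b set \<Rightarrow> ('b \<Rightarrow> int) \<Rightarrow> ('b \<Rightarrow> int) \<Rightarrow> int \<Rightarrow> 'c set \<Rightarrow> ('c \<Rightarrow> int) \<Rightarrow> ('c \<Rightarrow> int) \<Rightarrow> int \<Rightarrow>
    (('b \<Rightarrow>\<^sub>0 'r) \<Rightarrow> 'c \<Rightarrow>\<^sub>0 'r) \<Rightarrow> bool" where
  "glinear S hg ig n S' hg' ig' n' T \<longleftrightarrow>
     (\<forall>x\<in>vec S hg n. T x \<in> vec S' hg' n') \<and>
     (\<forall>x\<in>vec S hg n. \<forall>y\<in>vec S hg n. T (x + y) = T x + T y) \<and>
     (\<forall>p. \<forall>x\<in>vec S hg n. T (sm p x) = sm p (T x)) \<and>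
     (\<forall>d. \<forall>x\<in>hvec S hg ig n d. T x \<in> hvec S' hg' ig' n' d)"

lemma glinear_imp_hom:
  assumes inj: "inj mk" "inj mk'" and T: "glinear S hg ig n S' hg' ig' n' T"
  shows "(\<lambda>u. mk' (T (the_inv mk u))) \<in> gmod_hom L (free_mod mk S hg ig n) (free_mod mk' S' hg' ig' n')"
  using T unfolding glinear_def
  by (intro gmod_homI) (auto simp: free_mod_simps free_mod_ops[OF inj(1)] free_mod_ops[OF inj(2)] carrier_L the_inv_f_f[OF inj(1)] the_inv_f_f[OF inj(2)])

lemma hom_imp_glinear:
  assumes inj: "inj mk" "inj mk'" and f: "f \<in> gmod_hom L (free_mod mk S hg ig n) (free_mod mk' S' hg' ig' n')"
  shows "glinear S hg ig n S' hg' ig' n' (\<lambda>x. the_inv mk' (f (mk x)))"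
    "x \<in> vec S hg n \<Longrightarrow> mk' (the_inv mk' (f (mk x))) = f (mk x)"
proof -
  have *: "\<exists>y\<in>vec S' hg' n'. f (mk x) = mk' y" if "x \<in> vec S hg n" for x
    using gmod_homD(1)[OF f, of "mk x"] that by (auto simp: free_mod_simps)
  show b: "mk' (the_inv mk' (f (mk x))) = f (mk x)" if "x \<in> vec S hg n" for x
    using *[OF that] by (auto simp: the_inv_f_f[OF inj(2)])
  have c: "the_inv mk' (f (mk x)) \<in> vec S' hg' n'" if "x \<in> vec S hg n" for x
    using *[OF that] by (auto simp: the_inv_f_f[OF inj(2)])
  show "glinear S hg ig n S' hg' ig' n' (\<lambda>x. the_inv mk' (f (mk x)))"
    unfolding glinear_def
  proof (intro conjI ballI allI c)
    fix x y assume x: "x \<in> vec S hg n" and y: "y \<in> vec S hg n"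
    have "f (mk (x + y)) = f (mk x) \<oplus>\<^bsub>free_mod mk' S' hg' ig' n'\<^esub> f (mk y)"
      using gmod_homD(2)[OF f, of "mk x" "mk y"] x y by (simp add: free_mod_simps free_mod_ops(1)[OF inj(1)])
    also have "\<dots> = mk' (the_inv mk' (f (mk x))) \<oplus>\<^bsub>free_mod mk' S' hg' ig' n'\<^esub> mk' (the_inv mk' (f (mk y)))"
      by (simp only: b[OF x] b[OF y])
    also have "\<dots> = mk' (the_inv mk' (f (mk x)) + the_inv mk' (f (mk y)))"
      by (rule free_mod_ops(1)[OF inj(2)])
    finally show "the_inv mk' (f (mk (x + y))) = the_inv mk' (f (mk x)) + the_inv mk' (f (mk y))"
      by (simp only: the_inv_f_f[OF inj(2)])
  next
    fix p x assume x: "x \<in> vec S hg n"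
    have "f (mk (sm p x)) = cl p \<odot>\<^bsub>free_mod mk' S' hg' ig' n'\<^esub> f (mk x)"
      using gmod_homD(3)[OF f, of "cl p" "mk x"] x by (simp add: free_mod_simps free_mod_ops(2)[OF inj(1)] carrier_L)
    also have "\<dots> = cl p \<odot>\<^bsub>free_mod mk' S' hg' ig' n'\<^esub> mk' (the_inv mk' (f (mk x)))"
      by (simp only: b[OF x])
    also have "\<dots> = mk' (sm p (the_inv mk' (f (mk x))))"
      by (rule free_mod_ops(2)[OF inj(2)])
    finally show "the_inv mk' (f (mk (sm p x))) = sm p (the_inv mk' (f (mk x)))"
      by (simp only: the_inv_f_f[OF inj(2)])
  next
    fix d x assume "x \<in> hvec S hg ig n d"
    then show "the_inv mk' (f (mk x)) \<in> hvec S' hg' ig' n' d"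
      using gmod_homD(4)[OF f, of "mk x" d] by (auto simp: free_mod_simps the_inv_f_f[OF inj(2)])
  qed
qed

text \<open>Maps from a free module to an arbitrary module are given by the images of the basis.\<close>

definition lin :: "('a, 'u) gmodule \<Rightarrow> ('b \<Rightarrow> 'u) \<Rightarrow> ('b \<Rightarrow>\<^sub>0 'r) \<Rightarrow> 'u" where
  "lin M v x = finsum M (\<lambda>b. cl (lookup x b) \<odot>\<^bsub>M\<^esub> v b) (keys x)"

lemma lin_superset:
  assumes M: "graded_module L M" and T: "finite T" "keys x \<subseteq> T" "\<And>b. b \<in> T \<Longrightarrow> v b \<in> carrier M"
  shows "lin M v x = finsum M (\<lambda>b. cl (lookup x b) \<odot>\<^bsub>M\<^esub> v b) T"
proof -
  interpret module L M by (rule graded_moduleD[OF M])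
  show ?thesis unfolding lin_def
  proof (rule M.add.finprod_mono_neutral_cong_left)
    show "cl (lookup x b) \<odot>\<^bsub>M\<^esub> v b = \<zero>\<^bsub>M\<^esub>" if "b \<in> T - keys x" for b
    proof -
      have "lookup x b = 0" "v b \<in> carrier M" using that T by (auto simp: in_keys_iff)
      then show ?thesis by (simp add: cl_0 smult_l_null)
    qed
  qed (use T in \<open>auto simp: carrier_L\<close>)
qed

lemma lin_hom:
  assumes M: "graded_module L M" and inj: "inj mk"
    and v: "\<And>b. b \<in> S \<Longrightarrow> hg b = n \<Longrightarrow> v b \<in> mdeg M (ig b)"
  shows "(\<lambda>u. lin M v (the_inv mk u)) \<in> gmod_hom L (free_mod mk S hg ig n) M"
proof -
  interpret module L M by (rule graded_moduleD[OF M])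
  have vc: "v b \<in> carrier M" if "x \<in> vec S hg n" "b \<in> keys x" for x b
    using v that mdeg_in_carrier[OF M] by (auto simp: vec_def)
  have cL: "cl p \<in> carrier L" for p by (simp add: carrier_L)
  have inj': "the_inv mk (mk x) = x" for x using inj by (simp add: the_inv_f_f)
  show ?thesis
  proof (rule gmod_homI)
    fix u assume "u \<in> carrier (free_mod mk S hg ig n)"
    then obtain x where x: "x \<in> vec S hg n" "u = mk x" by (auto simp: free_mod_simps)
    show "lin M v (the_inv mk u) \<in> carrier M"
      unfolding lin_def x inj' using vc[OF x(1)] cL by (intro M.finsum_closed) auto
    { fix u' assume "u' \<in> carrier (free_mod mk S hg ig n)"
      then obtain y where y: "y \<in> vec S hg n" "u' = mk y" by (auto simp: free_mod_simps)
      let ?T = "keys x \<union> keys y"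
      have T: "finite ?T" "\<And>b. b \<in> ?T \<Longrightarrow> v b \<in> carrier M" using vc x y by auto
      have "lin M v (x + y) = finsum M (\<lambda>b. cl (lookup (x + y) b) \<odot>\<^bsub>M\<^esub> v b) ?T"
        using keys_add[of x y] by (intro lin_superset[OF M T(1) _ T(2)]) auto
      also have "\<dots> = finsum M (\<lambda>b. cl (lookup x b) \<odot>\<^bsub>M\<^esub> v b \<oplus>\<^bsub>M\<^esub> cl (lookup y b) \<odot>\<^bsub>M\<^esub> v b) ?T"
        using T(2) cL by (intro M.finsum_cong') (auto simp: lookup_add cl_add smult_l_distr)
      also have "\<dots> = finsum M (\<lambda>b. cl (lookup x b) \<odot>\<^bsub>M\<^esub> v b) ?T \<oplus>\<^bsub>M\<^esub> finsum M (\<lambda>b. cl (lookup y b) \<odot>\<^bsub>M\<^esub> v b) ?T"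
        using T(2) cL by (intro M.finsum_addf) auto
      also have "finsum M (\<lambda>b. cl (lookup x b) \<odot>\<^bsub>M\<^esub> v b) ?T = lin M v x"
        by (rule lin_superset[OF M T(1) _ T(2), symmetric]) auto
      also have "finsum M (\<lambda>b. cl (lookup y b) \<odot>\<^bsub>M\<^esub> v b) ?T = lin M v y"
        by (rule lin_superset[OF M T(1) _ T(2), symmetric]) auto
      finally show "lin M v (the_inv mk (u \<oplus>\<^bsub>free_mod mk S hg ig n\<^esub> u')) = lin M v (the_inv mk u) \<oplus>\<^bsub>M\<^esub> lin M v (the_inv mk u')"
        by (simp add: x y free_mod_ops[OF inj] inj') }
    { fix a assume "a \<in> carrier L"
      then obtain p where p: "a = cl p" by (auto simp: carrier_L)
      have "lin M v (sm p x) = finsum M (\<lambda>b. cl (lookup (sm p x) b) \<odot>\<^bsub>M\<^esub> v b) (keys x)"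
        using keys_sm[of p x] vc[OF x(1)] by (intro lin_superset[OF M]) auto
      also have "\<dots> = finsum M (\<lambda>b. cl p \<odot>\<^bsub>M\<^esub> (cl (lookup x b) \<odot>\<^bsub>M\<^esub> v b)) (keys x)"
        using vc[OF x(1)] cL by (intro M.finsum_cong') (auto simp: lookup_sm cl_nf cl_mult smult_assoc1)
      also have "\<dots> = cl p \<odot>\<^bsub>M\<^esub> lin M v x"
        unfolding lin_def using vc[OF x(1)] cL by (intro finsum_smult_ldistr[symmetric]) auto
      finally show "lin M v (the_inv mk (a \<odot>\<^bsub>free_mod mk S hg ig n\<^esub> u)) = a \<odot>\<^bsub>M\<^esub> lin M v (the_inv mk u)"
        by (simp add: x p free_mod_ops[OF inj] inj') }
  next
    fix d u assume "u \<in> mdeg (free_mod mk S hg ig n) d"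
    then obtain x where x: "x \<in> hvec S hg ig n d" "u = mk x" by (auto simp: free_mod_simps)
    have "cl (lookup x b) \<odot>\<^bsub>M\<^esub> v b \<in> mdeg M d" if "b \<in> keys x" for b
    proof -
      have "v b \<in> mdeg M (ig b)" using v x(1) that by (auto simp: hvec_def vec_def)
      moreover have "cl (lookup x b) \<in> rdeg L (d - ig b)" using x(1) by (auto simp: rdeg_L hvec_def)
      ultimately show ?thesis using mdeg_smult[OF M, of _ "d - ig b" _ "ig b"] by auto
    qed
    then show "lin M v (the_inv mk u) \<in> mdeg M d" unfolding lin_def x inj' by (rule mdeg_finsum[OF M])
  qed
qed

lemma lin_unit_vec:
  assumes M: "graded_module L M" and "v b \<in> carrier M"
  shows "lin M v (unit_vec b) = v b"
proof -
  interpret module L M by (rule graded_moduleD[OF M])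
  have "lin M v (unit_vec b) = finsum M (\<lambda>c. cl (lookup (unit_vec b) c) \<odot>\<^bsub>M\<^esub> v c) {b}"
    using assms by (intro lin_superset[OF M]) (auto simp: unit_vec_def)
  also have "\<dots> = cl (nf 1) \<odot>\<^bsub>M\<^esub> v b"
    using assms by (simp add: unit_vec_def carrier_L)
  finally show ?thesis using assms by (simp add: cl_nf cl_one)
qed

lemma hom_as_lin:
  assumes M: "graded_module L M" and inj: "inj mk" and f: "f \<in> gmod_hom L (free_mod mk S hg ig n) M"
    and x: "x \<in> vec S hg n"
  shows "f (mk x) = lin M (\<lambda>b. f (mk (unit_vec b))) x"
proof -
  have e: "unit_vec b \<in> vec S hg n" if "b \<in> keys x" for b
    by (rule unit_vec_vec) (use that x in \<open>auto simp: vec_def\<close>)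
  have se: "sm (lookup x b) (unit_vec b) \<in> vec S hg n" if "b \<in> keys x" for b
    using vec_sm[OF e[OF that]] .
  have "mk x = mk (\<Sum>b\<in>keys x. sm (lookup x b) (unit_vec b))"
    using x vec_decomposition[of x] by (simp add: vec_def)
  also have "\<dots> = finsum (free_mod mk S hg ig n) (\<lambda>b. mk (sm (lookup x b) (unit_vec b))) (keys x)"
    by (rule free_mod_finsum[OF inj, symmetric]) (rule se)
  finally have "f (mk x) = finsum M (\<lambda>b. f (mk (sm (lookup x b) (unit_vec b)))) (keys x)"
    using gmod_hom_finsum[OF free_mod_graded[OF inj] M f, of "keys x" "\<lambda>b. mk (sm (lookup x b) (unit_vec b))"] se
    by (simp add: free_mod_simps)
  also have "\<dots> = lin M (\<lambda>b. f (mk (unit_vec b))) x"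
    unfolding lin_def
  proof (rule abelian_monoid.finsum_cong'[OF abelian_group.axioms(1)[OF graded_moduleD(2)[OF M]] refl])
    interpret module L M by (rule graded_moduleD[OF M])
    show "(\<lambda>b. cl (lookup x b) \<odot>\<^bsub>M\<^esub> f (mk (unit_vec b))) \<in> keys x \<rightarrow> carrier M"
      using e gmod_homD(1)[OF f] by (auto simp: free_mod_simps carrier_L)
    show "f (mk (sm (lookup x b) (unit_vec b))) = cl (lookup x b) \<odot>\<^bsub>M\<^esub> f (mk (unit_vec b))" if "b \<in> keys x" for b
      using gmod_homD(3)[OF f, of "cl (lookup x b)" "mk (unit_vec b)"] e[OF that]
      by (simp add: free_mod_simps free_mod_ops[OF inj] carrier_L)
  qed
  finally show ?thesis .
qed

text \<open>Chain map and homotopy equations are equations between homomorphisms and will be checked on basis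
  elements by this principle.\<close>

lemma hom_ext:
  assumes M: "graded_module L M" and inj: "inj mk"
    and f: "f \<in> gmod_hom L (free_mod mk S hg ig n) M" and g: "g \<in> gmod_hom L (free_mod mk S hg ig n) M"
    and eq: "\<And>b. b \<in> S \<Longrightarrow> hg b = n \<Longrightarrow> f (mk (unit_vec b)) = g (mk (unit_vec b))"
    and u: "u \<in> carrier (free_mod mk S hg ig n)"
  shows "f u = g u"
proof -
  obtain x where x: "x \<in> vec S hg n" "u = mk x" using u by (auto simp: free_mod_simps)
  have "b \<in> S \<and> hg b = n" if "b \<in> keys x" for b using that x by (auto simp: vec_def)
  then have "lin M (\<lambda>b. f (mk (unit_vec b))) x = lin M (\<lambda>b. g (mk (unit_vec b))) x"
    unfolding lin_def
  proof (intro abelian_monoid.finsum_cong'[OF abelian_group.axioms(1)[OF graded_moduleD(2)[OF M]] refl])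
    interpret module L M by (rule graded_moduleD[OF M])
    assume *: "\<And>b. b \<in> keys x \<Longrightarrow> b \<in> S \<and> hg b = n"
    show "(\<lambda>b. cl (lookup x b) \<odot>\<^bsub>M\<^esub> g (mk (unit_vec b))) \<in> keys x \<rightarrow> carrier M"
    proof
      fix b assume "b \<in> keys x"
      then have "unit_vec b \<in> vec S hg n" using * by (intro unit_vec_vec) auto
      then have "g (mk (unit_vec b)) \<in> carrier M" by (intro gmod_homD(1)[OF g]) (simp add: free_mod_simps)
      then show "cl (lookup x b) \<odot>\<^bsub>M\<^esub> g (mk (unit_vec b)) \<in> carrier M" by (simp add: carrier_L)
    qed
  qed (use eq in auto)
  then show ?thesis using hom_as_lin[OF M inj f x(1)] hom_as_lin[OF M inj g x(1)] x by simp
qed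

end

section \<open>Semi-free complexes are K-projective\<close>

text \<open>The one place where a quasi-isomorphism is used to solve equations: a cocycle that becomes a
  boundary downstairs bounds upstairs, compatibly with the given bounding element.\<close>

lemma quasi_iso_solve:
  assumes Q: "cochain_complex L Q" and A: "cochain_complex L A" and t: "t \<in> quasi_iso L Q A"
    and a: "a \<in> mdeg (obj Q (m + 1)) d" "dif Q (m + 1) a = \<zero>\<^bsub>obj Q (m + 1 + 1)\<^esub>"
    and b: "b \<in> mdeg (obj A m) d" "t (m + 1) a = dif A m b"
  shows "\<exists>q\<in>mdeg (obj Q m) d. \<exists>w\<in>mdeg (obj A (m - 1)) d.
     dif Q m q = a \<and> dif A (m - 1) w = t m q \<ominus>\<^bsub>obj A m\<^esub> b"
proof -
  note gQ = cochain_complexD(1)[OF Q] and gA = cochain_complexD(1)[OF A]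
  note dQ = cochain_complexD(3)[OF Q, of m] and dA = cochain_complexD(4)[OF A, of m]
  note dA' = cochain_complexD(3)[OF A, of m]
  note T = t[unfolded quasi_iso_iff[OF Q A]]
  have tm: "t m \<in> gmod_hom L (obj Q m) (obj A m)" by (rule chain_mapD(1)[OF conjunct1[OF T]])
  have tc: "t (m + 1) (dif Q m x) = dif A m (t m x)" if "x \<in> carrier (obj Q m)" for x
    by (rule chain_mapD(2)[OF conjunct1[OF T] that])
  have ac: "a \<in> carrier (obj Q (m + 1))" and bc: "b \<in> carrier (obj A m)"
    using mdeg_in_carrier[OF gQ a(1)] mdeg_in_carrier[OF gA b(1)] by auto
  interpret Am: abelian_group "obj A m" by (rule cochain_complexD[OF A])
  interpret Qm: abelian_group "obj Q m" by (rule cochain_complexD[OF Q])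
  interpret Q1: abelian_group "obj Q (m + 1)" by (rule cochain_complexD[OF Q])
  interpret A1: abelian_group "obj A (m + 1)" by (rule cochain_complexD[OF A])
  have "a \<in> cocycles Q (m + 1)" using ac a(2) by (simp add: cocycles_def)
  moreover have "t (m + 1) a \<in> coboundaries A (m + 1)" using b(2) bc by (simp add: coboundaries_def)
  ultimately have "a \<in> coboundaries Q (m + 1)" using T by blast
  then obtain q0 where q0: "q0 \<in> carrier (obj Q m)" "a = dif Q m q0" by (auto simp: coboundaries_def)
  define q1 where "q1 = cpt (obj Q m) d q0"
  have q1: "q1 \<in> mdeg (obj Q m) d" "dif Q m q1 = a"
    using cpt_decomposition(1)[OF gQ q0(1)] cpt_hom[OF gQ gQ dQ q0(1), of d] cpt_homogeneous[OF gQ a(1)] q0(2)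
    by (simp_all add: q1_def)
  have q1c: "q1 \<in> carrier (obj Q m)" by (rule mdeg_in_carrier[OF gQ q1(1)])
  have tq1: "t m q1 \<in> mdeg (obj A m) d" by (rule gmod_homD(4)[OF tm q1(1)])
  define y where "y = t m q1 \<ominus>\<^bsub>obj A m\<^esub> b"
  have y: "y \<in> mdeg (obj A m) d" unfolding y_def by (rule mdeg_diff[OF gA tq1 b(1)])
  have "dif A m y = \<zero>\<^bsub>obj A (m + 1)\<^esub>"
    using gmod_hom_zero_neg(3)[OF gA gA dA' mdeg_in_carrier[OF gA tq1] bc] tc[OF q1c] q1(2) b(2)
      gmod_homD(1)[OF dA' bc]
    by (simp add: y_def A1.r_neg a_minus_def)
  then have "y \<in> cocycles A m" using mdeg_in_carrier[OF gA y] by (simp add: cocycles_def)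
  then obtain q2 w where q2: "q2 \<in> cocycles Q m" and w: "w \<in> carrier (obj A (m - 1))"
    and yw: "y = dif A (m - 1) w \<oplus>\<^bsub>obj A m\<^esub> t m q2" using T by blast
  have q2c: "q2 \<in> carrier (obj Q m)" "dif Q m q2 = \<zero>\<^bsub>obj Q (m + 1)\<^esub>" using q2 by (auto simp: cocycles_def)
  define q3 where "q3 = cpt (obj Q m) d q2"
  define w3 where "w3 = cpt (obj A (m - 1)) d w"
  have q3: "q3 \<in> mdeg (obj Q m) d" and w3: "w3 \<in> mdeg (obj A (m - 1)) d"
    using cpt_decomposition(1)[OF gQ q2c(1)] cpt_decomposition(1)[OF gA w] by (simp_all add: q3_def w3_def)
  have dq3: "dif Q m q3 = \<zero>\<^bsub>obj Q (m + 1)\<^esub>"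
    using cpt_hom[OF gQ gQ dQ q2c(1), of d] cpt_homogeneous[OF gQ mdeg_zero[OF gQ, of "m + 1" d], of d] q2c(2)
    by (simp add: q3_def)
  have "y = cpt (obj A m) d y" using cpt_homogeneous[OF gA y, of d] by simp
  also have "\<dots> = cpt (obj A m) d (dif A (m - 1) w) \<oplus>\<^bsub>obj A m\<^esub> cpt (obj A m) d (t m q2)"
    unfolding yw by (rule cpt_add[OF gA gmod_homD(1)[OF dA w] gmod_homD(1)[OF tm q2c(1)]])
  also have "\<dots> = dif A (m - 1) w3 \<oplus>\<^bsub>obj A m\<^esub> t m q3"
    using cpt_hom[OF gA gA dA w, of d] cpt_hom[OF gQ gA tm q2c(1), of d] by (simp add: w3_def q3_def)
  finally have yw3: "y = dif A (m - 1) w3 \<oplus>\<^bsub>obj A m\<^esub> t m q3" .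
  note c = mdeg_in_carrier[OF gQ q3] mdeg_in_carrier[OF gA w3]
  note c' = gmod_homD(1)[OF dA c(2)] gmod_homD(1)[OF tm c(1)] mdeg_in_carrier[OF gA tq1]
  let ?q = "q1 \<ominus>\<^bsub>obj Q m\<^esub> q3"
  have "dif Q m ?q = a"
    using gmod_hom_zero_neg(3)[OF gQ gQ dQ q1c c(1)] dq3 q1(2) ac by (simp add: a_minus_def)
  moreover have "dif A (m - 1) w3 = t m ?q \<ominus>\<^bsub>obj A m\<^esub> b"
  proof -
    have "t m ?q \<ominus>\<^bsub>obj A m\<^esub> b = y \<ominus>\<^bsub>obj A m\<^esub> t m q3"
      unfolding gmod_hom_zero_neg(3)[OF gQ gA tm q1c c(1)] y_def
      unfolding a_minus_def using c' bc by (simp add: Am.a_ac)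
    also have "\<dots> = dif A (m - 1) w3" using c' by (simp add: yw3 a_minus_def Am.a_assoc Am.r_neg)
    finally show ?thesis ..
  qed
  ultimately show ?thesis using mdeg_diff[OF gQ q1(1) q3] w3 by blast
qed

context graded_coeff
begin

definition free_cpx :: "(('b \<Rightarrow>\<^sub>0 'r) \<Rightarrow> 'u) \<Rightarrow> 'b set \<Rightarrow> ('b \<Rightarrow> int) \<Rightarrow> ('b \<Rightarrow> int) \<Rightarrow>
    (('b \<Rightarrow>\<^sub>0 'r) \<Rightarrow> 'b \<Rightarrow>\<^sub>0 'r) \<Rightarrow> ('a, 'u) cpx" where
  "free_cpx mk S hg ig \<delta> = \<lparr>obj = (\<lambda>n. free_mod mk S hg ig n), dif = (\<lambda>n u. mk (\<delta> (the_inv mk u)))\<rparr>"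

lemma free_cpx_simps [simp]:
  "obj (free_cpx mk S hg ig \<delta>) n = free_mod mk S hg ig n" "dif (free_cpx mk S hg ig \<delta>) n u = mk (\<delta> (the_inv mk u))"
  by (simp_all add: free_cpx_def)

definition is_differential :: "'b set \<Rightarrow> ('b \<Rightarrow> int) \<Rightarrow> ('b \<Rightarrow> int) \<Rightarrow> (('b \<Rightarrow>\<^sub>0 'r) \<Rightarrow> 'b \<Rightarrow>\<^sub>0 'r) \<Rightarrow> bool" where
  "is_differential S hg ig \<delta> \<longleftrightarrow>
     (\<forall>n. glinear S hg ig n S hg ig (n + 1) \<delta>) \<and> (\<forall>n. \<forall>x\<in>vec S hg n. \<delta> (\<delta> x) = 0)"

lemma free_cpx_complex:
  assumes inj: "inj mk" and d: "is_differential S hg ig \<delta>"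
  shows "cochain_complex L (free_cpx mk S hg ig \<delta>)"
  unfolding cochain_complex_def
proof (intro conjI allI ballI)
  fix n
  show "graded_module L (obj (free_cpx mk S hg ig \<delta>) n)" by (simp add: free_mod_graded[OF inj])
  have "(\<lambda>u. mk (\<delta> (the_inv mk u))) \<in> gmod_hom L (free_mod mk S hg ig n) (free_mod mk S hg ig (n + 1))"
    by (rule glinear_imp_hom[OF inj inj]) (use d in \<open>simp add: is_differential_def\<close>)
  then show "dif (free_cpx mk S hg ig \<delta>) n \<in> gmod_hom L (obj (free_cpx mk S hg ig \<delta>) n) (obj (free_cpx mk S hg ig \<delta>) (n + 1))"
    by (simp add: free_cpx_def)
  fix x assume "x \<in> carrier (obj (free_cpx mk S hg ig \<delta>) n)"
  then show "dif (free_cpx mk S hg ig \<delta>) (n + 1) (dif (free_cpx mk S hg ig \<delta>) n x) = \<zero>\<^bsub>obj (free_cpx mk S hg ig \<delta>) (n + 1 + 1)\<^esub>"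
    using d by (auto simp: free_mod_simps the_inv_f_f[OF inj] is_differential_def)
qed

definition lin_ext :: "('b \<Rightarrow> 'c \<Rightarrow>\<^sub>0 'r) \<Rightarrow> ('b \<Rightarrow>\<^sub>0 'r) \<Rightarrow> 'c \<Rightarrow>\<^sub>0 'r" where
  "lin_ext \<beta> x = (\<Sum>b\<in>keys x. sm (lookup x b) (\<beta> b))"

lemma lin_ext_superset: "finite T \<Longrightarrow> keys x \<subseteq> T \<Longrightarrow> lin_ext \<beta> x = (\<Sum>b\<in>T. sm (lookup x b) (\<beta> b))"
  unfolding lin_ext_def by (rule sum.mono_neutral_left) (auto simp: in_keys_iff)

lemma lin_ext_0 [simp]: "lin_ext \<beta> 0 = 0" by (simp add: lin_ext_def)

lemma lin_ext_add: "lin_ext \<beta> (x + y) = lin_ext \<beta> x + lin_ext \<beta> y"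
proof -
  let ?T = "keys x \<union> keys y"
  have "lin_ext \<beta> (x + y) = (\<Sum>b\<in>?T. sm (lookup (x + y) b) (\<beta> b))"
    by (rule lin_ext_superset) (auto simp: keys_add)
  also have "\<dots> = (\<Sum>b\<in>?T. sm (lookup x b) (\<beta> b)) + (\<Sum>b\<in>?T. sm (lookup y b) (\<beta> b))"
    by (simp add: lookup_add sm_add sum.distrib)
  also have "\<dots> = lin_ext \<beta> x + lin_ext \<beta> y" by (subst (1 2) lin_ext_superset[of ?T]) auto
  finally show ?thesis .
qed

lemma lin_ext_minus: "lin_ext \<beta> (- x) = - lin_ext \<beta> x" "lin_ext \<beta> (x - y) = lin_ext \<beta> x - lin_ext \<beta> y"
proof -
  show *: "lin_ext \<beta> (- x) = - lin_ext \<beta> x" for x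
    using lin_ext_add[of \<beta> x "- x"] by (simp add: eq_neg_iff_add_eq_0 add.commute)
  show "lin_ext \<beta> (x - y) = lin_ext \<beta> x - lin_ext \<beta> y" using lin_ext_add[of \<beta> x "- y"] by (simp add: *)
qed

lemma sm_sum: "sm p (sum f A) = (\<Sum>i\<in>A. sm p (f i))"
  by (induction A rule: infinite_finite_induct) (auto simp: sm_add)

lemma lin_ext_sm: "lin_ext \<beta> (sm p x) = sm p (lin_ext \<beta> x)"
proof -
  have "lin_ext \<beta> (sm p x) = (\<Sum>b\<in>keys x. sm (nf (p * lookup x b)) (\<beta> b))"
    using keys_sm[of p x] by (subst lin_ext_superset[of "keys x"]) (auto simp: lookup_sm)
  also have "\<dots> = (\<Sum>b\<in>keys x. sm p (sm (lookup x b) (\<beta> b)))"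
    by (intro sum.cong refl) (simp add: sm_sm sm_cong[OF cl_nf])
  finally show ?thesis by (simp add: lin_ext_def sm_sum)
qed

lemma lin_ext_sum: "lin_ext \<beta> (sum f A) = (\<Sum>i\<in>A. lin_ext \<beta> (f i))"
  by (induction A rule: infinite_finite_induct) (auto simp: lin_ext_add)

lemma lin_ext_unit_vec: "normal_vec (\<beta> b) \<Longrightarrow> lin_ext \<beta> (unit_vec b) = \<beta> b"
  using lin_ext_superset[of "{b}" "unit_vec b" \<beta>] by (auto simp: unit_vec_def sm_cong[OF cl_nf] sm_one)

lemma lin_ext_glinear:
  assumes "\<And>b. b \<in> S \<Longrightarrow> hg b = n \<Longrightarrow> \<beta> b \<in> hvec S' hg' ig' n' (ig b)"
  shows "glinear S hg ig n S' hg' ig' n' (lin_ext \<beta>)"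
  unfolding glinear_def
proof (intro conjI ballI allI lin_ext_add lin_ext_sm)
  fix x assume x: "x \<in> vec S hg n"
  show "lin_ext \<beta> x \<in> vec S' hg' n'" unfolding lin_ext_def
  proof (intro vec_sum vec_sm)
    fix b assume "b \<in> keys x"
    then have "\<beta> b \<in> hvec S' hg' ig' n' (ig b)" using x by (intro assms) (auto simp: vec_def)
    then show "\<beta> b \<in> vec S' hg' n'" by (rule hvec_vec)
  qed
next
  fix d x assume x: "x \<in> hvec S hg ig n d"
  show "lin_ext \<beta> x \<in> hvec S' hg' ig' n' d" unfolding lin_ext_def
  proof (rule hvec_sum)
    fix b assume "b \<in> keys x"
    then have "\<beta> b \<in> hvec S' hg' ig' n' (ig b)" using assms x by (auto simp: hvec_def vec_def)
    then show "sm (lookup x b) (\<beta> b) \<in> hvec S' hg' ig' n' d"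
      using hvec_sm[of "d - ig b" "lookup x b" "\<beta> b" S' hg' ig' n' "ig b"] x by (auto simp: hvec_def)
  qed
qed

lemma lin_ext_differential:
  assumes \<beta>: "\<And>b. b \<in> S \<Longrightarrow> \<beta> b \<in> hvec S hg ig (hg b + 1) (ig b)"
    and \<beta>2: "\<And>b. b \<in> S \<Longrightarrow> lin_ext \<beta> (\<beta> b) = 0"
  shows "is_differential S hg ig (lin_ext \<beta>)"
  unfolding is_differential_def
proof (intro conjI allI ballI)
  show "glinear S hg ig n S hg ig (n + 1) (lin_ext \<beta>)" for n by (rule lin_ext_glinear) (use \<beta> in auto)
  fix n x assume x: "x \<in> vec S hg n"
  have "lin_ext \<beta> (lin_ext \<beta> x) = (\<Sum>b\<in>keys x. sm (lookup x b) (lin_ext \<beta> (\<beta> b)))"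
    unfolding lin_ext_def[of _ x] by (simp add: lin_ext_sum lin_ext_sm)
  also have "\<dots> = 0" using x \<beta>2 by (intro sum.neutral) (auto simp: vec_def)
  finally show "lin_ext \<beta> (lin_ext \<beta> x) = 0" .
qed

lemma lin_cong:
  assumes "graded_module L M" "\<And>b. b \<in> keys x \<Longrightarrow> v b = v' b" "\<And>b. b \<in> keys x \<Longrightarrow> v' b \<in> carrier M"
  shows "lin M v x = lin M v' x"
proof -
  interpret module L M by (rule graded_moduleD[OF assms(1)])
  show ?thesis unfolding lin_def using assms by (intro M.finsum_cong') (auto simp: carrier_L)
qed

lemma free_mod_subset_hom:
  assumes "inj mk" "T \<subseteq> S" "f \<in> gmod_hom L (free_mod mk S hg ig n) M"
  shows "f \<in> gmod_hom L (free_mod mk T hg ig n) M"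
proof -
  have v: "vec T hg n \<subseteq> vec S hg n" and h: "hvec T hg ig n d \<subseteq> hvec S hg ig n d" for d
    using assms(2) by (auto simp: vec_def hvec_def)
  show ?thesis
  proof (rule gmod_homI)
    fix u assume "u \<in> carrier (free_mod mk T hg ig n)"
    then have u: "u \<in> carrier (free_mod mk S hg ig n)" using v by (auto simp: free_mod_simps)
    show "f u \<in> carrier M" by (rule gmod_homD(1)[OF assms(3) u])
    have "add (free_mod mk T hg ig n) = add (free_mod mk S hg ig n)" by (simp add: free_mod_def)
    then show "f (u \<oplus>\<^bsub>free_mod mk T hg ig n\<^esub> w) = f u \<oplus>\<^bsub>M\<^esub> f w" if "w \<in> carrier (free_mod mk T hg ig n)" for w
      using gmod_homD(2)[OF assms(3) u, of w] that v by (auto simp: free_mod_simps)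
    show "f (a \<odot>\<^bsub>free_mod mk T hg ig n\<^esub> u) = a \<odot>\<^bsub>M\<^esub> f u" if "a \<in> carrier L" for a
      using gmod_homD(3)[OF assms(3) that u] by (simp add: free_mod_def)
  next
    fix d u assume "u \<in> mdeg (free_mod mk T hg ig n) d"
    then show "f u \<in> mdeg M d" using gmod_homD(4)[OF assms(3), of u d] h by (auto simp: free_mod_simps)
  qed
qed

text \<open>The linear extension \<open>lin_ext \<beta>\<close> of boundaries \<open>\<beta>\<close> that lower a rank makes the free module semi-free.
  The pair \<open>(u, v)\<close> is a map from it into the cone of the quasi-isomorphism \<open>t\<close>, in degrees shifted by \<open>i\<close>.
  As the cone is acyclic, the map is null-homotopic, and the components \<open>G\<close> and \<open>H\<close> of a null homotopy are
  found one basis element at a time, in the order of the rank. For \<open>i n = n\<close> and \<open>u = 0\<close> this lifts \<open>v\<close>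
  along \<open>t\<close> up to homotopy; for \<open>i n = n - 1\<close> it lifts a homotopy.\<close>

lemma cone_lift:
  assumes inj: "inj (mk :: ('b \<Rightarrow>\<^sub>0 'r) \<Rightarrow> 'u)"
    and \<beta>: "\<And>b. b \<in> S \<Longrightarrow> \<beta> b \<in> hvec S hg ig (hg b + 1) (ig b)"
    and \<beta>2: "\<And>b. b \<in> S \<Longrightarrow> lin_ext \<beta> (\<beta> b) = 0"
    and rk: "\<And>b c. b \<in> S \<Longrightarrow> c \<in> keys (\<beta> b) \<Longrightarrow> rk c < (rk b :: nat)"
    and Q: "cochain_complex L Q" and A: "cochain_complex L A" and t: "t \<in> quasi_iso L Q A"
    and i: "\<And>n. i (n + 1) = i n + (1 :: int)"
    and u: "\<And>n. u n \<in> gmod_hom L (free_mod mk S hg ig n) (obj Q (i n + 1))"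
    and v: "\<And>n. v n \<in> gmod_hom L (free_mod mk S hg ig n) (obj A (i n))"
    and U: "\<And>n x. x \<in> vec S hg n \<Longrightarrow>
      dif Q (i n + 1) (u n (mk x)) \<oplus>\<^bsub>obj Q (i n + 1 + 1)\<^esub> u (n + 1) (mk (lin_ext \<beta> x)) = \<zero>\<^bsub>obj Q (i n + 1 + 1)\<^esub>"
    and V: "\<And>n x. x \<in> vec S hg n \<Longrightarrow>
      dif A (i n) (v n (mk x)) = v (n + 1) (mk (lin_ext \<beta> x)) \<oplus>\<^bsub>obj A (i n + 1)\<^esub> t (i n + 1) (u n (mk x))"
  shows "\<exists>G H. (\<forall>n. G n \<in> gmod_hom L (free_mod mk S hg ig n) (obj Q (i n))) \<and>
    (\<forall>n. H n \<in> gmod_hom L (free_mod mk S hg ig n) (obj A (i n - 1))) \<and>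
    (\<forall>n. \<forall>x\<in>vec S hg n. dif Q (i n) (G n (mk x)) = u n (mk x) \<oplus>\<^bsub>obj Q (i n + 1)\<^esub> G (n + 1) (mk (lin_ext \<beta> x))) \<and>
    (\<forall>n. \<forall>x\<in>vec S hg n. dif A (i n - 1) (H n (mk x)) =
       t (i n) (G n (mk x)) \<ominus>\<^bsub>obj A (i n)\<^esub> (v n (mk x) \<oplus>\<^bsub>obj A (i n)\<^esub> H (n + 1) (mk (lin_ext \<beta> x))))"
proof -
  note gQ = cochain_complexD(1)[OF Q] and gA = cochain_complexD(1)[OF A]
  note dQ = cochain_complexD(3)[OF Q] and dA = cochain_complexD(4)[OF A]
  have tm: "t m \<in> gmod_hom L (obj Q m) (obj A m)" for m
    by (rule chain_mapD(1)[OF quasi_iso_chain_map[OF t]])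
  \<comment> \<open>\<open>Pr f b r\<close>: the pair \<open>r\<close> is a possible value of \<open>(G, H)\<close> at \<open>b\<close>, given the values \<open>f\<close> at the boundary of
    \<open>b\<close>; the restriction makes the dependence on these values visible to the recursion principle\<close>
  define Pr where "Pr = (\<lambda>(f :: 'b \<Rightarrow> 'u \<times> 'u) b (r :: 'u \<times> 'u). b \<in> S \<longrightarrow>
     fst r \<in> mdeg (obj Q (i (hg b))) (ig b) \<and> snd r \<in> mdeg (obj A (i (hg b) - 1)) (ig b) \<and>
     dif Q (i (hg b)) (fst r) = u (hg b) (mk (unit_vec b)) \<oplus>\<^bsub>obj Q (i (hg b) + 1)\<^esub>
        lin (obj Q (i (hg b) + 1)) (\<lambda>c. fst (restrict f (keys (\<beta> b)) c)) (\<beta> b) \<and>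
     dif A (i (hg b) - 1) (snd r) = t (i (hg b)) (fst r) \<ominus>\<^bsub>obj A (i (hg b))\<^esub>
        (v (hg b) (mk (unit_vec b)) \<oplus>\<^bsub>obj A (i (hg b))\<^esub>
           lin (obj A (i (hg b))) (\<lambda>c. snd (restrict f (keys (\<beta> b)) c)) (\<beta> b)))"
  have unrestrict: "lin (obj Q (i (hg b) + 1)) (\<lambda>c. fst (restrict f (keys (\<beta> b)) c)) (\<beta> b) =
      lin (obj Q (i (hg b) + 1)) (\<lambda>c. fst (f c)) (\<beta> b)"
    "lin (obj A (i (hg b))) (\<lambda>c. snd (restrict f (keys (\<beta> b)) c)) (\<beta> b) =
      lin (obj A (i (hg b))) (\<lambda>c. snd (f c)) (\<beta> b)"
    if b: "b \<in> S" and f: "\<And>c. c \<in> keys (\<beta> b) \<Longrightarrow> Pr f c (f c)" for b f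
  proof -
    have c: "c \<in> S" "i (hg c) = i (hg b) + 1" "i (hg c) - 1 = i (hg b)" if "c \<in> keys (\<beta> b)" for c
      using \<beta>[OF b] that i by (auto simp: hvec_def vec_def)
    have "fst (f c) \<in> carrier (obj Q (i (hg b) + 1))" "snd (f c) \<in> carrier (obj A (i (hg b)))"
      if "c \<in> keys (\<beta> b)" for c
      using f[OF that] c[OF that] mdeg_in_carrier[OF gQ] mdeg_in_carrier[OF gA] unfolding Pr_def by auto
    then show "lin (obj Q (i (hg b) + 1)) (\<lambda>c. fst (restrict f (keys (\<beta> b)) c)) (\<beta> b) =
      lin (obj Q (i (hg b) + 1)) (\<lambda>c. fst (f c)) (\<beta> b)"
      "lin (obj A (i (hg b))) (\<lambda>c. snd (restrict f (keys (\<beta> b)) c)) (\<beta> b) =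
      lin (obj A (i (hg b))) (\<lambda>c. snd (f c)) (\<beta> b)"
      by (intro lin_cong[OF gQ] lin_cong[OF gA]; simp)+
  qed
  have inv: "the_inv mk (mk x) = x" for x using inj by (simp add: the_inv_f_f)
  define Sol where "Sol = (\<lambda>(f :: 'b \<Rightarrow> 'u \<times> 'u) T n.
      (\<lambda>w. lin (obj Q (i n)) (\<lambda>c. fst (f c)) (the_inv mk w)) \<in> gmod_hom L (free_mod mk T hg ig n) (obj Q (i n)) \<and>
      (\<lambda>w. lin (obj A (i n - 1)) (\<lambda>c. snd (f c)) (the_inv mk w)) \<in> gmod_hom L (free_mod mk T hg ig n) (obj A (i n - 1)) \<and>
      (\<forall>x\<in>vec T hg n. dif Q (i n) (lin (obj Q (i n)) (\<lambda>c. fst (f c)) x) =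
        u n (mk x) \<oplus>\<^bsub>obj Q (i n + 1)\<^esub> lin (obj Q (i n + 1)) (\<lambda>c. fst (f c)) (lin_ext \<beta> x)) \<and>
      (\<forall>x\<in>vec T hg n. dif A (i n - 1) (lin (obj A (i n - 1)) (\<lambda>c. snd (f c)) x) =
         t (i n) (lin (obj Q (i n)) (\<lambda>c. fst (f c)) x) \<ominus>\<^bsub>obj A (i n)\<^esub>
         (v n (mk x) \<oplus>\<^bsub>obj A (i n)\<^esub> lin (obj A (i n)) (\<lambda>c. snd (f c)) (lin_ext \<beta> x))))"
  \<comment> \<open>if the values \<open>f\<close> satisfy the equations on the elements of a sub-basis \<open>T\<close> that contains its
    boundaries, then their linear extensions satisfy them on its span\<close>
  have eqs: "Sol f T n"
    if T: "T \<subseteq> S" "\<And>b c. b \<in> T \<Longrightarrow> c \<in> keys (\<beta> b) \<Longrightarrow> c \<in> T" and f: "\<And>b. b \<in> T \<Longrightarrow> Pr f b (f b)" for f T n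
  proof -
    have f0: "Pr f b (f b)" "b \<in> S" if "b \<in> T" for b using f T that by auto
    have f': "Pr f b (f b)" "b \<in> S"
        "dif Q (i (hg b)) (fst (f b)) = u (hg b) (mk (unit_vec b)) \<oplus>\<^bsub>obj Q (i (hg b) + 1)\<^esub>
        lin (obj Q (i (hg b) + 1)) (\<lambda>c. fst (f c)) (\<beta> b)"
        "dif A (i (hg b) - 1) (snd (f b)) = t (i (hg b)) (fst (f b)) \<ominus>\<^bsub>obj A (i (hg b))\<^esub>
        (v (hg b) (mk (unit_vec b)) \<oplus>\<^bsub>obj A (i (hg b))\<^esub> lin (obj A (i (hg b))) (\<lambda>c. snd (f c)) (\<beta> b))"
      if "b \<in> T" for b
      using f0[OF that] unrestrict[OF f0(2)[OF that] f0(1)[OF T(2)[OF that]]] unfolding Pr_def by auto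
    have \<beta>T: "\<beta> b \<in> hvec T hg ig (hg b + 1) (ig b)" if "b \<in> T" for b
      using \<beta>[of b] T that by (auto simp: hvec_def vec_def)
    have G: "(\<lambda>w. lin (obj Q (i n)) (\<lambda>c. fst (f c)) (the_inv mk w)) \<in> gmod_hom L (free_mod mk T hg ig n) (obj Q (i n))" for n
      by (rule lin_hom[OF gQ inj]) (use f' in \<open>auto simp: Pr_def\<close>)
    have H: "(\<lambda>w. lin (obj A (i n - 1)) (\<lambda>c. snd (f c)) (the_inv mk w)) \<in> gmod_hom L (free_mod mk T hg ig n) (obj A (i n - 1))" for n
      by (rule lin_hom[OF gA inj]) (use f' in \<open>auto simp: Pr_def\<close>)
    have B: "(\<lambda>w. mk (lin_ext \<beta> (the_inv mk w))) \<in> gmod_hom L (free_mod mk T hg ig n) (free_mod mk T hg ig (n + 1))"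
      by (rule glinear_imp_hom[OF inj inj lin_ext_glinear]) (use \<beta>T in auto)
    have XB: "(\<lambda>w. lin (obj Q (i n + 1)) (\<lambda>c. fst (f c)) (lin_ext \<beta> (the_inv mk w))) \<in> gmod_hom L (free_mod mk T hg ig n) (obj Q (i n + 1))"
      using gmod_hom_comp[OF B G] by (simp add: inv i)
    have YB: "(\<lambda>w. lin (obj A (i n)) (\<lambda>c. snd (f c)) (lin_ext \<beta> (the_inv mk w))) \<in> gmod_hom L (free_mod mk T hg ig n) (obj A (i n))"
      using gmod_hom_comp[OF B H] by (simp add: inv i)
    note uT = free_mod_subset_hom[OF inj T(1) u, of n] and vT = free_mod_subset_hom[OF inj T(1) v, of n]
    note gT = free_mod_graded[OF inj, of T hg ig n]
    have nr: "normal_vec (\<beta> b)" if "b \<in> T" for b using \<beta>T[OF that] by (simp add: hvec_def vec_def)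
    have l1: "lin (obj Q (i (hg b))) (\<lambda>c. fst (f c)) (unit_vec b) = fst (f b)" if "b \<in> T" for b
      using f'[OF that] mdeg_in_carrier[OF gQ] by (intro lin_unit_vec[OF gQ]) (auto simp: Pr_def)
    have l2: "lin (obj A (i (hg b) - 1)) (\<lambda>c. snd (f c)) (unit_vec b) = snd (f b)" if "b \<in> T" for b
      using f'[OF that] mdeg_in_carrier[OF gA] by (intro lin_unit_vec[OF gA]) (auto simp: Pr_def)
    have 1: "dif Q (i n) (lin (obj Q (i n)) (\<lambda>c. fst (f c)) x) =
        u n (mk x) \<oplus>\<^bsub>obj Q (i n + 1)\<^esub> lin (obj Q (i n + 1)) (\<lambda>c. fst (f c)) (lin_ext \<beta> x)" if x: "x \<in> vec T hg n" for x
    proof -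
      have "(\<lambda>w. dif Q (i n) (lin (obj Q (i n)) (\<lambda>c. fst (f c)) (the_inv mk w))) (mk x) =
        (\<lambda>w. u n w \<oplus>\<^bsub>obj Q (i n + 1)\<^esub> lin (obj Q (i n + 1)) (\<lambda>c. fst (f c)) (lin_ext \<beta> (the_inv mk w))) (mk x)"
      proof (rule hom_ext[OF gQ inj gmod_hom_comp[OF G dQ] gmod_hom_add[OF gT gQ uT XB]])
        show "mk x \<in> carrier (free_mod mk T hg ig n)" using x by (simp add: free_mod_simps)
        fix b assume b: "b \<in> T" "hg b = n"
        show "dif Q (i n) (lin (obj Q (i n)) (\<lambda>c. fst (f c)) (the_inv mk (mk (unit_vec b)))) =
          u n (mk (unit_vec b)) \<oplus>\<^bsub>obj Q (i n + 1)\<^esub> lin (obj Q (i n + 1)) (\<lambda>c. fst (f c)) (lin_ext \<beta> (the_inv mk (mk (unit_vec b))))"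
          using f'(3)[OF b(1)] b(2) l1[OF b(1)] nr[OF b(1)] by (simp add: inv lin_ext_unit_vec)
      qed
      then show ?thesis by (simp add: inv)
    qed
    have 2: "dif A (i n - 1) (lin (obj A (i n - 1)) (\<lambda>c. snd (f c)) x) =
         t (i n) (lin (obj Q (i n)) (\<lambda>c. fst (f c)) x) \<ominus>\<^bsub>obj A (i n)\<^esub>
         (v n (mk x) \<oplus>\<^bsub>obj A (i n)\<^esub> lin (obj A (i n)) (\<lambda>c. snd (f c)) (lin_ext \<beta> x))" if x: "x \<in> vec T hg n" for x
    proof -
      have "(\<lambda>w. dif A (i n - 1) (lin (obj A (i n - 1)) (\<lambda>c. snd (f c)) (the_inv mk w))) (mk x) =
         (\<lambda>w. t (i n) (lin (obj Q (i n)) (\<lambda>c. fst (f c)) (the_inv mk w)) \<ominus>\<^bsub>obj A (i n)\<^esub>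
         (v n w \<oplus>\<^bsub>obj A (i n)\<^esub> lin (obj A (i n)) (\<lambda>c. snd (f c)) (lin_ext \<beta> (the_inv mk w)))) (mk x)"
      proof (rule hom_ext[OF gA inj gmod_hom_comp[OF H dA]
            gmod_hom_diff[OF gT gA gmod_hom_comp[OF G tm] gmod_hom_add[OF gT gA vT YB]]])
        show "mk x \<in> carrier (free_mod mk T hg ig n)" using x by (simp add: free_mod_simps)
        fix b assume b: "b \<in> T" "hg b = n"
        show "dif A (i n - 1) (lin (obj A (i n - 1)) (\<lambda>c. snd (f c)) (the_inv mk (mk (unit_vec b)))) =
          t (i n) (lin (obj Q (i n)) (\<lambda>c. fst (f c)) (the_inv mk (mk (unit_vec b)))) \<ominus>\<^bsub>obj A (i n)\<^esub>
           (v n (mk (unit_vec b)) \<oplus>\<^bsub>obj A (i n)\<^esub>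
              lin (obj A (i n)) (\<lambda>c. snd (f c)) (lin_ext \<beta> (the_inv mk (mk (unit_vec b)))))"
          using f'(4)[OF b(1)] b(2) l1[OF b(1)] l2[OF b(1)] nr[OF b(1)] by (simp add: inv lin_ext_unit_vec)
      qed
      then show ?thesis by (simp add: inv)
    qed
    show ?thesis unfolding Sol_def using G H 1 2 by blast
  qed
  have "\<exists>f. \<forall>b. Pr f b (f b)"
  proof (rule dependent_wf_choice[where R = "measure rk"])
    fix f g :: "'b \<Rightarrow> 'u \<times> 'u" and b r assume *: "\<And>c. (c, b) \<in> measure rk \<Longrightarrow> f c = g c"
    show "Pr f b r = Pr g b r"
    proof (cases "b \<in> S")
      case True
      then have "f c = g c" if "c \<in> keys (\<beta> b)" for c using * rk that by simp
      then have "restrict f (keys (\<beta> b)) = restrict g (keys (\<beta> b))" by (rule restrict_ext)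
      then show ?thesis by (simp only: Pr_def)
    qed (simp add: Pr_def)
  next
    fix b and f :: "'b \<Rightarrow> 'u \<times> 'u" assume f: "\<And>c. (c, b) \<in> measure rk \<Longrightarrow> Pr f c (f c)"
    show "\<exists>r. Pr f b r"
    proof (cases "b \<in> S")
      case b: True
      define T where "T = {c \<in> S. rk c < rk b}"
      have cS: "c \<in> S" if "b \<in> S" "c \<in> keys (\<beta> b)" for b c using \<beta>[OF that(1)] that(2) by (auto simp: hvec_def vec_def)
      have T: "T \<subseteq> S" "\<And>b c. b \<in> T \<Longrightarrow> c \<in> keys (\<beta> b) \<Longrightarrow> c \<in> T" "\<And>c. c \<in> T \<Longrightarrow> Pr f c (f c)"
        using rk cS f by (auto simp: T_def) (meson less_trans)
      define n where "n = hg b"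
      define z where "z = \<beta> b"
      have z: "z \<in> hvec T hg ig (n + 1) (ig b)"
        using \<beta>[OF b] rk[OF b] cS[OF b] by (auto simp: z_def hvec_def vec_def T_def n_def)
      have zS: "z \<in> vec S hg (n + 1)" using z T(1) by (auto simp: hvec_def vec_def)
      have bz: "lin_ext \<beta> z = 0" using \<beta>2[OF b] by (simp add: z_def)
      have be: "lin_ext \<beta> (unit_vec b) = z" using z by (simp add: z_def lin_ext_unit_vec hvec_def vec_def)
      have e: "unit_vec b \<in> hvec S hg ig n (ig b)" using unit_vec_hvec[OF b] by (simp add: n_def)
      have "Sol f T (n + 1)" by (rule eqs[OF T])
      note E = this[unfolded Sol_def i add_diff_cancel_right']
      let ?G = "lin (obj Q (i n + 1)) (\<lambda>c. fst (f c))" and ?H = "lin (obj A (i n)) (\<lambda>c. snd (f c))"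
      have zm: "mk z \<in> mdeg (free_mod mk T hg ig (n + 1)) (ig b)" using z by (simp add: free_mod_simps)
      have Xz: "?G z \<in> mdeg (obj Q (i n + 1)) (ig b)"
        using gmod_homD(4)[OF conjunct1[OF E] zm] by (simp add: inv)
      have Yz: "?H z \<in> mdeg (obj A (i n)) (ig b)"
        using gmod_homD(4)[OF conjunct1[OF conjunct2[OF E]] zm] by (simp add: inv)
      have l0: "lin M w (0 :: 'b \<Rightarrow>\<^sub>0 'r) = \<zero>\<^bsub>M\<^esub>" if "graded_module L M" for M :: "('a, 'u) gmodule" and w
        by (simp add: lin_def abelian_monoid.finsum_empty[OF abelian_group.axioms(1)[OF graded_moduleD(2)[OF that]]])
      have em: "mk (unit_vec b) \<in> mdeg (free_mod mk S hg ig n) (ig b)" using e by (simp add: free_mod_simps)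
      have ue: "u n (mk (unit_vec b)) \<in> mdeg (obj Q (i n + 1)) (ig b)" by (rule gmod_homD(4)[OF u em])
      have ve: "v n (mk (unit_vec b)) \<in> mdeg (obj A (i n)) (ig b)" by (rule gmod_homD(4)[OF v em])
      have uz: "u (n + 1) (mk z) \<in> carrier (obj Q (i n + 1 + 1))"
        using gmod_homD(1)[OF u, of "mk z" "n + 1"] zS by (simp add: free_mod_simps i)
      have vz: "v (n + 1) (mk z) \<in> carrier (obj A (i n + 1))"
        using gmod_homD(1)[OF v, of "mk z" "n + 1"] zS by (simp add: free_mod_simps i)
      interpret Q1: abelian_group "obj Q (i n + 1)" by (rule cochain_complexD[OF Q])
      interpret Q2: abelian_group "obj Q (i n + 1 + 1)" by (rule cochain_complexD[OF Q])
      interpret A0: abelian_group "obj A (i n)" by (rule cochain_complexD[OF A])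
      interpret A1: abelian_group "obj A (i n + 1)" by (rule cochain_complexD[OF A])
      let ?a = "u n (mk (unit_vec b)) \<oplus>\<^bsub>obj Q (i n + 1)\<^esub> ?G z"
      let ?b = "v n (mk (unit_vec b)) \<oplus>\<^bsub>obj A (i n)\<^esub> ?H z"
      have dXz: "dif Q (i n + 1) (?G z) = u (n + 1) (mk z)"
        using bspec[OF conjunct1[OF conjunct2[OF conjunct2[OF E]]] hvec_vec[OF z]]
        by (simp only: bz l0[OF gQ] Q2.r_zero[OF uz])
      have "t (i n + 1) (?G z) \<in> carrier (obj A (i n + 1))"
        using gmod_homD(1)[OF tm mdeg_in_carrier[OF gQ Xz]] .
      then have dYz: "dif A (i n) (?H z) = t (i n + 1) (?G z) \<ominus>\<^bsub>obj A (i n + 1)\<^esub> v (n + 1) (mk z)"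
        using bspec[OF conjunct2[OF conjunct2[OF conjunct2[OF E]]] hvec_vec[OF z]] vz
        by (simp add: bz l0[OF gA])
      have 1: "dif Q (i n + 1) ?a = \<zero>\<^bsub>obj Q (i n + 1 + 1)\<^esub>"
        using U[OF hvec_vec[OF e]] gmod_homD(2)[OF dQ mdeg_in_carrier[OF gQ ue] mdeg_in_carrier[OF gQ Xz]]
        by (simp add: be dXz)
      have 2: "t (i n + 1) ?a = dif A (i n) ?b"
      proof -
        have c: "t (i n + 1) (u n (mk (unit_vec b))) \<in> carrier (obj A (i n + 1))"
          by (rule gmod_homD(1)[OF tm mdeg_in_carrier[OF gQ ue]])
        have c': "t (i n + 1) (?G z) \<in> carrier (obj A (i n + 1))"
          by (rule gmod_homD(1)[OF tm mdeg_in_carrier[OF gQ Xz]])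
        have "dif A (i n) ?b = (v (n + 1) (mk z) \<oplus>\<^bsub>obj A (i n + 1)\<^esub> t (i n + 1) (u n (mk (unit_vec b)))) \<oplus>\<^bsub>obj A (i n + 1)\<^esub>
            (t (i n + 1) (?G z) \<ominus>\<^bsub>obj A (i n + 1)\<^esub> v (n + 1) (mk z))"
          using V[OF hvec_vec[OF e]] gmod_homD(2)[OF cochain_complexD(3)[OF A] mdeg_in_carrier[OF gA ve] mdeg_in_carrier[OF gA Yz]]
          by (simp add: be dYz)
        also have "\<dots> = t (i n + 1) (u n (mk (unit_vec b))) \<oplus>\<^bsub>obj A (i n + 1)\<^esub> t (i n + 1) (?G z)"
        proof -
          have "(p \<oplus>\<^bsub>obj A (i n + 1)\<^esub> q) \<oplus>\<^bsub>obj A (i n + 1)\<^esub> (r \<ominus>\<^bsub>obj A (i n + 1)\<^esub> p) = q \<oplus>\<^bsub>obj A (i n + 1)\<^esub> r"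
            if "p \<in> carrier (obj A (i n + 1))" "q \<in> carrier (obj A (i n + 1))" "r \<in> carrier (obj A (i n + 1))" for p q r
          proof -
            have "(p \<oplus>\<^bsub>obj A (i n + 1)\<^esub> q) \<oplus>\<^bsub>obj A (i n + 1)\<^esub> (r \<ominus>\<^bsub>obj A (i n + 1)\<^esub> p) =
               (q \<oplus>\<^bsub>obj A (i n + 1)\<^esub> r) \<oplus>\<^bsub>obj A (i n + 1)\<^esub> (p \<oplus>\<^bsub>obj A (i n + 1)\<^esub> \<ominus>\<^bsub>obj A (i n + 1)\<^esub> p)"
              using that by (simp only: a_minus_def A1.a_ac A1.a_inv_closed A1.a_closed)
            then show ?thesis using that by (simp add: A1.r_neg)
          qed
          then show ?thesis using vz c c' by blast
        qed
        finally show ?thesis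
          using gmod_homD(2)[OF tm mdeg_in_carrier[OF gQ ue] mdeg_in_carrier[OF gQ Xz]] by simp
      qed
      from quasi_iso_solve[OF Q A t mdeg_add[OF gQ ue Xz] 1 mdeg_add[OF gA ve Yz] 2]
      obtain q w where "q \<in> mdeg (obj Q (i n)) (ig b)" "w \<in> mdeg (obj A (i n - 1)) (ig b)"
        "dif Q (i n) q = ?a" "dif A (i n - 1) w = t (i n) q \<ominus>\<^bsub>obj A (i n)\<^esub> ?b" by blast
      moreover have "\<And>c. c \<in> keys (\<beta> b) \<Longrightarrow> Pr f c (f c)" using f rk[OF b] by simp
      ultimately show ?thesis
        by (intro exI[of _ "(q, w)"]) (simp add: Pr_def n_def z_def unrestrict[OF b] del: restrict_apply)
    qed (simp add: Pr_def)
  qed simp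
  then obtain f where f: "\<And>b. Pr f b (f b)" by blast
  have cS: "c \<in> S" if "b \<in> S" "c \<in> keys (\<beta> b)" for b c using \<beta>[OF that(1)] that(2) by (auto simp: hvec_def vec_def)
  have "Sol f S n" for n
    by (rule eqs[OF subset_refl cS f])
  note E = this[unfolded Sol_def]
  show ?thesis
  proof (intro exI conjI allI)
    fix n
    let ?G = "\<lambda>n w. lin (obj Q (i n)) (\<lambda>c. fst (f c)) (the_inv mk w)"
    let ?H = "\<lambda>n w. lin (obj A (i n - 1)) (\<lambda>c. snd (f c)) (the_inv mk w)"
    show "?G n \<in> gmod_hom L (free_mod mk S hg ig n) (obj Q (i n))" using E[of n] by blast
    show "?H n \<in> gmod_hom L (free_mod mk S hg ig n) (obj A (i n - 1))" using E[of n] by blast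
    show "\<forall>x\<in>vec S hg n. dif Q (i n) (?G n (mk x)) = u n (mk x) \<oplus>\<^bsub>obj Q (i n + 1)\<^esub> ?G (n + 1) (mk (lin_ext \<beta> x))"
      using E[of n] by (simp add: inv i)
    show "\<forall>x\<in>vec S hg n. dif A (i n - 1) (?H n (mk x)) =
       t (i n) (?G n (mk x)) \<ominus>\<^bsub>obj A (i n)\<^esub> (v n (mk x) \<oplus>\<^bsub>obj A (i n)\<^esub> ?H (n + 1) (mk (lin_ext \<beta> x)))"
      using E[of n] by (simp add: inv i)
  qed
qed

end

context graded_coeff
begin

text \<open>Both halves are instances of the lifting of maps into cones. For injectivity, the signs \<open>(-1)\<^sup>n\<close> turn a
  homotopy from \<open>t g\<close> to \<open>t g'\<close> into a map to the cone.\<close>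

lemma semifree_kproj:
  assumes inj: "inj (mk :: ('b \<Rightarrow>\<^sub>0 'r) \<Rightarrow> 'u)"
    and \<beta>: "\<And>b. b \<in> S \<Longrightarrow> \<beta> b \<in> hvec S hg ig (hg b + 1) (ig b)"
    and \<beta>2: "\<And>b. b \<in> S \<Longrightarrow> lin_ext \<beta> (\<beta> b) = 0"
    and rk: "\<And>b c. b \<in> S \<Longrightarrow> c \<in> keys (\<beta> b) \<Longrightarrow> rk c < (rk b :: nat)"
  shows "kproj L (free_cpx mk S hg ig (lin_ext \<beta>))"
  unfolding kproj_def
proof (intro conjI allI impI ballI)
  let ?P = "free_cpx mk S hg ig (lin_ext \<beta>)"
  show P: "cochain_complex L ?P" by (rule free_cpx_complex[OF inj lin_ext_differential[OF \<beta> \<beta>2]])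
  have inv: "the_inv mk (mk x) = x" for x using inj by (simp add: the_inv_f_f)
  have dx: "lin_ext \<beta> x \<in> vec S hg (n + 1)" if "x \<in> vec S hg n" for x n
    using lin_ext_differential[OF \<beta> \<beta>2] that by (auto simp: is_differential_def glinear_def)
  have dmk: "dif ?P n (mk x) = mk (lin_ext \<beta> x)" for n x by (simp add: inv)
  fix Q A :: "('a, 'u) cpx" and t
  assume Q: "cochain_complex L Q" and A: "cochain_complex L A" and t: "t \<in> quasi_iso L Q A"
  note gQ = cochain_complexD(1)[OF Q] and gA = cochain_complexD(1)[OF A] and gP = free_mod_graded[OF inj]
  note tc = quasi_iso_chain_map[OF t]
  note tm = chain_mapD(1)[OF tc]
  { fix f assume f: "f \<in> chain_map L ?P A"
    have fm: "f n \<in> gmod_hom L (free_mod mk S hg ig n) (obj A n)" for n using chain_mapD(1)[OF f, of n] by simp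
    have fd: "dif A n (f n (mk x)) = f (n + 1) (mk (lin_ext \<beta> x))" if "x \<in> vec S hg n" for n x
      using chain_mapD(2)[OF f, of "mk x" n] that by (simp add: dmk free_mod_simps inv)
    have "\<exists>G H. (\<forall>n. G n \<in> gmod_hom L (free_mod mk S hg ig n) (obj Q n)) \<and>
      (\<forall>n. H n \<in> gmod_hom L (free_mod mk S hg ig n) (obj A (n - 1))) \<and>
      (\<forall>n. \<forall>x\<in>vec S hg n. dif Q n (G n (mk x)) = \<zero>\<^bsub>obj Q (n + 1)\<^esub> \<oplus>\<^bsub>obj Q (n + 1)\<^esub> G (n + 1) (mk (lin_ext \<beta> x))) \<and>
      (\<forall>n. \<forall>x\<in>vec S hg n. dif A (n - 1) (H n (mk x)) =
         t n (G n (mk x)) \<ominus>\<^bsub>obj A n\<^esub> (f n (mk x) \<oplus>\<^bsub>obj A n\<^esub> H (n + 1) (mk (lin_ext \<beta> x))))"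
    proof (rule cone_lift[OF inj \<beta> \<beta>2 rk Q A t])
      show "(\<lambda>x. \<zero>\<^bsub>obj Q (n + 1)\<^esub>) \<in> gmod_hom L (free_mod mk S hg ig n) (obj Q (n + 1))" for n
        by (rule gmod_hom_zero[OF gP gQ])
      fix n x assume x: "x \<in> vec S hg n"
      interpret Q2: abelian_group "obj Q (n + 1 + 1)" by (rule cochain_complexD[OF Q])
      interpret A1: abelian_group "obj A (n + 1)" by (rule cochain_complexD[OF A])
      show "dif Q (n + 1) \<zero>\<^bsub>obj Q (n + 1)\<^esub> \<oplus>\<^bsub>obj Q (n + 1 + 1)\<^esub> \<zero>\<^bsub>obj Q (n + 1 + 1)\<^esub> = \<zero>\<^bsub>obj Q (n + 1 + 1)\<^esub>"
        by (simp only: gmod_hom_zero_neg(1)[OF gQ gQ cochain_complexD(3)[OF Q]] Q2.r_zero[OF Q2.zero_closed])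
      have "f (n + 1) (mk (lin_ext \<beta> x)) \<in> carrier (obj A (n + 1))"
        using gmod_homD(1)[OF fm, of "mk (lin_ext \<beta> x)" "n + 1"] dx[OF x] by (simp add: free_mod_simps)
      then show "dif A n (f n (mk x)) = f (n + 1) (mk (lin_ext \<beta> x)) \<oplus>\<^bsub>obj A (n + 1)\<^esub> t (n + 1) \<zero>\<^bsub>obj Q (n + 1)\<^esub>"
        using fd[OF x] by (simp add: gmod_hom_zero_neg(1)[OF gQ gA tm])
    qed (use fm in simp_all)
    then obtain G H where G: "\<And>n. G n \<in> gmod_hom L (free_mod mk S hg ig n) (obj Q n)"
      and H: "\<And>n. H n \<in> gmod_hom L (free_mod mk S hg ig n) (obj A (n - 1))"
      and dG: "\<And>n x. x \<in> vec S hg n \<Longrightarrow> dif Q n (G n (mk x)) = \<zero>\<^bsub>obj Q (n + 1)\<^esub> \<oplus>\<^bsub>obj Q (n + 1)\<^esub> G (n + 1) (mk (lin_ext \<beta> x))"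
      and dH: "\<And>n x. x \<in> vec S hg n \<Longrightarrow> dif A (n - 1) (H n (mk x)) =
         t n (G n (mk x)) \<ominus>\<^bsub>obj A n\<^esub> (f n (mk x) \<oplus>\<^bsub>obj A n\<^esub> H (n + 1) (mk (lin_ext \<beta> x)))"
      by blast
    have "G \<in> chain_map L ?P Q" unfolding chain_map_def
    proof (intro CollectI conjI allI ballI)
      show "G n \<in> gmod_hom L (obj ?P n) (obj Q n)" for n using G by simp
      fix n u assume "u \<in> carrier (obj ?P n)"
      then obtain x where x: "x \<in> vec S hg n" "u = mk x" by (auto simp: free_mod_simps)
      interpret Q1: abelian_group "obj Q (n + 1)" by (rule cochain_complexD[OF Q])
      have "G (n + 1) (mk (lin_ext \<beta> x)) \<in> carrier (obj Q (n + 1))"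
        using gmod_homD(1)[OF G, of "mk (lin_ext \<beta> x)" "n + 1"] dx[OF x(1)] by (simp add: free_mod_simps)
      then show "G (n + 1) (dif ?P n u) = dif Q n (G n u)" using dG[OF x(1)] by (simp add: x dmk inv)
    qed
    moreover have "homotopic L ?P A (comp_map t G) f"
    proof (rule homotopicI)
      show "H n \<in> gmod_hom L (obj ?P n) (obj A (n - 1))" for n using H by simp
      fix n u assume "u \<in> carrier (obj ?P n)"
      then obtain x where x: "x \<in> vec S hg n" "u = mk x" by (auto simp: free_mod_simps)
      interpret A0: abelian_group "obj A n" by (rule cochain_complexD[OF A])
      have u: "mk x \<in> carrier (free_mod mk S hg ig n)" using x by (simp add: free_mod_simps)
      have c: "t n (G n (mk x)) \<in> carrier (obj A n)" by (rule gmod_homD(1)[OF tm gmod_homD(1)[OF G u]])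
      have c': "f n (mk x) \<in> carrier (obj A n)" by (rule gmod_homD(1)[OF fm u])
      have "H (n + 1) (mk (lin_ext \<beta> x)) \<in> carrier (obj A (n + 1 - 1))"
        using dx[OF x(1)] by (intro gmod_homD(1)[OF H]) (simp add: free_mod_simps)
      then have c'': "H (n + 1) (mk (lin_ext \<beta> x)) \<in> carrier (obj A n)" by simp
      have "t n (G n (mk x)) \<ominus>\<^bsub>obj A n\<^esub> f n (mk x) =
        (t n (G n (mk x)) \<ominus>\<^bsub>obj A n\<^esub> (f n (mk x) \<oplus>\<^bsub>obj A n\<^esub> H (n + 1) (mk (lin_ext \<beta> x)))) \<oplus>\<^bsub>obj A n\<^esub> H (n + 1) (mk (lin_ext \<beta> x))"
        using c c' c'' by (simp add: a_minus_def A0.minus_add A0.a_assoc A0.l_neg)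
      then show "comp_map t G n u \<ominus>\<^bsub>obj A n\<^esub> f n u = dif A (n - 1) (H n u) \<oplus>\<^bsub>obj A n\<^esub> H (n + 1) (dif ?P n u)"
        unfolding x dmk dH[OF x(1)] by (simp add: comp_map_def)
    qed
    ultimately show "\<exists>g\<in>chain_map L ?P Q. homotopic L ?P A (comp_map t g) f" by blast }
  { fix g g' assume g: "g \<in> chain_map L ?P Q" and g': "g' \<in> chain_map L ?P Q"
      and "homotopic L ?P A (comp_map t g) (comp_map t g')"
    then obtain k where k: "homotopy L ?P A k (comp_map t g) (comp_map t g')" by (auto simp: homotopic_iff)
    have gm: "g n \<in> gmod_hom L (free_mod mk S hg ig n) (obj Q n)" "g' n \<in> gmod_hom L (free_mod mk S hg ig n) (obj Q n)" for n
      using chain_mapD(1)[OF g, of n] chain_mapD(1)[OF g', of n] by simp_all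
    have km: "k n \<in> gmod_hom L (free_mod mk S hg ig n) (obj A (n - 1))"
      "k (n + 1) \<in> gmod_hom L (free_mod mk S hg ig (n + 1)) (obj A n)" for n
      using homotopyD(1,2)[OF k, of n] by simp_all
    have um: "(\<lambda>x. g n x \<ominus>\<^bsub>obj Q n\<^esub> g' n x) \<in> gmod_hom L (free_mod mk S hg ig n) (obj Q n)" for n
      by (rule gmod_hom_diff[OF gP gQ gm])
    have gd: "dif Q n (g n (mk x) \<ominus>\<^bsub>obj Q n\<^esub> g' n (mk x)) =
        g (n + 1) (mk (lin_ext \<beta> x)) \<ominus>\<^bsub>obj Q (n + 1)\<^esub> g' (n + 1) (mk (lin_ext \<beta> x))" if x: "x \<in> vec S hg n" for n x
    proof -
      have u: "mk x \<in> carrier (free_mod mk S hg ig n)" using x by (simp add: free_mod_simps)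
      show ?thesis
        using chain_mapD(2)[OF g, of "mk x" n] chain_mapD(2)[OF g', of "mk x" n] u
        unfolding gmod_hom_zero_neg(3)[OF gQ gQ cochain_complexD(3)[OF Q] gmod_homD(1)[OF gm(1) u] gmod_homD(1)[OF gm(2) u]] free_cpx_simps(1) dmk
        by simp
    qed
    have "\<exists>G H. (\<forall>n. G n \<in> gmod_hom L (free_mod mk S hg ig n) (obj Q (n - 1))) \<and>
      (\<forall>n. H n \<in> gmod_hom L (free_mod mk S hg ig n) (obj A (n - 1 - 1))) \<and>
      (\<forall>n. \<forall>x\<in>vec S hg n. dif Q (n - 1) (G n (mk x)) =
         sg (obj Q n) n (g n (mk x) \<ominus>\<^bsub>obj Q n\<^esub> g' n (mk x)) \<oplus>\<^bsub>obj Q (n - 1 + 1)\<^esub> G (n + 1) (mk (lin_ext \<beta> x))) \<and>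
      (\<forall>n. \<forall>x\<in>vec S hg n. dif A (n - 1 - 1) (H n (mk x)) =
         t (n - 1) (G n (mk x)) \<ominus>\<^bsub>obj A (n - 1)\<^esub> (sg (obj A (n - 1)) n (k n (mk x)) \<oplus>\<^bsub>obj A (n - 1)\<^esub> H (n + 1) (mk (lin_ext \<beta> x))))"
    proof (rule cone_lift[OF inj \<beta> \<beta>2 rk Q A t])
      show "(\<lambda>x. sg (obj Q n) n (g n x \<ominus>\<^bsub>obj Q n\<^esub> g' n x)) \<in> gmod_hom L (free_mod mk S hg ig n) (obj Q (n - 1 + 1))" for n
        using sg_gmod_hom[OF gP gQ um] by simp
      show "(\<lambda>x. sg (obj A (n - 1)) n (k n x)) \<in> gmod_hom L (free_mod mk S hg ig n) (obj A (n - 1))" for n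
        by (rule sg_gmod_hom[OF gP gA km(1)])
      fix n x assume x: "x \<in> vec S hg n"
      have i: "n - 1 + 1 = n" "n - 1 + 1 + 1 = n + 1" by simp_all
      have u: "mk x \<in> carrier (free_mod mk S hg ig n)" and du: "mk (lin_ext \<beta> x) \<in> carrier (free_mod mk S hg ig (n + 1))"
        using x dx[OF x] by (simp_all add: free_mod_simps)
      interpret Q0: abelian_group "obj Q n" by (rule cochain_complexD[OF Q])
      interpret Q1: abelian_group "obj Q (n + 1)" by (rule cochain_complexD[OF Q])
      interpret A0: abelian_group "obj A n" by (rule cochain_complexD[OF A])
      have c: "g (n + 1) (mk (lin_ext \<beta> x)) \<ominus>\<^bsub>obj Q (n + 1)\<^esub> g' (n + 1) (mk (lin_ext \<beta> x)) \<in> carrier (obj Q (n + 1))"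
        by (rule gmod_homD(1)[OF um du])
      have "dif Q n (sg (obj Q n) n (g n (mk x) \<ominus>\<^bsub>obj Q n\<^esub> g' n (mk x))) =
          sg (obj Q (n + 1)) n (g (n + 1) (mk (lin_ext \<beta> x)) \<ominus>\<^bsub>obj Q (n + 1)\<^esub> g' (n + 1) (mk (lin_ext \<beta> x)))"
        by (simp only: gmod_hom_sg[OF gQ gQ cochain_complexD(3)[OF Q] gmod_homD(1)[OF um u]] gd[OF x])
      then show "dif Q (n - 1 + 1) (sg (obj Q n) n (g n (mk x) \<ominus>\<^bsub>obj Q n\<^esub> g' n (mk x))) \<oplus>\<^bsub>obj Q (n - 1 + 1 + 1)\<^esub>
        sg (obj Q (n + 1)) (n + 1) (g (n + 1) (mk (lin_ext \<beta> x)) \<ominus>\<^bsub>obj Q (n + 1)\<^esub> g' (n + 1) (mk (lin_ext \<beta> x))) =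
        \<zero>\<^bsub>obj Q (n - 1 + 1 + 1)\<^esub>"
        unfolding i using c by (cases "even n") (simp_all add: sg_def Q1.r_neg Q1.l_neg del: Q1.minus_closed)
      define a where "a = t n (g n (mk x)) \<ominus>\<^bsub>obj A n\<^esub> t n (g' n (mk x))"
      define b where "b = dif A (n - 1) (k n (mk x))"
      define c where "c = k (n + 1) (mk (lin_ext \<beta> x))"
      have b: "b \<in> carrier (obj A n)" unfolding b_def
        by (rule gmod_homD(1)[OF cochain_complexD(4)[OF A] gmod_homD(1)[OF km(1) u]])
      have c: "c \<in> carrier (obj A n)" unfolding c_def by (rule gmod_homD(1)[OF km(2) du])
      have abc: "a = b \<oplus>\<^bsub>obj A n\<^esub> c"
        using homotopyD(3)[OF k, of "mk x" n] u unfolding free_cpx_simps(1) dmk a_def b_def c_def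
        by (simp add: comp_map_def)
      have ta: "t n (g n (mk x) \<ominus>\<^bsub>obj Q n\<^esub> g' n (mk x)) = a"
        unfolding a_def by (rule gmod_hom_zero_neg(3)[OF gQ gA tm gmod_homD(1)[OF gm(1) u] gmod_homD(1)[OF gm(2) u]])
      have "sg (obj A n) n b = sg (obj A n) (n + 1) c \<oplus>\<^bsub>obj A n\<^esub> sg (obj A n) n (b \<oplus>\<^bsub>obj A n\<^esub> c)"
      proof -
        have "b = \<ominus>\<^bsub>obj A n\<^esub> c \<oplus>\<^bsub>obj A n\<^esub> (b \<oplus>\<^bsub>obj A n\<^esub> c)"
          using b c by (metis A0.a_comm A0.a_closed A0.r_neg1)
        moreover have "\<ominus>\<^bsub>obj A n\<^esub> b = c \<oplus>\<^bsub>obj A n\<^esub> \<ominus>\<^bsub>obj A n\<^esub> (b \<oplus>\<^bsub>obj A n\<^esub> c)"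
        proof -
          have "\<ominus>\<^bsub>obj A n\<^esub> (b \<oplus>\<^bsub>obj A n\<^esub> c) = \<ominus>\<^bsub>obj A n\<^esub> c \<oplus>\<^bsub>obj A n\<^esub> \<ominus>\<^bsub>obj A n\<^esub> b"
            using b c A0.a_comm[of b c] A0.minus_add[of c b] by simp
          then show ?thesis using b c A0.r_neg2[of c "\<ominus>\<^bsub>obj A n\<^esub> b"] by simp
        qed
        ultimately show ?thesis by (cases "even n") (simp_all add: sg_def)
      qed
      then have "dif A (n - 1) (sg (obj A (n - 1)) n (k n (mk x))) =
          sg (obj A n) (n + 1) c \<oplus>\<^bsub>obj A n\<^esub> t n (sg (obj Q n) n (g n (mk x) \<ominus>\<^bsub>obj Q n\<^esub> g' n (mk x)))"
        by (simp only: gmod_hom_sg[OF gA gA cochain_complexD(4)[OF A] gmod_homD(1)[OF km(1) u]] b_def[symmetric]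
            gmod_hom_sg[OF gQ gA tm gmod_homD(1)[OF um u]] ta abc)
      then show "dif A (n - 1) (sg (obj A (n - 1)) n (k n (mk x))) =
        sg (obj A (n + 1 - 1)) (n + 1) (k (n + 1) (mk (lin_ext \<beta> x))) \<oplus>\<^bsub>obj A (n - 1 + 1)\<^esub>
        t (n - 1 + 1) (sg (obj Q n) n (g n (mk x) \<ominus>\<^bsub>obj Q n\<^esub> g' n (mk x)))"
        unfolding i add_diff_cancel_right' c_def .
    qed simp_all
    then obtain G where G: "\<And>n. G n \<in> gmod_hom L (free_mod mk S hg ig n) (obj Q (n - 1))"
      and "\<And>n x. x \<in> vec S hg n \<Longrightarrow> dif Q (n - 1) (G n (mk x)) =
         sg (obj Q n) n (g n (mk x) \<ominus>\<^bsub>obj Q n\<^esub> g' n (mk x)) \<oplus>\<^bsub>obj Q (n - 1 + 1)\<^esub> G (n + 1) (mk (lin_ext \<beta> x))"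
      by blast
    note dG = this(2)[unfolded diff_add_cancel]
    show "homotopic L ?P Q g g'"
    proof (rule homotopicI)
      show "(\<lambda>x. sg (obj Q (n - 1)) n (G n x)) \<in> gmod_hom L (obj ?P n) (obj Q (n - 1))" for n
        unfolding free_cpx_simps(1) by (rule sg_gmod_hom[OF gP gQ G])
      fix n w assume "w \<in> carrier (obj ?P n)"
      then obtain x where x: "x \<in> vec S hg n" "w = mk x" by (auto simp: free_mod_simps)
      have u: "mk x \<in> carrier (free_mod mk S hg ig n)" and du: "mk (lin_ext \<beta> x) \<in> carrier (free_mod mk S hg ig (n + 1))"
        using x dx[OF x(1)] by (simp_all add: free_mod_simps)
      interpret Q0: abelian_group "obj Q n" by (rule cochain_complexD[OF Q])
      define a where "a = g n (mk x) \<ominus>\<^bsub>obj Q n\<^esub> g' n (mk x)"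
      define c where "c = G (n + 1) (mk (lin_ext \<beta> x))"
      have a: "a \<in> carrier (obj Q n)" unfolding a_def by (rule gmod_homD(1)[OF um u])
      have c: "c \<in> carrier (obj Q n)" using gmod_homD(1)[OF G du] by (simp add: c_def)
      have "dif Q (n - 1) (sg (obj Q (n - 1)) n (G n (mk x))) = sg (obj Q n) n (sg (obj Q n) n a \<oplus>\<^bsub>obj Q n\<^esub> c)"
        by (simp only: gmod_hom_sg[OF gQ gQ cochain_complexD(4)[OF Q] gmod_homD(1)[OF G u]] dG[OF x(1)] a_def c_def)
      moreover have "a = sg (obj Q n) n (sg (obj Q n) n a \<oplus>\<^bsub>obj Q n\<^esub> c) \<oplus>\<^bsub>obj Q n\<^esub> sg (obj Q n) (n + 1) c"
        using a c by (cases "even n") (simp_all add: sg_def Q0.minus_add Q0.a_assoc Q0.r_neg Q0.l_neg)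
      ultimately show "g n w \<ominus>\<^bsub>obj Q n\<^esub> g' n w = dif Q (n - 1) (sg (obj Q (n - 1)) n (G n w)) \<oplus>\<^bsub>obj Q n\<^esub>
          sg (obj Q (n + 1 - 1)) (n + 1) (G (n + 1) (dif ?P n w))"
        unfolding x dmk add_diff_cancel_right' a_def[symmetric] c_def[symmetric] by simp
    qed }
qed

end

section \<open>Cell resolutions\<close>

text \<open>A homogeneous chain map is a quasi-isomorphism as soon as the two conditions hold for homogeneous
  elements, because the homogeneous components of cocycles are cocycles.\<close>

lemma quasi_iso_homogeneousI:
  assumes A: "cochain_complex L A" and B: "cochain_complex L B" and f: "f \<in> chain_map L A B"
    and 1: "\<And>n d z w. z \<in> cocycles A n \<Longrightarrow> z \<in> mdeg (obj A n) d \<Longrightarrow> w \<in> mdeg (obj B (n - 1)) d \<Longrightarrow>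
      f n z = dif B (n - 1) w \<Longrightarrow> z \<in> coboundaries A n"
    and 2: "\<And>n d y. y \<in> cocycles B n \<Longrightarrow> y \<in> mdeg (obj B n) d \<Longrightarrow> \<exists>z\<in>cocycles A n. y = f n z"
  shows "f \<in> quasi_iso L A B"
  unfolding quasi_iso_iff[OF A B]
proof (intro conjI allI ballI impI f)
  note gA = cochain_complexD(1)[OF A] and gB = cochain_complexD(1)[OF B]
  have coc: "cpt (obj C n) d z \<in> cocycles C n" if C: "cochain_complex L C" and z: "z \<in> cocycles C n" for C :: "('a, 'b) cpx" and n d z
  proof -
    note gC = cochain_complexD(1)[OF C]
    have z': "z \<in> carrier (obj C n)" "dif C n z = \<zero>\<^bsub>obj C (n + 1)\<^esub>" using z by (auto simp: cocycles_def)
    show ?thesis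
      using cpt_hom[OF gC gC cochain_complexD(3)[OF C] z'(1), of d] mdeg_in_carrier[OF gC cpt_decomposition(1)[OF gC z'(1)], of d]
        cpt_homogeneous[OF gC mdeg_zero[OF gC, of "n + 1" d], of d]
      by (simp add: cocycles_def z'(2))
  qed
  fix n
  interpret Bn: abelian_group "obj B n" by (rule cochain_complexD[OF B])
  interpret An: abelian_group "obj A n" by (rule cochain_complexD[OF A])
  note sA = cocycles_subgroup[OF A, of n] and fm = chain_mapD(1)[OF f]
  { fix z assume z: "z \<in> cocycles A n" and "f n z \<in> coboundaries B n"
    then obtain w where w: "w \<in> carrier (obj B (n - 1))" "f n z = dif B (n - 1) w" by (auto simp: coboundaries_def)
    have zc: "z \<in> carrier (obj A n)" using z by (simp add: cocycles_def)
    show "z \<in> coboundaries A n"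
    proof (rule graded_induct[OF gA zc, where Q = "\<lambda>z. z \<in> coboundaries A n"])
      show "\<zero>\<^bsub>obj A n\<^esub> \<in> coboundaries A n" using subgroup.one_closed[OF sA(3)] by simp
      show "y \<oplus>\<^bsub>obj A n\<^esub> z \<in> coboundaries A n" if "y \<in> coboundaries A n" "z \<in> coboundaries A n" for y z
        using subgroup.m_closed[OF sA(3) that] by simp
      fix d
      have "f n (cpt (obj A n) d z) = dif B (n - 1) (cpt (obj B (n - 1)) d w)"
        using cpt_hom[OF gA gB fm zc, of d] cpt_hom[OF gB gB cochain_complexD(4)[OF B] w(1), of d] w(2) by simp
      then show "cpt (obj A n) d z \<in> coboundaries A n"
        by (rule 1[OF coc[OF A z] cpt_decomposition(1)[OF gA zc] cpt_decomposition(1)[OF gB w(1)]])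
    qed }
  { fix y assume y: "y \<in> cocycles B n"
    have yc: "y \<in> carrier (obj B n)" using y by (simp add: cocycles_def)
    have "\<exists>z\<in>cocycles A n. y = f n z"
    proof (rule graded_induct[OF gB yc, where Q = "\<lambda>y. \<exists>z\<in>cocycles A n. y = f n z"])
      show "\<exists>z\<in>cocycles A n. \<zero>\<^bsub>obj B n\<^esub> = f n z"
        by (rule bexI[of _ "\<zero>\<^bsub>obj A n\<^esub>"])
          (use subgroup.one_closed[OF sA(1)] gmod_hom_zero_neg(1)[OF gA gB fm] in simp_all)
      fix x y assume "\<exists>z\<in>cocycles A n. x = f n z" "\<exists>z\<in>cocycles A n. y = f n z"
      then obtain z z' where z: "z \<in> cocycles A n" "x = f n z" "z' \<in> cocycles A n" "y = f n z'" by blast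
      then have "z \<oplus>\<^bsub>obj A n\<^esub> z' \<in> cocycles A n" using subgroup.m_closed[OF sA(1)] by simp
      moreover have "x \<oplus>\<^bsub>obj B n\<^esub> y = f n (z \<oplus>\<^bsub>obj A n\<^esub> z')"
        using z gmod_homD(2)[OF fm] by (simp add: cocycles_def)
      ultimately show "\<exists>z\<in>cocycles A n. x \<oplus>\<^bsub>obj B n\<^esub> y = f n z" by blast
    next
      fix d show "\<exists>z\<in>cocycles A n. cpt (obj B n) d y = f n z"
        by (rule 2[OF coc[OF B y] cpt_decomposition(1)[OF gB yc]])
    qed
    then obtain z where z: "z \<in> cocycles A n" "y = f n z" by blast
    let ?w = "\<zero>\<^bsub>obj B (n - 1)\<^esub>"
    have "?w \<in> carrier (obj B (n - 1))" by (rule mdeg_in_carrier[OF gB mdeg_zero[OF gB, of _ 0]])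
    moreover have "y = dif B (n - 1) ?w \<oplus>\<^bsub>obj B n\<^esub> f n z"
      using yc z(2) gmod_hom_zero_neg(1)[OF gB gB cochain_complexD(4)[OF B]] by simp
    ultimately show "\<exists>z\<in>cocycles A n. \<exists>w\<in>carrier (obj B (n - 1)). y = dif B (n - 1) w \<oplus>\<^bsub>obj B n\<^esub> f n z"
      using z(1) by blast }
qed

text \<open>A cell \<open>Cell n d y zs\<close> is a generator in bidegree \<open>(n, d)\<close> that is sent to \<open>y\<close> and whose boundary
  is the combination of earlier cells that is listed in \<open>zs\<close>. All cells that make sense are attached at
  once.\<close>

datatype ('r, 'u) cell = Cell (chg: int) (cig: int) (cval: 'u) (crel: "('r \<times> ('r, 'u) cell) list")

lemma cell_size: "(q, c') \<in> set (crel c) \<Longrightarrow> size c' < size c"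
proof (cases c)
  case (Cell n d y zs)
  assume "(q, c') \<in> set (crel c)"
  then have "(q, c') \<in> set zs" using Cell by simp
  then have "size c' \<le> size_list (size_prod (\<lambda>_. 0) size) zs"
    by (rule size_list_estimation') simp
  then show ?thesis by (simp add: Cell)
qed

context graded_coeff
begin

definition cbd :: "('r, 'u) cell \<Rightarrow> ('r, 'u) cell \<Rightarrow>\<^sub>0 'r" where
  "cbd c = (\<Sum>(q, c')\<leftarrow>crel c. Poly_Mapping.single c' (nf q))"

inductive valid :: "('a, 'u) cpx \<Rightarrow> ('r, 'u) cell \<Rightarrow> bool" for F where
  validI: "(\<forall>qc\<in>set zs. valid F (snd qc)) \<Longrightarrow> cbd (Cell n d y zs) \<in> hvec UNIV chg cig (n + 1) d \<Longrightarrow>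
    lin_ext cbd (cbd (Cell n d y zs)) = 0 \<Longrightarrow> y \<in> mdeg (obj F n) d \<Longrightarrow>
    dif F n y = lin (obj F (n + 1)) cval (cbd (Cell n d y zs)) \<Longrightarrow> valid F (Cell n d y zs)"

lemma keys_cbd: "keys (cbd c) \<subseteq> snd ` set (crel c)"
proof -
  have "keys (\<Sum>(q, c')\<leftarrow>zs. Poly_Mapping.single c' (nf q)) \<subseteq> snd ` set zs" for zs :: "('r \<times> ('r, 'u) cell) list"
  proof (induction zs)
    case (Cons z zs)
    obtain q c' where z: "z = (q, c')" by (cases z)
    have "keys (Poly_Mapping.single c' (nf q)) \<subseteq> {c'}" by simp
    then show ?case using Cons keys_add[of "Poly_Mapping.single c' (nf q)" "\<Sum>(q, c')\<leftarrow>zs. Poly_Mapping.single c' (nf q)"]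
      by (auto simp: z)
  qed simp
  then show ?thesis by (simp add: cbd_def)
qed

lemma keys_cbd_size: "c' \<in> keys (cbd c) \<Longrightarrow> size c' < size c"
  using keys_cbd[of c] cell_size by fastforce

lemma validD:
  assumes "valid F c"
  shows "cbd c \<in> hvec {c. valid F c} chg cig (chg c + 1) (cig c)" "lin_ext cbd (cbd c) = 0"
    "cval c \<in> mdeg (obj F (chg c)) (cig c)"
    "dif F (chg c) (cval c) = lin (obj F (chg c + 1)) cval (cbd c)"
proof -
  obtain zs n d y where validI: "c = Cell n d y zs" "\<forall>qc\<in>set zs. valid F (snd qc)"
    "cbd (Cell n d y zs) \<in> hvec UNIV chg cig (n + 1) d" "lin_ext cbd (cbd (Cell n d y zs)) = 0"
    "y \<in> mdeg (obj F n) d" "dif F n y = lin (obj F (n + 1)) cval (cbd (Cell n d y zs))"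
    using assms by (cases) blast
  have "keys (cbd c) \<subseteq> {c. valid F c}" using keys_cbd[of c] validI(1,2) by auto
  then show "cbd c \<in> hvec {c. valid F c} chg cig (chg c + 1) (cig c)"
    using validI by (auto simp: hvec_def vec_def)
  show "lin_ext cbd (cbd c) = 0" "cval c \<in> mdeg (obj F (chg c)) (cig c)"
    "dif F (chg c) (cval c) = lin (obj F (chg c + 1)) cval (cbd c)"
    using validI by simp_all
qed

lemma cell_exists:
  assumes x: "x \<in> hvec {c. valid F c} chg cig (n + 1) d" and dx: "lin_ext cbd x = 0"
    and y: "y \<in> mdeg (obj F n) d" and dy: "dif F n y = lin (obj F (n + 1)) cval x"
  shows "\<exists>c. valid F c \<and> chg c = n \<and> cig c = d \<and> cval c = y \<and> cbd c = x"
proof -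
  obtain cs where cs: "set cs = keys x" "distinct cs" using finite_distinct_list[OF finite_keys[of x]] by blast
  let ?zs = "map (\<lambda>c. (lookup x c, c)) cs"
  let ?c = "Cell n d y ?zs"
  have "cbd ?c = (\<Sum>c\<leftarrow>cs. Poly_Mapping.single c (nf (lookup x c)))"
    by (simp add: cbd_def o_def)
  also have "\<dots> = (\<Sum>c\<in>keys x. Poly_Mapping.single c (nf (lookup x c)))"
    using cs by (simp add: sum_list_distinct_conv_sum_set)
  also have "\<dots> = x"
  proof (rule poly_mapping_eqI)
    fix b
    have "nf (lookup x c) = lookup x c" for c using x by (simp add: hvec_def vec_def normal_vec_def)
    then have "lookup (\<Sum>c\<in>keys x. Poly_Mapping.single c (nf (lookup x c))) b = (\<Sum>c\<in>keys x. if c = b then lookup x c else 0)"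
      by (simp add: lookup_sum lookup_single when_def)
    then show "lookup (\<Sum>c\<in>keys x. Poly_Mapping.single c (nf (lookup x c))) b = lookup x b"
      by (simp add: in_keys_iff)
  qed
  finally have cx: "cbd ?c = x" .
  have "valid F ?c"
  proof (rule valid.validI)
    show "\<forall>qc\<in>set ?zs. valid F (snd qc)" using x cs by (auto simp: hvec_def vec_def)
    show "cbd ?c \<in> hvec UNIV chg cig (n + 1) d" using x unfolding cx by (auto simp: hvec_def vec_def)
  qed (use cx dx y dy in simp_all)
  then show ?thesis using cx by (intro exI[of _ ?c]) simp
qed

definition resol :: "((('r, 'u) cell \<Rightarrow>\<^sub>0 'r) \<Rightarrow> 'u) \<Rightarrow> ('a, 'u) cpx \<Rightarrow> ('a, 'u) cpx" where
  "resol mk F = free_cpx mk {c. valid F c} chg cig (lin_ext cbd)"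

definition aug :: "((('r, 'u) cell \<Rightarrow>\<^sub>0 'r) \<Rightarrow> 'u) \<Rightarrow> ('a, 'u) cpx \<Rightarrow> 'u maps" where
  "aug mk F = (\<lambda>n u. lin (obj F n) cval (the_inv mk u))"

lemma resol_differential: "is_differential {c. valid F c} chg cig (lin_ext cbd)"
  by (rule lin_ext_differential) (use validD in auto)

text \<open>A cocycle of \<open>F\<close> is hit by the cell with zero boundary that was attached for it, and a cocycle of
  the resolution that becomes a boundary in \<open>F\<close> bounds the cell that was attached for it. One round of
  cells is enough for both, since a cell may have any cells of smaller size in its boundary.\<close>

theorem resol_resolution:
  assumes inj: "inj mk" and F: "cochain_complex L F"
  shows "resolution L F (resol mk F) (aug mk F)"
  unfolding resolution_def
proof (intro conjI F)
  let ?S = "{c. valid F c}"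
  show K: "kproj L (resol mk F)" unfolding resol_def
    by (rule semifree_kproj[OF inj, where rk = size]) (use validD keys_cbd_size in auto)
  note P = kproj_complex[OF K] and gF = cochain_complexD(1)[OF F]
  have inv: "the_inv mk (mk x) = x" for x using inj by (simp add: the_inv_f_f)
  have obj: "obj (resol mk F) n = free_mod mk ?S chg cig n" for n by (simp add: resol_def)
  have dmk: "dif (resol mk F) n (mk x) = mk (lin_ext cbd x)" for n x by (simp add: resol_def inv)
  have am: "aug mk F n \<in> gmod_hom L (free_mod mk ?S chg cig n) (obj F n)" for n
    unfolding aug_def by (rule lin_hom[OF gF inj]) (use validD(3) in auto)
  have B: "(\<lambda>w. mk (lin_ext cbd (the_inv mk w))) \<in> gmod_hom L (free_mod mk ?S chg cig n) (free_mod mk ?S chg cig (n + 1))" for n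
    by (rule glinear_imp_hom[OF inj inj]) (use resol_differential[of F] in \<open>simp add: is_differential_def\<close>)
  have chain: "aug mk F \<in> chain_map L (resol mk F) F"
    unfolding chain_map_def
  proof (intro CollectI conjI allI ballI)
    show "aug mk F n \<in> gmod_hom L (obj (resol mk F) n) (obj F n)" for n unfolding obj by (rule am)
    fix n u assume u: "u \<in> carrier (obj (resol mk F) n)"
    have "(\<lambda>w. aug mk F (n + 1) (mk (lin_ext cbd (the_inv mk w)))) u = (\<lambda>w. dif F n (aug mk F n w)) u"
    proof (rule hom_ext[OF gF inj gmod_hom_comp[OF B am] gmod_hom_comp[OF am cochain_complexD(3)[OF F]]])
      show "u \<in> carrier (free_mod mk ?S chg cig n)" using u by (simp add: obj)
      fix c assume c: "c \<in> ?S" "chg c = n"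
      have "normal_vec (cbd c)" using validD(1)[of F c] c by (simp add: hvec_def vec_def)
      then show "aug mk F (n + 1) (mk (lin_ext cbd (the_inv mk (mk (unit_vec c))))) = dif F n (aug mk F n (mk (unit_vec c)))"
        using c validD(4)[of F c] lin_unit_vec[where v = cval and b = c, OF gF mdeg_in_carrier[OF gF validD(3)[of F c]]]
        by (simp add: aug_def inv lin_ext_unit_vec)
    qed
    then show "aug mk F (n + 1) (dif (resol mk F) n u) = dif F n (aug mk F n u)" by (simp add: resol_def)
  qed
  show "aug mk F \<in> quasi_iso L (resol mk F) F"
  proof (rule quasi_iso_homogeneousI[OF P F chain])
    fix n d z w assume z: "z \<in> cocycles (resol mk F) n" and zd: "z \<in> mdeg (obj (resol mk F) n) d"
      and w: "w \<in> mdeg (obj F (n - 1)) d" and e: "aug mk F n z = dif F (n - 1) w"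
    obtain x where x: "x \<in> hvec ?S chg cig n d" "z = mk x" using zd by (auto simp: obj free_mod_simps)
    have "mk (lin_ext cbd x) = mk 0" using z unfolding cocycles_def x(2) by (simp add: dmk obj free_mod_simps)
    then have dx: "lin_ext cbd x = 0" using inj by (simp add: inj_eq)
    have "\<exists>c. valid F c \<and> chg c = n - 1 \<and> cig c = d \<and> cval c = w \<and> cbd c = x"
      by (rule cell_exists) (use x dx w e in \<open>simp_all add: aug_def inv\<close>)
    then obtain c where c: "valid F c" "chg c = n - 1" "cbd c = x" by blast
    have "normal_vec (cbd c)" using x by (simp add: c hvec_def vec_def)
    then have "z = dif (resol mk F) (n - 1) (mk (unit_vec c))" unfolding dmk by (simp add: lin_ext_unit_vec c x)
    moreover have "mk (unit_vec c) \<in> carrier (obj (resol mk F) (n - 1))"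
      unfolding obj using unit_vec_vec[of c ?S chg "n - 1"] c by (simp add: free_mod_simps)
    ultimately show "z \<in> coboundaries (resol mk F) n" by (auto simp: coboundaries_def)
  next
    fix n d y assume y: "y \<in> cocycles F n" and yd: "y \<in> mdeg (obj F n) d"
    have "\<exists>c. valid F c \<and> chg c = n \<and> cig c = d \<and> cval c = y \<and> cbd c = 0"
    proof (rule cell_exists)
      have "lin (obj F (n + 1)) cval (0 :: ('r, 'b) cell \<Rightarrow>\<^sub>0 'r) = \<zero>\<^bsub>obj F (n + 1)\<^esub>"
        by (simp add: lin_def abelian_monoid.finsum_empty[OF abelian_group.axioms(1)[OF cochain_complexD(2)[OF F]]])
      then show "dif F n y = lin (obj F (n + 1)) cval (0 :: ('r, 'b) cell \<Rightarrow>\<^sub>0 'r)"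
        using y by (simp add: cocycles_def)
    qed (use yd in simp_all)
    then obtain c where c: "valid F c" "chg c = n" "cval c = y" "cbd c = 0" by blast
    have v: "unit_vec c \<in> vec ?S chg n" using unit_vec_vec[of c ?S chg n] c by simp
    have "lin_ext cbd (unit_vec c) = 0" using lin_ext_unit_vec[of cbd c] c(4) by (simp add: normal_vec_def)
    then have "mk (unit_vec c) \<in> cocycles (resol mk F) n"
      unfolding cocycles_def using v dmk[of n "unit_vec c"] by (auto simp: obj free_mod_simps)
    moreover have "y = aug mk F n (mk (unit_vec c))"
      using lin_unit_vec[where v = cval and b = c, OF gF mdeg_in_carrier[OF gF validD(3)[OF c(1)]]] c by (simp add: aug_def inv)
    ultimately show "\<exists>z\<in>cocycles (resol mk F) n. y = aug mk F n z" by blast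
  qed
qed

end

section \<open>Smallness, restated for free complexes with a block decomposition\<close>

lemma dhom_group:
  assumes res: "resolution L F P p" and B: "cochain_complex L B"
  shows "group (dhom L F B)"
proof -
  interpret comm_monoid "dhom L F B" by (rule dhom_comm_monoid[OF res B])
  note P = resolutionD(3)[OF res]
  show ?thesis
  proof (rule group_l_invI)
    fix \<alpha> assume "\<alpha> \<in> carrier (dhom L F B)"
    then obtain f where f: "f \<in> chain_map L P B" "\<alpha> = cls L F P p B f" unfolding carrier_dhom[OF res B] by blast
    note nf = neg_map_chain_map[OF P B f(1)]
    have "heq L P B (add_map B (neg_map B f) f) (zero_map B)"
    proof (rule heq_pointwise[OF P B add_map_chain_map[OF P B nf f(1)] zero_map_chain_map[OF P B]])
      fix n x assume x: "x \<in> carrier (obj P n)"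
      interpret Bn: abelian_group "obj B n" by (rule cochain_complexD[OF B])
      show "add_map B (neg_map B f) f n x = zero_map B n x"
        using gmod_homD(1)[OF chain_mapD(1)[OF f(1)] x] by (simp add: add_map_def neg_map_def zero_map_def Bn.l_neg)
    qed
    then have "cls L F P p B (neg_map B f) \<otimes>\<^bsub>dhom L F B\<^esub> \<alpha> = \<one>\<^bsub>dhom L F B\<^esub>"
      unfolding f(2) mult_dhom[OF res B nf f(1)] one_dhom[OF res B]
      using cls_eq_iff[OF res B add_map_chain_map[OF P B nf f(1)] zero_map_chain_map[OF P B]] by blast
    then show "\<exists>\<beta>\<in>carrier (dhom L F B). \<beta> \<otimes>\<^bsub>dhom L F B\<^esub> \<alpha> = \<one>\<^bsub>dhom L F B\<^esub>"
      using nf unfolding carrier_dhom[OF res B] by blast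
  qed
qed

text \<open>Postcomposition with an honest chain map.\<close>

lemma dcomp_loc_cls:
  assumes res: "resolution L F P p" and resA: "resolution L A PA pA" and B: "cochain_complex L B"
    and k: "k \<in> chain_map L A B" and f: "f \<in> chain_map L P A"
  shows "dcomp L F A B (loc L A B k) (cls L F P p A f) = cls L F P p B (comp_map k f)"
proof -
  note P = resolutionD[OF res] and A = resolutionD[OF resA]
  obtain l where l: "l \<in> chain_map L P PA" "heq L P A (comp_map pA l) f"
    using kproj_lift[OF P(2) A(3) A(1) A(4) f] .
  have "dcomp L F A B (loc L A B k) (cls L F P p A f) = cls L F P p B (comp_map (comp_map k pA) l)"
    unfolding loc_cls[OF resA B k]
    by (rule dcomp_cls[OF res resA B f comp_map_chain_map[OF A(5) k] l])
  also have "\<dots> = cls L F P p B (comp_map k f)"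
    using heq_left[OF l(2) B k] heqD(3,4)[OF heq_left[OF l(2) B k]]
    by (simp add: cls_eq_iff[OF res B] comp_map_assoc)
  finally show ?thesis .
qed

context graded_coeff
begin

definition vres :: "'b set \<Rightarrow> ('b \<Rightarrow>\<^sub>0 'r) \<Rightarrow> 'b \<Rightarrow>\<^sub>0 'r" where
  "vres T x = Poly_Mapping.mapp (\<lambda>b q. if b \<in> T then q else 0) x"

lemma lookup_vres: "lookup (vres T x) b = (if b \<in> T then lookup x b else 0)"
  by (simp add: vres_def lookup_mapp when_def in_keys_iff)

lemma keys_vres: "keys (vres T x) = keys x \<inter> T"
  by (auto simp: in_keys_iff lookup_vres split: if_splits)

lemma vres_add: "vres T (x + y) = vres T x + vres T y"
  by (rule poly_mapping_eqI) (simp add: lookup_vres lookup_add)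

lemma vres_diff: "vres T (x - y) = vres T x - vres T y"
  by (rule poly_mapping_eqI) (simp add: lookup_vres lookup_minus)

lemma vres_sm: "vres T (sm p x) = sm p (vres T x)"
  by (rule poly_mapping_eqI) (simp add: lookup_vres lookup_sm)

lemma vres_0 [simp]: "vres T 0 = 0"
  by (rule poly_mapping_eqI) (simp add: lookup_vres)

lemma vres_vec: "x \<in> vec S hg n \<Longrightarrow> vres T x \<in> vec (S \<inter> T) hg n"
  by (auto simp: vec_def normal_vec_def lookup_vres keys_vres)

lemma vres_hvec: "x \<in> hvec S hg ig n d \<Longrightarrow> vres T x \<in> hvec (S \<inter> T) hg ig n d"
  by (auto simp: hvec_def vres_vec lookup_vres)

lemma vres_id: "keys x \<subseteq> T \<Longrightarrow> vres T x = x"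
  by (rule poly_mapping_eqI) (auto simp: lookup_vres in_keys_iff)

lemma vec_mono: "T \<subseteq> S \<Longrightarrow> vec T hg n \<subseteq> vec S hg n"
  and hvec_mono: "T \<subseteq> S \<Longrightarrow> hvec T hg ig n d \<subseteq> hvec S hg ig n d"
  by (auto simp: vec_def hvec_def)

text \<open>A partition of the basis that the differential respects is a direct sum decomposition. The blocks
  are subcomplexes with the same elements, so the inclusions are identity maps.\<close>

lemma block_direct_sum:
  fixes blk :: "'b \<Rightarrow> 'u" and mk :: "('b \<Rightarrow>\<^sub>0 'r) \<Rightarrow> 'u"
  assumes inj: "inj mk" and d: "is_differential S hg ig \<delta>"
    and db: "\<And>i. is_differential {b \<in> S. blk b = i} hg ig \<delta>"
  shows "is_direct_sum L UNIV (\<lambda>i. free_cpx mk {b \<in> S. blk b = i} hg ig \<delta>) (free_cpx mk S hg ig \<delta>) (\<lambda>i. id_map)"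
  unfolding is_direct_sum_def
proof (intro conjI ballI allI)
  let ?S = "\<lambda>i. {b \<in> S. blk b = i}"
  show "cochain_complex L (free_cpx mk (?S i) hg ig \<delta>)" for i by (rule free_cpx_complex[OF inj db])
  show "cochain_complex L (free_cpx mk S hg ig \<delta>)" by (rule free_cpx_complex[OF inj d])
  show "id_map \<in> chain_map L (free_cpx mk (?S i) hg ig \<delta>) (free_cpx mk S hg ig \<delta>)" for i
    using free_mod_subset_hom[OF inj _ gmod_hom_id, of "?S i" S] by (auto simp: chain_map_def id_map_def)
  fix n y assume "y \<in> carrier (obj (free_cpx mk S hg ig \<delta>) n)"
  then obtain v where v: "v \<in> vec S hg n" "y = mk v" by (auto simp: free_mod_simps)
  have mk0: "mk z = mk 0 \<longleftrightarrow> z = 0" for z using inj by (auto simp: inj_eq)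
  let ?x = "\<lambda>i. vres {b. blk b = i} v"
  have xv: "?x i \<in> vec (?S i) hg n" for i using vres_vec[OF v(1), of "{b. blk b = i}"] by (simp add: Int_def)
  have sv: "vec (?S i) hg n \<subseteq> vec S hg n" for i by (rule vec_mono) auto
  have fin: "finite {i. ?x i \<noteq> 0}"
  proof (rule finite_subset)
    show "{i. ?x i \<noteq> 0} \<subseteq> blk ` keys v"
      by (auto simp: poly_mapping_eq_iff fun_eq_iff lookup_vres in_keys_iff split: if_splits)
  qed simp
  have sum: "(\<Sum>i\<in>K. ?x i) = v" if "finite K" "{i. ?x i \<noteq> 0} \<subseteq> K" for K
  proof (rule poly_mapping_eqI)
    fix b
    have "lookup (\<Sum>i\<in>K. ?x i) b = (\<Sum>i\<in>K. if i = blk b then lookup v b else 0)"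
      by (auto simp: lookup_sum lookup_vres intro!: sum.cong)
    also have "\<dots> = lookup v b"
    proof (cases "blk b \<in> K")
      case False
      then have "?x (blk b) = 0" using that by auto
      then have "lookup (?x (blk b)) b = 0" by simp
      then have "lookup v b = 0" by (simp add: lookup_vres)
      then show ?thesis by (simp cong: if_cong)
    qed (simp add: that)
    finally show "lookup (\<Sum>i\<in>K. ?x i) b = lookup v b" .
  qed
  show "\<exists>!x. x \<in> (\<Pi>\<^sub>E i\<in>UNIV. carrier (obj (free_cpx mk (?S i) hg ig \<delta>) n)) \<and>
        finite {i \<in> UNIV. x i \<noteq> \<zero>\<^bsub>obj (free_cpx mk (?S i) hg ig \<delta>) n\<^esub>} \<and>
        y = finsum (obj (free_cpx mk S hg ig \<delta>) n) (\<lambda>i. id_map n (x i)) {i \<in> UNIV. x i \<noteq> \<zero>\<^bsub>obj (free_cpx mk (?S i) hg ig \<delta>) n\<^esub>}"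
  proof (rule ex1I[of _ "\<lambda>i. mk (?x i)"])
    have "finsum (free_mod mk S hg ig n) (\<lambda>i. mk (?x i)) {i. ?x i \<noteq> 0} = mk (\<Sum>i | ?x i \<noteq> 0. ?x i)"
      by (rule free_mod_finsum[OF inj]) (use xv sv in blast)
    then show "(\<lambda>i. mk (?x i)) \<in> (\<Pi>\<^sub>E i\<in>UNIV. carrier (obj (free_cpx mk (?S i) hg ig \<delta>) n)) \<and>
        finite {i \<in> UNIV. mk (?x i) \<noteq> \<zero>\<^bsub>obj (free_cpx mk (?S i) hg ig \<delta>) n\<^esub>} \<and>
        y = finsum (obj (free_cpx mk S hg ig \<delta>) n) (\<lambda>i. id_map n (mk (?x i))) {i \<in> UNIV. mk (?x i) \<noteq> \<zero>\<^bsub>obj (free_cpx mk (?S i) hg ig \<delta>) n\<^esub>}"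
      using xv fin sum[OF fin subset_refl] by (simp add: free_mod_simps mk0 id_map_def v(2) PiE_def Pi_def)
    fix x assume x: "x \<in> (\<Pi>\<^sub>E i\<in>UNIV. carrier (obj (free_cpx mk (?S i) hg ig \<delta>) n)) \<and>
        finite {i \<in> UNIV. x i \<noteq> \<zero>\<^bsub>obj (free_cpx mk (?S i) hg ig \<delta>) n\<^esub>} \<and>
        y = finsum (obj (free_cpx mk S hg ig \<delta>) n) (\<lambda>i. id_map n (x i)) {i \<in> UNIV. x i \<noteq> \<zero>\<^bsub>obj (free_cpx mk (?S i) hg ig \<delta>) n\<^esub>}"
    then have "\<forall>i. \<exists>w. w \<in> vec (?S i) hg n \<and> x i = mk w" by (auto simp: free_mod_simps PiE_def Pi_def)
    then obtain w where w: "\<And>i. w i \<in> vec (?S i) hg n" and xw: "\<And>i. x i = mk (w i)" by metis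
    have finw: "finite {i. w i \<noteq> 0}" using x by (simp add: xw free_mod_simps mk0)
    have "finsum (free_mod mk S hg ig n) (\<lambda>i. mk (w i)) {i. w i \<noteq> 0} = mk (\<Sum>i | w i \<noteq> 0. w i)"
      by (rule free_mod_finsum[OF inj]) (use w sv in blast)
    then have "mk v = mk (\<Sum>i | w i \<noteq> 0. w i)"
      using x by (simp add: xw free_mod_simps mk0 id_map_def v(2))
    then have vw: "v = (\<Sum>i | w i \<noteq> 0. w i)" using inj by (simp add: inj_eq)
    have "w i = ?x i" for i
    proof (rule poly_mapping_eqI)
      fix b
      have "lookup (w j) b = (if blk b = j then lookup (w j) b else 0)" for j
        using w[of j] by (auto simp: vec_def in_keys_iff)
      then have "lookup v b = (\<Sum>j | w j \<noteq> 0. if blk b = j then lookup (w j) b else 0)"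
        unfolding vw lookup_sum by (intro sum.cong) auto
      also have "\<dots> = lookup (w (blk b)) b" using finw by (simp add: sum.delta)
      finally show "lookup (w i) b = lookup (?x i) b"
        using \<open>lookup (w i) b = (if blk b = i then lookup (w i) b else 0)\<close> by (auto simp: lookup_vres)
    qed
    then show "x = (\<lambda>i. mk (?x i))" using xw by auto
  qed
qed

text \<open>A map from a small object into a direct sum lands, up to homotopy, in finitely many summands,
  because its class is a finite sum of classes of maps into single summands.\<close>

lemma small_finite_blocks:
  fixes blk :: "'b \<Rightarrow> 'u" and mk :: "('b \<Rightarrow>\<^sub>0 'r) \<Rightarrow> 'u" and mk0 :: "(('r, 'u) cell \<Rightarrow>\<^sub>0 'r) \<Rightarrow> 'u"
  assumes inj: "inj mk" and inj0: "inj mk0" and d: "is_differential S hg ig \<delta>"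
    and db: "\<And>i. is_differential {b \<in> S. blk b = i} hg ig \<delta>"
    and res: "resolution L F P p" and small: "small L F"
    and f: "f \<in> chain_map L P (free_cpx mk S hg ig \<delta>)"
  shows "\<exists>J f'. finite J \<and> heq L P (free_cpx mk S hg ig \<delta>) f f' \<and>
    (\<forall>n. \<forall>x\<in>carrier (obj P n). f' n x \<in> mk ` vec {b \<in> S. blk b \<in> J} hg n)"
proof -
  let ?S = "\<lambda>i. {b \<in> S. blk b = i}"
  let ?A = "\<lambda>i. free_cpx mk (?S i) hg ig \<delta>" and ?B = "free_cpx mk S hg ig \<delta>"
  note P = resolutionD(3)[OF res]
  have A: "cochain_complex L (?A i)" for i by (rule free_cpx_complex[OF inj db])
  have B: "cochain_complex L ?B" by (rule free_cpx_complex[OF inj d])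
  note ds = block_direct_sum[OF inj d db]
  have io: "id_map \<in> chain_map L (?A i) ?B" for i using ds by (simp add: is_direct_sum_def)
  have "sum_comparison L F UNIV ?A ?B (\<lambda>i. id_map) \<in> iso (sum_group UNIV (\<lambda>i. dhom L F (?A i))) (dhom L F ?B)"
    by (rule small[unfolded small_def, rule_format, OF ds])
  then have surj: "sum_comparison L F UNIV ?A ?B (\<lambda>i. id_map) ` carrier (sum_group UNIV (\<lambda>i. dhom L F (?A i))) =
      carrier (dhom L F ?B)"
    by (simp add: iso_def bij_betw_def)
  have "cls L F P p ?B f \<in> carrier (dhom L F ?B)"
    unfolding carrier_dhom[OF res B] using f by (rule imageI)
  then obtain \<alpha> where f\<alpha>: "cls L F P p ?B f = sum_comparison L F UNIV ?A ?B (\<lambda>i. id_map) \<alpha>"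
    and \<alpha>: "\<alpha> \<in> carrier (sum_group UNIV (\<lambda>i. dhom L F (?A i)))"
    unfolding surj[symmetric] by (rule imageE)
  have \<alpha>': "\<alpha> i \<in> carrier (dhom L F (?A i))" "finite {i \<in> UNIV. \<alpha> i \<noteq> \<one>\<^bsub>dhom L F (?A i)\<^esub>}" for i
    using \<alpha> carrier_sum_group[of UNIV "\<lambda>i. dhom L F (?A i)"] dhom_group[OF res A] by (auto simp: PiE_def Pi_def)
  have "\<forall>i. \<exists>a. a \<in> chain_map L P (?A i) \<and> \<alpha> i = cls L F P p (?A i) a"
    using \<alpha>'(1) unfolding carrier_dhom[OF res A] by blast
  then obtain a where "\<forall>i. a i \<in> chain_map L P (?A i) \<and> \<alpha> i = cls L F P p (?A i) (a i)"
    by (rule choice[THEN exE])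
  then have a: "\<And>i. a i \<in> chain_map L P (?A i)" and \<alpha>a: "\<And>i. \<alpha> i = cls L F P p (?A i) (a i)"
    by simp_all
  have aB: "a i \<in> chain_map L P ?B" for i using comp_map_chain_map[OF a io, of i] by simp
  have dc: "dcomp L F (?A i) ?B (loc L (?A i) ?B id_map) (\<alpha> i) = cls L F P p ?B (a i)" for i
    unfolding \<alpha>a using dcomp_loc_cls[OF res resol_resolution[OF inj0 A] B io a, of i] by simp
  define J where "J = {i \<in> UNIV. \<alpha> i \<noteq> \<one>\<^bsub>dhom L F (?A i)\<^esub>}"
  interpret H: comm_monoid "dhom L F ?B" by (rule dhom_comm_monoid[OF res B])
  have fin: "\<exists>f'\<in>chain_map L P ?B. finprod (dhom L F ?B) (\<lambda>i. cls L F P p ?B (a i)) K = cls L F P p ?B f' \<and>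
      (\<forall>n. \<forall>x\<in>carrier (obj P n). f' n x \<in> mk ` vec {b \<in> S. blk b \<in> K} hg n)" if "finite K" for K
    using that
  proof (induction K rule: finite_induct)
    case empty
    show ?case
      by (rule bexI[OF _ zero_map_chain_map[OF P B]])
        (auto simp: one_dhom[OF res B] zero_map_def free_mod_simps)
  next
    case (insert i K)
    then obtain f' where f': "f' \<in> chain_map L P ?B"
      "finprod (dhom L F ?B) (\<lambda>i. cls L F P p ?B (a i)) K = cls L F P p ?B f'"
      "\<And>n x. x \<in> carrier (obj P n) \<Longrightarrow> f' n x \<in> mk ` vec {b \<in> S. blk b \<in> K} hg n" by blast
    have "finprod (dhom L F ?B) (\<lambda>i. cls L F P p ?B (a i)) (insert i K) =
       cls L F P p ?B (a i) \<otimes>\<^bsub>dhom L F ?B\<^esub> cls L F P p ?B f'"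
      using insert.hyps aB unfolding f'(2)[symmetric]
      by (intro H.finprod_insert) (auto simp: carrier_dhom[OF res B])
    also have "\<dots> = cls L F P p ?B (add_map ?B (a i) f')" by (rule mult_dhom[OF res B aB f'(1)])
    finally have "finprod (dhom L F ?B) (\<lambda>i. cls L F P p ?B (a i)) (insert i K) = cls L F P p ?B (add_map ?B (a i) f')" .
    moreover have "add_map ?B (a i) f' n x \<in> mk ` vec {b \<in> S. blk b \<in> insert i K} hg n" if x: "x \<in> carrier (obj P n)" for n x
    proof -
      have "a i n x \<in> mk ` vec (?S i) hg n" using gmod_homD(1)[OF chain_mapD(1)[OF a] x] by (simp add: free_mod_simps)
      then obtain v w where v: "v \<in> vec (?S i) hg n" "a i n x = mk v" and w: "w \<in> vec {b \<in> S. blk b \<in> K} hg n" "f' n x = mk w"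
        using f'(3)[OF x] by blast
      have "v \<in> vec {b \<in> S. blk b \<in> insert i K} hg n" "w \<in> vec {b \<in> S. blk b \<in> insert i K} hg n"
        using v w by (auto simp: vec_def)
      from vec_add[OF this] show ?thesis by (auto simp: add_map_def v w free_mod_ops[OF inj])
    qed
    ultimately show ?case using add_map_chain_map[OF P B aB f'(1)] by blast
  qed
  have J: "finite J" using \<alpha>'(2) by (simp add: J_def)
  obtain f' where f': "f' \<in> chain_map L P ?B"
    "finprod (dhom L F ?B) (\<lambda>i. cls L F P p ?B (a i)) J = cls L F P p ?B f'"
    "\<forall>n. \<forall>x\<in>carrier (obj P n). f' n x \<in> mk ` vec {b \<in> S. blk b \<in> J} hg n"
    using fin[OF J] by blast
  have "cls L F P p ?B f = cls L F P p ?B f'"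
    unfolding f\<alpha> sum_comparison_def dc J_def[symmetric] by (rule f'(2))
  then have "heq L P ?B f f'" using cls_eq_iff[OF res B f f'(1)] by blast
  then show ?thesis using J f' by blast
qed

text \<open>The same in terms of vectors: outside finitely many blocks a chain map from the resolution of a
  small object is null-homotopic.\<close>

lemma small_null_homotopic_tail:
  fixes blk :: "'b \<Rightarrow> 'u" and mk :: "('b \<Rightarrow>\<^sub>0 'r) \<Rightarrow> 'u" and mk0 :: "(('r, 'u) cell \<Rightarrow>\<^sub>0 'r) \<Rightarrow> 'u"
    and mk1 :: "('c \<Rightarrow>\<^sub>0 'r) \<Rightarrow> 'u"
  assumes inj: "inj mk" and inj0: "inj mk0" and inj1: "inj mk1"
    and d: "is_differential S hg ig \<delta>"
    and db: "\<And>i. is_differential {b \<in> S. blk b = i} hg ig \<delta>"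
    and d1: "is_differential S1 hg1 ig1 \<delta>1"
    and res: "resolution L F (free_cpx mk1 S1 hg1 ig1 \<delta>1) p" and small: "small L F"
    and T: "\<And>n. glinear S1 hg1 ig1 n S hg ig n (T n)"
    and Td: "\<And>n x. x \<in> vec S1 hg1 n \<Longrightarrow> T (n + 1) (\<delta>1 x) = \<delta> (T n x)"
  shows "\<exists>J H. finite J \<and> (\<forall>n. glinear S1 hg1 ig1 n S hg ig (n - 1) (H n)) \<and>
    (\<forall>n. \<forall>x\<in>vec S1 hg1 n. \<forall>b. blk b \<notin> J \<longrightarrow>
       lookup (T n x) b = lookup (\<delta> (H n x) + H (n + 1) (\<delta>1 x)) b)"
proof -
  let ?P = "free_cpx mk1 S1 hg1 ig1 \<delta>1" and ?B = "free_cpx mk S hg ig \<delta>"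
  have inv: "the_inv mk (mk x) = x" for x using inj by (simp add: the_inv_f_f)
  have inv1: "the_inv mk1 (mk1 x) = x" for x using inj1 by (simp add: the_inv_f_f)
  define f where "f = (\<lambda>n u. mk (T n (the_inv mk1 u)))"
  have "f \<in> chain_map L ?P ?B" unfolding chain_map_def
  proof (intro CollectI conjI allI ballI)
    show "f n \<in> gmod_hom L (obj ?P n) (obj ?B n)" for n
      unfolding f_def free_cpx_simps(1) by (rule glinear_imp_hom[OF inj1 inj T])
    fix n u assume "u \<in> carrier (obj ?P n)"
    then obtain x where "x \<in> vec S1 hg1 n" "u = mk1 x" by (auto simp: free_mod_simps)
    then show "f (n + 1) (dif ?P n u) = dif ?B n (f n u)" by (simp add: f_def inv inv1 Td)
  qed
  from small_finite_blocks[OF inj inj0 d db res small this]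
  obtain J f' where J: "finite J" and h: "heq L ?P ?B f f'"
    and f': "\<And>n x. x \<in> carrier (obj ?P n) \<Longrightarrow> f' n x \<in> mk ` vec {b \<in> S. blk b \<in> J} hg n" by blast
  obtain h where h: "homotopy L ?P ?B h f f'" using heqD(5)[OF h] by (auto simp: homotopic_iff)
  define H where "H = (\<lambda>n x. the_inv mk (h n (mk1 x)))"
  have hm: "h n \<in> gmod_hom L (free_mod mk1 S1 hg1 ig1 n) (free_mod mk S hg ig (n - 1))" for n
    using homotopyD(1)[OF h, of n] by simp
  have gH: "glinear S1 hg1 ig1 n S hg ig (n - 1) (H n)" for n
    unfolding H_def by (rule hom_imp_glinear(1)[OF inj1 inj hm])
  have mkH: "mk (H n x) = h n (mk1 x)" if "x \<in> vec S1 hg1 n" for n x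
    unfolding H_def by (rule hom_imp_glinear(2)[OF inj1 inj hm that])
  have "lookup (T n x) b = lookup (\<delta> (H n x) + H (n + 1) (\<delta>1 x)) b"
    if x: "x \<in> vec S1 hg1 n" and b: "blk b \<notin> J" for n x b
  proof -
    have u: "mk1 x \<in> carrier (obj ?P n)" using x by (simp add: free_mod_simps)
    obtain y where y: "y \<in> vec {b \<in> S. blk b \<in> J} hg n" "f' n (mk1 x) = mk y" using f'[OF u] by blast
    have yS: "y \<in> vec S hg n" using y(1) vec_mono[of "{b \<in> S. blk b \<in> J}" S] by blast
    have dx: "\<delta>1 x \<in> vec S1 hg1 (n + 1)" using d1 x by (simp add: is_differential_def glinear_def)
    have Tx: "T n x \<in> vec S hg n" using T[of n] x by (simp add: glinear_def)
    have "mk (T n x - y) = f n (mk1 x) \<ominus>\<^bsub>obj ?B n\<^esub> f' n (mk1 x)"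
      unfolding y(2) by (simp add: f_def inv1 free_mod_minus(2)[OF inj yS Tx])
    also have "\<dots> = mk (\<delta> (H n x) + H (n + 1) (\<delta>1 x))"
      unfolding homotopyD(3)[OF h u] by (simp add: mkH[OF x, symmetric] mkH[OF dx, symmetric] inv inv1 free_mod_ops[OF inj])
    finally have "T n x - y = \<delta> (H n x) + H (n + 1) (\<delta>1 x)" using inj by (simp add: inj_eq)
    moreover have "lookup y b = 0" using y(1) b by (auto simp: vec_def in_keys_iff)
    ultimately show ?thesis by (metis lookup_minus diff_zero)
  qed
  then show ?thesis using J gH by blast
qed

end

section \<open>The identity of a small object is homotopic to a finite map\<close>

context graded_coeff
begin

lemma glinearD:
  assumes "glinear S hg ig n S' hg' ig' n' T"
  shows "x \<in> vec S hg n \<Longrightarrow> T x \<in> vec S' hg' n'"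
    "x \<in> vec S hg n \<Longrightarrow> y \<in> vec S hg n \<Longrightarrow> T (x + y) = T x + T y"
    "x \<in> vec S hg n \<Longrightarrow> T (sm p x) = sm p (T x)"
    "x \<in> hvec S hg ig n d \<Longrightarrow> T x \<in> hvec S' hg' ig' n' d"
  using assms by (auto simp: glinear_def)

lemma glinear_zero: "glinear S hg ig n S' hg' ig' n' T \<Longrightarrow> T 0 = 0"
  using glinearD(2)[of S hg ig n S' hg' ig' n' T 0 0] by simp

lemma glinear_add: "glinear S hg ig n S' hg' ig' n' T \<Longrightarrow> glinear S hg ig n S' hg' ig' n' U \<Longrightarrow>
    glinear S hg ig n S' hg' ig' n' (\<lambda>x. T x + U x)"
  by (auto simp: glinear_def vec_add hvec_add sm_add)

lemma glinear_diff: "glinear S hg ig n S' hg' ig' n' T \<Longrightarrow> glinear S hg ig n S' hg' ig' n' U \<Longrightarrow>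
    glinear S hg ig n S' hg' ig' n' (\<lambda>x. T x - U x)"
  by (auto simp: glinear_def vec_diff hvec_diff sm_minus)

lemma glinear_comp: "glinear S hg ig n S' hg' ig' n' T \<Longrightarrow> glinear S' hg' ig' n' S'' hg'' ig'' n'' U \<Longrightarrow>
    glinear S hg ig n S'' hg'' ig'' n'' (\<lambda>x. U (T x))"
  by (auto simp: glinear_def)

lemma glinear_const_0: "glinear S hg ig n S' hg' ig' n' (\<lambda>x. 0)"
  by (auto simp: glinear_def)

lemma glinear_id: "glinear S hg ig n S hg ig n (\<lambda>x. x)"
  by (auto simp: glinear_def)

lemma glinear_vres: "S \<inter> T \<subseteq> S' \<Longrightarrow> glinear S hg ig n S' hg ig n (vres T)"
  unfolding glinear_def
  by (auto intro: vres_add vres_sm subsetD[OF vec_mono vres_vec] subsetD[OF hvec_mono vres_hvec])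

lemma glinear_mono: "glinear S hg ig n S' hg' ig' n' T \<Longrightarrow> S' \<subseteq> S'' \<Longrightarrow> glinear S hg ig n S'' hg' ig' n' T"
  unfolding glinear_def by (auto intro: subsetD[OF vec_mono] subsetD[OF hvec_mono])

lemma vec_shift: "vec S (\<lambda>b. hg b - 1) n = vec S hg (n + 1)"
  and hvec_shift: "hvec S (\<lambda>b. hg b - 1) ig n d = hvec S hg ig (n + 1) d"
proof -
  have "hg b - 1 = n \<longleftrightarrow> hg b = n + 1" for b by auto
  then show "vec S (\<lambda>b. hg b - 1) n = vec S hg (n + 1)"
    and "hvec S (\<lambda>b. hg b - 1) ig n d = hvec S hg ig (n + 1) d" by (simp_all add: vec_def hvec_def)
qed

subsection \<open>Families of vectors\<close>

text \<open>A sequence of vectors that vanish at almost all indices is a vector over pairs. In this way the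
  direct sum of a sequence of free complexes is a free complex with blocks.\<close>

definition pick :: "nat \<Rightarrow> (nat \<times> 'b \<Rightarrow>\<^sub>0 'r) \<Rightarrow> 'b \<Rightarrow>\<^sub>0 'r" where
  "pick j = Poly_Mapping.map_key (Pair j)"

definition glue :: "(nat \<Rightarrow> 'b \<Rightarrow>\<^sub>0 'r) \<Rightarrow> nat \<times> 'b \<Rightarrow>\<^sub>0 'r" where
  "glue g = Abs_poly_mapping (\<lambda>(j, b). lookup (g j) b)"

lemma lookup_pick: "lookup (pick j y) b = lookup y (j, b)"
  by (simp add: pick_def Poly_Mapping.map_key.rep_eq inj_def)

lemma lookup_glue:
  assumes "finite {j. g j \<noteq> 0}"
  shows "lookup (glue g) (j, b) = lookup (g j) b"
proof -
  have "{(j, b). lookup (g j) b \<noteq> 0} \<subseteq> (\<Union>j\<in>{j. g j \<noteq> 0}. Pair j ` keys (g j))"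
  proof safe
    fix j b assume nz: "lookup (g j) b \<noteq> 0"
    then have "g j \<noteq> 0" by auto
    moreover have "b \<in> keys (g j)" using nz by (simp add: in_keys_iff)
    ultimately show "(j, b) \<in> (\<Union>j\<in>{j. g j \<noteq> 0}. Pair j ` keys (g j))" by blast
  qed
  then have "finite {(j, b). lookup (g j) b \<noteq> 0}"
    by (rule finite_subset) (use assms in auto)
  moreover have "{x. (case x of (j, b) \<Rightarrow> lookup (g j) b) \<noteq> 0} = {(j, b). lookup (g j) b \<noteq> 0}"
    by auto
  ultimately have "finite {x. (case x of (j, b) \<Rightarrow> lookup (g j) b) \<noteq> 0}" by simp
  then show ?thesis unfolding glue_def by (simp add: Abs_poly_mapping_inverse)
qed

lemma pick_glue: "finite {j. g j \<noteq> 0} \<Longrightarrow> pick j (glue g) = g j"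
  by (rule poly_mapping_eqI) (simp add: lookup_pick lookup_glue)

lemma pick_add: "pick j (x + y) = pick j x + pick j y"
  and pick_sm: "pick j (sm p x) = sm p (pick j x)"
  and pick_0 [simp]: "pick j 0 = 0"
  by (rule poly_mapping_eqI; simp add: lookup_pick lookup_add lookup_sm)+

lemma pick_eqI: "(\<And>j. pick j x = pick j y) \<Longrightarrow> x = y"
  by (rule poly_mapping_eqI) (metis lookup_pick surj_pair)

lemma pick_finite: "finite {j. pick j y \<noteq> 0}"
proof (rule finite_subset)
  show "{j. pick j y \<noteq> 0} \<subseteq> fst ` keys y"
  proof
    fix j assume "j \<in> {j. pick j y \<noteq> 0}"
    then obtain b where "lookup y (j, b) \<noteq> 0"
      by (auto simp: poly_mapping_eq_iff fun_eq_iff lookup_pick)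
    then have "(j, b) \<in> keys y" by (simp add: in_keys_iff)
    then show "j \<in> fst ` keys y" by force
  qed
qed simp

lemma vec_family_iff: "y \<in> vec {(j, b). b \<in> S j} (\<lambda>(j, b). hg b) n \<longleftrightarrow> (\<forall>j. pick j y \<in> vec (S j) hg n)"
  by (fastforce simp: vec_def normal_vec_def lookup_pick in_keys_iff)

lemma hvec_family_iff: "y \<in> hvec {(j, b). b \<in> S j} (\<lambda>(j, b). hg b) (\<lambda>(j, b). ig b) n d \<longleftrightarrow>
    (\<forall>j. pick j y \<in> hvec (S j) hg ig n d)"
  by (auto simp: hvec_def vec_family_iff lookup_pick)

lemma glue_glinear:
  assumes t: "\<And>j. glinear S hg ig n (S' j) hg' ig' n' (t j)" and fin: "\<And>x. x \<in> vec S hg n \<Longrightarrow> finite {j. t j x \<noteq> 0}"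
  shows "glinear S hg ig n {(j, b). b \<in> S' j} (\<lambda>(j, b). hg' b) (\<lambda>(j, b). ig' b) n' (\<lambda>x. glue (\<lambda>j. t j x))"
  unfolding glinear_def
proof (intro conjI ballI allI)
  fix x assume x: "x \<in> vec S hg n"
  show "glue (\<lambda>j. t j x) \<in> vec {(j, b). b \<in> S' j} (\<lambda>(j, b). hg' b) n'"
    using glinearD(1)[OF t x] by (simp add: vec_family_iff pick_glue[OF fin[OF x]])
  { fix y assume y: "y \<in> vec S hg n"
    show "glue (\<lambda>j. t j (x + y)) = glue (\<lambda>j. t j x) + glue (\<lambda>j. t j y)"
      by (rule pick_eqI, subst pick_glue[OF fin[OF vec_add[OF x y]]])
        (simp add: pick_glue[OF fin[OF x]] pick_glue[OF fin[OF y]] pick_add glinearD(2)[OF t x y]) }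
  fix p show "glue (\<lambda>j. t j (sm p x)) = sm p (glue (\<lambda>j. t j x))"
    by (rule pick_eqI, subst pick_glue[OF fin[OF vec_sm[OF x]]])
      (simp add: pick_glue[OF fin[OF x]] pick_sm glinearD(3)[OF t x])
next
  fix d x assume x: "x \<in> hvec S hg ig n d"
  show "glue (\<lambda>j. t j x) \<in> hvec {(j, b). b \<in> S' j} (\<lambda>(j, b). hg' b) (\<lambda>(j, b). ig' b) n' d"
    using glinearD(4)[OF t x] by (simp add: hvec_family_iff pick_glue[OF fin[OF hvec_vec[OF x]]])
qed

lemma glinear_pick: "glinear {(j, b). b \<in> S j} (\<lambda>(j, b). hg b) (\<lambda>(j, b). ig b) n (S j) hg ig n (pick j)"
  unfolding glinear_def by (auto simp: pick_add pick_sm hvec_family_iff) (simp add: vec_family_iff)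

lemma family_differential:
  assumes d: "\<And>j. is_differential (S j) hg ig \<delta>" and d0: "\<delta> 0 = 0"
  shows "is_differential {(j, b). b \<in> S j} (\<lambda>(j, b). hg b) (\<lambda>(j, b). ig b) (\<lambda>y. glue (\<lambda>j. \<delta> (pick j y)))"
proof -
  have fin: "finite {j. \<delta> (pick j y) \<noteq> 0}" for y
    by (rule finite_subset[OF _ pick_finite[of y]]) (use d0 in auto)
  show ?thesis unfolding is_differential_def
  proof (intro conjI allI ballI)
    fix n
    have "glinear {(j, b). b \<in> S j} (\<lambda>(j, b). hg b) (\<lambda>(j, b). ig b) n (S j) hg ig (n + 1) (\<lambda>y. \<delta> (pick j y))" for j
      using d[of j] by (intro glinear_comp[OF glinear_pick]) (simp add: is_differential_def)
    then show "glinear {(j, b). b \<in> S j} (\<lambda>(j, b). hg b) (\<lambda>(j, b). ig b) n {(j, b). b \<in> S j} (\<lambda>(j, b). hg b) (\<lambda>(j, b). ig b) (n + 1)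
        (\<lambda>y. glue (\<lambda>j. \<delta> (pick j y)))"
      by (rule glue_glinear) (rule fin)
    fix y assume "y \<in> vec {(j, b). b \<in> S j} (\<lambda>(j, b). hg b) n"
    then have y: "pick j y \<in> vec (S j) hg n" for j by (simp add: vec_family_iff)
    have "\<delta> (\<delta> (pick j y)) = 0" for j using d[of j] y[of j] by (simp add: is_differential_def)
    then show "glue (\<lambda>j. \<delta> (pick j (glue (\<lambda>j. \<delta> (pick j y))))) = 0"
      by (intro pick_eqI) (simp add: pick_glue[OF fin] pick_glue)
  qed
qed

text \<open>A locally finite sequence of chain maps out of the resolution of a small object is
  null-homotopic from some index on, by a locally finite sequence of homotopies.\<close>

lemma small_family_tail:
  fixes mk :: "(nat \<times> 'c \<Rightarrow>\<^sub>0 'r) \<Rightarrow> 'u" and mk0 :: "(('r, 'u) cell \<Rightarrow>\<^sub>0 'r) \<Rightarrow> 'u"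
    and mk1 :: "('b \<Rightarrow>\<^sub>0 'r) \<Rightarrow> 'u" and nu :: "nat \<Rightarrow> 'u" and S :: "nat \<Rightarrow> 'c set"
    and t :: "nat \<Rightarrow> int \<Rightarrow> ('b \<Rightarrow>\<^sub>0 'r) \<Rightarrow> 'c \<Rightarrow>\<^sub>0 'r"
  assumes inj: "inj mk" and inj0: "inj mk0" and inj1: "inj mk1" and nu: "inj nu"
    and d1: "is_differential S1 hg1 ig1 \<delta>1"
    and res: "resolution L F (free_cpx mk1 S1 hg1 ig1 \<delta>1) p" and small: "small L F"
    and d: "\<And>j. is_differential (S j) hg ig \<delta>" and d0: "\<delta> 0 = 0"
    and t: "\<And>j n. glinear S1 hg1 ig1 n (S j) hg ig n (t j n)"
    and fin: "\<And>n x. x \<in> vec S1 hg1 n \<Longrightarrow> finite {j. t j n x \<noteq> 0}"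
    and td: "\<And>j n x. x \<in> vec S1 hg1 n \<Longrightarrow> t j (n + 1) (\<delta>1 x) = \<delta> (t j n x)"
  shows "\<exists>N H. (\<forall>j n. glinear S1 hg1 ig1 n (S j) hg ig (n - 1) (H j n)) \<and>
    (\<forall>n. \<forall>x\<in>vec S1 hg1 n. finite {j. H j n x \<noteq> 0}) \<and>
    (\<forall>j n. \<forall>x\<in>vec S1 hg1 n. j \<ge> N \<longrightarrow> t j n x = \<delta> (H j n x) + H j (n + 1) (\<delta>1 x))"
proof -
  let ?S = "{(j, b). b \<in> S j}" and ?h = "\<lambda>(j :: nat, b). hg b" and ?i = "\<lambda>(j :: nat, b). ig b"
  let ?d = "\<lambda>y. glue (\<lambda>j. \<delta> (pick j y))"
  let ?T = "\<lambda>n x. glue (\<lambda>j. t j n x)"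
  have dfin: "finite {j. \<delta> (pick j y) \<noteq> 0}" for y
    by (rule finite_subset[OF _ pick_finite[of y]]) (use d0 in auto)
  have block: "is_differential {x \<in> ?S. nu (fst x) = i} ?h ?i ?d" for i
  proof -
    have "is_differential (if nu j = i then S j else {}) hg ig \<delta>" for j
    proof (cases "nu j = i")
      case False
      have "x = 0" if "x \<in> vec {} hg n" for x :: "'c \<Rightarrow>\<^sub>0 'r" and n using that by (auto simp: vec_def)
      then have "is_differential {} hg ig \<delta>"
        using d0 by (auto simp: is_differential_def glinear_def hvec_def vec_def normal_vec_def)
      then show ?thesis using False by simp
    qed (simp add: d)
    from family_differential[OF this d0]
    show ?thesis by (rule back_subst[of "\<lambda>S. is_differential S ?h ?i ?d"]) (auto split: if_splits)
  qed
  have "\<exists>J H. finite J \<and> (\<forall>n. glinear S1 hg1 ig1 n ?S ?h ?i (n - 1) (H n)) \<and>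
    (\<forall>n. \<forall>x\<in>vec S1 hg1 n. \<forall>b. nu (fst b) \<notin> J \<longrightarrow>
       lookup (?T n x) b = lookup (?d (H n x) + H (n + 1) (\<delta>1 x)) b)"
  proof (rule small_null_homotopic_tail[OF inj inj0 inj1 family_differential[OF d d0] block d1 res small])
    show "glinear S1 hg1 ig1 n ?S ?h ?i n (?T n)" for n by (rule glue_glinear[OF t fin])
    fix n x assume x: "x \<in> vec S1 hg1 n"
    have dx: "\<delta>1 x \<in> vec S1 hg1 (n + 1)" using d1 x by (simp add: is_differential_def glinear_def)
    have "finite {j. \<delta> (t j n x) \<noteq> 0}"
      by (rule finite_subset[OF _ fin[OF x]]) (use d0 in auto)
    then show "?T (n + 1) (\<delta>1 x) = ?d (?T n x)"
      by (intro pick_eqI, subst pick_glue[OF fin[OF dx]])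
        (simp add: pick_glue[OF fin[OF x]] pick_glue td[OF x])
  qed
  then obtain J H where J: "finite J" and H: "\<And>n. glinear S1 hg1 ig1 n ?S ?h ?i (n - 1) (H n)"
    and eq: "\<And>n x b. x \<in> vec S1 hg1 n \<Longrightarrow> nu (fst b) \<notin> J \<Longrightarrow>
       lookup (?T n x) b = lookup (?d (H n x) + H (n + 1) (\<delta>1 x)) b" by blast
  have "finite (nu -` J)" using J nu by (rule finite_vimageI)
  then obtain N where N: "\<And>j. j \<in> nu -` J \<Longrightarrow> j < N" by (auto simp: finite_nat_set_iff_bounded)
  show ?thesis
  proof (intro exI conjI allI ballI impI)
    show "glinear S1 hg1 ig1 n (S j) hg ig (n - 1) (\<lambda>x. pick j (H n x))" for j n
      by (rule glinear_comp[OF H glinear_pick])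
    show "finite {j. pick j (H n x) \<noteq> 0}" for n x by (rule pick_finite)
    fix j n x assume x: "x \<in> vec S1 hg1 n" and j: "N \<le> j"
    show "t j n x = \<delta> (pick j (H n x)) + pick j (H (n + 1) (\<delta>1 x))"
    proof (rule poly_mapping_eqI)
      fix b
      have "nu j \<notin> J" using N[of j] j by auto
      then have "lookup (?T n x) (j, b) = lookup (?d (H n x) + H (n + 1) (\<delta>1 x)) (j, b)"
        by (intro eq[OF x]) simp
      then show "lookup (t j n x) b = lookup (\<delta> (pick j (H n x)) + pick j (H (n + 1) (\<delta>1 x))) b"
        by (simp add: lookup_glue[OF fin[OF x]] lookup_add lookup_glue[OF dfin] lookup_pick)
    qed
  qed
qed

text \<open>At each vector, the indices at which the sequence does not vanish must be finite in number; for a locally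
  finite sequence of linear maps this is again a linear map.\<close>

definition lsum :: "(nat \<Rightarrow> ('b \<Rightarrow>\<^sub>0 'r) \<Rightarrow> 'c \<Rightarrow>\<^sub>0 'r) \<Rightarrow> ('b \<Rightarrow>\<^sub>0 'r) \<Rightarrow> 'c \<Rightarrow>\<^sub>0 'r" where
  "lsum k x = (\<Sum>j | k j x \<noteq> 0. k j x)"

lemma lsum_superset: "finite B \<Longrightarrow> {j. k j x \<noteq> 0} \<subseteq> B \<Longrightarrow> lsum k x = (\<Sum>j\<in>B. k j x)"
  unfolding lsum_def by (rule sum.mono_neutral_left) auto

lemma lsum_glinear:
  assumes k: "\<And>j. glinear S hg ig n S' hg' ig' n' (k j)" and fin: "\<And>x. x \<in> vec S hg n \<Longrightarrow> finite {j. k j x \<noteq> 0}"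
  shows "glinear S hg ig n S' hg' ig' n' (lsum k)"
  unfolding glinear_def
proof (intro conjI ballI allI)
  fix x assume x: "x \<in> vec S hg n"
  show "lsum k x \<in> vec S' hg' n'" unfolding lsum_def by (rule vec_sum) (rule glinearD(1)[OF k x])
  { fix y assume y: "y \<in> vec S hg n"
    let ?B = "{j. k j x \<noteq> 0} \<union> {j. k j y \<noteq> 0}"
    have B: "finite ?B" using fin[OF x] fin[OF y] by simp
    have "lsum k (x + y) = (\<Sum>j\<in>?B. k j (x + y))"
      by (rule lsum_superset[OF B]) (auto simp: glinearD(2)[OF k x y])
    also have "\<dots> = (\<Sum>j\<in>?B. k j x) + (\<Sum>j\<in>?B. k j y)" by (simp add: glinearD(2)[OF k x y] sum.distrib)
    also have "\<dots> = lsum k x + lsum k y" by (subst (1 2) lsum_superset[OF B]) auto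
    finally show "lsum k (x + y) = lsum k x + lsum k y" . }
  fix p
  have "lsum k (sm p x) = (\<Sum>j | k j x \<noteq> 0. k j (sm p x))"
    by (rule lsum_superset[OF fin[OF x]]) (auto simp: glinearD(3)[OF k x])
  then show "lsum k (sm p x) = sm p (lsum k x)" by (simp add: lsum_def sm_sum glinearD(3)[OF k x])
next
  fix d x assume x: "x \<in> hvec S hg ig n d"
  show "lsum k x \<in> hvec S' hg' ig' n' d" unfolding lsum_def by (rule hvec_sum) (rule glinearD(4)[OF k x])
qed

lemma keys_lin_ext: "keys (lin_ext \<beta> x) \<subseteq> (\<Union>b\<in>keys x. keys (\<beta> b))"
  unfolding lin_ext_def by (rule subset_trans[OF keys_sum UN_mono[OF subset_refl keys_sm]])

end

subsection \<open>Reduction to bounded rank, and then to finitely many cells\<close>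

text \<open>The basis \<open>S\<close> stands for the cells of a resolution of the small object \<open>F\<close>, and \<open>rk\<close> for their size.
  The injections \<open>mk0\<close>, \<open>mk1\<close> and \<open>mk2\<close> place resolutions, the complex on \<open>S\<close> and direct sums of sequences of
  its subcomplexes into the universe; \<open>nu\<close> and \<open>cu\<close> index the summands by elements of the universe.\<close>

locale small_semifree = graded_coeff L cl nf prj
  for L :: "'a gring" and cl :: "'r::comm_ring_1 \<Rightarrow> 'a" and nf prj +
  fixes mk0 :: "(('r, 'u) cell \<Rightarrow>\<^sub>0 'r) \<Rightarrow> 'u" and mk1 :: "('c \<Rightarrow>\<^sub>0 'r) \<Rightarrow> 'u"
    and mk2 :: "(nat \<times> 'c \<Rightarrow>\<^sub>0 'r) \<Rightarrow> 'u" and nu :: "nat \<Rightarrow> 'u" and cu :: "'c \<Rightarrow> 'u"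
    and S :: "'c set" and hg ig :: "'c \<Rightarrow> int" and \<beta> :: "'c \<Rightarrow> 'c \<Rightarrow>\<^sub>0 'r" and rk :: "'c \<Rightarrow> nat"
    and F :: "('a, 'u) cpx" and p :: "'u maps"
  assumes inj0: "inj mk0" and inj1: "inj mk1" and inj2: "inj mk2" and nu: "inj nu" and cu: "inj cu"
    and \<beta>: "\<And>b. b \<in> S \<Longrightarrow> \<beta> b \<in> hvec S hg ig (hg b + 1) (ig b)"
    and \<beta>2: "\<And>b. b \<in> S \<Longrightarrow> lin_ext \<beta> (\<beta> b) = 0"
    and rk: "\<And>b c. b \<in> S \<Longrightarrow> c \<in> keys (\<beta> b) \<Longrightarrow> rk c < rk b"
    and res: "resolution L F (free_cpx mk1 S hg ig (lin_ext \<beta>)) p" and small: "small L F"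
begin

abbreviation V :: "int \<Rightarrow> ('c \<Rightarrow>\<^sub>0 'r) set" where "V n \<equiv> vec S hg n"
abbreviation \<delta> :: "('c \<Rightarrow>\<^sub>0 'r) \<Rightarrow> 'c \<Rightarrow>\<^sub>0 'r" where "\<delta> \<equiv> lin_ext \<beta>"

lemma delta_differential: "is_differential S hg ig \<delta>"
  by (rule lin_ext_differential[OF \<beta> \<beta>2])

lemma \<delta>_glinear: "glinear S hg ig n S hg ig (n + 1) \<delta>" and \<delta>\<delta>: "x \<in> V n \<Longrightarrow> \<delta> (\<delta> x) = 0"
  using delta_differential by (auto simp: is_differential_def)

lemma \<delta>_V: "x \<in> V n \<Longrightarrow> \<delta> x \<in> V (n + 1)"
  by (rule glinearD(1)[OF \<delta>_glinear])

lemma keys_\<beta>: "b \<in> S \<Longrightarrow> keys (\<beta> b) \<subseteq> S"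
  using \<beta>[of b] by (auto simp: hvec_def vec_def)

lemma sub_differential:
  assumes "T \<subseteq> S" "\<And>b. b \<in> T \<Longrightarrow> keys (\<beta> b) \<subseteq> T"
  shows "is_differential T hg ig \<delta>"
proof (rule lin_ext_differential)
  fix b assume b: "b \<in> T"
  then have "b \<in> S" using assms by blast
  then show "\<beta> b \<in> hvec T hg ig (hg b + 1) (ig b)" "\<delta> (\<beta> b) = 0"
    using \<beta>[of b] \<beta>2[of b] assms(2)[OF b] by (auto simp: hvec_def vec_def)
qed

lemma rank_differential: "is_differential {b \<in> S. rk b \<le> j} hg ig \<delta>"
proof (rule sub_differential)
  fix b assume "b \<in> {b \<in> S. rk b \<le> j}"
  then show "keys (\<beta> b) \<subseteq> {b \<in> S. rk b \<le> j}"
    using keys_\<beta>[of b] rk[of b] by fastforce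
qed auto

definition homotopic_to_id :: "(int \<Rightarrow> ('c \<Rightarrow>\<^sub>0 'r) \<Rightarrow> 'c \<Rightarrow>\<^sub>0 'r) \<Rightarrow> bool" where
  "homotopic_to_id \<psi> \<longleftrightarrow> (\<forall>n. glinear S hg ig n S hg ig n (\<psi> n)) \<and>
     (\<forall>n. \<forall>x\<in>V n. \<psi> (n + 1) (\<delta> x) = \<delta> (\<psi> n x)) \<and>
     (\<exists>k. (\<forall>n. glinear S hg ig n S hg ig (n - 1) (k n)) \<and>
          (\<forall>n. \<forall>x\<in>V n. x - \<psi> n x = \<delta> (k n x) + k (n + 1) (\<delta> x)))"

text \<open>Let \<open>\<pi> j\<close> be the projection to the subcomplex of rank at most \<open>j\<close>. It fails to be a chain map by the
  connecting map \<open>\<theta> j = \<pi> j \<circ> \<delta> \<circ> (1 - \<pi> j)\<close>. On any vector only finitely many \<open>\<theta> j\<close> are nonzero, so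
  almost all of them are null-homotopic, and the homotopy \<open>H j\<close> corrects \<open>\<pi> j\<close> to a chain map \<open>\<psi> j\<close>.
  On a given vector \<open>\<psi> j\<close> is the identity for large \<open>j\<close>. So the differences \<open>\<psi> (j + 1) - \<psi> j\<close> are again
  locally finite; almost all are null-homotopic, and they sum up to a homotopy from \<open>\<psi> M\<close> to the
  identity.\<close>

lemma bounded_rank:
  "\<exists>M \<psi>. homotopic_to_id \<psi> \<and> (\<forall>n. \<forall>x\<in>V n. keys (\<psi> n x) \<subseteq> {b. rk b < M})"
proof -
  define R where "R = (\<lambda>j. {b \<in> S. rk b \<le> j})"
  define \<pi> where "\<pi> = (\<lambda>j. vres {b :: 'c. rk b \<le> j} :: ('c \<Rightarrow>\<^sub>0 'r) \<Rightarrow> _)"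
  define \<theta> where "\<theta> = (\<lambda>j x. \<pi> j (\<delta> (x - \<pi> j x)))"
  have \<pi>R: "glinear S hg ig n (R j) hg ig n (\<pi> j)" for n j unfolding \<pi>_def by (rule glinear_vres) (auto simp: R_def)
  have \<pi>S: "glinear S hg ig n S hg ig n (\<pi> j)" for n j by (rule glinear_mono[OF \<pi>R]) (auto simp: R_def)
  have \<pi>V: "\<pi> j x \<in> V n" if "x \<in> V n" for j x n by (rule glinearD(1)[OF \<pi>S that])
  have \<pi>id: "\<pi> j x = x" if "x \<in> vec (R j) hg n" for j x n
    unfolding \<pi>_def by (rule vres_id) (use that in \<open>auto simp: vec_def R_def\<close>)
  have RV: "vec (R j) hg n \<subseteq> V n" for j n by (rule vec_mono) (auto simp: R_def)
  have rd: "is_differential (R j) hg ig \<delta>" for j unfolding R_def by (rule rank_differential)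
  have dR: "\<delta> x \<in> vec (R j) hg (n + 1)" if "x \<in> vec (R j) hg n" for j x n
    using rd[of j] that by (simp add: is_differential_def glinear_def)
  have \<pi>d\<pi>: "\<pi> j (\<delta> (\<pi> j x)) = \<delta> (\<pi> j x)" if "x \<in> V n" for j x n
    by (rule \<pi>id[OF dR[OF glinearD(1)[OF \<pi>R that]]])
  have \<pi>delta_differential: "\<pi> j (x - y) = \<pi> j x - \<pi> j y" for j x y by (simp add: \<pi>_def vres_diff)
  have \<theta>: "\<theta> j x = \<pi> j (\<delta> x) - \<delta> (\<pi> j x)" if "x \<in> V n" for j x n
    using \<pi>d\<pi>[OF that] by (simp add: \<theta>_def lin_ext_minus \<pi>delta_differential)
  have rank_bound: "\<exists>m. \<forall>j\<ge>m. \<pi> j x = x" for x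
  proof -
    obtain m where "\<And>i. i \<in> rk ` keys x \<Longrightarrow> i < m"
      by (meson finite_imageI finite_keys finite_nat_set_iff_bounded)
    then have "keys x \<subseteq> {b. rk b \<le> j}" if "j \<ge> m" for j using that by fastforce
    then show ?thesis unfolding \<pi>_def by (intro exI[of _ m] allI impI vres_id)
  qed
  have "\<exists>N H. (\<forall>j n. glinear S hg ig n (R j) (\<lambda>b. hg b - 1) ig (n - 1) (H j n)) \<and>
    (\<forall>n. \<forall>x\<in>V n. finite {j. H j n x \<noteq> 0}) \<and>
    (\<forall>j n. \<forall>x\<in>V n. j \<ge> N \<longrightarrow> \<theta> j x = - \<delta> (H j n x) + H j (n + 1) (\<delta> x))"
  proof (rule small_family_tail[OF inj2 inj0 inj1 nu delta_differential res small])
    have "glinear (R j) (\<lambda>b. hg b - 1) ig n (R j) (\<lambda>b. hg b - 1) ig (n + 1) (\<lambda>x. - \<delta> x)" for j n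
    proof -
      have "glinear (R j) hg ig (n + 1) (R j) hg ig (n + 1 + 1) (\<lambda>x. 0 - \<delta> x)"
        by (rule glinear_diff[OF glinear_const_0]) (rule rd[of j, unfolded is_differential_def, THEN conjunct1, rule_format])
      then show ?thesis unfolding glinear_def vec_shift hvec_shift by simp
    qed
    moreover have "- \<delta> (- \<delta> x) = 0" if "x \<in> vec (R j) (\<lambda>b. hg b - 1) n" for j n x
      using that RV[of j "n + 1"] \<delta>\<delta>[of x "n + 1"] unfolding vec_shift by (auto simp: lin_ext_minus)
    ultimately show "is_differential (R j) (\<lambda>b. hg b - 1) ig (\<lambda>x. - \<delta> x)" for j
      unfolding is_differential_def by blast
    have "glinear S hg ig n (R j) hg ig (n + 1) (\<theta> j)" for j n
      unfolding \<theta>_def by (rule glinear_comp[OF glinear_comp[OF glinear_diff[OF glinear_id \<pi>S] \<delta>_glinear] \<pi>R])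
    then show "glinear S hg ig n (R j) (\<lambda>b. hg b - 1) ig n (\<theta> j)" for j n
      unfolding glinear_def vec_shift hvec_shift .
    fix n x assume x: "x \<in> V n"
    obtain m where m: "\<And>j. j \<ge> m \<Longrightarrow> \<pi> j x = x" using rank_bound by blast
    show "finite {j. \<theta> j x \<noteq> 0}"
    proof (rule finite_subset)
      show "{j. \<theta> j x \<noteq> 0} \<subseteq> {..<m}"
        using m by (auto simp: \<theta>_def \<pi>_def) (metis lin_ext_0 diff_self linorder_not_less vres_0)
    qed simp
    show "\<theta> j (\<delta> x) = - \<delta> (\<theta> j x)" for j
    proof -
      have "\<theta> j (\<delta> x) = - \<delta> (\<pi> j (\<delta> x))"
        using \<theta>[OF \<delta>_V[OF x]] \<delta>\<delta>[OF x] by (simp add: \<pi>_def)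
      moreover have "\<delta> (\<theta> j x) = \<delta> (\<pi> j (\<delta> x))"
        using \<theta>[OF x] \<delta>\<delta>[OF \<pi>V[OF x]] by (simp add: lin_ext_minus)
      ultimately show ?thesis by simp
    qed
  qed simp
  then obtain N H where H0: "\<And>j n. glinear S hg ig n (R j) (\<lambda>b. hg b - 1) ig (n - 1) (H j n)"
    and Hfin: "\<And>n x. x \<in> V n \<Longrightarrow> finite {j. H j n x \<noteq> 0}"
    and Heq: "\<And>j n x. x \<in> V n \<Longrightarrow> j \<ge> N \<Longrightarrow> \<theta> j x = - \<delta> (H j n x) + H j (n + 1) (\<delta> x)" by blast
  have H: "glinear S hg ig n (R j) hg ig n (H j n)" for j n
    using H0[of n j] unfolding glinear_def vec_shift hvec_shift by simp
  define \<psi> where "\<psi> = (\<lambda>j n x. \<pi> j x - H j n x)"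
  have \<psi>R: "glinear S hg ig n (R j) hg ig n (\<psi> j n)" for j n unfolding \<psi>_def by (rule glinear_diff[OF \<pi>R H])
  have \<psi>S: "glinear S hg ig n S hg ig n (\<psi> j n)" for j n by (rule glinear_mono[OF \<psi>R]) (auto simp: R_def)
  have \<psi>d: "\<psi> j (n + 1) (\<delta> x) = \<delta> (\<psi> j n x)" if "x \<in> V n" "j \<ge> N" for j n x
    using Heq[OF that] \<theta>[OF that(1), of j] by (simp add: \<psi>_def lin_ext_minus algebra_simps)
  have \<psi>id: "\<exists>m. \<forall>j\<ge>m. \<psi> j n x = x" if x: "x \<in> V n" for n x
  proof -
    obtain m where m: "\<forall>j\<ge>m. \<pi> j x = x" using rank_bound by blast
    obtain m' where m': "\<forall>j\<in>{j. H j n x \<noteq> 0}. j < m'"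
      using Hfin[OF x] unfolding finite_nat_set_iff_bounded by (rule exE)
    have "\<forall>j\<ge>m'. H j n x = 0"
    proof (intro allI impI)
      fix j assume "m' \<le> j"
      then show "H j n x = 0" using bspec[OF m', of j] by (cases "H j n x = 0") auto
    qed
    with m have "\<forall>j\<ge>max m m'. \<psi> j n x = x" by (simp add: \<psi>_def)
    then show ?thesis by blast
  qed
  define D where "D = (\<lambda>j n x. if j \<ge> N then \<psi> (Suc j) n x - \<psi> j n x else 0)"
  have "\<exists>N K. (\<forall>j n. glinear S hg ig n (R (Suc j)) hg ig (n - 1) (K j n)) \<and>
    (\<forall>n. \<forall>x\<in>V n. finite {j. K j n x \<noteq> 0}) \<and>
    (\<forall>j n. \<forall>x\<in>V n. j \<ge> N \<longrightarrow> D j n x = \<delta> (K j n x) + K j (n + 1) (\<delta> x))"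
  proof (rule small_family_tail[OF inj2 inj0 inj1 nu delta_differential res small])
    show "is_differential (R (Suc j)) hg ig \<delta>" for j by (rule rd)
    show "glinear S hg ig n (R (Suc j)) hg ig n (D j n)" for j n
    proof (cases "j \<ge> N")
      case True
      have "glinear S hg ig n (R (Suc j)) hg ig n (\<psi> j n)" by (rule glinear_mono[OF \<psi>R]) (auto simp: R_def)
      then show ?thesis using True glinear_diff[OF \<psi>R, of n "Suc j"] by (simp add: D_def)
    qed (simp add: D_def glinear_const_0)
    fix n x assume x: "x \<in> V n"
    obtain m where m: "\<And>j. j \<ge> m \<Longrightarrow> \<psi> j n x = x" using \<psi>id[OF x] by blast
    show "finite {j. D j n x \<noteq> 0}"
    proof (rule finite_subset)
      show "{j. D j n x \<noteq> 0} \<subseteq> {..<m}"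
      proof
        fix j assume "j \<in> {j. D j n x \<noteq> 0}"
        then show "j \<in> {..<m}" using m[of j] m[of "Suc j"] by (cases "j < m") (auto simp: D_def split: if_splits)
      qed
    qed simp
    show "D j (n + 1) (\<delta> x) = \<delta> (D j n x)" for j
      using \<psi>d[OF x, of j] \<psi>d[OF x, of "Suc j"] by (simp add: D_def lin_ext_minus)
  qed simp
  then obtain N' K where K: "\<And>j n. glinear S hg ig n (R (Suc j)) hg ig (n - 1) (K j n)"
    and Kfin: "\<And>n x. x \<in> V n \<Longrightarrow> finite {j. K j n x \<noteq> 0}"
    and Keq: "\<And>j n x. x \<in> V n \<Longrightarrow> j \<ge> N' \<Longrightarrow> D j n x = \<delta> (K j n x) + K j (n + 1) (\<delta> x)" by blast
  define M where "M = max N N'"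
  define K' where "K' = (\<lambda>n j x. if j \<ge> M then K j n x else 0)"
  have K': "glinear S hg ig n S hg ig (n - 1) (K' n j)" for n j
  proof -
    have "glinear S hg ig n S hg ig (n - 1) (K j n)" by (rule glinear_mono[OF K]) (auto simp: R_def)
    then show ?thesis by (cases "M \<le> j") (simp_all add: K'_def glinear_const_0)
  qed
  have K'fin: "finite {j. K' n j x \<noteq> 0}" if "x \<in> V n" for n x
    by (rule finite_subset[OF _ Kfin[OF that]]) (auto simp: K'_def)
  have "homotopic_to_id (\<psi> M)"
    unfolding homotopic_to_id_def
  proof (intro conjI allI ballI exI)
    show "glinear S hg ig n S hg ig n (\<psi> M n)" for n by (rule \<psi>S)
    show "glinear S hg ig n S hg ig (n - 1) (lsum (K' n))" for n by (rule lsum_glinear[OF K' K'fin])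
    fix n x assume x: "x \<in> V n"
    show "\<psi> M (n + 1) (\<delta> x) = \<delta> (\<psi> M n x)" by (rule \<psi>d[OF x]) (simp add: M_def)
    obtain m where m: "\<And>j. j \<ge> m \<Longrightarrow> \<psi> j n x = x" using \<psi>id[OF x] by blast
    obtain m1 where m1: "\<forall>j\<in>{j. K' n j x \<noteq> 0}. j < m1"
      using K'fin[OF x] unfolding finite_nat_set_iff_bounded by (rule exE)
    obtain m2 where m2: "\<forall>j\<in>{j. K' (n + 1) j (\<delta> x) \<noteq> 0}. j < m2"
      using K'fin[OF \<delta>_V[OF x]] unfolding finite_nat_set_iff_bounded by (rule exE)
    define B where "B = M + m + m1 + m2"
    have s1: "lsum (K' n) x = (\<Sum>j\<in>{M..<B}. K' n j x)"
    proof (rule lsum_superset)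
      show "{j. K' n j x \<noteq> 0} \<subseteq> {M..<B}"
      proof
        fix j assume "j \<in> {j. K' n j x \<noteq> 0}"
        then show "j \<in> {M..<B}" using bspec[OF m1, of j] by (auto simp: B_def K'_def split: if_splits)
      qed
    qed simp
    have s2: "lsum (K' (n + 1)) (\<delta> x) = (\<Sum>j\<in>{M..<B}. K' (n + 1) j (\<delta> x))"
    proof (rule lsum_superset)
      show "{j. K' (n + 1) j (\<delta> x) \<noteq> 0} \<subseteq> {M..<B}"
      proof
        fix j assume "j \<in> {j. K' (n + 1) j (\<delta> x) \<noteq> 0}"
        then show "j \<in> {M..<B}" using bspec[OF m2, of j] by (auto simp: B_def K'_def split: if_splits)
      qed
    qed simp
    have "x - \<psi> M n x = \<psi> B n x - \<psi> M n x" using m[of B] by (simp add: B_def)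
    also have "\<dots> = (\<Sum>j\<in>{M..<B}. \<psi> (Suc j) n x - \<psi> j n x)"
      by (rule sum_Suc_diff'[symmetric]) (simp add: B_def)
    also have "\<dots> = (\<Sum>j\<in>{M..<B}. \<delta> (K' n j x) + K' (n + 1) j (\<delta> x))"
    proof (intro sum.cong refl)
      fix j assume "j \<in> {M..<B}"
      then show "\<psi> (Suc j) n x - \<psi> j n x = \<delta> (K' n j x) + K' (n + 1) j (\<delta> x)"
        using Keq[OF x, of j] by (simp add: D_def K'_def M_def)
    qed
    also have "\<dots> = \<delta> (lsum (K' n) x) + lsum (K' (n + 1)) (\<delta> x)"
      by (simp add: s1 s2 sum.distrib lin_ext_sum)
    finally show "x - \<psi> M n x = \<delta> (lsum (K' n) x) + lsum (K' (n + 1)) (\<delta> x)" .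
  qed
  moreover have "keys (\<psi> M n x) \<subseteq> {b. rk b < Suc M}" if "x \<in> V n" for n x
    using glinearD(1)[OF \<psi>R that, of M] by (auto simp: vec_def R_def)
  ultimately show ?thesis by blast
qed

definition closed_cells :: "'c set \<Rightarrow> bool" where
  "closed_cells E \<longleftrightarrow> E \<subseteq> S \<and> (\<forall>b\<in>E. keys (\<beta> b) \<subseteq> E)"

lemma finite_closure: "finite C \<Longrightarrow> C \<subseteq> S \<Longrightarrow> \<exists>E. finite E \<and> C \<subseteq> E \<and> closed_cells E"
proof -
  have one: "\<exists>E. finite E \<and> b \<in> E \<and> closed_cells E" if "b \<in> S" for b
    using that
  proof (induction "rk b" arbitrary: b rule: less_induct)
    case less
    have "\<forall>c\<in>keys (\<beta> b). \<exists>E. finite E \<and> c \<in> E \<and> closed_cells E"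
      using less rk keys_\<beta> by blast
    then obtain E where E: "\<forall>c\<in>keys (\<beta> b). finite (E c) \<and> c \<in> E c \<and> closed_cells (E c)"
      by (rule bchoice[THEN exE])
    have "finite (insert b (\<Union>c\<in>keys (\<beta> b). E c))" using E by auto
    moreover have "closed_cells (insert b (\<Union>c\<in>keys (\<beta> b). E c))"
      using E less.prems unfolding closed_cells_def by blast
    ultimately show ?case by blast
  qed
  assume C: "finite C" "C \<subseteq> S"
  then have "\<forall>b\<in>C. \<exists>E. finite E \<and> b \<in> E \<and> closed_cells E" using one by blast
  then obtain E where E: "\<forall>b\<in>C. finite (E b) \<and> b \<in> E b \<and> closed_cells (E b)"
    by (rule bchoice[THEN exE])
  have "finite (\<Union>b\<in>C. E b)" "C \<subseteq> (\<Union>b\<in>C. E b)" using E C by auto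
  moreover have "closed_cells (\<Union>b\<in>C. E b)" using E unfolding closed_cells_def by blast
  ultimately show ?thesis by blast
qed

text \<open>Modulo the finite subcomplex on \<open>E\<close>, the cells of top rank \<open>m\<close> form a direct sum with zero
  differential. So the top component of \<open>\<psi>\<close> can be pushed by a homotopy into finitely many of them, and
  these are then added to \<open>E\<close> together with their boundaries.\<close>

lemma lower_rank:
  assumes E: "finite E" "closed_cells E" and \<psi>: "homotopic_to_id \<psi>"
    and \<psi>E: "\<And>n x. x \<in> V n \<Longrightarrow> keys (\<psi> n x) \<subseteq> E \<union> {b. rk b < Suc m}"
  shows "\<exists>E' \<psi>'. finite E' \<and> closed_cells E' \<and> homotopic_to_id \<psi>' \<and>
    (\<forall>n. \<forall>x\<in>V n. keys (\<psi>' n x) \<subseteq> E' \<union> {b. rk b < m})"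
proof -
  define T where "T = {b \<in> S. rk b = m \<and> b \<notin> E}"
  have \<psi>glinear: "glinear S hg ig n S hg ig n (\<psi> n)" for n using \<psi> by (simp add: homotopic_to_id_def)
  have \<psi>d: "\<psi> (n + 1) (\<delta> x) = \<delta> (\<psi> n x)" if "x \<in> V n" for n x
    using \<psi> that by (simp add: homotopic_to_id_def)
  obtain k where k: "\<And>n. glinear S hg ig n S hg ig (n - 1) (k n)"
    and keq: "\<And>n x. x \<in> V n \<Longrightarrow> x - \<psi> n x = \<delta> (k n x) + k (n + 1) (\<delta> x)"
    using \<psi> unfolding homotopic_to_id_def by blast
  have kd: "keys (\<delta> y) \<subseteq> E \<union> {b. rk b < m}" if "y \<in> V n" "keys y \<subseteq> E \<union> {b. rk b < Suc m}" for y n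
  proof
    fix c assume "c \<in> keys (\<delta> y)"
    then obtain b where b: "b \<in> keys y" "c \<in> keys (\<beta> b)"
      by (auto dest: subsetD[OF keys_lin_ext])
    have bS: "b \<in> S" using b that by (auto simp: vec_def)
    show "c \<in> E \<union> {b. rk b < m}"
    proof (cases "b \<in> E")
      case True
      then show ?thesis using E(2) b by (auto simp: closed_cells_def)
    next
      case False
      then have "rk b < Suc m" using that(2) b(1) by blast
      then show ?thesis using rk[OF bS b(2)] by simp
    qed
  qed
  have zd: "is_differential R hg ig (\<lambda>x. 0)" for R :: "'c set"
    by (simp add: is_differential_def glinear_const_0)
  have "\<exists>J H. finite J \<and> (\<forall>n. glinear S hg ig n T hg ig (n - 1) (H n)) \<and>
    (\<forall>n. \<forall>x\<in>V n. \<forall>b. cu b \<notin> J \<longrightarrow> lookup (vres T (\<psi> n x)) b = lookup (0 + H (n + 1) (\<delta> x)) b)"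
  proof (rule small_null_homotopic_tail[OF inj1 inj0 inj1 zd zd delta_differential res small])
    show "glinear S hg ig n T hg ig n (\<lambda>x. vres T (\<psi> n x))" for n
      by (rule glinear_comp[OF \<psi>glinear glinear_vres]) (auto simp: T_def)
    fix n x assume x: "x \<in> V n"
    have "keys (\<psi> (n + 1) (\<delta> x)) \<inter> T = {}"
      using kd[OF glinearD(1)[OF \<psi>glinear x] \<psi>E[OF x]] unfolding \<psi>d[OF x] by (auto simp: T_def)
    then show "vres T (\<psi> (n + 1) (\<delta> x)) = 0"
      by (intro poly_mapping_eqI) (auto simp: lookup_vres in_keys_iff)
  qed
  then obtain J H where J: "finite J" and H: "\<And>n. glinear S hg ig n T hg ig (n - 1) (H n)"
    and Heq: "\<And>n x b. x \<in> V n \<Longrightarrow> cu b \<notin> J \<Longrightarrow> lookup (vres T (\<psi> n x)) b = lookup (H (n + 1) (\<delta> x)) b"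
    unfolding add_0 by blast
  have TS: "T \<subseteq> S" by (auto simp: T_def)
  have HS: "glinear S hg ig n S hg ig (n - 1) (H n)" for n by (rule glinear_mono[OF H TS])
  have HS': "glinear S hg ig (n + 1) S hg ig n (H (n + 1))" for n using HS[of "n + 1"] by simp
  have dk: "glinear S hg ig (n - 1) S hg ig n \<delta>" for n using \<delta>_glinear[of "n - 1"] by simp
  define C where "C = {b \<in> T. cu b \<in> J}"
  have "finite C"
    by (rule finite_subset[OF _ finite_vimageI[OF J cu]]) (auto simp: C_def)
  moreover have "C \<subseteq> S" using TS by (auto simp: C_def)
  ultimately obtain E1 where E1: "finite E1" "C \<subseteq> E1" "closed_cells E1" using finite_closure by blast
  define E' where "E' = E \<union> E1"
  define \<psi>' where "\<psi>' = (\<lambda>n x. \<psi> n x - \<delta> (H n x) - H (n + 1) (\<delta> x))"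
  have "finite E'" "closed_cells E'" using E E1 by (auto simp: E'_def closed_cells_def)
  moreover have "homotopic_to_id \<psi>'"
    unfolding homotopic_to_id_def
  proof (intro conjI allI ballI exI)
    show "glinear S hg ig n S hg ig n (\<psi>' n)" for n
      unfolding \<psi>'_def
      by (rule glinear_diff[OF glinear_diff[OF \<psi>glinear glinear_comp[OF HS dk]] glinear_comp[OF \<delta>_glinear HS']])
    show "glinear S hg ig n S hg ig (n - 1) (\<lambda>x. k n x + H n x)" for n by (rule glinear_add[OF k HS])
    fix n x assume x: "x \<in> V n"
    have H0: "H (n + 1 + 1) 0 = 0" by (rule glinear_zero[OF H])
    have "\<delta> (\<delta> (H n x)) = 0" by (rule \<delta>\<delta>[OF glinearD(1)[OF HS x]])
    then show "\<psi>' (n + 1) (\<delta> x) = \<delta> (\<psi>' n x)"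
      using \<psi>d[OF x] \<delta>\<delta>[OF x] H0 by (simp add: \<psi>'_def lin_ext_minus)
    show "x - \<psi>' n x = \<delta> (k n x + H n x) + (k (n + 1) (\<delta> x) + H (n + 1) (\<delta> x))"
      using keq[OF x] by (simp add: \<psi>'_def lin_ext_add algebra_simps)
  qed
  moreover have "keys (\<psi>' n x) \<subseteq> E' \<union> {b. rk b < m}" if x: "x \<in> V n" for n x
  proof
    fix b assume "b \<in> keys (\<psi>' n x)"
    then have nz: "lookup (\<psi>' n x) b \<noteq> 0" by (simp add: in_keys_iff)
    show "b \<in> E' \<union> {b. rk b < m}"
    proof (rule ccontr)
      assume b: "b \<notin> E' \<union> {b. rk b < m}"
      have "keys (\<delta> (H n x)) \<subseteq> E \<union> {b. rk b < m}"
        using glinearD(1)[OF H x] by (intro kd[OF glinearD(1)[OF HS x]]) (auto simp: vec_def T_def)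
      then have 1: "lookup (\<delta> (H n x)) b = 0" using b by (auto simp: E'_def in_keys_iff)
      have Hk: "keys (H (n + 1) (\<delta> x)) \<subseteq> T" using glinearD(1)[OF H \<delta>_V[OF x]] by (auto simp: vec_def)
      have \<psi>k: "keys (\<psi> n x) \<subseteq> S" using glinearD(1)[OF \<psi>glinear x] by (auto simp: vec_def)
      show False
      proof (cases "b \<in> T")
        case True
        then have "cu b \<notin> J" using b E1(2) by (auto simp: C_def E'_def)
        then have "lookup (\<psi> n x) b = lookup (H (n + 1) (\<delta> x)) b"
          using Heq[OF x, of b] True by (simp add: lookup_vres)
        then show False using nz 1 by (simp add: \<psi>'_def lookup_minus)
      next
        case False
        then have "b \<notin> keys (\<psi> n x)" using b \<psi>E[OF x] \<psi>k by (fastforce simp: T_def E'_def)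
        moreover have "b \<notin> keys (H (n + 1) (\<delta> x))" using False Hk by blast
        ultimately show False using nz 1 by (simp add: \<psi>'_def lookup_minus in_keys_iff)
      qed
    qed
  qed
  ultimately show ?thesis by blast
qed

text \<open>Descend from the bounded rank \<open>M\<close> to rank \<open>0\<close>, below which there are no cells.\<close>

theorem finite_cells:
  "\<exists>E \<psi>. finite E \<and> E \<subseteq> S \<and> homotopic_to_id \<psi> \<and> (\<forall>n. \<forall>x\<in>V n. keys (\<psi> n x) \<subseteq> E)"
proof -
  obtain M \<psi> where \<psi>: "homotopic_to_id \<psi>" "\<forall>n. \<forall>x\<in>V n. keys (\<psi> n x) \<subseteq> {b. rk b < M}"
    using bounded_rank by blast
  have "\<exists>E \<psi>. finite E \<and> closed_cells E \<and> homotopic_to_id \<psi> \<and>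
      (\<forall>n. \<forall>x\<in>V n. keys (\<psi> n x) \<subseteq> E \<union> {b. rk b < m})" if "m \<le> M" for m
    using that
  proof (induction m rule: inc_induct)
    case base
    have "closed_cells {}" by (simp add: closed_cells_def)
    then show ?case using \<psi> by (intro exI[of _ "{}"] exI[of _ \<psi>]) simp
  next
    case (step m)
    then obtain E \<psi> where "finite E" "closed_cells E" "homotopic_to_id \<psi>"
      "\<And>n x. x \<in> V n \<Longrightarrow> keys (\<psi> n x) \<subseteq> E \<union> {b. rk b < Suc m}" by blast
    then show ?case by (rule lower_rank)
  qed
  from this[of 0] show ?thesis by (auto simp: closed_cells_def)
qed

end

section \<open>Nilpotence\<close>

context graded_coeff
begin

text \<open>Every finite set of coefficients lies in a subring in which the reduced homogeneous elements
  have bounded degree.\<close>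

definition locally_bounded :: bool where
  "locally_bounded \<longleftrightarrow> (\<forall>Z. finite Z \<longrightarrow> (\<exists>U D. Z \<subseteq> U \<and> 0 \<in> U \<and>
     (\<forall>p\<in>U. \<forall>q\<in>U. p + q \<in> U \<and> p * q \<in> U) \<and> (\<forall>p\<in>U. nf p \<in> U) \<and>
     (\<forall>p\<in>U. \<forall>d. prj d p = p \<longrightarrow> nf p = p \<longrightarrow> \<bar>d\<bar> > D \<longrightarrow> p = 0)))"

lemma mshift_free_mod: "mshift b (free_mod mk S hg ig n) = free_mod mk S hg (\<lambda>c. ig c + b) n"
proof -
  have "hvec S hg ig n (d - b) = hvec S hg (\<lambda>c. ig c + b) n d" for d
    by (simp add: hvec_def algebra_simps)
  then show ?thesis by (simp add: mshift_def free_mod_def)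
qed

end

context small_semifree
begin

abbreviation P :: "('a, 'u) cpx" where "P \<equiv> free_cpx mk1 S hg ig \<delta>"

lemma glinear_expand:
  assumes T: "glinear S hg ig' n S' hg' ig'' n' T" and x: "x \<in> vec S hg n"
  shows "T x = (\<Sum>c\<in>keys x. sm (lookup x c) (T (unit_vec c)))"
proof -
  have u: "unit_vec c \<in> vec S hg n" if "c \<in> keys x" for c
    by (rule unit_vec_vec) (use that x in \<open>auto simp: vec_def\<close>)
  have "T (\<Sum>c\<in>A. sm (lookup x c) (unit_vec c)) = (\<Sum>c\<in>A. sm (lookup x c) (T (unit_vec c)))"
    if "A \<subseteq> keys x" for A
    using finite_subset[OF that finite_keys] that
  proof (induction A rule: finite_induct)
    case empty
    then show ?case by (simp add: glinear_zero[OF T])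
  next
    case (insert c A)
    have "sm (lookup x c) (unit_vec c) \<in> vec S hg n" "(\<Sum>c\<in>A. sm (lookup x c) (unit_vec c)) \<in> vec S hg n"
      using insert.prems u by (auto intro!: vec_sum vec_sm)
    then show ?case using insert u by (simp add: glinearD(2)[OF T] glinearD(3)[OF T])
  qed
  moreover have "(\<Sum>c\<in>keys x. sm (lookup x c) (unit_vec c)) = x"
    using x by (intro vec_decomposition[symmetric]) (simp add: vec_def)
  ultimately show ?thesis by (metis subset_refl)
qed

text \<open>The composite of \<open>W\<close> with its shifts, on the level of vectors.\<close>

primrec iter :: "int \<Rightarrow> (int \<Rightarrow> ('c \<Rightarrow>\<^sub>0 'r) \<Rightarrow> 'c \<Rightarrow>\<^sub>0 'r) \<Rightarrow> nat \<Rightarrow> int \<Rightarrow> ('c \<Rightarrow>\<^sub>0 'r) \<Rightarrow> 'c \<Rightarrow>\<^sub>0 'r" where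
  "iter a W 0 n = W n"
| "iter a W (Suc m) n = (\<lambda>x. iter a W m n (W (n + int (Suc m) * a) x))"

lemma iter_glinear:
  assumes W: "\<And>n. glinear S hg (\<lambda>c. ig c + b) (n + a) S hg ig n (W n)"
  shows "glinear S hg (\<lambda>c. ig c + int (Suc m) * b) (n + int (Suc m) * a) S hg ig n (iter a W m n)"
proof (induction m)
  case (Suc m)
  let ?k = "n + int (Suc m) * a"
  have "glinear S hg (\<lambda>c. ig c + b + int (Suc m) * b) (?k + a) S hg (\<lambda>c. ig c + int (Suc m) * b) ?k (W ?k)"
  proof -
    have "hvec S hg (\<lambda>c. f c + e) n d = hvec S hg f n (d - e)" for f :: "'c \<Rightarrow> int" and e n d
      by (simp add: hvec_def algebra_simps)
    then show ?thesis using W[of ?k] unfolding glinear_def by simp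
  qed
  from glinear_comp[OF this Suc]
  show ?case by (simp add: algebra_simps)
qed (use W in simp)

text \<open>If \<open>a\<close> is nonzero, iterating leaves the finitely many cohomological degrees of \<open>E\<close>. If \<open>a = 0\<close>, the
  coefficients of the iterates stay in a bounded subring, but their degrees grow with \<open>b\<close>.\<close>

lemma iter_zero:
  assumes bounded: "locally_bounded" and E: "finite E" and ab: "(a, b) \<noteq> (0, 0)"
    and W: "\<And>n. glinear S hg (\<lambda>c. ig c + b) (n + a) S hg ig n (W n)"
    and WE: "\<And>n x. x \<in> V (n + a) \<Longrightarrow> keys (W n x) \<subseteq> E"
  shows "\<exists>m. \<forall>n. \<forall>x\<in>V (n + int (Suc m) * a). iter a W m n x = 0"
proof -
  have WV: "W n x \<in> V n" if "x \<in> V (n + a)" for n x using glinearD(1)[OF W that] .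
  have step: "n + int (Suc m) * a + a = n + int (Suc (Suc m)) * a" for n m by (simp add: algebra_simps)
  have iV: "iter a W m n x \<in> V n" if "x \<in> V (n + int (Suc m) * a)" for m n x
    by (rule glinearD(1)[OF iter_glinear[OF W] that])
  have iE: "keys (iter a W m n x) \<subseteq> E" if "x \<in> V (n + int (Suc m) * a)" for m n x
    using that
  proof (induction m arbitrary: x)
    case 0
    then show ?case using WE by simp
  next
    case (Suc m)
    have "W (n + int (Suc m) * a) x \<in> V (n + int (Suc m) * a)"
      by (rule WV) (use Suc.prems in \<open>simp only: step\<close>)
    then show ?case using Suc.IH by simp
  qed
  have i0: "iter a W m n 0 = 0" for m n by (rule glinear_zero[OF iter_glinear[OF W]])
  have bound: "\<exists>B\<ge>0. \<forall>c\<in>E. \<bar>f c\<bar> \<le> B" for f :: "'c \<Rightarrow> int"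
    using E by (intro exI[of _ "\<Sum>c\<in>E. \<bar>f c\<bar>"]) (auto intro: sum_nonneg member_le_sum)
  show ?thesis
  proof (cases "a = 0")
    case False
    obtain B where B: "B \<ge> 0" "\<And>c. c \<in> E \<Longrightarrow> \<bar>hg c\<bar> \<le> B" using bound[of hg] by blast
    define m where "m = nat (2 * B)"
    have "iter a W (Suc m) n x = 0" if x: "x \<in> V (n + int (Suc (Suc m)) * a)" for n x
    proof (rule ccontr)
      let ?k = "n + int (Suc m) * a"
      assume nz: "iter a W (Suc m) n x \<noteq> 0"
      have xk: "x \<in> V (?k + a)" using x by (simp only: step)
      have "W ?k x \<noteq> 0" using nz i0 by auto
      then obtain c where c: "c \<in> keys (W ?k x)" by fastforce
      have c1: "c \<in> E" "hg c = ?k" using WE[OF xk] WV[OF xk] c by (auto simp: vec_def)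
      obtain c' where c': "c' \<in> keys (iter a W (Suc m) n x)" using nz by fastforce
      have c2: "c' \<in> E" "hg c' = n" using iE[OF x] iV[OF x] c' by (auto simp: vec_def)
      have "\<bar>int (Suc m) * a\<bar> \<le> 2 * B" using B(2)[OF c1(1)] B(2)[OF c2(1)] c1(2) c2(2) by linarith
      moreover have "\<bar>int (Suc m) * a\<bar> \<ge> int (Suc m)" using False by (simp add: abs_mult mult_le_cancel_left1)
      ultimately show False using B(1) by (simp add: m_def)
    qed
    then show ?thesis by blast
  next
    case a: True
    then have b: "b \<noteq> 0" using ab by simp
    have W0: "glinear S hg (\<lambda>c. ig c + b) n S hg ig n (W n)" for n using W[of n] a by simp
    define Z where "Z = insert 1 ((\<lambda>(c, c'). lookup (W (hg c) (unit_vec c)) c') ` (E \<times> E))"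
    have "finite Z" using E by (simp add: Z_def)
    from bounded[unfolded locally_bounded_def, THEN spec, THEN mp, OF this]
    obtain U D where UD: "Z \<subseteq> U \<and> 0 \<in> U \<and>
       (\<forall>p\<in>U. \<forall>q\<in>U. p + q \<in> U \<and> p * q \<in> U) \<and> (\<forall>p\<in>U. nf p \<in> U) \<and>
       (\<forall>p\<in>U. \<forall>d. prj d p = p \<longrightarrow> nf p = p \<longrightarrow> \<bar>d\<bar> > D \<longrightarrow> p = 0)"
      by (elim exE) (rule that)
    then have Z: "Z \<subseteq> U" and U0: "0 \<in> U"
      and Uc: "\<And>p q. p \<in> U \<Longrightarrow> q \<in> U \<Longrightarrow> p + q \<in> U \<and> p * q \<in> U" and Un: "\<And>p. p \<in> U \<Longrightarrow> nf p \<in> U"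
      by simp_all
    have Ub: "p = 0" if "p \<in> U" "prj d p = p" "nf p = p" "\<bar>d\<bar> > D" for p d
      using UD that by simp
    define G where "G = (\<lambda>n d. {y \<in> hvec S hg ig n d. keys y \<subseteq> E \<and> (\<forall>c. lookup y c \<in> U)})"
    have hb: "hvec S hg (\<lambda>c. ig c + b) n (d + b) = hvec S hg ig n d" for n d by (simp add: hvec_def)
    have WG: "W n y \<in> G n (d + b)" if y: "y \<in> G n d" for n d y
    proof -
      have yh: "y \<in> hvec S hg ig n d" and yE: "keys y \<subseteq> E" and yU: "\<And>c. lookup y c \<in> U" using y by (auto simp: G_def)
      have yV: "y \<in> V n" by (rule hvec_vec[OF yh])
      have "W n y \<in> hvec S hg ig n (d + b)" using glinearD(4)[OF W0, of y n "d + b"] yh by (simp add: hb)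
      moreover have WyE: "keys (W n y) \<subseteq> E" using WE[of y n] yV a by simp
      moreover have "lookup (W n y) c' \<in> U" for c'
      proof (cases "c' \<in> E")
        case True
        have "lookup (W n y) c' = (\<Sum>c\<in>keys y. nf (lookup y c * lookup (W n (unit_vec c)) c'))"
          by (simp add: glinear_expand[OF W0 yV] lookup_sum lookup_sm)
        also have "\<dots> \<in> U"
        proof -
          have t: "nf (lookup y c * lookup (W n (unit_vec c)) c') \<in> U" if "c \<in> keys y" for c
          proof -
            have "hg c = n" "c \<in> E" using yV yE that by (auto simp: vec_def)
            then have "lookup (W n (unit_vec c)) c' \<in> U" using Z True unfolding Z_def by force
            then show ?thesis using Un Uc yU by blast
          qed
          have "(\<Sum>c\<in>A. nf (lookup y c * lookup (W n (unit_vec c)) c')) \<in> U" if "A \<subseteq> keys y" for A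
            using finite_subset[OF that finite_keys] that
            by (induction A rule: finite_induct) (use U0 Uc t in auto)
          then show ?thesis by blast
        qed
        finally show ?thesis .
      next
        case False
        then have "lookup (W n y) c' = 0" using WyE by (auto simp: in_keys_iff)
        then show ?thesis using U0 by simp
      qed
      ultimately show ?thesis by (simp add: G_def)
    qed
    have IG: "iter a W m n y \<in> G n (d + int (Suc m) * b)" if "y \<in> G n d" for m n d y
      using that
    proof (induction m arbitrary: y d)
      case 0
      then show ?case using WG by simp
    next
      case (Suc m)
      have "iter a W m n (W n y) \<in> G n (d + b + int (Suc m) * b)" by (rule Suc.IH[OF WG[OF Suc.prems]])
      then show ?case by (simp add: a algebra_simps)
    qed
    obtain B where B: "B \<ge> 0" "\<And>c. c \<in> E \<Longrightarrow> \<bar>ig c\<bar> \<le> B" using bound[of ig] by blast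
    define m where "m = nat (\<bar>D\<bar> + 2 * B)"
    have unit0: "iter a W m n (unit_vec c) = 0" if c: "c \<in> E" "c \<in> S" "hg c = n" for n c
    proof (rule poly_mapping_eqI)
      fix c'
      have "nf 1 \<in> U" using Z Un by (auto simp: Z_def)
      then have "unit_vec c \<in> G n (ig c)"
        using unit_vec_hvec[of c S hg n ig] c U0 by (auto simp: G_def unit_vec_def lookup_single when_def split: if_splits)
      then have g: "iter a W m n (unit_vec c) \<in> G n (ig c + int (Suc m) * b)" by (rule IG)
      show "lookup (iter a W m n (unit_vec c)) c' = lookup 0 c'"
      proof (cases "c' \<in> E")
        case True
        let ?d = "ig c + int (Suc m) * b - ig c'"
        have "\<bar>int (Suc m) * b\<bar> \<ge> int (Suc m)" using b by (simp add: abs_mult mult_le_cancel_left1)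
        then have "\<bar>?d\<bar> > D" using B(1) B(2)[OF c(1)] B(2)[OF True] by (simp add: m_def)
        then have "lookup (iter a W m n (unit_vec c)) c' = 0"
          using g by (intro Ub[of _ ?d]) (auto simp: G_def hvec_def vec_def normal_vec_def)
        then show ?thesis by simp
      next
        case False
        then show ?thesis using g by (auto simp: G_def in_keys_iff)
      qed
    qed
    have "iter a W (Suc m) n x = 0" if x: "x \<in> V (n + int (Suc (Suc m)) * a)" for n x
    proof -
      have xn: "x \<in> V n" using x a by simp
      have y: "W n x \<in> V n" "keys (W n x) \<subseteq> E" using WV[of x n] WE[of x n] xn a by simp_all
      have g: "glinear S hg (\<lambda>c. ig c + int (Suc m) * b) n S hg ig n (iter a W m n)" using iter_glinear[OF W, of m n] a by simp
      have "iter a W m n (W n x) = (\<Sum>c\<in>keys (W n x). sm (lookup (W n x) c) (iter a W m n (unit_vec c)))"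
        by (rule glinear_expand[OF g y(1)])
      also have "\<dots> = 0"
      proof (rule sum.neutral, rule ballI)
        fix c assume "c \<in> keys (W n x)"
        then have "c \<in> E" "c \<in> S" "hg c = n" using y by (auto simp: vec_def)
        then show "sm (lookup (W n x) c) (iter a W m n (unit_vec c)) = 0" by (simp add: unit0)
      qed
      finally show ?thesis by (simp add: a)
    qed
    then show ?thesis by blast
  qed
qed

primrec comp_shifts :: "int \<Rightarrow> 'u maps \<Rightarrow> nat \<Rightarrow> 'u maps" where
  "comp_shifts a \<gamma> 0 = \<gamma>"
| "comp_shifts a \<gamma> (Suc m) = comp_map (comp_shifts a \<gamma> m) (shift_map (int (Suc m) * a) \<gamma>)"

lemma P_complex: "cochain_complex L P" and F_complex: "cochain_complex L F"
  using resolutionD[OF res] by auto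

lemma Suc_shift:
  assumes "cochain_complex L A"
  shows "shift (int (Suc m) * a) (int (Suc m) * b) (shift a b A) = shift (int (Suc (Suc m)) * a) (int (Suc (Suc m)) * b) A"
  using shift_shift[OF assms, of "int (Suc m) * a" "int (Suc m) * b" a b] by (simp add: algebra_simps)

lemma comp_shifts_chain_map:
  assumes \<gamma>: "\<gamma> \<in> chain_map L (shift a b P) P"
  shows "comp_shifts a \<gamma> m \<in> chain_map L (shift (int (Suc m) * a) (int (Suc m) * b) P) P"
proof (induction m)
  case (Suc m)
  have "shift_map (int (Suc m) * a) \<gamma> \<in> chain_map L (shift (int (Suc (Suc m)) * a) (int (Suc (Suc m)) * b) P)
      (shift (int (Suc m) * a) (int (Suc m) * b) P)"
    using shift_map_chain_map[OF shift_complex[OF P_complex] P_complex \<gamma>, of "int (Suc m) * a" "int (Suc m) * b"]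
    by (simp only: Suc_shift[OF P_complex])
  from comp_map_chain_map[OF this Suc] show ?case by simp
qed (use \<gamma> in simp)

text \<open>The resolution of a shift of \<open>F\<close> is the shift of the resolution, so the lift of each factor to the
  resolutions is a shift of \<open>\<gamma>\<close>.\<close>

lemma iterate_eq_cls:
  assumes \<gamma>: "\<gamma> \<in> chain_map L (shift a b P) P"
    and g: "g = cls L (shift a b F) (shift a b P) (shift_map a p) F (comp_map p \<gamma>)"
  shows "iterate L a b F g m = cls L (shift (int (Suc m) * a) (int (Suc m) * b) F)
    (shift (int (Suc m) * a) (int (Suc m) * b) P) (shift_map (int (Suc m) * a) p) F (comp_map p (comp_shifts a \<gamma> m))"
proof (induction m)
  case 0
  then show ?case by (simp add: g)
next
  case (Suc m)
  let ?a = "int (Suc m) * a" and ?b = "int (Suc m) * b"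
  let ?a' = "int (Suc (Suc m)) * a" and ?b' = "int (Suc (Suc m)) * b"
  note pc = resolutionD(5)[OF res]
  have p\<gamma>: "comp_map p \<gamma> \<in> chain_map L (shift a b P) F" by (rule comp_map_chain_map[OF \<gamma> pc])
  have aa: "?a + a = ?a'" by (simp add: algebra_simps)
  have "dshift L ?a ?b (shift a b F) F g = cls L (shift ?a' ?b' F) (shift ?a' ?b' P) (shift_map ?a' p) (shift ?a ?b F)
      (shift_map ?a (comp_map p \<gamma>))"
    using dshift_cls[OF resolution_shift[OF res] F_complex p\<gamma>, of ?a ?b]
    unfolding g[symmetric] Suc_shift[OF F_complex] Suc_shift[OF P_complex] shift_map_shift_map aa .
  moreover have "dcomp L (shift ?a' ?b' F) (shift ?a ?b F) F
      (cls L (shift ?a ?b F) (shift ?a ?b P) (shift_map ?a p) F (comp_map p (comp_shifts a \<gamma> m)))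
      (cls L (shift ?a' ?b' F) (shift ?a' ?b' P) (shift_map ?a' p) (shift ?a ?b F) (shift_map ?a (comp_map p \<gamma>))) =
    cls L (shift ?a' ?b' F) (shift ?a' ?b' P) (shift_map ?a' p) F
      (comp_map (comp_map p (comp_shifts a \<gamma> m)) (shift_map ?a \<gamma>))"
  proof (rule dcomp_cls[OF resolution_shift[OF res] resolution_shift[OF res] F_complex])
    show f: "shift_map ?a (comp_map p \<gamma>) \<in> chain_map L (shift ?a' ?b' P) (shift ?a ?b F)"
      using shift_map_chain_map[OF shift_complex[OF P_complex] F_complex p\<gamma>, of ?a ?b] by (simp only: Suc_shift[OF P_complex])
    show "comp_map p (comp_shifts a \<gamma> m) \<in> chain_map L (shift ?a ?b P) F"
      by (rule comp_map_chain_map[OF comp_shifts_chain_map[OF \<gamma>] pc])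
    show "shift_map ?a \<gamma> \<in> chain_map L (shift ?a' ?b' P) (shift ?a ?b P)"
      using shift_map_chain_map[OF shift_complex[OF P_complex] P_complex \<gamma>, of ?a ?b] by (simp only: Suc_shift[OF P_complex])
    show "heq L (shift ?a' ?b' P) (shift ?a ?b F) (comp_map (shift_map ?a p) (shift_map ?a \<gamma>)) (shift_map ?a (comp_map p \<gamma>))"
      using heq_refl[OF shift_complex[OF P_complex] shift_complex[OF F_complex] f] by (simp only: shift_map_comp)
  qed
  ultimately show ?case by (simp add: Suc comp_map_assoc)
qed

lemma comp_shifts_heq:
  assumes h: "heq L (shift a b P) P \<gamma> \<omega>"
  shows "heq L (shift (int (Suc m) * a) (int (Suc m) * b) P) P (comp_shifts a \<gamma> m) (comp_shifts a \<omega> m)"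
proof (induction m)
  case (Suc m)
  let ?a = "int (Suc m) * a" and ?b = "int (Suc m) * b"
  have s: "heq L (shift (int (Suc (Suc m)) * a) (int (Suc (Suc m)) * b) P) (shift ?a ?b P) (shift_map ?a \<gamma>) (shift_map ?a \<omega>)"
    using shift_heq[OF h, of ?a ?b] by (simp only: Suc_shift[OF P_complex])
  show ?case
    using heq_trans[OF heq_left[OF s P_complex heqD(3)[OF Suc]] heq_right[OF Suc heqD(1)[OF s] heqD(4)[OF s]]] by simp
qed (use h in simp)

text \<open>Represent \<open>g\<close> by \<open>\<gamma>\<close> and replace \<open>\<gamma>\<close> by the homotopic map \<open>\<omega> = \<phi> \<gamma>\<close>, where \<open>\<phi>\<close> is the finite map that is
  homotopic to the identity. The values of \<open>\<omega>\<close> lie in the span of \<open>E\<close>, so some iterate vanishes on the nose.\<close>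

theorem self_map_nilpotent:
  assumes bounded: "locally_bounded" and ab: "(a, b) \<noteq> (0, 0)" and g: "g \<in> carrier (dhom L (shift a b F) F)"
  shows "nilpotent_map L a b F g"
proof -
  note res' = resolution_shift[OF res, of a b] and pc = resolutionD(5)[OF res]
  have inv: "the_inv mk1 (mk1 x) = x" for x using inj1 by (simp add: the_inv_f_f)
  obtain g0 where g0: "g0 \<in> chain_map L (shift a b P) F" "g = cls L (shift a b F) (shift a b P) (shift_map a p) F g0"
    using g unfolding carrier_dhom[OF res' F_complex] by blast
  obtain \<gamma> where \<gamma>: "\<gamma> \<in> chain_map L (shift a b P) P" "heq L (shift a b P) F (comp_map p \<gamma>) g0"
    using kproj_lift[OF resolutionD(2)[OF res'] P_complex F_complex resolutionD(4)[OF res] g0(1)] .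
  have g\<gamma>: "g = cls L (shift a b F) (shift a b P) (shift_map a p) F (comp_map p \<gamma>)"
    unfolding g0(2) using cls_eq_iff[OF res' F_complex heqD(3,4)[OF \<gamma>(2)]] \<gamma>(2) by simp
  obtain E \<psi> where E: "finite E" "homotopic_to_id \<psi>" "\<forall>n. \<forall>x\<in>V n. keys (\<psi> n x) \<subseteq> E"
    using finite_cells by blast
  obtain k where k: "\<And>n. glinear S hg ig n S hg ig (n - 1) (k n)"
    and keq: "\<And>n x. x \<in> V n \<Longrightarrow> x - \<psi> n x = \<delta> (k n x) + k (n + 1) (\<delta> x)"
    and \<psi>: "\<And>n. glinear S hg ig n S hg ig n (\<psi> n)" "\<And>n x. x \<in> V n \<Longrightarrow> \<psi> (n + 1) (\<delta> x) = \<delta> (\<psi> n x)"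
    using E(2) unfolding homotopic_to_id_def by blast
  define \<phi> where "\<phi> = (\<lambda>n u. mk1 (\<psi> n (the_inv mk1 u)))"
  have \<phi>: "\<phi> \<in> chain_map L P P" unfolding chain_map_def
  proof (intro CollectI conjI allI ballI)
    show "\<phi> n \<in> gmod_hom L (obj P n) (obj P n)" for n
      unfolding \<phi>_def free_cpx_simps(1) by (rule glinear_imp_hom[OF inj1 inj1 \<psi>(1)])
    fix n u assume "u \<in> carrier (obj P n)"
    then show "\<phi> (n + 1) (dif P n u) = dif P n (\<phi> n u)"
      by (auto simp: free_mod_simps \<phi>_def inv \<psi>(2))
  qed
  have \<phi>id: "heq L P P id_map \<phi>"
    unfolding heq_def
  proof (intro conjI P_complex \<phi> id_map_chain_map homotopicI)
    show "(\<lambda>u. mk1 (k n (the_inv mk1 u))) \<in> gmod_hom L (obj P n) (obj P (n - 1))" for n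
      unfolding free_cpx_simps(1) by (rule glinear_imp_hom[OF inj1 inj1 k])
    fix n u assume "u \<in> carrier (obj P n)"
    then obtain x where x: "x \<in> V n" "u = mk1 x" by (auto simp: free_mod_simps)
    show "id_map n u \<ominus>\<^bsub>obj P n\<^esub> \<phi> n u = dif P (n - 1) (mk1 (k n (the_inv mk1 u)))
        \<oplus>\<^bsub>obj P n\<^esub> mk1 (k (n + 1) (the_inv mk1 (dif P n u)))"
      using keq[OF x(1)] by (simp add: x id_map_def \<phi>_def inv free_mod_ops[OF inj1] free_mod_minus(2)[OF inj1 glinearD(1)[OF \<psi>(1) x(1)] x(1)])
  qed
  define \<omega> where "\<omega> = comp_map \<phi> \<gamma>"
  have \<gamma>\<omega>: "heq L (shift a b P) P \<gamma> \<omega>"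
    using heq_right[OF \<phi>id shift_complex[OF P_complex] \<gamma>(1)] by (simp add: \<omega>_def)
  define W where "W = (\<lambda>n x. the_inv mk1 (\<omega> n (mk1 x)))"
  have \<omega>hom: "\<omega> n \<in> gmod_hom L (free_mod mk1 S hg (\<lambda>c. ig c + b) (n + a)) (free_mod mk1 S hg ig n)" for n
    using chain_mapD(1)[OF heqD(4)[OF \<gamma>\<omega>], of n] by (simp add: mshift_free_mod)
  have \<gamma>hom: "\<gamma> n \<in> gmod_hom L (free_mod mk1 S hg (\<lambda>c. ig c + b) (n + a)) (free_mod mk1 S hg ig n)" for n
    using chain_mapD(1)[OF \<gamma>(1), of n] by (simp add: mshift_free_mod)
  have W: "glinear S hg (\<lambda>c. ig c + b) (n + a) S hg ig n (W n)" for n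
    unfolding W_def by (rule hom_imp_glinear(1)[OF inj1 inj1 \<omega>hom])
  have mkW: "mk1 (W n x) = \<omega> n (mk1 x)" if "x \<in> V (n + a)" for n x
    unfolding W_def by (rule hom_imp_glinear(2)[OF inj1 inj1 \<omega>hom that])
  have WE: "keys (W n x) \<subseteq> E" if x: "x \<in> V (n + a)" for n x
  proof -
    obtain y where y: "y \<in> V n" "\<gamma> n (mk1 x) = mk1 y"
      using gmod_homD(1)[OF \<gamma>hom, of "mk1 x" n] x by (auto simp: free_mod_simps)
    have "W n x = \<psi> n y" by (simp add: W_def \<omega>_def comp_map_def y(2) \<phi>_def inv)
    then show ?thesis using E(3) y(1) by simp
  qed
  have comp: "comp_shifts a \<omega> m n (mk1 x) = mk1 (iter a W m n x)" if "x \<in> V (n + int (Suc m) * a)" for m n x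
    using that
  proof (induction m arbitrary: x)
    case 0
    then show ?case by (simp add: mkW)
  next
    case (Suc m)
    let ?k = "n + int (Suc m) * a"
    have x: "x \<in> V (?k + a)" using Suc.prems by (simp add: algebra_simps)
    show ?case using Suc.IH[OF glinearD(1)[OF W x]] mkW[OF x] by (simp add: comp_map_def shift_map_def)
  qed
  obtain m where m: "\<And>n x. x \<in> V (n + int (Suc m) * a) \<Longrightarrow> iter a W m n x = 0"
    using iter_zero[OF bounded E(1) ab W WE] by blast
  let ?a = "int (Suc m) * a" and ?b = "int (Suc m) * b"
  note resm = resolution_shift[OF res, of ?a ?b]
  note Pm = shift_complex[OF P_complex, of ?a ?b]
  have \<Omega>: "comp_shifts a \<omega> m \<in> chain_map L (shift ?a ?b P) P" by (rule comp_shifts_chain_map[OF heqD(4)[OF \<gamma>\<omega>]])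
  have "heq L (shift ?a ?b P) F (comp_map p (comp_shifts a \<omega> m)) (zero_map F)"
  proof (rule heq_pointwise[OF Pm F_complex comp_map_chain_map[OF \<Omega> pc] zero_map_chain_map[OF Pm F_complex]])
    fix n u assume "u \<in> carrier (obj (shift ?a ?b P) n)"
    then obtain x where x: "x \<in> V (n + ?a)" "u = mk1 x" by (auto simp: free_mod_simps)
    have "comp_shifts a \<omega> m n u = mk1 0" unfolding x(2) comp[OF x(1)] m[OF x(1)] ..
    moreover have "p n (mk1 0) = \<zero>\<^bsub>obj F n\<^esub>"
      using gmod_hom_zero_neg(1)[OF cochain_complexD(1)[OF P_complex] cochain_complexD(1)[OF F_complex] chain_mapD(1)[OF pc], of n]
      by (simp add: free_mod_simps)
    ultimately show "comp_map p (comp_shifts a \<omega> m) n u = zero_map F n u" by (simp add: comp_map_def zero_map_def)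
  qed
  then have "heq L (shift ?a ?b P) F (comp_map p (comp_shifts a \<gamma> m)) (zero_map F)"
    using heq_trans[OF heq_left[OF comp_shifts_heq[OF \<gamma>\<omega>] F_complex pc]] by blast
  then have "iterate L a b F g m = \<one>\<^bsub>dhom L (shift ?a ?b F) F\<^esub>"
    unfolding iterate_eq_cls[OF \<gamma>(1) g\<gamma>] one_dhom[OF resm F_complex]
    using cls_eq_iff[OF resm F_complex] heqD(3,4) by blast
  then show ?thesis unfolding nilpotent_map_def by blast
qed

end

section \<open>The truncated polynomial algebra has normal forms\<close>

definition restr :: "('m \<Rightarrow> bool) \<Rightarrow> ('m \<Rightarrow>\<^sub>0 'k::zero) \<Rightarrow> 'm \<Rightarrow>\<^sub>0 'k" where
  "restr Q p = Poly_Mapping.mapp (\<lambda>m q. if Q m then q else 0) p"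

lemma lookup_restr: "lookup (restr Q p) m = (if Q m then lookup p m else 0)"
  by (simp add: restr_def lookup_mapp when_def in_keys_iff)

lemma restr_add: "restr Q (p + q) = restr Q p + restr Q (q :: 'm \<Rightarrow>\<^sub>0 'k::monoid_add)"
  by (rule poly_mapping_eqI) (simp add: lookup_restr lookup_add)

lemma restr_eq_self_iff: "restr Q p = p \<longleftrightarrow> (\<forall>m\<in>keys p. Q m)"
  by (auto simp: poly_mapping_eq_iff fun_eq_iff lookup_restr in_keys_iff)

lemma restr_eq_0_iff: "restr Q p = 0 \<longleftrightarrow> (\<forall>m\<in>keys p. \<not> Q m)"
  by (auto simp: poly_mapping_eq_iff fun_eq_iff lookup_restr in_keys_iff)

lemma restr_commute: "restr Q (restr R p) = restr R (restr Q p)"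
  by (rule poly_mapping_eqI) (simp add: lookup_restr)

definition reduced :: "(nat \<Rightarrow> nat) \<Rightarrow> (nat \<Rightarrow>\<^sub>0 nat) \<Rightarrow> bool" where
  "reduced n m \<longleftrightarrow> (\<forall>j. lookup m j < n (j + 1))"

definition hpart :: "int \<Rightarrow> 'k::field poly_inf \<Rightarrow> 'k poly_inf" where
  "hpart d = restr (\<lambda>m. int (mono_degree m) = d)"

lemma mono_degree_superset:
  "finite A \<Longrightarrow> keys m \<subseteq> A \<Longrightarrow> mono_degree m = (\<Sum>j\<in>A. lookup m j * 2 ^ (j + 1))"
  unfolding mono_degree_def by (rule sum.mono_neutral_left) (auto simp: in_keys_iff)

lemma mono_degree_add: "mono_degree (m + m') = mono_degree m + mono_degree m'"
proof -
  let ?A = "keys m \<union> keys m'"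
  have "mono_degree (m + m') = (\<Sum>j\<in>?A. lookup (m + m') j * 2 ^ (j + 1))"
    by (rule mono_degree_superset) (auto simp: keys_add)
  also have "\<dots> = (\<Sum>j\<in>?A. lookup m j * 2 ^ (j + 1)) + (\<Sum>j\<in>?A. lookup m' j * 2 ^ (j + 1))"
    by (simp add: lookup_add sum.distrib algebra_simps)
  also have "\<dots> = mono_degree m + mono_degree m'"
    by (subst (1 2) mono_degree_superset[of ?A]) auto
  finally show ?thesis .
qed

lemma indet_power: "(indet i ^ k :: 'k::field poly_inf) = Poly_Mapping.single (Poly_Mapping.single (i - 1) k) 1"
proof (induction k)
  case (Suc k)
  have "Poly_Mapping.single (i - 1) 1 + Poly_Mapping.single (i - 1) k = Poly_Mapping.single (i - 1) (Suc k)"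
    by (simp add: single_add[symmetric])
  then show ?case using Suc by (simp add: indet_def mult_single)
qed simp

abbreviation polys :: "'k::field poly_inf ring" where "polys \<equiv> ring_of_type_algebra"

lemma polys_simps:
  "carrier polys = UNIV" "x \<oplus>\<^bsub>polys\<^esub> y = x + y" "x \<otimes>\<^bsub>polys\<^esub> y = x * y" "\<zero>\<^bsub>polys\<^esub> = 0" "\<one>\<^bsub>polys\<^esub> = 1"
  by (simp_all add: ring_of_type_algebra_def)

lemma polys_cring: "cring (polys :: 'k::field poly_inf ring)"
  by (rule cring_from_type_algebra)

lemma polys_minus: "x \<ominus>\<^bsub>polys\<^esub> y = x - (y :: 'k::field poly_inf)"
proof -
  interpret cring "polys :: 'k poly_inf ring" by (rule polys_cring)
  have "\<ominus>\<^bsub>polys\<^esub> y = - y" by (rule minus_equality) (simp_all add: polys_simps)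
  then show ?thesis by (simp add: a_minus_def polys_simps)
qed

lemma trunc_ideal_ideal: "ideal (trunc_ideal n) (polys :: 'k::field poly_inf ring)"
proof -
  interpret cring "polys :: 'k poly_inf ring" by (rule polys_cring)
  show ?thesis unfolding trunc_ideal_def by (rule genideal_ideal) (simp add: polys_simps)
qed

text \<open>The ideal consists of the polynomials without reduced monomials.\<close>

lemma mem_trunc_ideal_iff: "p \<in> trunc_ideal n \<longleftrightarrow> restr (reduced n) (p :: 'k::field poly_inf) = 0"
proof
  interpret R: cring "polys :: 'k poly_inf ring" by (rule polys_cring)
  let ?J = "{p :: 'k poly_inf. \<forall>m\<in>keys p. \<not> reduced n m}"
  have up: "\<not> reduced n (m + m')" if "\<not> reduced n m'" for m m'
    using that by (auto simp: reduced_def lookup_add) (meson le_trans linorder_not_less trans_le_add2)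
  have J_mult: "x * p \<in> ?J" if "p \<in> ?J" for x p
  proof -
    have "keys (x * p) \<subseteq> {a + b | a b. a \<in> keys x \<and> b \<in> keys p}" by (rule keys_mult)
    then show ?thesis using that up by blast
  qed
  have "subgroup ?J (add_monoid polys)"
  proof (rule R.add.subgroupI)
    show "?J \<noteq> {}" by (auto intro!: exI[of _ 0])
    fix p q :: "'k poly_inf" assume p: "p \<in> ?J" and q: "q \<in> ?J"
    show "p \<oplus>\<^bsub>polys\<^esub> q \<in> ?J" using p q keys_add[of p q] by (auto simp: polys_simps)
    have "\<ominus>\<^bsub>polys\<^esub> p = - p" using polys_minus[of 0 p] by (simp add: a_minus_def polys_simps)
    then show "\<ominus>\<^bsub>polys\<^esub> p \<in> ?J" using p by (simp add: in_keys_iff)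
  qed (simp add: polys_simps)
  then have J: "ideal ?J polys"
    by (intro idealI R.ring_axioms) (use J_mult in \<open>auto simp: polys_simps mult.commute\<close>)
  assume "p \<in> trunc_ideal n"
  moreover have "{indet i ^ n i |i. i \<ge> 1} \<subseteq> ?J"
  proof safe
    fix i m assume i: "i \<ge> (1 :: nat)" and m: "m \<in> keys (indet i ^ n i :: 'k poly_inf)" and r: "reduced n m"
    have "m = Poly_Mapping.single (i - 1) (n i)" using m by (simp add: indet_power)
    moreover have "lookup m (i - 1) < n (i - 1 + 1)" using r unfolding reduced_def by blast
    ultimately show False using i by simp
  qed
  ultimately have "p \<in> ?J" using J by (auto simp: trunc_ideal_def genideal_def)
  then show "restr (reduced n) p = 0" by (simp add: restr_eq_0_iff)
next
  interpret R: cring "polys :: 'k poly_inf ring" by (rule polys_cring)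
  interpret I: ideal "trunc_ideal n" "polys :: 'k poly_inf ring" by (rule trunc_ideal_ideal)
  assume "restr (reduced n) p = 0"
  then have nr: "\<not> reduced n m" if "m \<in> keys p" for m using that by (simp add: restr_eq_0_iff)
  have one: "Poly_Mapping.single m c \<in> trunc_ideal n" if normal_vec: "\<not> reduced n m" for m and c :: 'k
  proof -
    obtain j where j: "n (j + 1) \<le> lookup m j" using normal_vec by (auto simp: reduced_def not_less)
    define m' where "m' = m - Poly_Mapping.single j (n (j + 1))"
    have "m = m' + Poly_Mapping.single j (n (j + 1))"
      using j by (intro poly_mapping_eqI) (auto simp: m'_def lookup_add lookup_minus lookup_single when_def)
    then have "Poly_Mapping.single m c = Poly_Mapping.single m' c * indet (j + 1) ^ n (j + 1)"
      by (simp add: indet_power mult_single)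
    moreover have "(indet (j + 1) ^ n (j + 1) :: 'k poly_inf) \<in> trunc_ideal n"
      unfolding trunc_ideal_def by (rule subsetD[OF R.genideal_self]) (auto simp: polys_simps intro!: exI[of _ "j + 1"])
    ultimately show ?thesis using I.I_l_closed[of "indet (j + 1) ^ n (j + 1)" "Poly_Mapping.single m' c"]
      by (simp add: polys_simps)
  qed
  have "(\<Sum>m\<in>A. Poly_Mapping.single m (lookup p m)) \<in> trunc_ideal n" if "A \<subseteq> keys p" for A
    using finite_subset[OF that finite_keys] that
  proof (induction A rule: finite_induct)
    case empty
    then show ?case using I.zero_closed by (simp add: polys_simps)
  next
    case (insert m A)
    then show ?case using I.a_closed[OF one[OF nr[of m]], of _ "lookup p m"] by (simp add: polys_simps)
  qed
  moreover have "p = (\<Sum>m\<in>keys p. Poly_Mapping.single m (lookup p m))"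
    by (rule poly_mapping_eqI) (simp add: lookup_sum lookup_single when_def in_keys_iff)
  ultimately show "p \<in> trunc_ideal n" by (metis subset_refl)
qed

definition tcl :: "(nat \<Rightarrow> nat) \<Rightarrow> 'k::field poly_inf \<Rightarrow> 'k poly_inf set" where
  "tcl n p = trunc_ideal n +>\<^bsub>polys\<^esub> p"

lemma tcl_eq_iff: "tcl n p = tcl n q \<longleftrightarrow> restr (reduced n) p = restr (reduced n) (q :: 'k::field poly_inf)"
proof -
  interpret R: cring "polys :: 'k poly_inf ring" by (rule polys_cring)
  have "tcl n p = tcl n q \<longleftrightarrow> p - q \<in> trunc_ideal n"
    using R.quotient_eq_iff_same_a_r_cos[OF trunc_ideal_ideal, of p q n]
    by (simp add: tcl_def polys_simps polys_minus)
  also have "\<dots> \<longleftrightarrow> restr (reduced n) p = restr (reduced n) q"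
    unfolding mem_trunc_ideal_iff
    by (simp add: poly_mapping_eq_iff fun_eq_iff lookup_restr lookup_minus)
  finally show ?thesis .
qed

lemma trunc_alg_simps:
  fixes p q :: "'k::field poly_inf"
  shows "carrier (trunc_alg n :: 'k poly_inf set gring) = range (tcl n)"
    "tcl n p \<oplus>\<^bsub>trunc_alg n\<^esub> tcl n q = tcl n (p + q)"
    "tcl n p \<otimes>\<^bsub>trunc_alg n\<^esub> tcl n q = tcl n (p * q)"
    "\<zero>\<^bsub>trunc_alg n\<^esub> = tcl n (0 :: 'k poly_inf)" "\<one>\<^bsub>trunc_alg n\<^esub> = tcl n (1 :: 'k poly_inf)"
    "rdeg (trunc_alg n) d = tcl n ` {p :: 'k poly_inf. hpart d p = p}"
proof -
  interpret R: cring "polys :: 'k poly_inf ring" by (rule polys_cring)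
  interpret I: ideal "trunc_ideal n" "polys :: 'k poly_inf ring" by (rule trunc_ideal_ideal)
  note hom = I.rcos_ring_hom
  show "carrier (trunc_alg n :: 'k poly_inf set gring) = range (tcl n)"
    by (auto simp: trunc_alg_def ring.defs gring.defs FactRing_def A_RCOSETS_def' tcl_def polys_simps)
  show "tcl n p \<oplus>\<^bsub>trunc_alg n\<^esub> tcl n q = tcl n (p + q)"
    using ring_hom_add[OF hom, of p q] by (simp add: trunc_alg_def ring.defs gring.defs tcl_def polys_simps)
  show "tcl n p \<otimes>\<^bsub>trunc_alg n\<^esub> tcl n q = tcl n (p * q)"
    using ring_hom_mult[OF hom, of p q] by (simp add: trunc_alg_def ring.defs gring.defs tcl_def polys_simps)
  show "\<one>\<^bsub>trunc_alg n\<^esub> = tcl n (1 :: 'k poly_inf)"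
    using ring_hom_one[OF hom] by (simp add: trunc_alg_def ring.defs gring.defs tcl_def polys_simps)
  have "\<zero>\<^bsub>(polys :: 'k poly_inf ring) Quot trunc_ideal n\<^esub> = trunc_ideal n +>\<^bsub>polys\<^esub> \<zero>\<^bsub>polys\<^esub>"
    using I.a_rcos_const[of "\<zero>\<^bsub>polys\<^esub>"] I.zero_closed by (simp add: FactRing_def)
  then show "\<zero>\<^bsub>trunc_alg n\<^esub> = tcl n (0 :: 'k poly_inf)"
    by (simp add: trunc_alg_def ring.defs gring.defs tcl_def polys_simps)
  show "rdeg (trunc_alg n) d = tcl n ` {p :: 'k poly_inf. hpart d p = p}"
    by (auto simp: trunc_alg_def ring.defs gring.defs tcl_def hpart_def restr_eq_self_iff homogeneous_poly_def)
qed

lemma trunc_alg_cring: "cring (trunc_alg n :: 'k::field poly_inf set gring)"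
proof (rule cringI)
  show "abelian_group (trunc_alg n :: 'k poly_inf set gring)"
  proof (rule abelian_groupI)
    fix x :: "'k poly_inf set" assume "x \<in> carrier (trunc_alg n)"
    then obtain p where "x = tcl n p" by (auto simp: trunc_alg_simps)
    then show "\<exists>y\<in>carrier (trunc_alg n). y \<oplus>\<^bsub>trunc_alg n\<^esub> x = \<zero>\<^bsub>trunc_alg n\<^esub>"
      by (intro bexI[of _ "tcl n (- p)"]) (auto simp: trunc_alg_simps)
  qed (auto simp: trunc_alg_simps add_ac)
  show "Group.comm_monoid (trunc_alg n :: 'k poly_inf set gring)"
    by (rule comm_monoidI) (auto simp: trunc_alg_simps mult_ac)
qed (auto simp: trunc_alg_simps distrib_right)

lemma hpart_sum: "(\<Sum>d | hpart d p \<noteq> 0. hpart d p) = p" and hpart_finite: "finite {d. hpart d p \<noteq> 0}"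
proof -
  have sub: "{d. hpart d p \<noteq> 0} \<subseteq> (\<lambda>m. int (mono_degree m)) ` keys p"
    by (auto simp: hpart_def restr_eq_0_iff)
  then show fin: "finite {d. hpart d p \<noteq> 0}" by (rule finite_subset) simp
  show "(\<Sum>d | hpart d p \<noteq> 0. hpart d p) = p"
  proof (rule poly_mapping_eqI)
    fix m
    have "lookup (\<Sum>d | hpart d p \<noteq> 0. hpart d p) m = (\<Sum>d | hpart d p \<noteq> 0. if int (mono_degree m) = d then lookup p m else 0)"
      by (simp add: lookup_sum hpart_def lookup_restr)
    also have "\<dots> = lookup p m"
    proof (cases "m \<in> keys p")
      case True
      then have "hpart (int (mono_degree m)) p \<noteq> 0" by (auto simp: hpart_def restr_eq_0_iff)
      then show ?thesis using fin by simp
    next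
      case False
      then have "lookup p m = 0" by (simp add: in_keys_iff)
      then show ?thesis by (simp cong: if_cong)
    qed
    finally show "lookup (\<Sum>d | hpart d p \<noteq> 0. hpart d p) m = lookup p m" .
  qed
qed

lemma trunc_alg_graded_coeff:
  "graded_coeff (trunc_alg n :: 'k::field poly_inf set gring) (tcl n) (restr (reduced n)) hpart"
proof (rule graded_coeff.intro)
  fix p q :: "'k poly_inf" and d e :: int
  show "cring (trunc_alg n :: 'k poly_inf set gring)" by (rule trunc_alg_cring)
  show "carrier (trunc_alg n :: 'k poly_inf set gring) = range (tcl n)" by (rule trunc_alg_simps)
  show "tcl n (p + q) = tcl n p \<oplus>\<^bsub>trunc_alg n\<^esub> tcl n q" "tcl n (p * q) = tcl n p \<otimes>\<^bsub>trunc_alg n\<^esub> tcl n q"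
    "tcl n (1 :: 'k poly_inf) = \<one>\<^bsub>trunc_alg n\<^esub>" by (simp_all add: trunc_alg_simps)
  show "restr (reduced n) p = restr (reduced n) q \<longleftrightarrow> tcl n p = tcl n q" by (simp add: tcl_eq_iff)
  show "tcl n (restr (reduced n) p) = tcl n p"
    unfolding tcl_eq_iff by (rule poly_mapping_eqI) (simp add: lookup_restr)
  show "restr (reduced n) (p + q) = restr (reduced n) p + restr (reduced n) q" by (rule restr_add)
  show "rdeg (trunc_alg n) d = tcl n ` {p :: 'k poly_inf. hpart d p = p}" by (rule trunc_alg_simps)
  show "hpart d (p + q) = hpart d p + hpart d q" by (simp add: hpart_def restr_add)
  show "hpart d (hpart e p) = (if d = e then hpart e p else 0)"
    by (rule poly_mapping_eqI) (auto simp: hpart_def lookup_restr)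
  show "finite {d. hpart d p \<noteq> 0}" "(\<Sum>d | hpart d p \<noteq> 0. hpart d p) = p" by (rule hpart_finite hpart_sum)+
  show "hpart 0 1 = (1 :: 'k poly_inf)" by (simp add: hpart_def restr_eq_self_iff mono_degree_def)
  show "hpart (d + e) (p * q) = p * q" if "hpart d p = p" "hpart e q = q"
  proof -
    have "keys (p * q) \<subseteq> {a + b | a b. a \<in> keys p \<and> b \<in> keys q}" by (rule keys_mult)
    then show ?thesis using that unfolding hpart_def restr_eq_self_iff by (auto simp: mono_degree_add)
  qed
  show "restr (reduced n) (hpart d p) = hpart d (restr (reduced n) p)" unfolding hpart_def by (rule restr_commute)
qed

text \<open>Finitely many polynomials involve finitely many variables, and a reduced monomial in the first
  \<open>M\<close> variables has bounded degree. This is where the truncation is used.\<close>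

lemma trunc_alg_locally_bounded:
  "graded_coeff.locally_bounded (restr (reduced n)) (hpart :: int \<Rightarrow> 'k::field poly_inf \<Rightarrow> _)"
proof -
  interpret graded_coeff "trunc_alg n :: 'k poly_inf set gring" "tcl n" "restr (reduced n)" hpart
    by (rule trunc_alg_graded_coeff)
  show ?thesis unfolding locally_bounded_def
  proof (intro allI impI)
    fix Z :: "'k poly_inf set" assume Z: "finite Z"
    have "finite (\<Union>p\<in>Z. \<Union>m\<in>keys p. keys m)" using Z by auto
    then obtain M where M: "\<forall>j\<in>(\<Union>p\<in>Z. \<Union>m\<in>keys p. keys m). j < M"
      unfolding finite_nat_set_iff_bounded by (rule exE)
    define U where "U = {p :: 'k poly_inf. \<forall>m\<in>keys p. keys m \<subseteq> {..<M}}"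
    define D where "D = (\<Sum>j<M. n (j + 1) * 2 ^ (j + 1))"
    have f1: "Z \<subseteq> U" using M by (auto simp: U_def)
    have f2: "0 \<in> U" by (simp add: U_def)
    have f3: "p + q \<in> U \<and> p * q \<in> U" if "p \<in> U" "q \<in> U" for p q
    proof
      show "p + q \<in> U" using that keys_add[of p q] unfolding U_def by blast
      show "p * q \<in> U" unfolding U_def
      proof (intro CollectI ballI)
        fix m assume "m \<in> keys (p * q)"
        then obtain a b where "m = a + b" "a \<in> keys p" "b \<in> keys q" using keys_mult[of p q] by blast
        then show "keys m \<subseteq> {..<M}" using that keys_add[of a b] unfolding U_def by blast
      qed
    qed
    have f4: "restr (reduced n) p \<in> U" if "p \<in> U" for p
      using that by (auto simp: U_def in_keys_iff lookup_restr split: if_splits)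
    have f5: "p = 0" if p: "p \<in> U" and d: "hpart d p = p" and r: "restr (reduced n) p = p" and D: "\<bar>d\<bar> > int D" for p d
    proof (rule ccontr)
      assume "p \<noteq> 0"
      then obtain m where m: "m \<in> keys p" by fastforce
      have "mono_degree m = (\<Sum>j<M. lookup m j * 2 ^ (j + 1))"
        by (rule mono_degree_superset) (use p m in \<open>auto simp: U_def\<close>)
      also have "\<dots> \<le> D" unfolding D_def
      proof (rule sum_mono)
        fix j assume "j \<in> {..<M}"
        have "lookup m j < n (j + 1)" using r m by (simp add: restr_eq_self_iff reduced_def)
        then show "lookup m j * 2 ^ (j + 1) \<le> n (j + 1) * 2 ^ (j + 1)" by simp
      qed
      finally have "int (mono_degree m) \<le> int D" by simp
      moreover have "int (mono_degree m) = d" using d m by (simp add: hpart_def restr_eq_self_iff)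
      ultimately show False using D by linarith
    qed
    show "\<exists>U D. Z \<subseteq> U \<and> 0 \<in> U \<and> (\<forall>p\<in>U. \<forall>q\<in>U. p + q \<in> U \<and> p * q \<in> U) \<and>
        (\<forall>p\<in>U. restr (reduced n) p \<in> U) \<and>
        (\<forall>p\<in>U. \<forall>d. hpart d p = p \<longrightarrow> restr (reduced n) p = p \<longrightarrow> \<bar>d\<bar> > D \<longrightarrow> p = 0)"
      using f1 f2 f3 f4 f5
      by (intro exI[of _ U] exI[of _ "int D"] conjI ballI allI impI) (assumption | blast)+
  qed
qed

section \<open>Room in the universe\<close>

text \<open>Cells are finite trees that are labelled by elements of \<open>'u\<close>, integers and coefficients, and vectors
  are finite lists of labelled cells. Since \<open>'u\<close> is infinite and there are only countably many coefficients,
  all of these can be coded by elements of \<open>'u\<close>.\<close>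

lemma ex_inj_pair:
  assumes "infinite (UNIV :: 'u set)"
  shows "\<exists>pr :: 'u \<times> 'u \<Rightarrow> 'u. inj pr"
proof -
  have "(card_of (UNIV \<times> UNIV :: ('u \<times> 'u) set), card_of (UNIV :: 'u set)) \<in> ordIso" by (rule card_of_Times_same_infinite[OF assms])
  then obtain pr :: "'u \<times> 'u \<Rightarrow> 'u" where "bij_betw pr (UNIV \<times> UNIV) UNIV" by (auto simp flip: card_of_ordIso)
  then show ?thesis by (auto simp: bij_betw_def)
qed

lemma ex_inj_nat:
  assumes "infinite (UNIV :: 'u set)"
  shows "\<exists>nu :: nat \<Rightarrow> 'u. inj nu"
  using infinite_countable_subset[OF assms] by blast

lemma ex_inj_list:
  assumes "infinite (UNIV :: 'u set)"
  shows "\<exists>enl :: 'u list \<Rightarrow> 'u. inj enl"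
proof -
  obtain pr :: "'u \<times> 'u \<Rightarrow> 'u" where pr: "inj pr" using ex_inj_pair[OF assms] by blast
  obtain nu :: "nat \<Rightarrow> 'u" where nu: "inj nu" using ex_inj_nat[OF assms] by blast
  define fo where "fo = (\<lambda>xs :: 'u list. foldr (\<lambda>x y. pr (x, y)) xs undefined)"
  have fo: "xs = ys" if "length xs = length ys" "fo xs = fo ys" for xs ys
    using that
  proof (induction xs ys rule: list_induct2)
    case (Cons x xs y ys)
    then have "pr (x, fo xs) = pr (y, fo ys)" by (simp add: fo_def)
    then show ?case using pr Cons.IH by (simp add: inj_eq)
  qed simp
  have "inj (\<lambda>xs. pr (nu (length xs), fo xs))"
  proof (rule injI)
    fix xs ys assume "pr (nu (length xs), fo xs) = pr (nu (length ys), fo ys)"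
    then have "length xs = length ys" "fo xs = fo ys" using pr nu by (auto simp: inj_eq)
    then show "xs = ys" by (rule fo)
  qed
  then show ?thesis by blast
qed

lemma ex_inj_poly_mapping:
  fixes e :: "'b \<Rightarrow> 'u" and f :: "'r::zero \<Rightarrow> 'u"
  assumes inf: "infinite (UNIV :: 'u set)" and e: "inj e" and f: "inj f"
  shows "\<exists>mk :: ('b \<Rightarrow>\<^sub>0 'r) \<Rightarrow> 'u. inj mk"
proof -
  obtain pr :: "'u \<times> 'u \<Rightarrow> 'u" where pr: "inj pr" using ex_inj_pair[OF inf] by blast
  obtain enl :: "'u list \<Rightarrow> 'u" where enl: "inj enl" using ex_inj_list[OF inf] by blast
  define ks where "ks = (\<lambda>x :: 'b \<Rightarrow>\<^sub>0 'r. SOME xs. set xs = keys x)"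
  have ks: "set (ks x) = keys x" for x
    unfolding ks_def by (rule someI_ex) (rule finite_list[OF finite_keys])
  have "inj (\<lambda>x. enl (map (\<lambda>b. pr (e b, f (lookup x b))) (ks x)))"
  proof (rule injI)
    fix x y assume "enl (map (\<lambda>b. pr (e b, f (lookup x b))) (ks x)) = enl (map (\<lambda>b. pr (e b, f (lookup y b))) (ks y))"
    then have "map (\<lambda>b. pr (e b, f (lookup x b))) (ks x) = map (\<lambda>b. pr (e b, f (lookup y b))) (ks y)"
      using enl by (simp add: inj_eq)
    then have "set (map (\<lambda>b. pr (e b, f (lookup x b))) (ks x)) = set (map (\<lambda>b. pr (e b, f (lookup y b))) (ks y))"
      by (rule arg_cong)
    then have eq: "(\<lambda>b. pr (e b, f (lookup x b))) ` keys x = (\<lambda>b. pr (e b, f (lookup y b))) ` keys y" by (simp add: ks)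
    have sub: "b \<in> keys y \<and> lookup x b = lookup y b"
      if im: "(\<lambda>b. pr (e b, f (lookup x b))) ` keys x \<subseteq> (\<lambda>b. pr (e b, f (lookup y b))) ` keys y" and bx: "b \<in> keys x" for x y b
    proof -
      obtain c where "c \<in> keys y" "pr (e b, f (lookup x b)) = pr (e c, f (lookup y c))"
        using subsetD[OF im imageI[OF bx]] by (rule imageE)
      then show ?thesis using pr e f by (auto simp: inj_eq)
    qed
    show "x = y"
    proof (rule poly_mapping_eqI)
      fix b show "lookup x b = lookup y b"
      proof (cases "b \<in> keys x")
        case True
        then show ?thesis using sub[OF equalityD1[OF eq]] by blast
      next
        case False
        then have "b \<notin> keys y" using sub[OF equalityD2[OF eq]] by blast
        then show ?thesis using False by (simp add: in_keys_iff)
      qed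
    qed
  qed
  then show ?thesis by blast
qed

primrec enc_cell :: "('u list \<Rightarrow> 'u) \<Rightarrow> ('u \<times> 'u \<Rightarrow> 'u) \<Rightarrow> (int \<Rightarrow> 'u) \<Rightarrow> ('r \<Rightarrow> 'u) \<Rightarrow> ('r, 'u) cell \<Rightarrow> 'u" where
  "enc_cell enl pr iu f (Cell n d y zs) =
     enl (iu n # iu d # y # map (\<lambda>(q, w). pr (f q, w)) (map (map_prod (\<lambda>q. q) (enc_cell enl pr iu f)) zs))"

lemma enc_cell_inj:
  assumes enl: "inj enl" and pr: "inj pr" and iu: "inj iu" and f: "inj f"
  shows "inj (enc_cell enl pr iu f)"
proof (rule injI)
  fix c c' :: "('b, 'a) cell"
  show "enc_cell enl pr iu f c = enc_cell enl pr iu f c' \<Longrightarrow> c = c'"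
  proof (induction c arbitrary: c')
    case (Cell n d y zs)
    obtain n' d' y' zs' where c': "c' = Cell n' d' y' zs'" by (cases c')
    have "n = n'" "d = d'" "y = y'" and m: "map (\<lambda>z. pr (f (fst z), enc_cell enl pr iu f (snd z))) zs =
        map (\<lambda>z. pr (f (fst z), enc_cell enl pr iu f (snd z))) zs'"
      using Cell.prems enl iu by (auto simp: c' inj_eq o_def case_prod_beta)
    moreover have "zs = zs'"
    proof (rule list.inj_map_strong[OF _ m])
      fix z z' assume z: "z \<in> set zs" and "z' \<in> set zs'"
        and e: "pr (f (fst z), enc_cell enl pr iu f (snd z)) = pr (f (fst z'), enc_cell enl pr iu f (snd z'))"
      obtain q x q' x' where zz: "z = (q, x)" "z' = (q', x')" by (cases z, cases z')
      have "f q = f q'" and x: "enc_cell enl pr iu f x = enc_cell enl pr iu f x'" using e pr by (auto simp: zz inj_eq)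
      moreover have "x = x'" by (rule Cell.IH[OF z _ x]) (simp add: zz)
      ultimately show "z = z'" using f by (simp add: zz inj_eq)
    qed
    ultimately show ?case by (simp add: c')
  qed
qed

lemma ex_inj_cell:
  fixes f :: "'r \<Rightarrow> 'u"
  assumes inf: "infinite (UNIV :: 'u set)" and f: "inj f"
  shows "\<exists>cu :: ('r, 'u) cell \<Rightarrow> 'u. inj cu"
proof -
  obtain pr :: "'u \<times> 'u \<Rightarrow> 'u" where pr: "inj pr" using ex_inj_pair[OF inf] by blast
  obtain enl :: "'u list \<Rightarrow> 'u" where enl: "inj enl" using ex_inj_list[OF inf] by blast
  obtain nu :: "nat \<Rightarrow> 'u" where nu: "inj nu" using ex_inj_nat[OF inf] by blast
  have iu: "inj (nu \<circ> to_nat :: int \<Rightarrow> 'u)" by (rule inj_compose[OF nu inj_to_nat])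
  show ?thesis using enc_cell_inj[OF enl pr iu f] by blast
qed

lemma ex_inj_polys:
  assumes k: "countable (UNIV :: 'k::field set)" and inf: "infinite (UNIV :: 'u set)"
  shows "\<exists>f :: 'k poly_inf \<Rightarrow> 'u. inj f"
proof -
  obtain nu :: "nat \<Rightarrow> 'u" where nu: "inj nu" using ex_inj_nat[OF inf] by blast
  obtain m :: "(nat \<Rightarrow>\<^sub>0 nat) \<Rightarrow> 'u" where m: "inj m" using ex_inj_poly_mapping[OF inf nu nu] by blast
  obtain c :: "'k \<Rightarrow> nat" where "inj c" using k unfolding countable_def by blast
  then have "inj (nu \<circ> c)" by (rule inj_compose[OF nu])
  from ex_inj_poly_mapping[OF inf m this] show ?thesis .
qed

section \<open>Nilpotence of self-maps of nonzero degree\<close>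

theorem proposition8p4:
  fixes n :: "nat \<Rightarrow> nat"
    and F :: "('k::field poly_inf set, 'u) cpx"
    and a b :: int
    and g :: "('k poly_inf set, 'u) dmor"
  assumes "countable (UNIV :: 'k set)"
    and "\<And>i. i \<ge> 1 \<Longrightarrow> n i \<ge> 2"
    and "infinite (UNIV :: 'u set)"
    and "cochain_complex (trunc_alg n) F"
    and "small (trunc_alg n) F"
    and "(a, b) \<noteq> (0, 0)"
    and "g \<in> carrier (dhom (trunc_alg n) (shift a b F) F)"
  shows "nilpotent_map (trunc_alg n) a b F g"
proof -
  interpret graded_coeff "trunc_alg n :: 'k poly_inf set gring" "tcl n" "restr (reduced n)" hpart
    by (rule trunc_alg_graded_coeff)
  obtain f :: "'k poly_inf \<Rightarrow> 'u" where f: "inj f" using ex_inj_polys[OF assms(1,3)] by blast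
  obtain nu :: "nat \<Rightarrow> 'u" where nu: "inj nu" using ex_inj_nat[OF assms(3)] by blast
  obtain pr :: "'u \<times> 'u \<Rightarrow> 'u" where pr: "inj pr" using ex_inj_pair[OF assms(3)] by blast
  obtain cu :: "('k poly_inf, 'u) cell \<Rightarrow> 'u" where cu: "inj cu" using ex_inj_cell[OF assms(3) f] by blast
  have "inj (pr \<circ> map_prod nu cu)" by (rule inj_compose[OF pr prod.inj_map[OF nu cu]])
  from ex_inj_poly_mapping[OF assms(3) this f]
  obtain mk2 :: "(nat \<times> ('k poly_inf, 'u) cell \<Rightarrow>\<^sub>0 'k poly_inf) \<Rightarrow> 'u" where mk2: "inj mk2" by blast
  obtain mk :: "(('k poly_inf, 'u) cell \<Rightarrow>\<^sub>0 'k poly_inf) \<Rightarrow> 'u" where mk: "inj mk"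
    using ex_inj_poly_mapping[OF assms(3) cu f] by blast
  interpret small_semifree "trunc_alg n :: 'k poly_inf set gring" "tcl n" "restr (reduced n)" hpart
    mk mk mk2 nu cu "{c. valid F c}" chg cig cbd size F "aug mk F"
  proof (unfold_locales)
    show "resolution (trunc_alg n) F (free_cpx mk {c. valid F c} chg cig (lin_ext cbd)) (aug mk F)"
      using resol_resolution[OF mk assms(4)] by (simp add: resol_def)
  qed (use mk mk2 nu cu assms(5) validD keys_cbd_size in auto)
  show ?thesis by (rule self_map_nilpotent[OF trunc_alg_locally_bounded assms(6,7)])
qed

end
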